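(* Let $M$ be a hyperbolic once-punctured torus bundle over the circle with monodromy $$\Omega = \pm R^{p_1}L^{q_1}\cdots R^{p_s}L^{q_s},$$ where $s\ge 1$ and all $p_i,q_i$ are positive integers. Let $C$ be a maximal horoball neighborhood of the cusp of $M$. Then $$\frac{16\sqrt{3}}{147}\, s \;\le\; \mathrm{area}(\partial C) \;<\; 2\sqrt{3}\,\frac{v_8}{v_3}\, s .$$ Furthermore, if $\gamma$ is any simple closed curve on $\partial C$ that is transverse to the fibers, then its length satisfies $$\ell(\gamma)\;\ge\;\frac{4\sqrt{6}}{147}\, s .$$
   Context: The mapping class group of the once-punctured torus is identified with $SL_2(\mathbb{Z})$, and $$R=\begin{bmatrix}1&1\\0&1\end{bmatrix},\qquad L=\begin{bmatrix}1&0\\1&1\end{bmatrix}.$$ The monodromy of a hyperbolic once-punctured torus bundle is conjugate to a matrix of the form $\pm R^{p_1}L^{q_1}\cdots R^{p_s}L^{q_s}$ with all $p_i,q_i$ positive, unique up to cyclic permutation of its letters. A maximal horoball neighborhood $C$ of the unique cusp is obtained by expanding an embedded horoball cusp neighborhood until it first meets itself; $\partial C$ then carries a flat metric, with respect to which area and length are measured. A simple closed curve on $\partial C$ is transverse to the fibers if it is transverse to the fibration of $\partial C$ by the boundary curves of the punctured-torus fibers. $v_3=1.0149\ldots$ is the volume of a regular ideal tetrahedron and $v_8=3.6638\ldots$ is the volume of a regular ideal octahedron in $\mathbb{H}^3$. *)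

theory Defs
  imports "HOL-Analysis.Analysis" "HOL-Algebra.Bij"
begin

section \<open>Quotient spaces\<close>

definition quotient_topology :: "'a topology \<Rightarrow> 'a rel \<Rightarrow> 'a set topology" where
  "quotient_topology X r =
     topology (\<lambda>U. U \<subseteq> topspace X // r \<and> openin X {x \<in> topspace X. r `` {x} \<in> U})"

lemma openin_quotient_topology:
  "openin (quotient_topology X r) U \<longleftrightarrow>
     U \<subseteq> topspace X // r \<and> openin X {x \<in> topspace X. r `` {x} \<in> U}"
proof -
  have "istopology (\<lambda>U. U \<subseteq> topspace X // r \<and> openin X {x \<in> topspace X. r `` {x} \<in> U})"
    unfolding istopology_def
  proof (rule conjI; intro allI impI)
    fix S T
    assume "S \<subseteq> topspace X // r \<and> openin X {x \<in> topspace X. r `` {x} \<in> S}"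
      and "T \<subseteq> topspace X // r \<and> openin X {x \<in> topspace X. r `` {x} \<in> T}"
    then have S: "S \<subseteq> topspace X // r" "openin X {x \<in> topspace X. r `` {x} \<in> S}"
      and T: "T \<subseteq> topspace X // r" "openin X {x \<in> topspace X. r `` {x} \<in> T}"
      by auto
    have "{x \<in> topspace X. r `` {x} \<in> S \<inter> T} =
        {x \<in> topspace X. r `` {x} \<in> S} \<inter> {x \<in> topspace X. r `` {x} \<in> T}" by blast
    then show "S \<inter> T \<subseteq> topspace X // r \<and> openin X {x \<in> topspace X. r `` {x} \<in> S \<inter> T}"
      using S T by (auto simp: openin_Int)
  next
    fix K
    assume K: "\<forall>S\<in>K. S \<subseteq> topspace X // r \<and> openin X {x \<in> topspace X. r `` {x} \<in> S}"
    have "{x \<in> topspace X. r `` {x} \<in> \<Union>K} =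
        \<Union>((\<lambda>S. {x \<in> topspace X. r `` {x} \<in> S}) ` K)" by blast
    moreover have "openin X (\<Union>((\<lambda>S. {x \<in> topspace X. r `` {x} \<in> S}) ` K))"
      using K by (intro openin_Union) auto
    ultimately show "\<Union>K \<subseteq> topspace X // r \<and> openin X {x \<in> topspace X. r `` {x} \<in> \<Union>K}"
      using K by auto
  qed
  then show ?thesis
    by (simp add: quotient_topology_def topology_inverse')
qed

lemma topspace_quotient_topology: "topspace (quotient_topology X r) = topspace X // r"
proof
  show "topspace (quotient_topology X r) \<subseteq> topspace X // r"
    using openin_quotient_topology openin_topspace by blast
  have "{x \<in> topspace X. r `` {x} \<in> topspace X // r} = topspace X"
    by (auto simp: quotientI)
  then show "topspace X // r \<subseteq> topspace (quotient_topology X r)"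
    by (intro openin_subset) (simp add: openin_quotient_topology)
qed

lemma quotient_map_quotient_topology:
  "quotient_map X (quotient_topology X r) (\<lambda>x. r `` {x})"
  unfolding quotient_map_def topspace_quotient_topology
  by (auto simp: openin_quotient_topology quotient_def)


section \<open>Punctured-torus bundles\<close>

definition R_mat :: "real^2^2" where
  "R_mat = vector [vector [1, 1], vector [0, 1]]"

definition L_mat :: "real^2^2" where
  "L_mat = vector [vector [1, 0], vector [1, 1]]"

text \<open>On the type of matrices \<open>*\<close> and \<open>^\<close> act entrywise, so powers are written with \<open>**\<close>.\<close>

definition mat_power :: "real^2^2 \<Rightarrow> nat \<Rightarrow> real^2^2" where
  "mat_power A n = (((**) A) ^^ n) (mat 1)"

primrec RL_word :: "(nat \<times> nat) list \<Rightarrow> real^2^2" where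
  "RL_word [] = mat 1"
| "RL_word (pq # w) = mat_power R_mat (fst pq) ** mat_power L_mat (snd pq) ** RL_word w"

definition Z2 :: "(real^2) set" where
  "Z2 = {x. \<forall>i. x $ i \<in> \<int>}"

text \<open>
  The once-punctured torus is \<open>(\<real>\<^sup>2 - \<int>\<^sup>2) / \<int>\<^sup>2\<close>, and a matrix \<open>A\<close> in \<open>SL\<^sub>2(\<int>)\<close> acts on it linearly.
  The mapping torus of \<open>A\<close> is the quotient of \<open>(\<real>\<^sup>2 - \<int>\<^sup>2) \<times> \<real>\<close> by the group generated by
  \<open>(x, t) \<mapsto> (x + v, t)\<close> for \<open>v\<close> in \<open>\<int>\<^sup>2\<close> and the gluing \<open>(x, t + 1) \<sim> (A x, t)\<close>.  The
  relation below says when two points are in the same orbit; it is symmetrised because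
  \<open>k\<close> is a natural number.
\<close>

definition punctured_plane_line :: "((real^2) \<times> real) set" where
  "punctured_plane_line = (- Z2) \<times> UNIV"

definition bundle_rel :: "real^2^2 \<Rightarrow> ((real^2) \<times> real) rel" where
  "bundle_rel A =
     {((x, t), (y, u)). x \<notin> Z2 \<and> y \<notin> Z2 \<and>
        (\<exists>k::nat. (t = u + real k \<and> mat_power A k *v x - y \<in> Z2) \<or>
                  (u = t + real k \<and> mat_power A k *v y - x \<in> Z2))}"

definition punctured_torus_bundle :: "real^2^2 \<Rightarrow> ((real^2) \<times> real) set topology" where
  "punctured_torus_bundle A =
     quotient_topology (top_of_set punctured_plane_line) (bundle_rel A)"


section \<open>Hyperbolic 3-manifolds\<close>

text \<open>The upper half-space model. Here \<open>dist\<close> is the Euclidean distance of \<open>\<complex> \<times> \<real>\<close>.\<close>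

definition H3 :: "(complex \<times> real) set" where
  "H3 = {p. 0 < snd p}"

definition hdist :: "complex \<times> real \<Rightarrow> complex \<times> real \<Rightarrow> real" where
  "hdist p q = arcosh (1 + (dist p q)\<^sup>2 / (2 * snd p * snd q))"

definition H3_isometry :: "(complex \<times> real \<Rightarrow> complex \<times> real) \<Rightarrow> bool" where
  "H3_isometry g \<longleftrightarrow> g \<in> Bij H3 \<and> (\<forall>p\<in>H3. \<forall>q\<in>H3. hdist (g p) (g q) = hdist p q)"

text \<open>
  Groups of isometries acting freely and properly discontinuously, i.e. the groups of deck
  transformations of complete hyperbolic 3-manifolds.
\<close>

definition hyperbolic_deck_group :: "(complex \<times> real \<Rightarrow> complex \<times> real) set \<Rightarrow> bool" where
  "hyperbolic_deck_group \<Gamma> \<longleftrightarrow>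
     subgroup \<Gamma> (BijGroup H3) \<and>
     (\<forall>g\<in>\<Gamma>. H3_isometry g) \<and>
     (\<forall>g\<in>\<Gamma>. (\<exists>p\<in>H3. g p = p) \<longrightarrow> (\<forall>p\<in>H3. g p = p)) \<and>
     (\<forall>K. compact K \<and> K \<subseteq> H3 \<longrightarrow> finite {g \<in> \<Gamma>. g ` K \<inter> K \<noteq> {}})"

definition orbit_rel :: "(complex \<times> real \<Rightarrow> complex \<times> real) set \<Rightarrow> (complex \<times> real) rel" where
  "orbit_rel \<Gamma> = {(p, q). p \<in> H3 \<and> (\<exists>g\<in>\<Gamma>. q = g p)}"

definition hyperbolic_manifold ::
    "(complex \<times> real \<Rightarrow> complex \<times> real) set \<Rightarrow> (complex \<times> real) set topology" where
  "hyperbolic_manifold \<Gamma> = quotient_topology (top_of_set H3) (orbit_rel \<Gamma>)"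


section \<open>Horoball neighborhoods of the cusp\<close>

text \<open>
  The horosphere at height 1 around \<open>\<infinity>\<close> carries the metric \<open>\<bar>dz\<bar>\<^sup>2\<close>.  A chart
  \<open>\<psi>\<close> of an open horoball \<open>B\<close> is an isometry of \<open>H3\<close> taking the horoball above this
  horosphere to \<open>B\<close>; so \<open>z \<mapsto> \<psi> (z, 1)\<close> is an isometric parametrisation of the horosphere
  bounding \<open>B\<close> by the Euclidean plane \<open>\<complex>\<close>.
\<close>

definition horoball_chart ::
    "(complex \<times> real) set \<Rightarrow> (complex \<times> real \<Rightarrow> complex \<times> real) \<Rightarrow> bool" where
  "horoball_chart B \<psi> \<longleftrightarrow> H3_isometry \<psi> \<and> \<psi> ` {p. 1 < snd p} = B"

definition horoball :: "(complex \<times> real) set \<Rightarrow> bool" where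
  "horoball B \<longleftrightarrow> (\<exists>\<psi>. horoball_chart B \<psi>)"

text \<open>
  A horoball neighborhood \<open>C\<close> of a cusp of the quotient of \<open>H3\<close> by \<open>\<Gamma>\<close> is represented by a
  horoball \<open>B\<close> of \<open>H3\<close> projecting onto it.  It is maximal when \<open>C\<close> is embedded but its
  boundary meets itself: some translate of \<open>B\<close> other than \<open>B\<close> is disjoint from \<open>B\<close> but
  tangent to it in \<open>H3\<close>.
\<close>

definition embedded_cusp_horoball ::
    "(complex \<times> real \<Rightarrow> complex \<times> real) set \<Rightarrow> (complex \<times> real) set \<Rightarrow> bool" where
  "embedded_cusp_horoball \<Gamma> B \<longleftrightarrow>
     horoball B \<and>
     (\<exists>g\<in>\<Gamma>. g ` B = B \<and> (\<exists>p\<in>H3. g p \<noteq> p)) \<and>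
     (\<forall>g\<in>\<Gamma>. g ` B = B \<or> g ` B \<inter> B = {})"

definition maximal_cusp_horoball ::
    "(complex \<times> real \<Rightarrow> complex \<times> real) set \<Rightarrow> (complex \<times> real) set \<Rightarrow> bool" where
  "maximal_cusp_horoball \<Gamma> B \<longleftrightarrow>
     embedded_cusp_horoball \<Gamma> B \<and>
     (\<exists>g\<in>\<Gamma>. g ` B \<noteq> B \<and> H3 \<inter> closure (g ` B) \<inter> closure B \<noteq> {})"

text \<open>
  The flat torus \<open>\<partial>C\<close> is the quotient of the horosphere bounding \<open>B\<close> by the stabiliser of \<open>B\<close>.
  In a chart it is the quotient of \<open>\<complex>\<close> by the following relation.  Elements of \<open>\<Gamma>\<close> not
  preserving \<open>B\<close> are left out, so the two sheets of \<open>\<partial>C\<close> at a self-tangency are not identified.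
\<close>

definition cusp_torus_rel ::
    "(complex \<times> real \<Rightarrow> complex \<times> real) set \<Rightarrow> (complex \<times> real) set \<Rightarrow>
     (complex \<times> real \<Rightarrow> complex \<times> real) \<Rightarrow> complex rel" where
  "cusp_torus_rel \<Gamma> B \<psi> = {(z, w). \<exists>g\<in>\<Gamma>. g ` B = B \<and> g (\<psi> (z, 1)) = \<psi> (w, 1)}"

text \<open>The area of \<open>\<partial>C\<close>: the area of any Borel fundamental domain, in any chart.\<close>

definition cusp_area ::
    "(complex \<times> real \<Rightarrow> complex \<times> real) set \<Rightarrow> (complex \<times> real) set \<Rightarrow> real" where
  "cusp_area \<Gamma> B =
     (THE a. \<exists>\<psi> D. horoball_chart B \<psi> \<and> D \<in> sets borel \<and>
                (\<forall>z. \<exists>!w. w \<in> D \<and> (z, w) \<in> cusp_torus_rel \<Gamma> B \<psi>) \<and>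
                a = measure lborel D)"


section \<open>Curves on the cusp torus transverse to the fibers\<close>

text \<open>
  Let \<open>h\<close> be a homeomorphism from the hyperbolic manifold to the punctured-torus bundle.  The
  bundle projection to \<open>\<real>/\<int>\<close> sends the class of \<open>(x, t)\<close> to \<open>t\<close>; \<open>\<tau>\<close> is a lift of it to
  a real function on the universal cover \<open>H3\<close>.
\<close>

definition lifted_projection ::
    "(complex \<times> real \<Rightarrow> complex \<times> real) set \<Rightarrow>
     ((complex \<times> real) set \<Rightarrow> ((real^2) \<times> real) set) \<Rightarrow> (complex \<times> real \<Rightarrow> real) \<Rightarrow> bool" where
  "lifted_projection \<Gamma> h \<tau> \<longleftrightarrow>
     continuous_on H3 \<tau> \<and> (\<forall>p\<in>H3. \<exists>x. (x, \<tau> p) \<in> h (orbit_rel \<Gamma> `` {p}))"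

text \<open>
  A fibration of \<open>\<partial>C\<close> by boundary curves of the fibers, given by the lift \<open>F\<close> of a
  circle-valued \<open>C\<^sup>1\<close> submersion of \<open>\<partial>C\<close> to the chart.  Because \<open>h\<close> is only a homeomorphism,
  its fibers need not meet \<open>\<partial>C\<close> in a fibration; as usual they have to be isotoped
  near the cusp.  So it is asked that the submersion be homotopic to the restriction of the
  bundle projection to \<open>\<partial>C\<close>, which is to say that \<open>F - \<tau>\<close> descends to \<open>\<partial>C\<close>; its fibers
  are then isotopic to the boundary curves of the punctured-torus fibers.
\<close>

definition boundary_fibration ::
    "(complex \<times> real \<Rightarrow> complex \<times> real) set \<Rightarrow>
     ((complex \<times> real) set \<Rightarrow> ((real^2) \<times> real) set) \<Rightarrow> (complex \<times> real) set \<Rightarrow>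
     (complex \<times> real \<Rightarrow> complex \<times> real) \<Rightarrow> (complex \<Rightarrow> real) \<Rightarrow> (complex \<Rightarrow> complex) \<Rightarrow> bool" where
  "boundary_fibration \<Gamma> h B \<psi> F grad \<longleftrightarrow>
     (\<forall>z. GDERIV F z :> grad z \<and> grad z \<noteq> 0) \<and> continuous_on UNIV grad \<and>
     (\<exists>\<tau>. lifted_projection \<Gamma> h \<tau> \<and>
        (\<forall>(z, w) \<in> cusp_torus_rel \<Gamma> B \<psi>. F w - \<tau> (\<psi> (w, 1)) = F z - \<tau> (\<psi> (z, 1))))"

text \<open>A \<open>C\<^sup>1\<close> simple closed curve on \<open>\<partial>C\<close>, lifted to the chart; \<open>c'\<close> is its velocity.\<close>

definition simple_closed_cusp_curve ::
    "(complex \<times> real \<Rightarrow> complex \<times> real) set \<Rightarrow> (complex \<times> real) set \<Rightarrow>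
     (complex \<times> real \<Rightarrow> complex \<times> real) \<Rightarrow> (real \<Rightarrow> complex) \<Rightarrow> (real \<Rightarrow> complex) \<Rightarrow> bool" where
  "simple_closed_cusp_curve \<Gamma> B \<psi> c c' \<longleftrightarrow>
     (\<forall>t\<in>{0..1}. (c has_vector_derivative c' t) (at t within {0..1})) \<and>
     continuous_on {0..1} c' \<and>
     (c 0, c 1) \<in> cusp_torus_rel \<Gamma> B \<psi> \<and>
     (\<forall>s\<in>{0..1}. \<forall>t\<in>{0..1}. (c s, c t) \<in> cusp_torus_rel \<Gamma> B \<psi> \<longrightarrow>
        s = t \<or> s = 0 \<and> t = 1 \<or> s = 1 \<and> t = 0)"

definition transverse_to_fibers ::
    "(complex \<Rightarrow> complex) \<Rightarrow> (real \<Rightarrow> complex) \<Rightarrow> (real \<Rightarrow> complex) \<Rightarrow> bool" where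
  "transverse_to_fibers grad c c' \<longleftrightarrow> (\<forall>t\<in>{0..1}. grad (c t) \<bullet> c' t \<noteq> 0)"

definition curve_length :: "(real \<Rightarrow> complex) \<Rightarrow> real" where
  "curve_length c' = integral {0..1} (\<lambda>t. norm (c' t))"


section \<open>Volumes of the regular ideal tetrahedron and octahedron\<close>

text \<open>
  In the Klein model of hyperbolic 3-space (the open unit ball, with volume form
  \<open>dx / (1 - \<bar>x\<bar>\<^sup>2)\<^sup>2\<close>) ideal polyhedra are the Euclidean convex hulls of points of the unit
  sphere.  Those points themselves form a null set.
\<close>

definition klein_volume :: "(real^3) set \<Rightarrow> real" where
  "klein_volume S = set_lebesgue_integral lborel S (\<lambda>x. 1 / (1 - (norm x)\<^sup>2)\<^sup>2)"

definition v3 :: real where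
  "v3 = klein_volume (convex hull ((\<lambda>x. (1 / sqrt 3) *\<^sub>R x) `
      {vector [1, 1, 1], vector [1, -1, -1], vector [-1, 1, -1], vector [-1, -1, 1]}))"

definition v8 :: real where
  "v8 = klein_volume (convex hull
      {vector [1, 0, 0], vector [-1, 0, 0], vector [0, 1, 0],
       vector [0, -1, 0], vector [0, 0, 1], vector [0, 0, -1]})"

end

theory Submission
  imports Defs "HOL-Homology.Homology" "HOL-Complex_Analysis.Complex_Analysis"
begin

text \<open>Put the horoball at infinity. The homeomorphism lifts to a map from \<open>H3\<close> onto the cover \<open>(\<complex> - \<int>[\<i>]) \<times> \<real>\<close> of the
 bundle, and the stabiliser of infinity consists of the translations by \<open>j lam + k nu\<close>, where \<open>lam = 2 mu\<close> comes
 from a loop around the puncture and \<open>nu\<close> from the monodromy. Each primitive slope \<open>v\<close> in \<open>\<int>[\<i>]\<close> gives a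
 matrix \<open>A v\<close>, with \<open>A (v + w) = A v A w\<close> up to sign along the edges \<open>(v, w)\<close> of the Farey graph; the commutator
 of \<open>A v\<close> and \<open>A w\<close> is minus the matrix of the translation by \<open>lam\<close>, so their traces satisfy the Markov equation
 \<open>x\<^sup>2 + y\<^sup>2 + z\<^sup>2 = x y z\<close> and the trace is \<open>-mu\<close> times the lower left entry \<open>c\<close>, whence \<open>\<bar>trace\<bar> \<ge> \<bar>mu\<bar>\<close>.
 Let \<open>a\<close> be the upper left entry. The monodromy moves an edge along a path whose \<open>2 s\<close> turning edges determine the
 change of the centres \<open>a / c\<close>.

 Upper bound: \<open>q = (ctr w - ctr v) / mu\<close> solves \<open>q\<^sup>2 - q + 1 / x\<^sup>2 + 1 / y\<^sup>2 = 0\<close>, so \<open>\<bar>Im q\<bar> \<le> 2 / \<bar>mu\<bar>\<^sup>2\<close>, and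
 summing over the turning edges bounds the area by \<open>8 s < 9 s \<le> 2 sqrt 3 (v8 / v3) s\<close>.

 Lower bound: if both ends of an edge had trace above \<open>2\<close>, the traces would grow along the periodic path. So there
 are \<open>s\<close> slopes of trace at most \<open>2\<close>, and the discs of radius \<open>\<bar>mu\<bar>\<^sup>2 / 8\<close> around their centres pack
 disjointly modulo \<open>mu\<close> and \<open>nu\<close>. Finally \<open>\<bar>mu\<bar>\<^sup>4\<close> is at least \<open>1.9203\<close>: the translation by \<open>mu\<close> normalises the
 group, which together with a tangency gives two parabolics with parameter \<open>\<rho>\<close> of modulus \<open>\<bar>mu\<bar>\<^sup>2\<close>, and for
 smaller \<open>\<bar>\<rho>\<bar>\<close> a short word in them contradicts the disjointness of the horoballs.\<close>

text \<open>The manifold and the bundle are linked by a homeomorphism only, so what an isometry or a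
  smooth fibration would give has to be won topologically. Orientation of deck transformations is a
  degree computation; that the horoball sits at a puncture follows from compactness of the
  complement of tubes around the punctures. No fundamental group is set up: group elements arise by
  comparing two lifts of one map on a connected set. Winding around the puncture has to be recorded,
  so slopes and base points are kept as logarithms, a half turn being \<open>ipi\<close>. Matrices
  are known only up to sign; the one sign that matters, that of the boundary parabolic, comes from a
  trace argument.

  The constant \<open>1.9203\<close> is dictated by the packing: its yield
  \<open>pi |mu|^4 / 32\<close> per block must reach \<open>16 sqrt 3 / 147\<close>, that is,
  \<open>|mu|^4\<close> must be at least about \<open>1.92028\<close>. The \<open>9\<close> is
  \<open>2 sqrt 3\<close> times \<open>3 sqrt 3 / 2\<close>, the ratio of the Euclidean volumes of
  the regular octahedron and tetrahedron inscribed in one sphere.\<close>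

type_synonym point3 = "complex \<times> real"
abbreviation ipi :: complex where "ipi \<equiv> of_real pi * \<i>"
abbreviation tpi :: complex where "tpi \<equiv> 2 * of_real pi * \<i>"

section \<open>Isometries of the upper half-space\<close>

datatype m2 = M2 (e11: complex) (e12: complex) (e21: complex) (e22: complex)

definition det2 :: "m2 => complex" where
 "det2 M = e11 M * e22 M - e12 M * e21 M"

definition tr2 :: "m2 => complex" where
 "tr2 M = e11 M + e22 M"

fun mmul :: "m2 => m2 => m2" (infixl "*m" 70) where
 "M2 a b c d *m M2 a' b' c' d' = M2 (a * a' + b * c') (a * b' + b * d') (c * a' + d * c') (c * b' + d * d')"

definition minv :: "m2 => m2" where
 "minv M = M2 (e22 M) (- e12 M) (- e21 M) (e11 M)"

definition mneg :: "m2 => m2" where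
 "mneg M = M2 (- e11 M) (- e12 M) (- e21 M) (- e22 M)"

definition mid :: m2 where "mid = M2 1 0 0 1"

text \<open>For the quaternion \<open>w = z + t j\<close>, \<open>hden\<close> is the squared norm
  of \<open>c w + d\<close>, and \<open>hnum\<close> is the complex part of \<open>a w + b\<close>
  times the conjugate of \<open>c w + d\<close>.\<close>

definition hden :: "m2 => point3 => real" where
 "hden M p = (cmod (e21 M * fst p + e22 M))^2 + (cmod (e21 M))^2 * (snd p)^2"

definition hnum :: "m2 => point3 => complex" where
 "hnum M p = (e11 M * fst p + e12 M) * cnj (e21 M * fst p + e22 M) + e11 M * cnj (e21 M) * (of_real (snd p))^2"

text \<open>The Poincare extension of a Moebius transformation.\<close>

definition mob :: "m2 => point3 => point3" where
 "mob M p = (hnum M p / of_real (hden M p), snd p / hden M p)"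

definition cconj :: "point3 => point3" where
 "cconj p = (cnj (fst p), snd p)"

text \<open>Twice the hyperbolic cosine of the distance; being rational in the real coordinates, it
  makes invariance a matter of algebra.\<close>

definition hD :: "point3 => point3 => real" where
 "hD p q = ((cmod (fst p - fst q))^2 + (snd p)^2 + (snd q)^2) / (snd p * snd q)"

lemma det2_mmul: "det2 (M *m N) = det2 M * det2 N"
 by (cases M; cases N) (simp add: det2_def algebra_simps)

lemma det2_minv [simp]: "det2 (minv M) = det2 M"
 by (cases M) (simp add: det2_def minv_def algebra_simps)

lemma det2_mneg [simp]: "det2 (mneg M) = det2 M"
 by (cases M) (simp add: det2_def mneg_def algebra_simps)

lemma det2_mid [simp]: "det2 mid = 1" by (simp add: det2_def mid_def)

lemma mmul_assoc: "(A *m B) *m C = A *m (B *m C)"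
 by (cases A; cases B; cases C) (simp add: algebra_simps)

lemma mmul_mid [simp]: "M *m mid = M" "mid *m M = M"
 by (cases M; simp add: mid_def)+

lemma mmul_minv: "det2 M = 1 ==> M *m minv M = mid" "det2 M = 1 ==> minv M *m M = mid"
 by (cases M; simp add: mid_def minv_def det2_def algebra_simps)+

lemma tr2_mmul_commute: "tr2 (A *m B) = tr2 (B *m A)"
 by (cases A; cases B) (simp add: tr2_def algebra_simps)

lemma hden_pos:
 assumes "det2 M = 1" "p : H3" shows "0 < hden M p"
proof (cases "e21 M = 0")
 case True
 hence "e22 M ~= 0" using assms(1) by (auto simp: det2_def)
 thus ?thesis using True by (simp add: hden_def)
next
 case False
 hence "0 < (cmod (e21 M))^2 * (snd p)^2" using assms(2) by (simp add: H3_def)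
 thus ?thesis unfolding hden_def by (smt (verit) zero_le_power2)
qed

lemma mob_in_H3: "det2 M = 1 ==> p : H3 ==> mob M p : H3"
 using hden_pos[of M p] by (simp add: mob_def H3_def)

lemma hden_complex: "complex_of_real (hden M p) =
 (e21 M * fst p + e22 M) * cnj (e21 M * fst p + e22 M) + e21 M * cnj (e21 M) * (of_real (snd p))^2"
 unfolding hden_def of_real_add of_real_mult complex_norm_square by simp

text \<open>In the Hermitian model a point is the matrix with entries \<open>(\<bar>z\<bar>\<^sup>2 + t\<^sup>2) / t\<close>, \<open>z / t\<close>, \<open>1 / t\<close>
 and \<open>M\<close> acts by congruence; \<open>hnum\<close> and the two values of \<open>hden\<close> below are its entries
 multiplied by \<open>t\<close>.\<close>

abbreviation mrev :: "m2 => m2" where "mrev M \<equiv> M2 (e21 M) (e22 M) (e11 M) (e12 M)"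

text \<open>Conjugates enter as independent variables, which leaves an identity of commutative
  polynomials.\<close>

lemma herm_pair_aux:
 fixes u us v vs u' us' v' vs' a as c cs S T :: complex
 shows "(u * us + a * as * T) * (v' * vs' + c * cs * S) + (u' * us' + a * as * S) * (v * vs + c * cs * T)
  - ((u * vs + a * cs * T) * (us' * v' + as * c * S) + (us * v + as * c * T) * (u' * vs' + a * cs * S)) =
  (u * v' - u' * v) * (us * vs' - us' * vs) + S * ((c * u - a * v) * (cs * us - as * vs)) + T * ((c * u' - a * v') * (cs * us' - as * vs'))"
 by (simp add: algebra_simps)

text \<open>The polarised determinant of two Hermitian matrices: congruence by \<open>M\<close>
  multiplies it by \<open>|det M|^2\<close>, and on two points it is the numerator of
  \<open>hD\<close>. The case \<open>p = q\<close> is the ordinary determinant.\<close>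

lemma herm_pair:
 "complex_of_real (hden (mrev M) p * hden M q + hden (mrev M) q * hden M p)
  - (hnum M p * cnj (hnum M q) + cnj (hnum M p) * hnum M q) =
 det2 M * cnj (det2 M) * of_real ((cmod (fst p - fst q))^2 + (snd p)^2 + (snd q)^2)"
proof -
 obtain z t w s where pq: "p = (z,t)" "q = (w,s)" by (cases p, cases q) auto
 obtain a b c d where M: "M = M2 a b c d" by (cases M)
 define u v u' v' where uv: "u = a * z+b" "v = c * z + d" "u' = a * w+b" "v' = c * w + d"
 have dd: "u * v' - u' * v = (a * d-b * c) * (z - w)" "c * u - a * v = - (a * d-b * c)" "c * u' - a * v' = - (a * d-b * c)"
  unfolding uv by (simp_all add: algebra_simps)
 have "complex_of_real (hden (mrev M) p * hden M q + hden (mrev M) q * hden M p)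
  - (hnum M p * cnj (hnum M q) + cnj (hnum M p) * hnum M q) =
  (u * v' - u' * v) * (cnj u * cnj v' - cnj u' * cnj v)
  + (of_real s)^2 * ((c * u - a * v) * (cnj c * cnj u - cnj a * cnj v)) + (of_real t)^2 * ((c * u' - a * v') * (cnj c * cnj u' - cnj a * cnj v'))"
  unfolding herm_pair_aux[symmetric] of_real_add of_real_mult hden_complex hnum_def pq M
  by (simp add: uv)
 also have "... = det2 M * cnj (det2 M) * ((z - w) * cnj (z - w) + (of_real s)^2 + (of_real t)^2)"
  unfolding dd complex_cnj_mult[symmetric] complex_cnj_diff[symmetric] by (simp add: M det2_def algebra_simps)
 also have "... = det2 M * cnj (det2 M) * of_real ((cmod (fst p - fst q))^2 + (snd p)^2 + (snd q)^2)"
  unfolding of_real_add complex_norm_square pq by simp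
 finally show ?thesis .
qed

lemma herm_det:
 assumes "det2 M = 1"
 shows "(cmod (hnum M p))^2 + (snd p)^2 = hden (mrev M) p * hden M p"
proof -
 have "complex_of_real (2 * (hden (mrev M) p * hden M p)) - 2 * of_real ((cmod (hnum M p))^2)
  = of_real (2 * (snd p)^2)"
  using herm_pair[of M p p] assms by (simp add: complex_norm_square[symmetric] mult.commute)
 hence "complex_of_real (2 * (hden (mrev M) p * hden M p) - 2 * (cmod (hnum M p))^2)
  = of_real (2 * (snd p)^2)" by simp
 thus ?thesis unfolding of_real_eq_iff by simp
qed

lemma fst_mob: "fst (mob M p) = hnum M p / of_real (hden M p)"
 and snd_mob: "snd (mob M p) = snd p / hden M p"
 by (simp_all add: mob_def)

lemma norm_mob:
 assumes "det2 M = 1" "p : H3"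
 shows "(cmod (fst (mob M p)))^2 + (snd (mob M p))^2 = hden (mrev M) p / hden M p"
proof -
 have "hden M p > 0" using hden_pos assms by blast
 thus ?thesis using herm_det[OF assms(1), of p]
  by (simp add: fst_mob snd_mob norm_divide power_divide field_simps power2_eq_square
    flip: distrib_left add_divide_distrib)
qed

lemma hD_alt: "p : H3 ==> q : H3 ==>
 hD p q = (((cmod (fst p))^2 + (snd p)^2) + ((cmod (fst q))^2 + (snd q)^2)
   - 2 * Re (fst p * cnj (fst q))) / (snd p * snd q)"
 unfolding hD_def cmod_power2 by (simp add: power2_eq_square algebra_simps)

lemma mob_hD:
 assumes M: "det2 M = 1" and p: "p : H3" and q: "q : H3"
 shows "hD (mob M p) (mob M q) = hD p q"
proof -
 have pos: "hden M p > 0" "hden M q > 0" "snd p > 0" "snd q > 0"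
  using hden_pos M p q by (auto simp: H3_def)
 have "of_real (hden (mrev M) p * hden M q + hden (mrev M) q * hden M p)
  - complex_of_real (2 * Re (hnum M p * cnj (hnum M q))) =
  of_real ((cmod (fst p - fst q))^2 + (snd p)^2 + (snd q)^2)"
  using herm_pair[of M p q] M complex_add_cnj[of "hnum M p * cnj (hnum M q)"] by simp
 hence *: "hden (mrev M) p * hden M q + hden (mrev M) q * hden M p
  - 2 * Re (hnum M p * cnj (hnum M q)) = (cmod (fst p - fst q))^2 + (snd p)^2 + (snd q)^2"
  unfolding of_real_diff[symmetric] of_real_eq_iff .
 have R: "Re (fst (mob M p) * cnj (fst (mob M q))) = Re (hnum M p * cnj (hnum M q)) / (hden M p * hden M q)"
  by (simp add: fst_mob flip: of_real_mult)
 have "hD (mob M p) (mob M q) = (hden (mrev M) p / hden M p + hden (mrev M) q / hden M q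
   - 2 * Re (hnum M p * cnj (hnum M q)) / (hden M p * hden M q)) / (snd p * snd q / (hden M p * hden M q))"
  using hD_alt[OF mob_in_H3[OF M p] mob_in_H3[OF M q]] norm_mob[OF M p] norm_mob[OF M q]
  unfolding R by (simp add: snd_mob)
 also have "hden (mrev M) p / hden M p + hden (mrev M) q / hden M q
   - 2 * Re (hnum M p * cnj (hnum M q)) / (hden M p * hden M q) = (hden (mrev M) p * hden M q + hden (mrev M) q * hden M p
  - 2 * Re (hnum M p * cnj (hnum M q))) / (hden M p * hden M q)"
  using pos by (simp add: add_divide_distrib diff_divide_distrib)
 also have "... / (snd p * snd q / (hden M p * hden M q)) = (hden (mrev M) p * hden M q + hden (mrev M) q * hden M p
  - 2 * Re (hnum M p * cnj (hnum M q))) / (snd p * snd q)"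
  using pos by simp
 finally show ?thesis unfolding * hD_def .
qed

text \<open>The cocycle law of the automorphy factor; with \<open>hnum_comp\<close> it makes
  \<open>mob\<close> an action.\<close>

lemma hden_comp:
 assumes "det2 N = 1" "p : H3"
 shows "hden M (mob N p) * hden N p = hden (M *m N) p"
proof -
 obtain a b c d where M: "M = M2 a b c d" by (cases M)
 obtain a' b' c' d' where N: "N = M2 a' b' c' d'" by (cases N)
 obtain z t where p: "p = (z,t)" by (cases p)
 have pos: "hden N p > 0" using assms hden_pos by blast
 have "hden M (mob N p) = (cmod c)^2 * ((cmod (fst (mob N p)))^2 + (snd (mob N p))^2)
  + 2 * Re (c * fst (mob N p) * cnj d) + (cmod d)^2"
  unfolding hden_def M m2.sel cmod_power2 by (simp add: power2_eq_square algebra_simps)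
 hence "hden M (mob N p) * hden N p = (cmod c)^2 * hden (mrev N) p
  + 2 * Re (c * hnum N p * cnj d) + (cmod d)^2 * hden N p"
  unfolding norm_mob[OF assms] unfolding fst_mob using pos by (simp add: field_simps)
 moreover have "complex_of_real ... = of_real (hden (M *m N) p)"
 proof -
  have 2: "complex_of_real (2 * Re (c * hnum N p * cnj d)) = c * hnum N p * cnj d + cnj (c * hnum N p * cnj d)"
   by (simp only: complex_add_cnj)
  show ?thesis
   unfolding of_real_add 2 unfolding of_real_mult hden_complex hnum_def M N p mmul.simps
   by (simp only: complex_norm_square fst_conv snd_conv m2.sel complex_cnj_add complex_cnj_mult
    complex_cnj_cnj complex_cnj_complex_of_real complex_cnj_power) (simp add: algebra_simps power2_eq_square)
 qed
 ultimately show ?thesis by (metis of_real_eq_iff)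
qed

lemma hnum_comp:
 assumes "det2 N = 1" "p : H3"
 shows "hnum M (mob N p) * of_real (hden N p) = hnum (M *m N) p"
proof -
 obtain a b c d where M: "M = M2 a b c d" by (cases M)
 obtain a' b' c' d' where N: "N = M2 a' b' c' d'" by (cases N)
 obtain z t where p: "p = (z,t)" by (cases p)
 have pos: "hden N p > 0" using assms hden_pos by blast
 have "hnum M (mob N p) = a * cnj c * of_real ((cmod (fst (mob N p)))^2 + (snd (mob N p))^2)
  + a * fst (mob N p) * cnj d + b * cnj c * cnj (fst (mob N p)) + b * cnj d"
  unfolding hnum_def M m2.sel of_real_add complex_norm_square by (simp add: algebra_simps)
 hence "hnum M (mob N p) * of_real (hden N p) = a * cnj c * of_real (hden (mrev N) p)
  + a * hnum N p * cnj d + b * cnj c * cnj (hnum N p) + b * cnj d * of_real (hden N p)"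
  unfolding norm_mob[OF assms] unfolding fst_mob using pos by (simp add: field_simps)
 also have "... = hnum (M *m N) p"
   unfolding of_real_add of_real_mult hden_complex hnum_def M N p mmul.simps
   by (simp only: complex_norm_square fst_conv snd_conv m2.sel complex_cnj_add complex_cnj_mult
    complex_cnj_cnj complex_cnj_complex_of_real complex_cnj_power) (simp add: algebra_simps power2_eq_square)
 finally show ?thesis .
qed

lemma mob_mmul:
 assumes "det2 N = 1" "p : H3"
 shows "mob (M *m N) p = mob M (mob N p)"
proof -
 have pos: "hden N p > 0" using assms hden_pos by blast
 show ?thesis
 proof (rule prod_eqI)
  show "fst (mob (M *m N) p) = fst (mob M (mob N p))"
   unfolding fst_mob[of "M *m N"] fst_mob[of M] hnum_comp[OF assms, symmetric] hden_comp[OF assms, symmetric]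
   using pos by simp
  show "snd (mob (M *m N) p) = snd (mob M (mob N p))"
   unfolding snd_mob[of "M *m N"] snd_mob[of M] hden_comp[OF assms, symmetric]
   using pos by (simp add: snd_mob mult.commute)
 qed
qed

lemma mob_mid [simp]: "mob mid p = p"
 by (simp add: mob_def mid_def hnum_def hden_def)

lemma mob_mneg [simp]: "mob (mneg M) p = mob M p"
proof -
 have "cmod (- (e21 M * fst p) - e22 M) = cmod (e21 M * fst p + e22 M)"
  by (metis minus_add_distrib norm_minus_cancel uminus_add_conv_diff add.commute)
 hence "hden (mneg M) p = hden M p" by (simp add: mneg_def hden_def)
 moreover have "hnum (mneg M) p = hnum M p" by (simp add: mneg_def hnum_def algebra_simps)
 ultimately show ?thesis by (simp add: mob_def)
qed

lemma mob_minv: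
 assumes "det2 M = 1" "p : H3"
 shows "mob (minv M) (mob M p) = p" "mob M (mob (minv M) p) = p"
 using mob_mmul[of M p "minv M"] mob_mmul[of "minv M" p M] assms by (simp_all add: mmul_minv)

section \<open>Classification of the isometries of hyperbolic space\<close>

lemma hdist_eq_arcosh:
 assumes "p : H3" "q : H3"
 shows "hdist p q = arcosh (hD p q / 2)" "hD p q / 2 >= 1"
proof -
 obtain z s w t where pq: "p = (z,s)" "q = (w,t)" by (cases p, cases q) auto
 have pos: "s > 0" "t > 0" using assms pq by (auto simp: H3_def)
 have d: "(dist p q)^2 = (cmod (z - w))^2 + (s - t)^2"
  unfolding pq dist_prod_def by (simp add: dist_norm)
 have e: "1 + (dist p q)^2 / (2 * snd p * snd q) = hD p q / 2"
  unfolding d unfolding hD_def pq using pos by (simp add: divide_simps) (simp add: power2_eq_square algebra_simps)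
 show "hdist p q = arcosh (hD p q / 2)" unfolding hdist_def e ..
 show "hD p q / 2 >= 1" unfolding e[symmetric] unfolding pq using pos by simp
qed

lemma hdist_eq_iff:
 assumes "p : H3" "q : H3" "p' : H3" "q' : H3"
 shows "hdist p q = hdist p' q' \<longleftrightarrow> hD p q = hD p' q'"
proof -
 have "cosh (arcosh (hD p q / 2)) = hD p q / 2" "cosh (arcosh (hD p' q' / 2)) = hD p' q' / 2"
  using hdist_eq_arcosh assms by (auto intro: cosh_arcosh_real)
 thus ?thesis using hdist_eq_arcosh assms by (metis divide_cancel_right zero_neq_numeral)
qed

lemma H3_isometry_in: "H3_isometry g ==> p : H3 ==> g p : H3"
 unfolding H3_isometry_def Bij_def bij_betw_def by auto

lemma H3_isometry_hD: "H3_isometry g ==> p : H3 ==> q : H3 ==> hD (g p) (g q) = hD p q"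
 using hdist_eq_iff H3_isometry_in unfolding H3_isometry_def by blast

lemma H3_iff: "(z, t) : H3 \<longleftrightarrow> 0 < t" by (simp add: H3_def)

lemma mob_translate_base:
 assumes "0 < t" shows "EX M. det2 M = 1 & mob M (0,1) = (z, t)"
proof (intro exI conjI)
 let ?M = "M2 (of_real (sqrt t)) (z / of_real (sqrt t)) 0 (1 / of_real (sqrt t))"
 show "det2 ?M = 1" using assms by (simp add: det2_def)
 have "(cmod (1 / of_real (sqrt t)))^2 = 1 / t"
  using assms by (simp add: norm_divide power_divide)
 moreover have "complex_of_real (sqrt t) * of_real (sqrt t) = of_real t"
  using assms by (metis abs_of_pos of_real_mult real_sqrt_abs2 real_sqrt_mult)
 ultimately show "mob ?M (0,1) = (z, t)"
  using assms by (simp add: mob_def hden_def hnum_def)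
qed

lemma mob_rotate_base:
 assumes q: "q : H3" and D: "hD q (0,1) = hD (0,2) (0,1)"
 shows "EX M. det2 M = 1 & mob M (0,1) = (0,1) & mob M (0,2) = q"
proof -
 obtain z t where qq: "q = (z,t)" by (cases q)
 have t: "t > 0" using q qq by (simp add: H3_def)
 have "((cmod z)^2 + t^2 + 1) / t = 5 / 2" using D unfolding qq hD_def by simp
 hence zz: "(cmod z)^2 = 5 / 2 * t - t^2 - 1" using t by (simp add: field_simps)
 have fac: "5 / 2 * t - t^2 - 1 = (2 - t) * (t - 1/2)" by (simp add: field_simps power2_eq_square)
 have "0 <= (2 - t) * (t - 1/2)" using zz fac by (metis zero_le_power2)
 hence tb: "t <= 2" "1/2 <= t" using t by (auto simp: zero_le_mult_iff)
 show ?thesis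
 proof (cases "t = 2")
  case True
  hence "z = 0" using zz fac by simp
  hence "mob mid (0,2) = q" "mob mid (0,1) = (0,1)" using True qq by auto
  thus ?thesis using det2_mid by blast
 next
  case False
  hence t2: "t < 2" using tb by simp
  \<comment> \<open>The unitary matrix with entries \<open>u\<close> and \<open>r\<close> fixes
    \<open>(0,1)\<close>; it sends \<open>(0,2)\<close> to \<open>q\<close> when
    \<open>1 + 3 r^2 = 2 / t\<close> and \<open>3 r u = 2 z / t\<close>.\<close>
  define r where "r = sqrt ((2 - t) / (3 * t))"
  have r2: "r^2 = (2 - t) / (3 * t)" and r: "r > 0" using t t2 by (auto simp: r_def)
  define u where "u = 2 * z / of_real (3 * t * r)"
  have u2: "(cmod u)^2 = 1 - r^2"
  proof -
   have "(cmod u)^2 = 4 * (cmod z)^2 / (9 * t^2 * r^2)"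
    using t r by (simp add: u_def norm_divide norm_mult power_divide power_mult_distrib)
   also have "... = 4 * ((2 - t) * (t - 1/2)) / (3 * t * (2 - t))"
    unfolding r2 zz fac using t by (simp add: power2_eq_square)
   also have "... = 4 * (t - 1/2) / (3 * t)" using t2 t by (simp add: divide_simps)
   also have "... = 1 - r^2" unfolding r2 using t by (simp add: field_simps)
   finally show ?thesis .
  qed
  let ?M = "M2 u (- of_real r) (of_real r) (cnj u)"
  have "u * cnj u = of_real (1 - r^2)" using u2 complex_norm_square by metis
  hence d: "det2 ?M = 1" by (simp add: det2_def power2_eq_square)
  have h1: "hden ?M (0,1) = 1" using u2 r by (simp add: hden_def)
  have h2: "hden ?M (0,2) = 2 / t" using u2 t unfolding hden_def by (simp add: r2 power_mult_distrib divide_simps)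
  have n1: "hnum ?M (0,1) = 0" by (simp add: hnum_def)
  have n2: "hnum ?M (0,2) = 3 * of_real r * u" by (simp add: hnum_def power2_eq_square)
  have "3 * of_real r * u / of_real (2 / t) = z" using r t by (simp add: u_def field_simps)
  hence "mob ?M (0,2) = q" unfolding mob_def h2 n2 qq by simp
  moreover have "mob ?M (0,1) = (0,1)" unfolding mob_def h1 n1 by simp
  ultimately show ?thesis using d by blast
 qed
qed

text \<open>Distances to two points of the vertical axis determine height and modulus, so only a
  Euclidean isometry of the plane fixing \<open>0\<close> is left; its values at \<open>1\<close>
  and \<open>\<i>\<close> tell a rotation from a reflection.\<close>

lemma hD_isometry_fixing:
 assumes H: "!!p. p : H3 ==> g p : H3"
  and D: "!!p q. p : H3 ==> q : H3 ==> hD (g p) (g q) = hD p q"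
  and f1: "g (0,1) = (0,1)" and f2: "g (0,2) = (0,2)"
 shows "EX u. cmod u = 1 & ((ALL p:H3. g p = (u * fst p, snd p)) | (ALL p:H3. g p = (u * cnj (fst p), snd p)))"
proof -
 have base: "snd (g p) = snd p & cmod (fst (g p)) = cmod (fst p)" if p: "p : H3" for p
 proof -
  define s s' where "s = snd p" and "s' = snd (g p)"
  define a b where "a = (cmod (fst p))^2" and "b = (cmod (fst (g p)))^2"
  have pos: "s > 0" "s' > 0" using H[OF p] p by (auto simp: H3_def s_def s'_def)
  have 1: "(b + s'^2 + 1) / s' = (a + s^2 + 1) / s"
   using D[OF p, of "(0,1)"] f1 by (simp add: hD_def H3_iff a_def b_def s_def s'_def)
  have 2: "(b + s'^2 + 4) / (s' * 2) = (a + s^2 + 4) / (s * 2)"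
   using D[OF p, of "(0,2)"] f2 by (simp add: hD_def H3_iff a_def b_def s_def s'_def)
  have "3 / s' = (b + s'^2 + 4) / (s' * 2) * 2 - (b + s'^2 + 1) / s'"
   using pos by (simp add: field_simps)
  also have "... = 3 / s" unfolding 1 2 using pos by (simp add: field_simps)
  finally have ss: "s' = s" using pos by (simp add: field_simps)
  hence "b = a" using 1 pos by simp
  thus ?thesis using ss by (simp add: a_def b_def s_def s'_def)
 qed
 have dist: "cmod (fst (g p) - fst (g q)) = cmod (fst p - fst q)" if p: "p : H3" and q: "q : H3" for p q
 proof -
  have "snd p * snd q > 0" using p q by (simp add: H3_def)
  hence "(cmod (fst (g p) - fst (g q)))^2 = (cmod (fst p - fst q))^2"
   using D[OF p q] base[OF p] base[OF q] p q by (simp add: hD_def H3_def)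
  thus ?thesis by simp
 qed
 define u where "u = fst (g (1,1))"
 have u: "cmod u = 1" using base[of "(1,1)"] by (simp add: u_def H3_iff)
 have uu: "u * cnj u = 1" using u complex_norm_square[of u] by simp
 define e where "e p = fst (g p) * cnj u" for p
 have ge: "fst (g p) = u * e p" for p
  unfolding e_def using uu by (metis mult.assoc mult.commute mult.right_neutral)
 have en: "cmod (e p) = cmod (fst p)" and ed: "cmod (e p - e q) = cmod (fst p - fst q)"
  if "p : H3" "q : H3" for p q
  using base[OF that(1)] dist[OF that] u by (auto simp: ge norm_mult simp flip: right_diff_distrib)
 have e1: "e (1,1) = 1" using uu by (simp add: e_def u_def)
 have re: "Re (e p) = Re (fst p)" if p: "p : H3" for p
 proof -
  have "(cmod (e p - 1))^2 = (cmod (fst p - 1))^2" "(cmod (e p))^2 = (cmod (fst p))^2"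
   using ed[OF p, of "(1,1)"] en[OF p p] e1 by (auto simp: H3_iff)
  thus ?thesis unfolding cmod_power2 by (simp add: power2_eq_square algebra_simps)
 qed
 have im: "\<bar>Im (e p)\<bar> = \<bar>Im (fst p)\<bar>" if p: "p : H3" for p
 proof -
  have "(cmod (e p))^2 = (cmod (fst p))^2" using en[OF p p] by simp
  hence "(Im (e p))^2 = (Im (fst p))^2" unfolding cmod_power2 re[OF p] by simp
  thus ?thesis by (simp add: abs_eq_iff power2_eq_iff)
 qed
 have ei: "Re (e (\<i>,1)) = 0" using re[of "(\<i>,1)"] by (simp add: H3_iff)
 have gp: "g p = (u * e p, snd p)" if "p : H3" for p
  using base[OF that] ge[of p] by (simp add: prod_eq_iff)
 have imeq: "Im (e p) * Im (e (\<i>,1)) = Im (fst p)" if p: "p : H3" for p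
 proof -
  have "(cmod (e p - e (\<i>,1)))^2 = (cmod (fst p - \<i>))^2" using ed[OF p, of "(\<i>,1)"] by (simp add: H3_iff)
  moreover have "(Im (e (\<i>,1)))^2 = 1" using im[of "(\<i>,1)"] by (simp add: H3_iff abs_square_eq_1)
  moreover have "(Im (e p))^2 = (Im (fst p))^2" using im[OF p] by (metis power2_abs)
  ultimately show ?thesis unfolding cmod_power2 using re[OF p] ei
   by (simp add: power2_diff)
 qed
 have "Im (e (\<i>,1)) = 1 | Im (e (\<i>,1)) = -1" using im[of "(\<i>,1)"] by (auto simp: H3_iff abs_if split: if_splits)
 thus ?thesis
 proof
  assume "Im (e (\<i>,1)) = 1"
  hence "e p = fst p" if "p : H3" for p using imeq[OF that] re[OF that] by (simp add: complex_eq_iff)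
  thus ?thesis using gp u by auto
 next
  assume "Im (e (\<i>,1)) = -1"
  hence "e p = cnj (fst p)" if "p : H3" for p using imeq[OF that] re[OF that] by (simp add: complex_eq_iff)
  thus ?thesis using gp u by auto
 qed
qed

lemma mob_diag:
 assumes "cmod u = 1" shows "EX M. det2 M = 1 & (ALL p. mob M p = (u * fst p, snd p))"
proof (intro exI conjI allI)
 define v where "v = csqrt u"
 have v2: "v * v = u" by (metis power2_csqrt power2_eq_square v_def)
 have v1: "cmod v = 1" using assms by (simp add: v_def norm_csqrt)
 have vv: "v * cnj v = 1" using v1 complex_norm_square[of v] by simp
 show "det2 (M2 v 0 0 (cnj v)) = 1" using vv by (simp add: det2_def)
 fix p show "mob (M2 v 0 0 (cnj v)) p = (u * fst p, snd p)"
  using v1 v2 by (simp add: mob_def hden_def hnum_def mult.commute mult.left_commute)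
qed

text \<open>A Moebius map \<open>B\<close> with the same values at \<open>(0,1)\<close> and
  \<open>(0,2)\<close> is split off; what remains fixes both points.\<close>

theorem H3_isometry_cases:
 assumes g: "H3_isometry g"
 shows "EX M. det2 M = 1 & ((ALL p:H3. g p = mob M p) | (ALL p:H3. g p = mob M (cconj p)))"
proof -
 have j: "(0,1) : H3" "(0,2) : H3" by (auto simp: H3_iff)
 obtain A where A: "det2 A = 1" "mob A (0,1) = g (0,1)"
  using mob_translate_base[of "snd (g (0,1))" "fst (g (0,1))"] H3_isometry_in[OF g j(1)]
  by (auto simp: H3_def)
 define q where "q = mob (minv A) (g (0,2))"
 have q: "q : H3" using A by (simp add: q_def mob_in_H3 H3_isometry_in[OF g j(2)])
 have "hD q (0,1) = hD q (mob (minv A) (g (0,1)))"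
  using A mob_minv(1)[OF A(1) j(1)] by simp
 also have "... = hD (0,2) (0,1)"
  unfolding q_def using mob_hD[of "minv A"] A g by (simp add: H3_isometry_hD H3_isometry_in j)
 finally obtain U where U: "det2 U = 1" "mob U (0,1) = (0,1)" "mob U (0,2) = q"
  using mob_rotate_base[OF q] by blast
 define B where "B = A *m U"
 have B: "det2 B = 1" using A U by (simp add: B_def det2_mmul)
 have B1: "mob B (0,1) = g (0,1)" using mob_mmul[OF U(1) j(1)] A U by (simp add: B_def)
 have B2: "mob B (0,2) = g (0,2)" using mob_mmul[OF U(1) j(2)] A U
  mob_minv(2)[OF A(1) H3_isometry_in[OF g j(2)]] by (simp add: B_def q_def)
 define h where "h p = mob (minv B) (g p)" for p
 have "EX u. cmod u = 1 & ((ALL p:H3. h p = (u * fst p, snd p)) | (ALL p:H3. h p = (u * cnj (fst p), snd p)))"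
 proof (rule hD_isometry_fixing)
  show "p : H3 ==> h p : H3" for p using B by (simp add: h_def mob_in_H3 H3_isometry_in[OF g])
  show "p : H3 ==> q : H3 ==> hD (h p) (h q) = hD p q" for p q
   using B by (simp add: h_def mob_hD H3_isometry_in[OF g] H3_isometry_hD[OF g])
  show "h (0,1) = (0,1)" "h (0,2) = (0,2)"
   using mob_minv(1)[OF B] j B1 B2 by (metis h_def)+
 qed
 then obtain u where u: "cmod u = 1" "(ALL p:H3. h p = (u * fst p, snd p)) | (ALL p:H3. h p = (u * cnj (fst p), snd p))"
  by blast
 obtain V where V: "det2 V = 1" "!!p. mob V p = (u * fst p, snd p)" using mob_diag[OF u(1)] by blast
 have gh: "g p = mob B (h p)" if "p : H3" for p
  unfolding h_def using mob_minv(2)[OF B H3_isometry_in[OF g that]] by simp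
 have cc: "cconj p : H3" if "p : H3" for p using that by (simp add: H3_def cconj_def)
 have "(ALL p:H3. g p = mob (B *m V) p) | (ALL p:H3. g p = mob (B *m V) (cconj p))"
  using u(2)
 proof (elim disjE)
  assume "ALL p:H3. h p = (u * fst p, snd p)"
  thus ?thesis using gh V mob_mmul[OF V(1)] by simp
 next
  assume "ALL p:H3. h p = (u * cnj (fst p), snd p)"
  hence "h p = mob V (cconj p)" if "p : H3" for p using V that by (simp add: cconj_def)
  thus ?thesis using gh mob_mmul[OF V(1) cc] by simp
 qed
 moreover have "det2 (B *m V) = 1" using B V by (simp add: det2_mmul)
 ultimately show ?thesis by blast
qed

lemma cconj_H3 [simp]: "cconj p : H3 \<longleftrightarrow> p : H3"
 by (simp add: H3_def cconj_def)

lemma continuous_on_mob: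
 assumes "det2 M = 1" shows "continuous_on H3 (mob M)"
proof -
 have "continuous_on H3 (hden M)" "continuous_on H3 (hnum M)"
  unfolding hden_def hnum_def by (intro continuous_intros)+
 moreover have "ALL p:H3. hden M p ~= 0" using hden_pos[OF assms] by fastforce
 ultimately show ?thesis unfolding mob_def by (intro continuous_intros) auto
qed

lemma continuous_on_cconj: "continuous_on S cconj"
 unfolding cconj_def by (intro continuous_intros)

lemma H3_isometry_continuous:
 assumes "H3_isometry g" shows "continuous_on H3 g"
proof -
 obtain M where M: "det2 M = 1" "(ALL p:H3. g p = mob M p) | (ALL p:H3. g p = mob M (cconj p))"
  using H3_isometry_cases[OF assms] by blast
 have "continuous_on H3 (%p. mob M (cconj p))"
  by (rule continuous_on_compose2[OF continuous_on_mob[OF M(1)] continuous_on_cconj]) auto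
 thus ?thesis using M continuous_on_mob[OF M(1)] by (metis (no_types, lifting) continuous_on_cong)
qed

lemma mob_eq_id_imp:
 assumes "det2 M = 1" "!!p. p : H3 ==> mob M p = p"
 shows "M = mid | M = mneg mid"
proof -
 obtain a b c d where M: "M = M2 a b c d" by (cases M)
 have h: "hden M p = 1" if "p : H3" for p
 proof -
  have "snd p / hden M p = snd p" "snd p > 0" using assms(2)[OF that] that by (auto simp: snd_mob[symmetric] H3_def)
  thus ?thesis by (auto simp: divide_eq_eq split: if_splits)
 qed
 have "(cmod d)^2 + (cmod c)^2 = 1" "(cmod d)^2 + (cmod c)^2 * 4 = 1"
  using h[of "(0,1)"] h[of "(0,2)"] by (auto simp: M hden_def H3_iff)
 hence "(cmod c)^2 = 0" "(cmod d)^2 = 1" by linarith+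
 hence c: "c = 0" and d: "cmod d = 1" by (auto simp: abs_square_eq_1)
 have ad: "a * d = 1" using assms(1) c by (simp add: M det2_def)
 have n: "hnum M p = fst p" if "p : H3" for p using arg_cong[OF assms(2)[OF that], of fst] h[OF that] by (simp add: fst_mob)
 have "b * cnj d = 0" "(a + b) * cnj d = 1" using n[of "(0,1)"] n[of "(1,1)"] c by (auto simp: M hnum_def H3_iff)
 moreover have "d ~= 0" using d by auto
 ultimately have b: "b = 0" and "a * cnj d = 1" by auto
 moreover have "d * cnj d = 1" using d complex_norm_square[of d] by simp
 ultimately have "a = d" using \<open>d ~= 0\<close> by (metis mult_right_cancel complex_cnj_zero_iff)
 hence "a = 1 | a = -1" using ad by (metis power2_eq_1_iff power2_eq_square)
 thus ?thesis using b c \<open>a = d\<close> by (auto simp: M mid_def mneg_def)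
qed

section \<open>Horoballs\<close>

abbreviation Binf :: "(point3) set" where "Binf \<equiv> {p. 1 < snd p}"

lemma Binf_subset: "Binf <= H3" by (auto simp: H3_def)

lemma mob_upper:
 assumes "det2 M = 1" "e21 M = 0"
 shows "mob M p = ((e11 M)^2 * fst p + e11 M * e12 M, (cmod (e11 M))^2 * snd p)"
proof -
 have ad: "e11 M * e22 M = 1" using assms by (simp add: det2_def)
 hence nz: "e11 M ~= 0" by auto
 have nz: "e11 M ~= 0" "e22 M = 1 / e11 M" using ad nz by (auto simp: eq_divide_eq mult.commute)
 have "hden M p = 1 / (cmod (e11 M))^2" using assms nz by (simp add: hden_def norm_divide power_divide)
 moreover have "hnum M p = (e11 M * fst p + e12 M) / cnj (e11 M)" using assms nz by (simp add: hnum_def)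
 moreover have "complex_of_real ((cmod (e11 M))^2) / cnj (e11 M) = e11 M" unfolding complex_norm_square using nz by simp
 ultimately have "hnum M p / of_real (hden M p) = (e11 M * fst p + e12 M) * e11 M"
  by (simp add: divide_inverse mult.assoc mult.commute)
 thus ?thesis unfolding mob_def \<open>hden M p = _\<close> by (simp add: algebra_simps power2_eq_square)
qed

lemma mob_snd_at_pole:
 assumes "e21 M ~= 0"
 shows "snd (mob M (- e22 M / e21 M, t)) = 1 / ((cmod (e21 M))^2 * t)"
 using assms by (cases "t = 0") (auto simp: snd_mob hden_def power2_eq_square field_simps)

text \<open>If \<open>c\<close> is nonzero, the point above the pole \<open>- d / c\<close> at
  height \<open>t\<close> goes to height \<open>1 / (|c|^2 t)\<close>, which is low when
  \<open>t\<close> is large; if \<open>c = 0\<close>, heights are multiplied by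
  \<open>|a|^2\<close>.\<close>

lemma mob_Binf_eq:
 assumes M: "det2 M = 1" and eq: "mob M ` Binf = Binf"
 shows "e21 M = 0" "cmod (e11 M) = 1"
proof -
 show c: "e21 M = 0"
 proof (rule ccontr)
  assume nz: "e21 M ~= 0"
  define t where "t = max 2 (1 / (cmod (e21 M))^2)"
  have t: "t > 1" "1 / (cmod (e21 M))^2 <= t" by (auto simp: t_def)
  have "mob M (- e22 M / e21 M, t) : Binf" using eq t by (metis (mono_tags, lifting) imageI mem_Collect_eq snd_conv)
  hence "1 < 1 / ((cmod (e21 M))^2 * t)" using mob_snd_at_pole[OF nz] by simp
  moreover have "1 <= (cmod (e21 M))^2 * t" using t nz by (simp add: field_simps)
  ultimately show False by (simp add: field_simps split: if_splits)
 qed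
 define r where "r = (cmod (e11 M))^2"
 have r0: "r > 0" using M c by (auto simp: det2_def r_def)
 have s: "snd (mob M p) = r * snd p" for p using mob_upper[OF M c] by (simp add: r_def)
 have "r >= 1"
 proof (rule ccontr)
  assume "\<not> r >= 1"
  hence "(0, 1/r) : Binf" using r0 by simp
  hence "mob M (0,1/r) : Binf" using eq by blast
  thus False using s[of "(0,1/r)"] r0 by simp
 qed
 moreover have "r <= 1"
 proof (rule ccontr)
  assume "\<not> r <= 1"
  hence "(0, r) : Binf" by simp
  then obtain p where "p : Binf" "mob M p = (0,r)" using eq by (metis (no_types, lifting) imageE)
  thus False using s[of p] r0 by auto
 qed
 ultimately show "cmod (e11 M) = 1" by (simp add: r_def abs_square_eq_1)
qed

lemma mob_Binf_disjoint:
 assumes M: "det2 M = 1" and dis: "mob M ` Binf \<inter> Binf = {}"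
 shows "1 <= cmod (e21 M)"
proof (rule ccontr)
 assume l: "\<not> 1 <= cmod (e21 M)"
 show False
 proof (cases "e21 M = 0")
  case True
  hence a: "e11 M ~= 0" using M by (auto simp: det2_def)
  define t where "t = 1 + 1 / (cmod (e11 M))^2"
  have "(cmod (e11 M))^2 * t > 1" using a by (simp add: t_def algebra_simps)
  hence "mob M (0,t) : Binf" using mob_upper[OF M True] by simp
  moreover have "(0,t) : Binf" using a by (simp add: t_def)
  ultimately show False using dis by blast
 next
  case False
  define k where "k = cmod (e21 M)"
  have k: "0 < k" "k < 1" using False l by (auto simp: k_def)
  define t where "t = 1 / k"
  have "t > 1" using k by (simp add: t_def)
  moreover have "snd (mob M (- e22 M / e21 M, t)) = 1 / k"
   unfolding mob_snd_at_pole[OF False] k_def[symmetric] using k by (simp add: t_def power2_eq_square)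
  moreover have "1 / k > 1" using k by simp
  ultimately have "mob M (- e22 M / e21 M, t) : mob M ` Binf \<inter> Binf"
   by (intro IntI imageI CollectI) simp_all
  thus False using dis by simp
 qed
qed

text \<open>The closed horoball based at \<open>a / c\<close> has Euclidean diameter \<open>1 / \<bar>c\<bar>\<^sup>2\<close>.\<close>

lemma mob_Binf_closure_height:
 assumes M: "det2 M = 1" and c: "e21 M ~= 0" and q: "q : closure (mob M ` Binf)" "q : H3"
 shows "snd q <= 1 / (cmod (e21 M))^2"
proof -
 have "mob M ` Binf <= {q. snd q <= 1 / (cmod (e21 M))^2}"
 proof (rule image_subsetI)
  fix p :: "point3" assume "p : Binf"
  hence p: "1 < snd p" by simp
  have "(cmod (e21 M))^2 * snd p <= (cmod (e21 M))^2 * (snd p)^2"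
   using p by (intro mult_left_mono) (auto simp: power2_eq_square)
  also have "... <= hden M p" by (simp add: hden_def)
  finally have "(cmod (e21 M))^2 * snd p <= hden M p" .
  moreover have "0 < (cmod (e21 M))^2 * snd p" using c p by simp
  ultimately have "snd p / hden M p <= snd p / ((cmod (e21 M))^2 * snd p)"
   using p by (intro divide_left_mono) auto
  thus "mob M p : {q. snd q <= 1 / (cmod (e21 M))^2}"
   unfolding snd_mob mem_Collect_eq using p by (simp add: mult.commute)
 qed
 moreover have "closed {q :: point3. snd q <= 1 / (cmod (e21 M))^2}"
  by (intro closed_Collect_le continuous_intros)
 ultimately show ?thesis using q closure_minimal by blast
qed

section \<open>Covering actions and lifts\<close>

text \<open>The group laws are demanded on \<open>Y\<close> only, because values outside
  \<open>Y\<close> are arbitrary; for the same reason an element counts as trivial when it is the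
  identity on \<open>Y\<close>.\<close>

definition covering_action :: "'a::topological_space set => ('a => 'a) set => bool" where
 "covering_action Y G \<longleftrightarrow> open Y & (ALL g:G. continuous_on Y g & g ` Y <= Y) &
  (EX e:G. ALL y:Y. e y = y) &
  (ALL g:G. ALL h:G. EX k:G. ALL y:Y. k y = g (h y)) &
  (ALL g:G. EX k:G. ALL y:Y. k (g y) = y & g (k y) = y) &
  (ALL y:Y. EX U. open U & y : U & U <= Y & (ALL g:G. g ` U \<inter> U ~= {} --> (ALL y:Y. g y = y)))"

definition act_rel :: "'a set => ('a => 'a) set => 'a rel" where
 "act_rel Y G = {(y, y'). y : Y & (EX g:G. y' = g y)}"

locale cov_act =
 fixes Y :: "'a::t2_space set" and G :: "('a => 'a) set"
 assumes ca: "covering_action Y G"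
begin

lemma openY: "open Y" and act_cont: "g : G ==> continuous_on Y g"
 and act_in: "g : G ==> y : Y ==> g y : Y"
 using ca by (auto simp: covering_action_def)

lemmas D = ca[unfolded covering_action_def]

lemma act_id: obtains e where "e : G" "!!y. y : Y ==> e y = y"
 using D[THEN conjunct2, THEN conjunct2, THEN conjunct1] by (elim bexE) blast

lemma act_comp: assumes "g : G" "h : G" obtains k where "k : G" "!!y. y : Y ==> k y = g (h y)"
 using bspec[OF bspec[OF D[THEN conjunct2, THEN conjunct2, THEN conjunct2, THEN conjunct1] assms(1)] assms(2)] by (elim bexE) blast

lemma act_inv: assumes "g : G" obtains k where "k : G" "!!y. y : Y ==> k (g y) = y" "!!y. y : Y ==> g (k y) = y"
 using bspec[OF D[THEN conjunct2, THEN conjunct2, THEN conjunct2, THEN conjunct2, THEN conjunct1] assms] by (elim bexE) blast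

lemma act_nbhd: assumes "y : Y"
 obtains U where "open U" "y : U" "U <= Y"
  "!!g u v. g : G ==> u : U ==> g u : U ==> v : Y ==> g v = v"
proof -
 obtain U where U: "open U" "y : U" "U <= Y" "ALL g:G. g ` U \<inter> U ~= {} --> (ALL y:Y. g y = y)"
  using bspec[OF D[THEN conjunct2, THEN conjunct2, THEN conjunct2, THEN conjunct2, THEN conjunct2] assms] by (elim exE conjE)
 show ?thesis by (rule that[OF U(1-3)]) (use U(4) in blast)
qed

lemma act_free: assumes "g : G" "y : Y" "g y = y" "v : Y" shows "g v = v"
 using act_nbhd[OF assms(2)] assms by metis

lemma act_eq: assumes "g : G" "h : G" "y : Y" "g y = h y" "v : Y" shows "g v = h v"
proof -
 obtain h' where h': "h' : G" "!!y. y : Y ==> h' (h y) = y" "!!y. y : Y ==> h (h' y) = y"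
  using act_inv[OF assms(2)] by blast
 obtain k where k: "k : G" "!!y. y : Y ==> k y = h' (g y)" using act_comp[OF h'(1) assms(1)] by blast
 have "k y = y" using k h' assms by auto
 hence "k v = v" using act_free k assms by blast
 hence "h' (g v) = v" using k assms by auto
 thus ?thesis using h'(3)[of "g v"] act_in assms by metis
qed

lemma act_open_image: assumes "g : G" "open U" "U <= Y" shows "open (g ` U)"
proof -
 obtain k where k: "k : G" "!!y. y : Y ==> k (g y) = y" "!!y. y : Y ==> g (k y) = y"
  using act_inv[OF assms(1)] by blast
 have "g ` U = Y \<inter> k -` U" using k assms act_in by (auto simp: image_iff subset_iff) metis
 thus ?thesis using continuous_open_preimage[OF act_cont[OF k(1)] openY assms(2)] by simp
qed

lemma act_equiv: "equiv Y (act_rel Y G)"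
proof (rule equivI)
 show "act_rel Y G <= Y \<times> Y" using act_in by (auto simp: act_rel_def)
 show "refl_on Y (act_rel Y G)" using act_id by (auto simp: refl_on_def act_rel_def) metis
 show "sym (act_rel Y G)" unfolding sym_def act_rel_def using act_inv act_in by (auto) metis
 show "trans (act_rel Y G)" unfolding trans_def act_rel_def using act_comp act_in by (auto) metis
qed

lemma act_relD: "(y, y') : act_rel Y G ==> y : Y & y' : Y"
 using act_in by (auto simp: act_rel_def)

text \<open>The group element carrying \<open>f1\<close> to \<open>f2\<close> is locally constant,
  so the set where a given one works is open and closed.\<close>

lemma lift_unique:
 fixes f1 f2 :: "'b::topological_space => 'a"
 assumes S: "connected S" and c1: "continuous_on S f1" and c2: "continuous_on S f2"
  and rel: "!!d. d : S ==> (f1 d, f2 d) : act_rel Y G"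
 shows "EX g:G. ALL d:S. f2 d = g (f1 d)"
proof (cases "S = {}")
 case True thus ?thesis using act_id by (metis empty_iff)
next
 case False
 have loc: "EX N. openin (top_of_set S) N & d : N & (ALL d':N. f2 d' = g (f1 d'))"
  if d: "d : S" and g: "g : G" "f2 d = g (f1 d)" for d g
 proof -
  have Y12: "f1 d' : Y" "f2 d' : Y" if "d' : S" for d' using act_relD rel that by blast+
  obtain U where U: "open U" "f2 d : U" "U <= Y"
   "!!g u v. g : G ==> u : U ==> g u : U ==> v : Y ==> g v = v"
   using act_nbhd[OF Y12(2)[OF d]] by metis
  have cg: "continuous_on S (%x. g (f1 x))"
   by (rule continuous_on_compose2[OF act_cont[OF g(1)] c1]) (use Y12 in auto)
  let ?N = "(S \<inter> f2 -` U) \<inter> (S \<inter> (%x. g (f1 x)) -` U)"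
  have "openin (top_of_set S) ?N"
   by (intro openin_Int continuous_openin_preimage_gen c2 cg U)
  moreover have "d : ?N" using d g U by auto
  moreover have "f2 d' = g (f1 d')" if d': "d' : ?N" for d'
  proof -
   obtain h where h: "h : G" "f2 d' = h (f1 d')" using rel[of d'] d' by (auto simp: act_rel_def)
   obtain k where k: "k : G" "!!y. y : Y ==> k (g y) = y" using act_inv[OF g(1)] by metis
   obtain m where m: "m : G" "!!y. y : Y ==> m y = h (k y)" using act_comp[OF h(1) k(1)] by metis
   have i: "f1 d' : Y" "g (f1 d') : U" "f2 d' : U" using d' Y12 by auto
   have "m (g (f1 d')) = f2 d'" using m k h i act_in g by metis
   hence "m (g (f1 d')) = g (f1 d')" using U(4)[OF m(1) i(2)] i U(3) by auto
   thus ?thesis using \<open>m (g (f1 d')) = f2 d'\<close> by simp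
  qed
  ultimately show ?thesis by blast
 qed
 obtain d0 where d0: "d0 : S" using False by blast
 obtain g where g: "g : G" "f2 d0 = g (f1 d0)" using rel[OF d0] by (auto simp: act_rel_def)
 let ?A = "{d:S. f2 d = g (f1 d)}"
 have 1: "openin (top_of_set S) ?A"
  by (subst openin_subopen) (use loc g openin_imp_subset in "fastforce")
 have 2: "openin (top_of_set S) (S - ?A)"
 proof (subst openin_subopen, intro ballI)
  fix d assume d: "d : S - ?A"
  obtain h where h: "h : G" "f2 d = h (f1 d)" using rel[of d] d by (auto simp: act_rel_def)
  obtain N where N: "openin (top_of_set S) N" "d : N" "ALL d':N. f2 d' = h (f1 d')"
   using loc[of d h] d h by blast
  have "N <= S - ?A"
  proof
   fix x assume x: "x : N"
   hence xS: "x : S" using N openin_imp_subset by blast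
   have False if "f2 x = g (f1 x)"
   proof -
    have "h (f1 x) = g (f1 x)" using that N x by auto
    moreover have "f1 x : Y" "f1 d : Y" using act_relD rel xS d by blast+
    ultimately have "h (f1 d) = g (f1 d)" using act_eq[OF h(1) g(1)] by blast
    thus False using d h by auto
   qed
   thus "x : S - ?A" using xS by blast
  qed
  thus "EX T. openin (top_of_set S) T & d : T & T <= S - ?A" using N by blast
 qed
 have "closedin (top_of_set S) ?A" using 2 by (simp add: closedin_def Collect_restrict)
 hence "?A = S" using S 1 d0 g unfolding connected_clopen by (metis (mono_tags, lifting) empty_iff mem_Collect_eq)
 thus ?thesis using g by blast
qed

lemma lift_unique_eq:
 fixes f1 f2 :: "'b::topological_space => 'a"
 assumes "connected S" "continuous_on S f1" "continuous_on S f2"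
  and rel: "!!d. d : S ==> (f1 d, f2 d) : act_rel Y G"
  and d0: "d0 : S" "f1 d0 = f2 d0" and d: "d : S"
 shows "f1 d = f2 d"
proof -
 obtain g where g: "g : G" "ALL d:S. f2 d = g (f1 d)" using lift_unique[OF assms(1-4)] by blast
 have "f1 d0 : Y" "f1 d : Y" using act_relD rel d0 d by blast+
 moreover have "g (f1 d0) = f1 d0" using g d0 by auto
 ultimately show ?thesis using act_free[OF g(1)] g d by metis
qed

end

locale cov_act_normed = cov_act Y G for Y :: "'a::real_normed_vector set" and G
begin

text \<open>The quotient is only an abstract topology, so the lifting theorem is applied to the
  pulled-back covering \<open>W\<close> of \<open>S\<close>: a lift of \<open>f\<close> is a section
  of \<open>W\<close>.\<close>

lemma lift_exists:
 fixes S :: "'b::real_normed_vector set"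
 assumes S: "simply_connected S" "locally path_connected S"
  and f: "continuous_map (top_of_set S) (quotient_topology (top_of_set Y) (act_rel Y G)) f"
  and d0: "d0 : S" "y0 : f d0"
 shows "EX k. continuous_on S k & k ` S <= Y & (ALL d:S. k d : f d) & k d0 = y0"
proof -
 let ?r = "act_rel Y G"
 define W where "W = {(d, y). d : S & y : f d}"
 have fq: "f d : Y // ?r" if "d : S" for d
  using continuous_map_funspace[OF f] that by (auto simp: topspace_quotient_topology)
 have cls: "f d = ?r `` {y}" if "d : S" "y : f d" for d y
  using fq[OF that(1)] that(2) act_equiv by (metis Image_singleton_iff equiv_class_eq quotientE)
 have fY: "y : Y" if "d : S" "y : f d" for d y
  using fq[OF that(1)] that(2) act_equiv by (metis Union_iff Union_quotient)
 have ne: "f d ~= {}" if "d : S" for d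
  using fq[OF that] act_equiv in_quotient_imp_non_empty by blast
 have feq: "EX g:G. y' = g y" if "d : S" "y : f d" "y' : f d" for d y y'
  using cls[OF that(1,2)] that(3) by (auto simp: act_rel_def)
 have fcl: "g y : f d" if "d : S" "y : f d" "g : G" for d y g
  using cls[OF that(1,2)] fY[OF that(1,2)] that(3) by (auto simp: act_rel_def)
 have opn: "openin (top_of_set S) {d:S. f d \<inter> A ~= {}}" if A: "open A" "A <= Y" for A
 proof -
  let ?C = "(%y. ?r `` {y}) ` A"
  have "{x : Y. ?r `` {x} : ?C} = (\<Union>g\<in>G. g ` A)"
  proof safe
   fix x y assume "x : Y" "?r `` {x} = ?r `` {y}" "y : A"
   hence "(y, x) : ?r" using act_equiv A by (metis equiv_class_eq_iff subsetD)
   thus "x : (\<Union>g\<in>G. g ` A)" using \<open>y : A\<close> by (auto simp: act_rel_def)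
  next
   fix g y assume "g : G" "y : A"
   hence *: "(y, g y) : ?r" using A by (auto simp: act_rel_def)
   thus "g y : Y" using act_relD by blast
   show "?r `` {g y} : ?C" using * \<open>y : A\<close> act_equiv by (metis equiv_class_eq image_eqI)
  qed
  moreover have "open (\<Union>g\<in>G. g ` A)" using act_open_image A by blast
  ultimately have "openin (quotient_topology (top_of_set Y) ?r) ?C"
   using A openY by (auto simp: openin_quotient_topology quotient_def openin_open_eq)
  hence "openin (top_of_set S) {d : topspace (top_of_set S). f d : ?C}"
   using f openin_continuous_map_preimage by blast
  moreover have "{d : topspace (top_of_set S). f d : ?C} = {d:S. f d \<inter> A ~= {}}"
  proof safe
   fix d y assume "d : topspace (top_of_set S)" "f d = ?r `` {y}" "y : A" "f d \<inter> A = {}"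
   hence "y : f d" using act_equiv A by (metis equiv_class_self subsetD)
   thus False using \<open>y : A\<close> \<open>f d \<inter> A = {}\<close> by blast
  next
   fix d y assume "d : S" "y : f d" "y : A"
   thus "f d : ?C" using cls by blast
  qed auto
  ultimately show ?thesis by simp
 qed
 have "covering_space W fst S"
 proof
  show "continuous_on W fst" by (intro continuous_intros)
  show "fst ` W = S" using ne by (force simp: W_def)
  fix x assume x: "x : S"
  obtain y where y: "y : f x" using ne x by blast
  obtain U where U: "open U" "y : U" "U <= Y"
   "!!g u v. g : G ==> u : U ==> g u : U ==> v : Y ==> g v = v"
   using act_nbhd[OF fY[OF x y]] by metis
  define T where "T = {d:S. f d \<inter> U ~= {}}"
  \<comment> \<open>The sheets over \<open>T\<close>, one for each translate of the evenly covered
    set \<open>U\<close>.\<close>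
  define V where "V g = {(d, y). d : T & y : f d & y : g ` U}" for g
  have T: "openin (top_of_set S) T" unfolding T_def using opn U by blast
  \<comment> \<open>Translates of \<open>U\<close> by elements that differ on \<open>Y\<close> are
    disjoint.\<close>
  have key: "ALL v:Y. g v = h v" if gh: "g : G" "h : G" "u : U" "u' : U" "g u = h u'" for g h u u'
  proof -
   obtain h' where h': "h' : G" "!!y. y : Y ==> h' (h y) = y" "!!y. y : Y ==> h (h' y) = y"
    using act_inv[OF gh(2)] by metis
   obtain k where k: "k : G" "!!y. y : Y ==> k y = h' (g y)" using act_comp[OF h'(1) gh(1)] by metis
   have "u : Y" "u' : Y" using gh U(3) by auto
   hence "k u = u'" using k(2) h'(2) gh(5) by simp
   hence "k v = v" if "v : Y" for v using U(4)[OF k(1) gh(3)] that gh(4) by auto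
   hence "g v = h v" if "v : Y" for v using k h' act_in that gh(1) by metis
   thus ?thesis by simp
  qed
  have uniq: "y1 = y2" if g: "g : G" and d: "d : S" and y12: "y1 : f d" "y2 : f d" "y1 : g ` U" "y2 : g ` U" for g d y1 y2
  proof -
   obtain u1 u2 where u: "u1 : U" "u2 : U" "y1 = g u1" "y2 = g u2" using y12 by blast
   obtain m where m: "m : G" "y2 = m y1" using feq[OF d y12(1,2)] by blast
   obtain mg where mg: "mg : G" "!!y. y : Y ==> mg y = m (g y)" using act_comp[OF m(1) g] by metis
   have "mg u1 = g u2" using mg m u U(3) by auto
   hence "ALL v:Y. mg v = g v" using key[OF mg(1) g u(1,2)] by blast
   thus ?thesis using u mg m U(3) by auto
  qed
  have "\<Union> (V ` G) = W \<inter> fst -` T"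
  proof (intro equalityI subsetI)
   fix x assume "x : \<Union> (V ` G)"
   thus "x : W \<inter> fst -` T" by (auto simp: V_def W_def T_def)
  next
   fix x assume x: "x : W \<inter> fst -` T"
   obtain d y where dy: "x = (d, y)" by (cases x)
   obtain u where u: "d : T" "d : S" "y : f d" "u : f d" "u : U" using x by (auto simp: W_def T_def dy)
   obtain g where "g : G" "y = g u" using feq[OF u(2,4,3)] by blast
   thus "x : \<Union> (V ` G)" using u by (auto simp: V_def dy)
  qed
  moreover have "openin (top_of_set W) (V g)" if "g : G" for g
  proof -
   obtain T0 where T0: "open T0" "T = S \<inter> T0" using T by (auto simp: openin_open)
   have "V g = W \<inter> (T0 \<times> g ` U)" using T0 by (auto simp: V_def W_def)
   moreover have "open (T0 \<times> g ` U)" using T0 act_open_image[OF that U(1,3)] by (simp add: open_Times)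
   ultimately show ?thesis by (simp add: openin_open_Int)
  qed
  moreover have "pairwise disjnt (V ` G)"
  proof (clarsimp simp: pairwise_def disjnt_iff)
   fix g h d y assume gh: "g : G" "h : G" "V g ~= V h" "(d, y) : V g" "(d, y) : V h"
   then obtain u u' where "u : U" "u' : U" "y = g u" "y = h u'" by (auto simp: V_def)
   hence "ALL v:Y. g v = h v" using key gh by metis
   hence "g ` U = h ` U" using U(3) by (intro image_cong) auto
   thus False using gh(3) by (simp add: V_def)
  qed
  moreover have "EX q. homeomorphism (V g) T fst q" if g: "g : G" for g
  proof -
   define s where "s d = (THE y. y : f d & y : g ` U)" for d
   have s: "s d : f d & s d : g ` U" if d: "d : T" for d
   proof -
    obtain u where "d : S" "u : f d" "u : U" using d by (auto simp: T_def)
    hence "g u : f d & g u : g ` U" using fcl g by blast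
    hence "EX! y. y : f d & y : g ` U"
     using uniq[OF g \<open>d : S\<close>] by (intro ex1I[of _ "g u"]) simp_all
    thus ?thesis unfolding s_def by (rule theI')
   qed
   have TS: "T <= S" by (auto simp: T_def)
   have "continuous_on T s"
    unfolding continuous_openin_preimage_eq
   proof (intro allI impI)
    fix B :: "'a set" assume B: "open B"
    have gU: "open (g ` U)" "g ` U <= Y" using act_open_image[OF g U(1,3)] act_in[OF g] U(3) by auto
    have "T \<inter> s -` B = T \<inter> {d:S. f d \<inter> (B \<inter> g ` U) ~= {}}"
    proof (intro equalityI subsetI)
     fix d assume "d : T \<inter> s -` B"
     thus "d : T \<inter> {d:S. f d \<inter> (B \<inter> g ` U) ~= {}}" using s[of d] TS by auto
    next
     fix d assume d: "d : T \<inter> {d:S. f d \<inter> (B \<inter> g ` U) ~= {}}"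
     then obtain z where "z : f d" "z : B" "z : g ` U" "d : S" "d : T" by auto
     thus "d : T \<inter> s -` B" using uniq[OF g, of d z "s d"] s[of d] by auto
    qed
    moreover have "openin (top_of_set S) {d:S. f d \<inter> (B \<inter> g ` U) ~= {}}"
     using gU B by (intro opn) auto
    ultimately have "openin (top_of_set S) (T \<inter> s -` B)" using openin_Int[OF T] by simp
    thus "openin (top_of_set T) (T \<inter> s -` B)"
     by (rule openin_subset_trans) (use TS in auto)
   qed
   hence cs: "continuous_on T (%d. (d, s d))" by (intro continuous_intros)
   have sV: "(d, s d) : V g" if "d : T" for d using s[OF that] that by (simp add: V_def)
   have Vs: "fst x : T & x = (fst x, s (fst x))" if "x : V g" for x
   proof -
    have x: "fst x : T" "snd x : f (fst x)" "snd x : g ` U"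
     using that by (auto simp: V_def)
    have "fst x : S" using x TS by blast
    hence "snd x = s (fst x)" using uniq[OF g] x s[OF x(1)] by blast
    thus ?thesis using x by (simp add: prod_eq_iff)
   qed
   have "homeomorphism (V g) T fst (%d. (d, s d))"
    unfolding homeomorphism_def
   proof (intro conjI cs ballI)
    show "continuous_on (V g) fst" by (intro continuous_intros)
    show "fst ` V g = T" using sV Vs by force
    show "(%d. (d, s d)) ` T = V g"
    proof (intro equalityI subsetI)
     fix x assume "x : V g"
     thus "x : (%d. (d, s d)) ` T" using Vs[of x] by (intro image_eqI[of _ _ "fst x"]) auto
    qed (use sV in auto)
    show "(fst x, s (fst x)) = x" if "x : V g" for x using Vs[OF that] by simp
   qed simp
   thus ?thesis by blast
  qed
  ultimately show "EX T. x : T & openin (top_of_set S) T & (EX v. \<Union> v = W \<inter> fst -` T & (ALL u:v. openin (top_of_set W) u)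
    & pairwise disjnt v & (ALL u:v. EX q. homeomorphism u T fst q))"
   using T x y U(2) by (intro exI[of _ T] conjI exI[of _ "V ` G"]) (auto simp: T_def)
 qed
 then obtain k where k: "continuous_on S k" "k : S \<rightarrow> W" "!!d. d : S ==> fst (k d) = d"
  by (rule covering_space_lift[OF _ S continuous_on_id]) auto
 hence kf: "snd (k d) : f d" if "d : S" for d
  using that by (force simp: W_def)
 obtain g where g: "g : G" "y0 = g (snd (k d0))" using feq[OF d0(1) kf[OF d0(1)] d0(2)] by blast
 have ck: "continuous_on S (%d. g (snd (k d)))"
  by (rule continuous_on_compose2[OF act_cont[OF g(1)] continuous_on_snd[OF k(1)]]) (use kf fY in auto)
 show ?thesis
  by (rule exI[of _ "%d. g (snd (k d))"]) (use ck g kf fY fcl act_in in auto)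
qed

end

section \<open>The group of the mapping torus\<close>

definition adj2 :: "real^2^2 => real^2^2" where
 "adj2 A = vector [vector [A$2$2, - A$1$2], vector [- A$2$1, A$1$1]]"

definition int_mat :: "real^2^2 => bool" where
 "int_mat A \<longleftrightarrow> (ALL i j. A$i$j : \<int>)"

lemma adj2_mult: "det A = 1 ==> A ** adj2 A = mat 1" "det A = 1 ==> adj2 A ** A = mat 1"
 by (simp_all add: vec_eq_iff forall_2 adj2_def matrix_matrix_mult_def sum_2 mat_def det_2 algebra_simps)

lemma int_mat_adj2: "int_mat A ==> int_mat (adj2 A)"
 by (simp add: int_mat_def adj2_def forall_2)

lemma int_mat_mult: "int_mat A ==> int_mat B ==> int_mat (A ** B)"
 by (simp add: int_mat_def matrix_matrix_mult_def sum_2)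

lemma int_mat_1: "int_mat (mat 1)" by (simp add: int_mat_def mat_def)

lemma mat_power_0 [simp]: "mat_power A 0 = mat 1" by (simp add: mat_power_def)
lemma mat_power_Suc: "mat_power A (Suc n) = A ** mat_power A n" by (simp add: mat_power_def)

lemma int_mat_power: "int_mat A ==> int_mat (mat_power A n)"
 by (induction n) (simp_all add: mat_power_Suc int_mat_mult int_mat_1)

lemma det_mat_power: "det A = 1 ==> det (mat_power A n) = 1"
 by (induction n) (simp_all add: mat_power_Suc det_mul)

definition mpw :: "real^2^2 => int => real^2^2" where
 "mpw A k = (if k >= 0 then mat_power A (nat k) else mat_power (adj2 A) (nat (- k)))"

lemma mpw_0 [simp]: "mpw A 0 = mat 1" by (simp add: mpw_def)
lemma mpw_nat: "mpw A (int n) = mat_power A n" by (simp add: mpw_def)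

lemma mpw_Suc:
 assumes "det A = 1" shows "mpw A (k + 1) = A ** mpw A k"
proof -
 consider "k >= 0" | "k = -1" | "k < -1" by linarith
 thus ?thesis
 proof cases
  case 1 thus ?thesis by (simp add: mpw_def nat_add_distrib mat_power_Suc)
 next
  case 2 thus ?thesis by (simp add: mpw_def mat_power_def adj2_mult[OF assms])
 next
  case 3
  hence "nat (- k) = Suc (nat (- (k + 1)))" by linarith
  thus ?thesis using 3 assms
   by (simp add: mpw_def mat_power_Suc matrix_mul_assoc adj2_mult)
 qed
qed

lemma mpw_pred:
 assumes "det A = 1" shows "mpw A (k - 1) = adj2 A ** mpw A k"
 using mpw_Suc[OF assms, of "k - 1"] by (simp add: matrix_mul_assoc adj2_mult[OF assms])

lemma mpw_add:
 assumes "det A = 1" shows "mpw A (j + k) = mpw A j ** mpw A k"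
proof (induction j rule: int_induct[of _ 0])
 case base thus ?case by simp
next
 case (step1 i)
 thus ?case using mpw_Suc[OF assms, of "i + k"] mpw_Suc[OF assms, of i]
  by (simp add: matrix_mul_assoc add.commute add.left_commute)
next
 case (step2 i)
 thus ?case using mpw_pred[OF assms, of "i + k"] mpw_pred[OF assms, of i]
  by (simp add: matrix_mul_assoc algebra_simps)
qed

lemma mpw_inv:
 assumes "det A = 1" shows "mpw A (- k) ** mpw A k = mat 1" "mpw A k ** mpw A (- k) = mat 1"
 using mpw_add[OF assms, of "- k" k] mpw_add[OF assms, of k "- k"] by simp_all

lemma det_adj2: "det (adj2 A) = det A" by (simp add: adj2_def det_2)

lemma det_mpw: "det A = 1 ==> det (mpw A k) = 1"
 by (simp add: mpw_def det_mat_power det_adj2)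

lemma int_mat_mpw: "int_mat A ==> int_mat (mpw A k)"
 by (simp add: mpw_def int_mat_power int_mat_adj2)

lemma Z2_mult: "int_mat A ==> x : Z2 ==> A *v x : Z2"
 by (simp add: Z2_def int_mat_def matrix_vector_mult_def sum_2)

lemma Z2_add: "x : Z2 ==> y : Z2 ==> x + y : Z2" and Z2_uminus: "x : Z2 ==> - x : Z2"
 and Z2_diff: "x : Z2 ==> y : Z2 ==> x - y : Z2" and Z2_0: "0 : Z2"
 by (simp_all add: Z2_def)

lemma Z2_small: assumes "x : Z2" "norm x < 1" shows "x = 0"
proof -
 have "x $ i = 0" for i
 proof -
  have "\<bar>x $ i\<bar> < 1" using component_le_norm_cart[of x i] assms(2) by linarith
  moreover have "x $ i : \<int>" using assms(1) by (simp add: Z2_def)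
  ultimately show ?thesis using Ints_nonzero_abs_less1 by blast
 qed
 thus ?thesis by (simp add: vec_eq_iff)
qed

definition bundle_map :: "real^2^2 => int => real^2 => (real^2) \<times> real => (real^2) \<times> real" where
 "bundle_map A k v p = (mpw A k *v fst p + v, snd p - real_of_int k)"

definition bundle_group :: "real^2^2 => ((real^2) \<times> real => (real^2) \<times> real) set" where
 "bundle_group A = {bundle_map A k v | k v. v : Z2}"

lemma Z2_mpw_iff:
 assumes "det A = 1" "int_mat A" "v : Z2"
 shows "mpw A k *v x + v : Z2 \<longleftrightarrow> x : Z2"
proof
 assume "mpw A k *v x + v : Z2"
 hence "mpw A k *v x + v - v : Z2" using Z2_diff assms(3) by blast
 hence "mpw A (-k) *v (mpw A k *v x) : Z2" using Z2_mult int_mat_mpw assms by simp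
 thus "x : Z2" by (simp add: matrix_vector_mul_assoc mpw_inv[OF assms(1)])
qed (use Z2_mult int_mat_mpw assms Z2_add in blast)

lemma bundle_groupI: "v : Z2 ==> bundle_map A k v : bundle_group A"
 unfolding bundle_group_def by blast

text \<open>The two disjuncts of the relation are the nonnegative and the nonpositive powers of the
  gluing, so together they describe the orbits of a group.\<close>

lemma bundle_rel_eq:
 assumes A: "det A = 1" "int_mat A"
 shows "bundle_rel A = act_rel punctured_plane_line (bundle_group A)"
proof (intro equalityI subrelI)
 fix p q assume "(p, q) : bundle_rel A"
 moreover obtain x t where p: "p = (x, t)" by (cases p)
 moreover obtain y u where q: "q = (y, u)" by (cases q)
 ultimately obtain k :: nat where k: "x ~: Z2" "y ~: Z2"
  "t = u + real k & mat_power A k *v x - y : Z2 | u = t + real k & mat_power A k *v y - x : Z2"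
  by (auto simp: bundle_rel_def)
 have ex: "EX k' v. v : Z2 & y = mpw A k' *v x + v & u = t - real_of_int k'"
  using k(3)
 proof
  assume "t = u + real k & mat_power A k *v x - y : Z2"
  thus ?thesis using Z2_uminus[of "mat_power A k *v x - y"]
   by (intro exI[of _ "int k"] exI[of _ "y - mat_power A k *v x"]) (auto simp: mpw_nat)
 next
  assume *: "u = t + real k & mat_power A k *v y - x : Z2"
  define w where "w = mat_power A k *v y - x"
  have "mpw A (- int k) *v (x + w) = mpw A (- int k) *v (mpw A (int k) *v y)" by (simp add: w_def mpw_nat)
  also have "... = y" by (simp add: matrix_vector_mul_assoc mpw_inv[OF A(1)])
  finally have "y = mpw A (- int k) *v x + mpw A (- int k) *v w" by (simp add: matrix_vector_right_distrib)
  moreover have "mpw A (- int k) *v w : Z2" using * Z2_mult int_mat_mpw A unfolding w_def by blast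
  ultimately show ?thesis using * by (intro exI[of _ "- int k"]) auto
 qed
 then obtain k' v where kv: "v : Z2" "y = mpw A k' *v x + v" "u = t - real_of_int k'" by blast
 hence "q = bundle_map A k' v p" by (simp add: p q bundle_map_def)
 moreover have "bundle_map A k' v : bundle_group A" using kv by (auto simp: bundle_group_def)
 ultimately show "(p, q) : act_rel punctured_plane_line (bundle_group A)"
  using k(1) by (auto simp: act_rel_def punctured_plane_line_def p)
next
 fix p q assume "(p, q) : act_rel punctured_plane_line (bundle_group A)"
 then obtain k v where kv: "v : Z2" "q = bundle_map A k v p" "fst p ~: Z2"
  by (auto simp: act_rel_def bundle_group_def punctured_plane_line_def)
 obtain x t where p: "p = (x, t)" by (cases p)
 have nq: "mpw A k *v x + v ~: Z2" using kv p Z2_mpw_iff[OF A kv(1)] by simp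
 show "(p, q) : bundle_rel A"
 proof (cases "k >= 0")
  case True
  then obtain n where n: "k = int n" using nonneg_int_cases by blast
  thus ?thesis using kv nq p Z2_uminus by (auto simp: bundle_rel_def bundle_map_def mpw_nat intro!: exI[of _ n])
 next
  case False
  define n where "n = nat (- k)"
  have n: "k = - int n" using False by (simp add: n_def)
  have "mat_power A n *v (mpw A k *v x + v) - x = mat_power A n *v v"
   using mpw_inv(2)[OF A(1), of "int n"] n by (simp add: matrix_vector_right_distrib matrix_vector_mul_assoc mpw_nat)
  moreover have "mat_power A n *v v : Z2" using kv Z2_mult int_mat_power A by blast
  ultimately show ?thesis using kv nq p n by (auto simp: bundle_rel_def bundle_map_def intro!: exI[of _ n])
 qed
qed

lemma closed_Z2: "closed Z2"
proof (rule discrete_imp_closed[of 1])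
 show "ALL x:Z2. ALL y:Z2. dist y x < 1 --> y = x"
  using Z2_small Z2_diff by (metis dist_norm eq_iff_diff_eq_0)
qed simp

lemma open_punctured: "open punctured_plane_line"
 unfolding punctured_plane_line_def by (intro open_Times open_UNIV) (use closed_Z2 in "simp add: open_closed")

lemma bundle_map_comp:
 "det A = 1 ==> bundle_map A j v (bundle_map A k w p) = bundle_map A (j + k) (mpw A j *v w + v) p"
 by (simp add: bundle_map_def mpw_add matrix_vector_right_distrib matrix_vector_mul_assoc)

lemma bundle_map_0: "bundle_map A 0 0 p = p" by (simp add: bundle_map_def)

lemma covering_action_bundle:
 assumes A: "det A = 1" "int_mat A"
 shows "covering_action punctured_plane_line (bundle_group A)"
 unfolding covering_action_def
proof (intro conjI ballI)
 fix g assume "g : bundle_group A"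
 then obtain k v where g: "g = bundle_map A k v" "v : Z2" by (auto simp: bundle_group_def)
 show "continuous_on punctured_plane_line g"
  unfolding g bundle_map_def
  by (intro continuous_intros bounded_linear.continuous_on[OF matrix_vector_mul_bounded_linear])
 show "g ` punctured_plane_line <= punctured_plane_line"
  using Z2_mpw_iff[OF A g(2)] by (auto simp: g bundle_map_def punctured_plane_line_def)
 define w where "w = - (mpw A (-k) *v v)"
 have w: "w : Z2" using g Z2_uminus Z2_mult int_mat_mpw A by (simp add: w_def)
 have 1: "mpw A (-k) *v v + w = 0" by (simp add: w_def)
 have 2: "mpw A k *v w + v = 0"
  unfolding w_def linear_neg[OF matrix_vector_mul_linear]
  by (simp add: matrix_vector_mul_assoc mpw_inv[OF A(1)])
 show "EX k:bundle_group A. ALL y:punctured_plane_line. k (g y) = y & g (k y) = y"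
  using w 1 2 by (intro bexI[of _ "bundle_map A (-k) w"])
   (auto simp: g bundle_map_comp[OF A(1)] bundle_map_0 bundle_group_def)
next
 show "open punctured_plane_line" by (rule open_punctured)
 show "EX e:bundle_group A. ALL y:punctured_plane_line. e y = y"
 proof (intro bexI[of _ "bundle_map A 0 0"] ballI)
  show "bundle_map A 0 0 : bundle_group A" unfolding bundle_group_def using Z2_0 by blast
 qed (simp add: bundle_map_0)
next
 fix g h assume "g : bundle_group A" "h : bundle_group A"
 then obtain j v k w where g: "g = bundle_map A j v" "v : Z2" "h = bundle_map A k w" "w : Z2"
  by (auto simp: bundle_group_def)
 hence "mpw A j *v w + v : Z2" using Z2_add Z2_mult int_mat_mpw A by blast
 thus "EX k:bundle_group A. ALL y:punctured_plane_line. k y = g (h y)"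
  by (intro bexI[of _ "bundle_map A (j + k) (mpw A j *v w + v)"])
   (auto simp: bundle_map_comp[OF A(1)] bundle_group_def g)
next
 fix p assume p: "p : punctured_plane_line"
 \<comment> \<open>Radius \<open>1/4\<close> forces a returning element to have
   \<open>|k| < 1\<close> and then a translation vector of norm below \<open>1\<close>; both are
   integral, hence zero.\<close>
 let ?U = "(ball (fst p) (1/4) \<times> ball (snd p) (1/4)) \<inter> punctured_plane_line"
 have fr: "g y = y" if g: "g : bundle_group A" and u: "u : ?U" "g u : ?U" for g u y
 proof -
  obtain k v where kv: "g = bundle_map A k v" "v : Z2" using g by (auto simp: bundle_group_def)
  have "dist (snd p) (snd u) < 1/4" "dist (snd p) (snd u - real_of_int k) < 1/4"
   using u by (auto simp: kv bundle_map_def mem_Times_iff)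
  hence "\<bar>real_of_int k\<bar> < 1" unfolding dist_real_def by linarith
  hence k: "k = 0" by linarith
  have "dist (fst p) (fst u) < 1/4" "dist (fst p) (fst u + v) < 1/4"
   using u by (auto simp: kv k bundle_map_def mem_Times_iff)
  hence "dist (fst u) (fst u + v) < 1"
   using dist_triangle3[of "fst u" "fst u + v" "fst p"] by linarith
  hence "norm v < 1" by (simp add: dist_norm)
  hence "v = 0" using Z2_small kv by blast
  thus ?thesis using kv k by (simp add: bundle_map_0)
 qed
 have f4: "ALL g:bundle_group A. g ` ?U \<inter> ?U ~= {} --> (ALL y:punctured_plane_line. g y = y)"
 proof (intro ballI impI)
  fix g y assume g: "g : bundle_group A" "g ` ?U \<inter> ?U ~= {}"
  obtain x where x: "x : g ` ?U" "x : ?U" using g(2) by (meson disjoint_iff)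
  obtain u where u: "x = g u" "u : ?U" using x(1) by (rule imageE)
  show "g y = y" by (rule fr[OF g(1) u(2) x(2)[unfolded u(1)]])
 qed
 have f1: "open ?U" using open_punctured by (intro open_Int open_Times open_ball)
 have f2: "p : ?U" using p by (simp add: mem_Times_iff)
 have f3: "?U <= punctured_plane_line" by blast
 show "EX U. open U & p : U & U <= punctured_plane_line &
   (ALL g:bundle_group A. g ` U \<inter> U ~= {} --> (ALL y:punctured_plane_line. g y = y))"
  by (intro exI[of _ ?U] conjI f1 f2 f3 f4)
qed

lemma det_R_mat [simp]: "det R_mat = 1" and det_L_mat [simp]: "det L_mat = 1"
 and int_R_mat: "int_mat R_mat" and int_L_mat: "int_mat L_mat"
 by (simp_all add: R_mat_def L_mat_def det_2 int_mat_def forall_2)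

lemma RL_word_det: "det (RL_word w) = 1" and RL_word_int: "int_mat (RL_word w)"
 by (induction w) (simp_all add: det_mul det_mat_power int_mat_mult int_mat_power int_R_mat int_L_mat int_mat_1)

lemma det_uminus2: "det (- A :: real^2^2) = det A" by (simp add: det_2)
lemma int_mat_uminus: "int_mat A ==> int_mat (- A)" by (simp add: int_mat_def)

section \<open>Deck groups act as covering groups\<close>

lemma open_H3: "open H3"
 unfolding H3_def by (intro open_Collect_less continuous_intros)

lemma convex_H3: "convex H3"
proof -
 have "H3 = UNIV \<times> {0<..}" by (auto simp: H3_def)
 thus ?thesis by (metis convex_Times convex_UNIV convex_real_interval(3))
qed

lemma inv_into_H3_isometry:
 assumes "H3_isometry g"
 shows "bij_betw g H3 H3" "p : H3 ==> inv_into H3 g (g p) = p" "p : H3 ==> g (inv_into H3 g p) = p"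
  "p : H3 ==> inv_into H3 g p : H3"
proof -
 show b: "bij_betw g H3 H3" using assms by (simp add: H3_isometry_def Bij_def)
 show "p : H3 ==> inv_into H3 g (g p) = p" using b by (rule bij_betw_inv_into_left)
 show "p : H3 ==> g (inv_into H3 g p) = p" using b by (rule bij_betw_inv_into_right)
 show "p : H3 ==> inv_into H3 g p : H3" using bij_betw_inv_into[OF b] by (auto simp: bij_betw_def)
qed

lemma deck_group_ops:
 assumes "hyperbolic_deck_group \<Gamma>"
 shows "restrict (%p. p) H3 : \<Gamma>" "g : \<Gamma> ==> h : \<Gamma> ==> compose H3 g h : \<Gamma>"
  "g : \<Gamma> ==> restrict (inv_into H3 g) H3 : \<Gamma>" "g : \<Gamma> ==> H3_isometry g"
proof -
 interpret subgroup \<Gamma> "BijGroup H3" using assms by (simp add: hyperbolic_deck_group_def)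
 show "restrict (%p. p) H3 : \<Gamma>" using one_closed by (simp add: BijGroup_def)
 show i: "g : \<Gamma> ==> H3_isometry g" for g using assms by (simp add: hyperbolic_deck_group_def)
 hence B: "g : \<Gamma> ==> g : Bij H3" for g by (simp add: H3_isometry_def)
 show "g : \<Gamma> ==> h : \<Gamma> ==> compose H3 g h : \<Gamma>" using m_closed[of g h] B by (simp add: BijGroup_def)
 show "g : \<Gamma> ==> restrict (inv_into H3 g) H3 : \<Gamma>"
  using m_inv_closed[of g] inv_BijGroup[OF B] group_BijGroup by metis
qed

text \<open>Proper discontinuity leaves finitely many elements that bring a ball around
  \<open>y\<close> back to meet itself; those moving \<open>y\<close> are excluded by Hausdorff
  separation, those fixing it are trivial by freeness.\<close>

lemma covering_action_deck:
 assumes G: "hyperbolic_deck_group \<Gamma>"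
 shows "covering_action H3 \<Gamma>"
 unfolding covering_action_def
proof (intro conjI ballI)
 show "open H3" by (rule open_H3)
 show "EX e:\<Gamma>. ALL y:H3. e y = y" using deck_group_ops(1)[OF G] by (intro bexI) auto
 fix g assume g: "g : \<Gamma>"
 note i = deck_group_ops(4)[OF G g]
 show "continuous_on H3 g" using i by (rule H3_isometry_continuous)
 show "g ` H3 <= H3" using H3_isometry_in[OF i] by blast
 show "EX k:\<Gamma>. ALL y:H3. k (g y) = y & g (k y) = y"
  by (rule bexI[OF _ deck_group_ops(3)[OF G g]])
   (simp add: H3_isometry_in[OF i] inv_into_H3_isometry(2,3)[OF i])
next
 fix g h assume "g : \<Gamma>" "h : \<Gamma>"
 thus "EX k:\<Gamma>. ALL y:H3. k y = g (h y)"
  using deck_group_ops(2)[OF G] by (intro bexI[of _ "compose H3 g h"]) (auto simp: compose_def)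
next
 fix y assume y: "y : H3"
 obtain r where r: "r > 0" "cball y r <= H3" using open_H3 y open_contains_cball by blast
 define F where "F = {g : \<Gamma>. g ` cball y r \<inter> cball y r ~= {}}"
 define F' where "F' = {g : F. g y ~= y}"
 have fin: "finite F'" unfolding F'_def F_def
  using G r(2) by (intro finite_Collect_conjI disjI1) (simp add: hyperbolic_deck_group_def)
 have "EX V. open V & y : V & V <= H3 & g ` V \<inter> V = {}" if g: "g : F'" for g
 proof -
  have gi: "H3_isometry g" using g deck_group_ops(4)[OF G] by (auto simp: F'_def F_def)
  have "g y ~= y" using g by (simp add: F'_def)
  then obtain A B where AB: "open A" "open B" "g y : A" "y : B" "A \<inter> B = {}"
   using hausdorff[of "g y" y] by blast
  have "open (H3 \<inter> g -` A)" using continuous_open_preimage[OF H3_isometry_continuous[OF gi] open_H3 AB(1)] .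
  hence "open (B \<inter> (H3 \<inter> g -` A))" using AB by blast
  thus ?thesis using AB y by (intro exI[of _ "B \<inter> (H3 \<inter> g -` A)"]) blast
 qed
 then obtain V where V: "!!g. g : F' ==> open (V g) & y : V g & V g <= H3 & g ` V g \<inter> V g = {}" by metis
 define U where "U = ball y r \<inter> \<Inter> (V ` F')"
 have "open U" unfolding U_def using V fin by (intro open_Int open_ball open_INT) auto
 moreover have "y : U" using V r by (auto simp: U_def)
 moreover have "U <= H3" using r by (auto simp: U_def)
 moreover have "ALL y:H3. g y = y" if g: "g : \<Gamma>" "g ` U \<inter> U ~= {}" for g
 proof -
  have "U <= cball y r" by (auto simp: U_def)
  hence "g : F" using g by (auto simp: F_def)
  moreover have "g ~: F'"
  proof
   assume g': "g : F'"
   hence "U <= V g" by (auto simp: U_def)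
   thus False using g(2) V[OF g'] by blast
  qed
  ultimately have "g y = y" by (simp add: F'_def)
  thus ?thesis using G g y unfolding hyperbolic_deck_group_def by blast
 qed
 ultimately show "EX U. open U & y : U & U <= H3 & (ALL g:\<Gamma>. g ` U \<inter> U ~= {} --> (ALL y:H3. g y = y))"
  by blast
qed

section \<open>The developing map to the cover of the bundle\<close>

definition cpx :: "real^2 => complex" where "cpx x = Complex (x$1) (x$2)"
definition vec2 :: "complex => real^2" where "vec2 z = vector [Re z, Im z]"
definition lat :: "complex set" where "lat = {z. Re z : \<int> & Im z : \<int>}"
definition Epl :: "(point3) set" where "Epl = (- lat) \<times> UNIV"
definition linc :: "real^2^2 => int => complex => complex" where
 "linc A k z = cpx (mpw A k *v vec2 z)"

text \<open>The orbit relation of the bundle group in complex coordinates.\<close>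

definition qrel :: "(int => complex => complex) => point3 => point3 => bool" where
 "qrel lin e e' \<longleftrightarrow> (EX k v. v : lat & fst e' = lin k (fst e) + v & snd e' = snd e - real_of_int k)"

lemma cpx_vec2 [simp]: "cpx (vec2 z) = z" "vec2 (cpx x) = x"
 by (simp_all add: cpx_def vec2_def vec_eq_iff forall_2)

lemma vec2_Z2 [simp]: "vec2 z : Z2 \<longleftrightarrow> z : lat"
 by (simp add: vec2_def Z2_def lat_def forall_2)

lemma cpx_lat [simp]: "cpx x : lat \<longleftrightarrow> x : Z2"
 by (simp add: cpx_def Z2_def lat_def forall_2)

lemma cpx_add: "cpx (x + y) = cpx x + cpx y" by (simp add: cpx_def complex_eq_iff)

lemma vec2_add: "vec2 (x + y) = vec2 x + vec2 y" by (simp add: vec2_def vec_eq_iff forall_2)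

lemma continuous_on_cpx [continuous_intros]:
 "continuous_on S f ==> continuous_on S (%x. cpx (f x))"
 unfolding cpx_def Complex_eq by (intro continuous_intros continuous_on_component)

lemma continuous_on_vec2 [continuous_intros]:
 assumes "continuous_on S f" shows "continuous_on S (%x. vec2 (f x))"
proof -
 have "vec2 z = Re z *\<^sub>R axis 1 1 + Im z *\<^sub>R axis 2 1" for z
  by (simp add: vec2_def vec_eq_iff forall_2 axis_def)
 thus ?thesis using assms by (simp only:) (intro continuous_intros)
qed

lemma linc_eq: "linc A k z = Complex (mpw A k $1$1 * Re z + mpw A k $1$2 * Im z) (mpw A k $2$1 * Re z + mpw A k $2$2 * Im z)"
 by (simp add: linc_def cpx_def vec2_def matrix_vector_mult_def sum_2)

lemma quotient_eq_class: "equiv Y r ==> C : Y // r ==> x : C ==> C = r `` {x}"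
 by (metis Image_singleton_iff equiv_class_eq quotientE)

text \<open>\<open>lin k\<close> is the action of the \<open>k\<close>-th power of the monodromy on \<open>\<complex>\<close>, and \<open>\<phi>\<close> is the lift of the homeomorphism
 with the bundle; it is only known to have the unique lifting property of a covering map.\<close>

locale fibred =
 fixes G :: "(point3 => point3) set" and \<phi> :: "point3 => point3"
  and lin :: "int => complex => complex"
 assumes G_ca: "covering_action H3 G"
  and G_mob: "g : G ==> EX M. det2 M = 1 & ((ALL p:H3. g p = mob M p) | (ALL p:H3. g p = mob M (cconj p)))"
  and lin_0: "lin 0 z = z" and lin_add: "lin (j + k) z = lin j (lin k z)"
  and lin_plus: "lin k (z + w) = lin k z + lin k w"
  and lin_scale: "lin k (of_real r * z) = of_real r * lin k z"
  and lin_lat: "z : lat ==> lin k z : lat"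
  and lin_cross: "Im (cnj (lin k z) * lin k w) = Im (cnj z * w)"
  and lin_cont: "continuous_on UNIV (lin k)"
  and \<phi>_cont: "continuous_on H3 \<phi>" and \<phi>_in: "p : H3 ==> \<phi> p : Epl"
  and \<phi>_rel: "p : H3 ==> p' : H3 ==> (EX g:G. p' = g p) \<longleftrightarrow> qrel lin (\<phi> p) (\<phi> p')"
  and \<phi>_lift: "simply_connected S ==> locally path_connected S ==> continuous_on S f ==> f ` S <= Epl
   ==> d0 : S ==> p0 : H3 ==> \<phi> p0 = f d0 ==>
   EX k. continuous_on S k & k ` S <= H3 & (ALL d:S. \<phi> (k d) = f d) & k (d0 :: point3) = p0"

lemma orbit_rel_act: "orbit_rel \<Gamma> = act_rel H3 \<Gamma>"
 by (simp add: orbit_rel_def act_rel_def)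

text \<open>Conjugation by a chart brings the horoball into the standard position
  \<open>Binf\<close>.\<close>

definition conj_group :: "(point3 => point3) set => (point3 => point3) => (point3 => point3) set" where
 "conj_group \<Gamma> \<psi> = (%g p. inv_into H3 \<psi> (g (\<psi> p))) ` \<Gamma>"

lemma H3_isometry_inv:
 assumes "H3_isometry \<psi>" shows "H3_isometry (restrict (inv_into H3 \<psi>) H3)"
proof -
 note i = inv_into_H3_isometry[OF assms]
 have "bij_betw (restrict (inv_into H3 \<psi>) H3) H3 H3"
  using bij_betw_inv_into[OF i(1)] by (simp cong: bij_betw_cong)
 moreover have "hdist (inv_into H3 \<psi> p) (inv_into H3 \<psi> q) = hdist p q" if "p : H3" "q : H3" for p q
  using assms i(3,4) that unfolding H3_isometry_def by metis
 ultimately show ?thesis by (simp add: H3_isometry_def Bij_def)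
qed

lemma conj_group_isometry:
 assumes "hyperbolic_deck_group \<Gamma>" "H3_isometry \<psi>" "g : conj_group \<Gamma> \<psi>"
 shows "H3_isometry (restrict g H3)"
proof -
 obtain \<gamma> where g: "\<gamma> : \<Gamma>" "g = (%p. inv_into H3 \<psi> (\<gamma> (\<psi> p)))" using assms by (auto simp: conj_group_def)
 note i = inv_into_H3_isometry[OF assms(2)] and gi = deck_group_ops(4)[OF assms(1) g(1)]
 have "bij_betw (inv_into H3 \<psi> \<circ> (\<gamma> \<circ> \<psi>)) H3 H3"
  by (rule bij_betw_trans[OF bij_betw_trans[OF i(1) inv_into_H3_isometry(1)[OF gi]] bij_betw_inv_into[OF i(1)]])
 hence "bij_betw (restrict g H3) H3 H3" by (simp add: g comp_def cong: bij_betw_cong)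
 moreover have "hdist (g p) (g q) = hdist p q" if "p : H3" "q : H3" for p q
  using H3_isometry_inv[OF assms(2)] gi assms(2) that H3_isometry_in[OF assms(2)] H3_isometry_in[OF gi]
  unfolding H3_isometry_def g by simp
 ultimately show ?thesis by (simp add: H3_isometry_def Bij_def)
qed

lemma covering_action_conj:
 assumes D: "hyperbolic_deck_group \<Gamma>" and P: "H3_isometry \<psi>"
 shows "covering_action H3 (conj_group \<Gamma> \<psi>)"
proof -
 interpret c: cov_act H3 \<Gamma> by unfold_locales (rule covering_action_deck[OF D])
 note i = inv_into_H3_isometry[OF P]
 have pin: "\<psi> p : H3" if "p : H3" for p using H3_isometry_in[OF P that] .
 show ?thesis
  unfolding covering_action_def
 proof (intro conjI ballI)
  show "open H3" by (rule open_H3)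
  obtain e where "e : \<Gamma>" "!!y. y : H3 ==> e y = y" using c.act_id by blast
  thus "EX e:conj_group \<Gamma> \<psi>. ALL y:H3. e y = y"
   using pin i(2) unfolding conj_group_def by (intro bexI[OF _ imageI[of e]]) auto
  fix g assume g: "g : conj_group \<Gamma> \<psi>"
  note gi = conj_group_isometry[OF D P g]
  have "continuous_on H3 (restrict g H3)" using H3_isometry_continuous[OF gi] .
  thus "continuous_on H3 g" by (simp cong: continuous_on_cong)
  show "g ` H3 <= H3" using H3_isometry_in[OF gi] by auto
  obtain \<gamma> where \<gamma>: "\<gamma> : \<Gamma>" "g = (%p. inv_into H3 \<psi> (\<gamma> (\<psi> p)))" using g by (auto simp: conj_group_def)
  obtain k where k: "k : \<Gamma>" "!!y. y : H3 ==> k (\<gamma> y) = y" "!!y. y : H3 ==> \<gamma> (k y) = y"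
   using c.act_inv[OF \<gamma>(1)] by blast
  show "EX k:conj_group \<Gamma> \<psi>. ALL y:H3. k (g y) = y & g (k y) = y"
   unfolding conj_group_def
   by (intro bexI[OF _ imageI[OF k(1)]]) (simp add: \<gamma> i(2,3) pin c.act_in k \<gamma>(1))
 next
  fix g h assume "g : conj_group \<Gamma> \<psi>" "h : conj_group \<Gamma> \<psi>"
  then obtain \<gamma> \<eta> where gh: "\<gamma> : \<Gamma>" "g = (%p. inv_into H3 \<psi> (\<gamma> (\<psi> p)))" "\<eta> : \<Gamma>" "h = (%p. inv_into H3 \<psi> (\<eta> (\<psi> p)))"
   by (auto simp: conj_group_def)
  obtain k where k: "k : \<Gamma>" "!!y. y : H3 ==> k y = \<gamma> (\<eta> y)" using c.act_comp[OF gh(1,3)] by blast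
  show "EX k:conj_group \<Gamma> \<psi>. ALL y:H3. k y = g (h y)"
   unfolding conj_group_def
   by (intro bexI[OF _ imageI[OF k(1)]]) (simp add: gh i(3) pin c.act_in k)
 next
  fix y assume y: "y : H3"
  obtain U where U: "open U" "\<psi> y : U" "U <= H3"
   "!!g u v. g : \<Gamma> ==> u : U ==> g u : U ==> v : H3 ==> g v = v"
   using c.act_nbhd[OF pin[OF y]] by blast
  let ?V = "H3 \<inter> \<psi> -` U"
  have "open ?V" using continuous_open_preimage[OF H3_isometry_continuous[OF P] open_H3 U(1)] .
  moreover have mv: "g v = v" if g: "g : conj_group \<Gamma> \<psi>" and u: "u : ?V" "g u : ?V" and v: "v : H3" for g u v
  proof -
   obtain \<gamma> where \<gamma>: "\<gamma> : \<Gamma>" "g = (%p. inv_into H3 \<psi> (\<gamma> (\<psi> p)))" using g by (auto simp: conj_group_def)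
   have uH: "u : H3" "\<psi> u : U" "\<psi> (g u) : U" using u by auto
   have "\<psi> (g u) = \<gamma> (\<psi> u)" unfolding \<gamma>(2) by (rule i(3)) (rule c.act_in[OF \<gamma>(1) pin[OF uH(1)]])
   hence "\<gamma> (\<psi> v) = \<psi> v" using U(4)[OF \<gamma>(1) uH(2) _ pin[OF v]] uH by simp
   thus ?thesis using i(2)[OF v] by (simp add: \<gamma>)
  qed
  moreover have "ALL g:conj_group \<Gamma> \<psi>. g ` ?V \<inter> ?V ~= {} --> (ALL y:H3. g y = y)"
  proof (intro ballI impI)
   fix g v assume g: "g : conj_group \<Gamma> \<psi>" "g ` ?V \<inter> ?V ~= {}" "v : H3"
   then obtain u where "u : ?V" "g u : ?V" by blast
   thus "g v = v" using mv g by blast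
  qed
  moreover have "y : ?V" "?V <= H3" using U y by auto
  ultimately show "EX U. open U & y : U & U <= H3 & (ALL g:conj_group \<Gamma> \<psi>. g ` U \<inter> U ~= {} --> (ALL y:H3. g y = y))"
   by blast
 qed
qed

text \<open>\<open>\<phi>\<close> lifts the composite of the chart, the projection to the manifold
  and the homeomorphism. Its lifting property comes from the inverse homeomorphism: a map to the
  cover of the bundle is lifted to \<open>H3\<close> through it, and uniqueness of lifts shows that
  \<open>\<phi>\<close> takes this lift back to the given map.\<close>

lemma fibred_exists:
 assumes D: "hyperbolic_deck_group \<Gamma>" and A: "det A = 1" "int_mat A"
  and h: "homeomorphic_map (hyperbolic_manifold \<Gamma>) (punctured_torus_bundle A) h"
  and P: "H3_isometry \<psi>"
 shows "\<exists>\<phi>. fibred (conj_group \<Gamma> \<psi>) \<phi> (linc A) &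
  (ALL p:H3. (vec2 (fst (\<phi> p)), snd (\<phi> p)) : h (orbit_rel \<Gamma> `` {\<psi> p}))"
proof -
 let ?Y = punctured_plane_line
 interpret c: cov_act_normed H3 \<Gamma> by unfold_locales (rule covering_action_deck[OF D])
 interpret b: cov_act_normed ?Y "bundle_group A" by unfold_locales (rule covering_action_bundle[OF A])
 note i = inv_into_H3_isometry[OF P]
 have pin: "\<psi> p : H3" if "p : H3" for p using H3_isometry_in[OF P that] .
 let ?rb = "act_rel ?Y (bundle_group A)" and ?rc = "act_rel H3 \<Gamma>"
 have mfd: "hyperbolic_manifold \<Gamma> = quotient_topology (top_of_set H3) ?rc"
  by (simp add: hyperbolic_manifold_def orbit_rel_act)
 have bun: "punctured_torus_bundle A = quotient_topology (top_of_set ?Y) ?rb"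
  by (simp add: punctured_torus_bundle_def bundle_rel_eq[OF A])
 obtain hi where hi: "homeomorphic_maps (hyperbolic_manifold \<Gamma>) (punctured_torus_bundle A) h hi"
  using h homeomorphic_map_maps by blast
 have hc: "continuous_map (hyperbolic_manifold \<Gamma>) (punctured_torus_bundle A) h"
  "continuous_map (punctured_torus_bundle A) (hyperbolic_manifold \<Gamma>) hi"
  "!!x. x : H3 // ?rc ==> hi (h x) = x" "!!x. x : ?Y // ?rb ==> h (hi x) = x"
  using hi by (auto simp: homeomorphic_maps_def mfd bun topspace_quotient_topology)
 have qc: "continuous_map (top_of_set H3) (hyperbolic_manifold \<Gamma>) (%x. ?rc `` {x})"
  "continuous_map (top_of_set ?Y) (punctured_torus_bundle A) (%x. ?rb `` {x})"
  unfolding mfd bun by (intro quotient_imp_continuous_map quotient_map_quotient_topology)+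
 have hq: "h x : ?Y // ?rb" if "x : H3 // ?rc" for x
  using continuous_map_funspace[OF hc(1)] that by (auto simp: mfd bun topspace_quotient_topology)
 define f where "f p = h (?rc `` {\<psi> p})" for p
 have "continuous_map (top_of_set H3) (top_of_set H3) \<psi>"
  using H3_isometry_continuous[OF P] pin by auto
 hence "continuous_map (top_of_set H3) (punctured_torus_bundle A) (h \<circ> ((%x. ?rc `` {x}) \<circ> \<psi>))"
  using qc hc by (intro continuous_map_compose)
 hence fc: "continuous_map (top_of_set H3) (quotient_topology (top_of_set ?Y) ?rb) f"
  by (simp add: f_def[abs_def] comp_def bun)
 have j: "(0,1) : H3" by (simp add: H3_iff)
 have clsq: "?rc `` {p} : H3 // ?rc" if "p : H3" for p using that by (rule quotientI)
 have fq: "f p : ?Y // ?rb" if "p : H3" for p unfolding f_def using hq clsq pin that by blast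
 obtain y0 where y0: "y0 : f (0,1)"
  using in_quotient_imp_non_empty[OF b.act_equiv fq[OF j]] by blast
 obtain \<phi>' where \<phi>': "continuous_on H3 \<phi>'" "\<phi>' ` H3 <= ?Y" "!!p. p : H3 ==> \<phi>' p : f p"
  using b.lift_exists[OF _ _ fc j y0] convex_imp_simply_connected[OF convex_H3]
   convex_imp_locally_path_connected[OF convex_H3] by blast
 have fcls: "f p = ?rb `` {\<phi>' p}" if "p : H3" for p
  using quotient_eq_class[OF b.act_equiv fq[OF that] \<phi>'(3)[OF that]] .
 have \<phi>Y: "\<phi>' p : ?Y" if "p : H3" for p using \<phi>'(2) that by blast
 define \<phi> where "\<phi> p = (cpx (fst (\<phi>' p)), snd (\<phi>' p))" for p
 have v\<phi>: "(vec2 (fst (\<phi> p)), snd (\<phi> p)) = \<phi>' p" for p by (simp add: \<phi>_def)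
 have rel_b: "(y, y') : ?rb \<longleftrightarrow> qrel (linc A) (cpx (fst y), snd y) (cpx (fst y'), snd y')" if "y : ?Y" for y y'
 proof
  assume "(y, y') : ?rb"
  then obtain k v where "v : Z2" "y' = bundle_map A k v y" by (auto simp: act_rel_def bundle_group_def)
  thus "qrel (linc A) (cpx (fst y), snd y) (cpx (fst y'), snd y')"
   unfolding qrel_def by (intro exI[of _ k] exI[of _ "cpx v"]) (simp add: bundle_map_def linc_def cpx_add)
 next
  assume "qrel (linc A) (cpx (fst y), snd y) (cpx (fst y'), snd y')"
  then obtain k v where kv: "v : lat" "cpx (fst y') = linc A k (cpx (fst y)) + v" "snd y' = snd y - real_of_int k"
   by (auto simp: qrel_def)
  have "fst y' = vec2 (linc A k (cpx (fst y)) + v)" using kv(2) by (metis cpx_vec2(2))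
  hence "y' = bundle_map A k (vec2 v) y" using kv by (simp add: bundle_map_def linc_def vec2_add prod_eq_iff)
  moreover have "bundle_map A k (vec2 v) : bundle_group A" using kv by (intro bundle_groupI) simp
  ultimately show "(y, y') : ?rb" using that by (auto simp: act_rel_def)
 qed
 have "fibred (conj_group \<Gamma> \<psi>) \<phi> (linc A)"
 proof
  show "covering_action H3 (conj_group \<Gamma> \<psi>)" using covering_action_conj[OF D P] .
  show "EX M. det2 M = 1 & ((ALL p:H3. g p = mob M p) | (ALL p:H3. g p = mob M (cconj p)))"
   if "g : conj_group \<Gamma> \<psi>" for g
   using H3_isometry_cases[OF conj_group_isometry[OF D P that]] by simp
  show "linc A 0 z = z" for z by (simp add: linc_def)
  show "linc A (j + k) z = linc A j (linc A k z)" for j k z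
   by (simp add: linc_def mpw_add[OF A(1)] matrix_vector_mul_assoc)
  show "linc A k (z + w) = linc A k z + linc A k w" for k z w
   by (simp add: linc_eq complex_eq_iff algebra_simps)
  show "linc A k (of_real r * z) = of_real r * linc A k z" for k r z
   by (simp add: linc_eq complex_eq_iff algebra_simps)
  show "z : lat ==> linc A k z : lat" for k z
   unfolding linc_def using Z2_mult int_mat_mpw A by simp
  show "Im (cnj (linc A k z) * linc A k w) = Im (cnj z * w)" for k z w
  proof -
   have "mpw A k $1$1 * mpw A k $2$2 - mpw A k $1$2 * mpw A k $2$1 = 1"
    using det_mpw[OF A(1), of k] by (simp add: det_2)
   moreover have "Im (cnj (linc A k z) * linc A k w) =
    (mpw A k $1$1 * mpw A k $2$2 - mpw A k $1$2 * mpw A k $2$1) * Im (cnj z * w)"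
    by (simp add: linc_eq algebra_simps)
   ultimately show ?thesis by simp
  qed
  show "continuous_on UNIV (linc A k)" for k
   unfolding linc_eq Complex_eq by (intro continuous_intros)
  show "continuous_on H3 \<phi>" unfolding \<phi>_def using \<phi>'(1) by (intro continuous_intros)
  show "\<phi> p : Epl" if "p : H3" for p
   using \<phi>'(2) that by (auto simp: \<phi>_def Epl_def punctured_plane_line_def)
  show "(EX g:conj_group \<Gamma> \<psi>. p' = g p) \<longleftrightarrow> qrel (linc A) (\<phi> p) (\<phi> p')" if p: "p : H3" "p' : H3" for p p'
  proof -
   have "(EX g:conj_group \<Gamma> \<psi>. p' = g p) \<longleftrightarrow> (\<psi> p, \<psi> p') : ?rc"
   proof
    assume "EX g:conj_group \<Gamma> \<psi>. p' = g p"
    then obtain \<gamma> where \<gamma>: "\<gamma> : \<Gamma>" "p' = inv_into H3 \<psi> (\<gamma> (\<psi> p))" by (auto simp: conj_group_def)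
    hence "\<psi> p' = \<gamma> (\<psi> p)" using i(3) c.act_in[OF \<gamma>(1) pin[OF p(1)]] by simp
    thus "(\<psi> p, \<psi> p') : ?rc" using \<gamma> pin p by (auto simp: act_rel_def)
   next
    assume "(\<psi> p, \<psi> p') : ?rc"
    then obtain \<gamma> where \<gamma>: "\<gamma> : \<Gamma>" "\<psi> p' = \<gamma> (\<psi> p)" by (auto simp: act_rel_def)
    hence "p' = inv_into H3 \<psi> (\<gamma> (\<psi> p))" using i(2) p by metis
    thus "EX g:conj_group \<Gamma> \<psi>. p' = g p" using \<gamma> by (auto simp: conj_group_def)
   qed
   also have "... \<longleftrightarrow> ?rc `` {\<psi> p} = ?rc `` {\<psi> p'}"
    using eq_equiv_class_iff[OF c.act_equiv] pin p by blast
   also have "... \<longleftrightarrow> f p = f p'" unfolding f_def using hc(3) clsq pin p by metis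
   also have "... \<longleftrightarrow> (\<phi>' p, \<phi>' p') : ?rb"
    unfolding fcls[OF p(1)] fcls[OF p(2)]
    by (rule eq_equiv_class_iff[OF b.act_equiv \<phi>Y[OF p(1)] \<phi>Y[OF p(2)]])
   also have "... \<longleftrightarrow> qrel (linc A) (\<phi> p) (\<phi> p')"
    using rel_b[OF \<phi>Y[OF p(1)]] by (simp add: \<phi>_def)
   finally show ?thesis .
  qed
  fix S f0 and d0 p0 :: "point3"
  assume S: "simply_connected S" "locally path_connected S" "continuous_on S f0" "f0 ` S <= Epl"
   "d0 : S" "p0 : H3" "\<phi> p0 = f0 d0"
  define f' where "f' d = (vec2 (fst (f0 d)), snd (f0 d))" for d
  have f'c: "continuous_on S f'" unfolding f'_def using S(3) by (intro continuous_intros)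
  have f'Y: "f' d : ?Y" if "d : S" for d
   using S(4) that by (auto simp: f'_def Epl_def punctured_plane_line_def)
  have "continuous_map (top_of_set S) (hyperbolic_manifold \<Gamma>) (hi \<circ> ((%x. ?rb `` {x}) \<circ> f'))"
   using qc hc f'c f'Y by (intro continuous_map_compose) auto
  hence kc: "continuous_map (top_of_set S) (quotient_topology (top_of_set H3) ?rc) (%d. hi (?rb `` {f' d}))"
   by (simp add: comp_def mfd)
  have e0: "f' d0 = \<phi>' p0" using S(7) by (simp add: f'_def \<phi>_def flip: S(7))
  have "hi (?rb `` {f' d0}) = ?rc `` {\<psi> p0}"
   unfolding e0 using fcls[OF S(6)] hc(3)[OF clsq[OF pin[OF S(6)]]] by (simp add: f_def)
  hence "\<psi> p0 : hi (?rb `` {f' d0})" using equiv_class_self[OF c.act_equiv pin[OF S(6)]] by simp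
  then obtain k' where k': "continuous_on S k'" "k' ` S <= H3" "!!d. d : S ==> k' d : hi (?rb `` {f' d})" "k' d0 = \<psi> p0"
   using c.lift_exists[OF S(1,2) kc S(5)] by blast
  define k where "k d = inv_into H3 \<psi> (k' d)" for d
  have "continuous_on H3 (restrict (inv_into H3 \<psi>) H3)" using H3_isometry_continuous[OF H3_isometry_inv[OF P]] .
  hence "continuous_on H3 (inv_into H3 \<psi>)" by (simp cong: continuous_on_cong)
  hence kcont: "continuous_on S k" unfolding k_def
   using k'(1,2) by (rule continuous_on_compose2)
  have kH: "k d : H3" "\<psi> (k d) = k' d" if "d : S" for d
  proof -
   have k'H: "k' d : H3" using k'(2) that by blast
   show "k d : H3" "\<psi> (k d) = k' d" unfolding k_def by (rule i(4)[OF k'H], rule i(3)[OF k'H])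
  qed
  have k0: "k d0 = p0" using k'(4) i(2) S(6) by (simp add: k_def)
  have rel: "(\<phi>' (k d), f' d) : ?rb" if d: "d : S" for d
  proof -
   have q: "?rb `` {f' d} : ?Y // ?rb" using f'Y[OF d] by (rule quotientI)
   hence "hi (?rb `` {f' d}) : H3 // ?rc"
    using continuous_map_funspace[OF hc(2)] by (auto simp: mfd bun topspace_quotient_topology)
   hence "hi (?rb `` {f' d}) = ?rc `` {\<psi> (k d)}"
    using quotient_eq_class[OF c.act_equiv] k'(3)[OF d] kH[OF d] by simp
   hence "f (k d) = ?rb `` {f' d}" unfolding f_def using hc(4)[OF q] by simp
   hence "?rb `` {\<phi>' (k d)} = ?rb `` {f' d}" using fcls[OF kH(1)[OF d]] by simp
   thus ?thesis using eq_equiv_class_iff[OF b.act_equiv \<phi>Y[OF kH(1)[OF d]] f'Y[OF d]] by blast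
  qed
  have c1: "continuous_on S (%d. \<phi>' (k d))"
   by (rule continuous_on_compose2[OF \<phi>'(1) kcont]) (use kH in auto)
  have "\<phi>' (k d) = f' d" if "d : S" for d
   using b.lift_unique_eq[OF simply_connected_imp_connected[OF S(1)] c1 f'c rel S(5) _ that] e0 k0 by simp
  hence "\<phi> (k d) = f0 d" if "d : S" for d using that by (simp add: \<phi>_def f'_def)
  thus "EX k. continuous_on S k & k ` S <= H3 & (ALL d:S. \<phi> (k d) = f0 d) & k d0 = p0"
   using kcont kH k0 by blast
 qed
 moreover have "ALL p:H3. (vec2 (fst (\<phi> p)), snd (\<phi> p)) : h (orbit_rel \<Gamma> `` {\<psi> p})"
  unfolding v\<phi> orbit_rel_act using \<phi>'(3) by (simp add: f_def)
 ultimately show ?thesis by blast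
qed

section \<open>Local degree\<close>

text \<open>Index \<open>0\<close> gets the imaginary part because the standard reflection of degree
  \<open>-1\<close> negates coordinate \<open>0\<close>; thus \<open>cconj\<close> becomes that
  reflection.\<close>

definition io :: "point3 => nat => real" where
 "io p = (%i. if i = 0 then Im (fst p) else if i = 1 then Re (fst p) else if i = 2 then snd p else 0)"

definition oi :: "(nat => real) => point3" where
 "oi x = (Complex (x 1) (x 0), x 2)"

definition NS :: "(nat => real) set" where
 "NS = {x. (\<Sum>i\<le>2. x i ^ 2) = 1 & (ALL i>2. x i = 0)}"

lemma nsphere_top: "nsphere 2 = top_of_set NS"
 by (simp add: nsphere NS_def euclidean_product_topology)

lemma sum_le_2: "(\<Sum>i\<le>2. x i ^ 2) = (x 0)^2 + (x 1)^2 + ((x 2)^2 :: real)" for x :: "nat => real"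
 by (simp add: eval_nat_numeral)

lemma oi_io [simp]: "oi (io p) = p" by (simp add: oi_def io_def prod_eq_iff complex_eq_iff)

lemma io_oi: "x : NS ==> io (oi x) = x"
proof
 fix i assume "x : NS"
 hence "i > 2 ==> x i = 0" by (simp add: NS_def)
 moreover have "i = 0 | i = 1 | i = 2 | i > 2" by linarith
 ultimately show "io (oi x) i = x i" by (auto simp: io_def oi_def)
qed

lemma norm_pair_sq: "(norm p)^2 = (Re (fst p))^2 + (Im (fst p))^2 + (snd p)^2" for p :: "point3"
 by (simp add: norm_prod_def cmod_power2)

lemma norm_oi: "x : NS ==> norm (oi x) = 1"
proof -
 assume "x : NS"
 hence "(norm (oi x))^2 = 1" unfolding norm_pair_sq oi_def NS_def sum_le_2 by simp
 thus ?thesis by (simp add: abs_square_eq_1)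
qed

lemma io_NS: "norm p = 1 ==> io p : NS"
proof -
 assume "norm p = 1"
 hence "(Re (fst p))^2 + (Im (fst p))^2 + (snd p)^2 = 1" using norm_pair_sq[of p] by simp
 thus ?thesis by (simp add: NS_def sum_le_2 io_def)
qed

lemma continuous_on_io [continuous_intros]:
 assumes "continuous_on S f" shows "continuous_on S (%x. io (f x))"
proof (rule continuous_on_coordinatewise_then_product)
 fix i :: nat
 show "continuous_on S (%x. io (f x) i)"
  using assms by (cases "i = 0"; cases "i = 1"; cases "i = 2") (simp_all add: io_def continuous_intros)
qed

lemma continuous_on_oi [continuous_intros]:
 assumes "continuous_on S f" shows "continuous_on S (%x. oi (f x))"
proof -
 have "continuous_on S (%x. f x i)" for i
  using continuous_on_product_then_coordinatewise[OF assms] .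
 thus ?thesis unfolding oi_def Complex_eq by (intro continuous_intros)
qed

text \<open>Radial projection makes the degree available for every map of the sphere that omits the
  origin.\<close>

definition sdeg :: "(point3 => point3) => int" where
 "sdeg f = Brouwer_degree2 2 (%x. io (sgn (f (oi x))))"

abbreviation S2 :: "(point3) set" where "S2 \<equiv> sphere 0 1"

lemma sdeg_cong: "(!!u. norm u = 1 ==> f u = g u) ==> sdeg f = sdeg g"
 unfolding sdeg_def by (rule Brouwer_degree2_eq) (simp add: nsphere_top norm_oi)

lemma sdeg_homotopic:
 assumes c: "continuous_on ({0..1} \<times> S2) F" and nz: "!!s u. 0 <= s ==> s <= 1 ==> norm u = 1 ==> F (s, u) ~= 0"
 shows "sdeg (%u. F (0, u)) = sdeg (%u. F (1::real, u))"
 unfolding sdeg_def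
proof (rule Brouwer_degree2_homotopic)
 let ?h = "%q. io (sgn (F (fst q, oi (snd q))))"
 have "continuous_on ({0..1} \<times> NS) (%q. F (fst q, oi (snd q)))"
  by (rule continuous_on_compose2[OF c]) (auto intro!: continuous_on_Pair continuous_on_oi continuous_on_fst continuous_on_snd continuous_on_id simp: norm_oi)
 hence "continuous_on ({0..1} \<times> NS) ?h"
  unfolding sgn_div_norm using nz[OF _ _ norm_oi] by (intro continuous_on_io continuous_on_scaleR continuous_on_inverse continuous_on_norm) auto
 moreover have "?h ` ({0..1} \<times> NS) <= NS"
  using nz[OF _ _ norm_oi] by (auto intro!: io_NS simp: norm_sgn)
 ultimately have "continuous_map (prod_topology (top_of_set {0..1}) (nsphere 2)) (nsphere 2) ?h"
  unfolding nsphere_top by (auto simp: image_subset_iff)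
 thus "homotopic_with (%x. True) (nsphere 2) (nsphere 2) (%x. io (sgn (F (0, oi x)))) (%x. io (sgn (F (1, oi x))))"
  unfolding homotopic_with_def by (intro exI[of _ ?h]) auto
qed

lemma sph_continuous_map:
 assumes "continuous_on S2 f" "!!u. norm u = 1 ==> f u ~= 0"
 shows "continuous_map (nsphere 2) (nsphere 2) (%x. io (sgn (f (oi x))))"
proof -
 have "continuous_on NS (%x. f (oi x))"
  by (rule continuous_on_compose2[OF assms(1)]) (auto intro!: continuous_on_oi continuous_on_id simp: norm_oi)
 hence "continuous_on NS (%x. io (sgn (f (oi x))))"
  unfolding sgn_div_norm using assms(2)[OF norm_oi] by (intro continuous_on_io continuous_on_scaleR continuous_on_inverse continuous_on_norm) auto
 thus ?thesis
  using assms(2)[OF norm_oi] unfolding nsphere_top by (auto intro!: io_NS simp: norm_sgn)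
qed

lemma sdeg_comp:
 assumes f: "continuous_on S2 f" "!!u. norm u = 1 ==> f u ~= 0"
  and g: "continuous_on S2 g" "!!u. norm u = 1 ==> g u ~= 0"
 shows "sdeg (%u. g (sgn (f u))) = sdeg g * sdeg f"
 using Brouwer_degree2_compose[OF sph_continuous_map[OF f] sph_continuous_map[OF g]]
 by (simp add: sdeg_def comp_def)

lemma sdeg_id: "sdeg (%u. u) = 1"
proof -
 have "sdeg (%u. u) = Brouwer_degree2 2 id"
  unfolding sdeg_def by (rule Brouwer_degree2_eq) (simp add: nsphere_top norm_oi sgn_div_norm io_oi)
 thus ?thesis by simp
qed

lemma norm_cconj [simp]: "norm (cconj p) = norm p"
 by (simp add: cconj_def norm_prod_def)

lemma sdeg_cconj: "sdeg cconj = - 1"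
proof -
 have "sdeg cconj = Brouwer_degree2 2 (%x i. if i = 0 then - x i else x i)"
  unfolding sdeg_def
 proof (rule Brouwer_degree2_eq)
  fix x assume "x : topspace (nsphere 2)"
  hence x: "x : NS" by (simp add: nsphere_top)
  have "io (cconj (oi x)) i = (if i = 0 then - io (oi x) i else io (oi x) i)" for i
   by (simp add: io_def cconj_def)
  thus "io (sgn (cconj (oi x))) = (%i. if i = 0 then - x i else x i)"
   unfolding io_oi[OF x] by (intro ext) (simp add: sgn_div_norm norm_oi[OF x])
 qed
 thus ?thesis by (simp add: Brouwer_degree2_reflection)
qed

lemma sdeg_comp_cconj:
 assumes f: "continuous_on S2 f" "!!u. norm u = 1 ==> f u ~= 0"
 shows "sdeg (%u. f (cconj u)) = - sdeg f"
proof -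
 have "sdeg (%u. f (sgn (cconj u))) = sdeg f * sdeg cconj"
 proof (rule sdeg_comp[OF continuous_on_cconj _ f])
  fix u :: "point3" assume "norm u = 1"
  hence "norm (cconj u) = 1" by simp
  thus "cconj u ~= 0" by force
 qed
 moreover have "sdeg (%u. f (sgn (cconj u))) = sdeg (%u. f (cconj u))"
  by (rule sdeg_cong) (simp add: sgn_div_norm)
 ultimately show ?thesis by (simp add: sdeg_cconj)
qed

text \<open>Invariance of domain provides a continuous local inverse; its degree times that of
  \<open>f\<close> is the degree of the identity.\<close>

lemma sdeg_injective_nonzero:
 fixes f :: "point3 => point3"
 assumes U: "open U" "p : U" and f: "continuous_on U f" "inj_on f U"
 shows "EX r0>0. ALL r. 0 < r & r <= r0 --> cball p r <= U & sdeg (%u. f (p + r *\<^sub>R u) - f p) ~= 0"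
proof -
 obtain r1 where r1: "r1 > 0" "cball p r1 <= U" using U open_contains_cball by blast
 obtain ki where ki: "homeomorphism U (f ` U) f ki"
  using invariance_of_domain_homeomorphism[OF U(1) f(1) _ f(2)] by auto
 have inv: "!!x. x : U ==> ki (f x) = x" "!!y. y : f ` U ==> f (ki y) = y" "continuous_on (f ` U) ki"
  using ki by (auto simp: homeomorphism_def)
 have "open (f ` U)" using invariance_of_domain[OF f(1) U(1) f(2)] .
 then obtain \<delta> where \<delta>: "\<delta> > 0" "cball (f p) \<delta> <= f ` U" using U open_contains_cball by blast
 obtain r2 where r2: "r2 > 0" "!!x. x : U ==> dist x p < r2 ==> dist (f x) (f p) < \<delta>"
  using f(1) U(2) \<delta>(1) unfolding continuous_on_iff by metis
 define r0 where "r0 = min r1 (r2/2)"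
 have "cball p r <= U & sdeg (%u. f (p + r *\<^sub>R u) - f p) ~= 0" if r: "0 < r" "r <= r0" for r
 proof
  have rr: "r <= r1" "r < r2" using r r2(1) by (auto simp: r0_def)
  show cb: "cball p r <= U" using r1 rr subset_cball[of r r1 p] by blast
  define F where "F u = f (p + r *\<^sub>R u) - f p" for u
  have inU: "p + r *\<^sub>R u : U" if "norm u = 1" for u using cb that r by (auto simp: dist_norm)
  have Fc: "continuous_on S2 F" unfolding F_def
   by (intro continuous_intros continuous_on_compose2[OF f(1)]) (use inU in auto)
  have Fnz: "F u ~= 0" if u: "norm u = 1" for u
  proof
   assume "F u = 0"
   hence "p + r *\<^sub>R u = p" using inj_onD[OF f(2) _ inU[OF u] U(2)] by (simp add: F_def)
   thus False using u r by auto
  qed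
  have Fle: "norm (F u) <= \<delta>" if u: "norm u = 1" for u
   using r2(2)[OF inU[OF u]] u r rr by (simp add: F_def dist_norm)
  define h where "h u = ki (f p + \<delta> *\<^sub>R u) - p" for u
  have hb: "f p + s *\<^sub>R u : f ` U" if "norm u = 1" "0 <= s" "s <= \<delta>" for u s
   using subsetD[OF \<delta>(2), of "f p + s *\<^sub>R u"] that by (simp add: dist_norm)
  have hc: "continuous_on S2 h" unfolding h_def
   by (intro continuous_intros continuous_on_compose2[OF inv(3)]) (use hb \<delta> in auto)
  have hnz': "ki (f p + s *\<^sub>R u) - p ~= 0" if "norm u = 1" "0 < s" "s <= \<delta>" for u s
  proof
   assume "ki (f p + s *\<^sub>R u) - p = 0"
   hence "f p + s *\<^sub>R u = f p" using inv(2)[OF hb[of u s]] that by (metis eq_iff_diff_eq_0 less_eq_real_def)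
   thus False using that by auto
  qed
  have "sdeg h * sdeg F = sdeg (%u. h (sgn (F u)))"
   using sdeg_comp[OF Fc Fnz hc] hnz' \<delta> by (simp add: h_def)
  also have "... = sdeg (%u. r *\<^sub>R u)"
  proof -
   \<comment> \<open>The homotopy moves the radius from the constant \<open>\<delta>\<close> to
     \<open>norm (F u)\<close> along each ray; at the end the inverse undoes \<open>f\<close>
     exactly.\<close>
   define K where "K q = ki (f p + ((1 - fst q) * \<delta> + fst q * norm (F (snd q))) *\<^sub>R sgn (F (snd q))) - p" for q :: "real \<times> point3"
   have scal: "0 < (1 - s) * \<delta> + s * norm (F u)" "(1 - s) * \<delta> + s * norm (F u) <= \<delta>"
    if "0 <= s" "s <= 1" "norm u = 1" for s u
   proof -
    have "s * norm (F u) <= s * \<delta>" using Fle that by (intro mult_left_mono) auto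
    thus "(1 - s) * \<delta> + s * norm (F u) <= \<delta>" by (simp add: algebra_simps)
    have "0 < norm (F u)" using Fnz that by simp
    thus "0 < (1 - s) * \<delta> + s * norm (F u)"
     using that \<delta>(1) by (cases "s = 1") (auto intro!: add_pos_nonneg)
   qed
   have sg: "norm (sgn (F u)) = 1" if "norm u = 1" for u using Fnz[OF that] by (simp add: norm_sgn)
   have Fc2: "continuous_on ({0..1::real} \<times> S2) (%q. F (snd q))"
    by (rule continuous_on_compose2[OF Fc]) (auto intro!: continuous_intros)
   have "continuous_on ({0..1::real} \<times> S2) (%q. sgn (F (snd q)))"
    unfolding sgn_div_norm using Fnz by (intro continuous_intros Fc2) auto
   hence cG: "continuous_on ({0..1::real} \<times> S2) (%q. f p + ((1 - fst q) * \<delta> + fst q * norm (F (snd q))) *\<^sub>R sgn (F (snd q)))"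
    by (intro continuous_intros Fc2) (use Fnz in auto)
   have "(%q. f p + ((1 - fst q) * \<delta> + fst q * norm (F (snd q))) *\<^sub>R sgn (F (snd q))) ` ({0..1} \<times> S2) <= f ` U"
   proof (rule image_subsetI)
    fix q :: "real \<times> point3" assume "q : {0..1} \<times> S2"
    hence q: "0 <= fst q" "fst q <= 1" "norm (snd q) = 1" by (auto simp: mem_Times_iff)
    show "f p + ((1 - fst q) * \<delta> + fst q * norm (F (snd q))) *\<^sub>R sgn (F (snd q)) : f ` U"
     by (rule hb[OF sg[OF q(3)] less_imp_le[OF scal(1)[OF q]] scal(2)[OF q]])
   qed
   hence "continuous_on ({0..1} \<times> S2) K" unfolding K_def
    by (intro continuous_on_diff continuous_on_const continuous_on_compose2[OF inv(3) cG])
   hence "sdeg (%u. K (0, u)) = sdeg (%u. K (1, u))"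
    by (rule sdeg_homotopic) (use hnz' scal sg in "simp add: K_def")
   moreover have "sdeg (%u. K (0, u)) = sdeg (%u. h (sgn (F u)))" by (simp add: K_def h_def)
   moreover have "sdeg (%u. K (1, u)) = sdeg (%u. r *\<^sub>R u)"
    by (rule sdeg_cong) (simp add: K_def sgn_div_norm Fnz, simp add: F_def inv(1) inU)
   ultimately show ?thesis by simp
  qed
  also have "... = sdeg (%u. u)" unfolding sdeg_def using r by (simp add: sgn_scaleR)
  finally have "sdeg h * sdeg F = 1" by (simp add: sdeg_id)
  thus "sdeg (%u. f (p + r *\<^sub>R u) - f p) ~= 0" by (auto simp: F_def[abs_def])
 qed
 moreover have "r0 > 0" using r1 r2 by (simp add: r0_def)
 ultimately show ?thesis by blast
qed

section \<open>Connectedness of the special linear group\<close>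

abbreviation SL :: "(complex \<times> complex \<times> complex \<times> complex) set" where
 "SL \<equiv> {(a, b, c, d). a * d - b * c = 1}"

lemma dist_Pair_same: "dist (t, x) (t, y) = dist x y"
 by (simp add: dist_prod_def)

lemma SL_det2: "x : SL ==> det2 (M2 (fst x) (fst (snd x)) (fst (snd (snd x))) (snd (snd (snd x)))) = 1"
 by (auto simp: det2_def)

text \<open>The diagonal part is reached through a logarithm of \<open>a\<close>; then
  \<open>b\<close> and \<open>c\<close> are scaled up from \<open>0\<close>, with \<open>d\<close>
  determined by them. If \<open>a = 0\<close>, a shear makes it nonzero first.\<close>

lemma SL_path_component: assumes "(a, b, c, d) : SL" shows "path_component SL (1,0,0,1) (a,b,c,d)"
proof -
 have st: "path_component SL (g 0) (g 1)" if "continuous_on {0..1} g" "!!t. 0 <= t ==> t <= 1 ==> g t : SL" for g :: "real => _"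
  unfolding path_component_def by (intro exI[of _ g]) (use that in "simp add: path_def pathstart_def pathfinish_def path_image_def image_subset_iff")
 have nz: "path_component SL (1,0,0,1) (a,b,c,d)" if "a ~= 0" "(a,b,c,d) : SL" for a b c d
 proof -
  have "path_component SL (exp (of_real 0 * Ln a), 0, 0, exp (- (of_real 0 * Ln a))) (exp (of_real 1 * Ln a), 0, 0, exp (- (of_real 1 * Ln a)))"
   by (rule st[of "%t. (exp (of_real t * Ln a), 0, 0, exp (- (of_real t * Ln a)))"]) (auto intro!: continuous_intros simp: mult_exp_exp)
  hence 1: "path_component SL (1,0,0,1) (a,0,0,1/a)" using that by (simp add: exp_minus divide_inverse)
  have d: "d = (1 + b * c) / a" using that by (simp add: field_simps)
  have "path_component SL (a, of_real 0 * b, of_real 0 * c, (1 + of_real 0 * of_real 0 * b * c) / a)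
   (a, of_real 1 * b, of_real 1 * c, (1 + of_real 1 * of_real 1 * b * c) / a)"
   by (rule st[of "%t. (a, of_real t * b, of_real t * c, (1 + of_real t * of_real t * b * c) / a)"])
    (use that in "auto intro!: continuous_intros")
  hence "path_component SL (a,0,0,1/a) (a,b,c,d)" using d by simp
  thus ?thesis using 1 path_component_trans by blast
 qed
 show ?thesis
 proof (cases "a = 0")
  case False thus ?thesis using nz assms by blast
 next
  case True
  hence c: "c ~= 0" using assms by auto
  have "path_component SL (a + of_real 0 * c, b + of_real 0 * d, c, d) (a + of_real 1 * c, b + of_real 1 * d, c, d)"
   by (rule st[of "%t. (a + of_real t * c, b + of_real t * d, c, d)"])
    (use assms in "auto intro!: continuous_intros simp: algebra_simps")
  hence 1: "path_component SL (a, b, c, d) (a + c, b + d, c, d)" by simp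
  have "path_component SL (1,0,0,1) (a + c, b + d, c, d)"
   by (rule nz) (use True c assms in "auto simp: algebra_simps")
  thus ?thesis using 1 path_component_trans path_component_sym by blast
 qed
qed

section \<open>Deck transformations preserve orientation\<close>

lemma lat_add: "x : lat ==> y : lat ==> x + y : lat" and lat_diff: "x : lat ==> y : lat ==> x - y : lat"
 and lat_uminus: "x : lat ==> - x : lat" and lat_0 [simp]: "0 : lat"
 by (auto simp: lat_def)

lemma lat_norm_ge: assumes "x : lat" "x ~= 0" shows "1 <= cmod x"
proof (rule ccontr)
 assume "\<not> 1 <= cmod x"
 hence "\<bar>Re x\<bar> < 1" "\<bar>Im x\<bar> < 1" using abs_Re_le_cmod[of x] abs_Im_le_cmod[of x] by linarith+
 hence "Re x = 0" "Im x = 0" using assms(1) Ints_nonzero_abs_less1 by (auto simp: lat_def)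
 thus False using assms(2) by (simp add: complex_eq_iff)
qed

lemma continuous_lat_const:
 fixes f :: "'a::topological_space => complex"
 assumes "connected S" "continuous_on S f" "!!x. x : S ==> f x : lat"
 shows "EX c:lat. ALL x:S. f x = c"
proof -
 have "f constant_on S"
 proof (rule continuous_discrete_range_constant[OF assms(1,2)])
  fix x assume "x : S"
  thus "EX e>0. ALL y. y : S & f y ~= f x --> e <= norm (f y - f x)"
   using assms(3) lat_diff lat_norm_ge by (intro exI[of _ 1]) (metis eq_iff_diff_eq_0 zero_less_one)
 qed
 then obtain c where c: "ALL x:S. f x = c" by (auto simp: constant_on_def)
 show ?thesis
 proof (cases "S = {}")
  case True thus ?thesis using lat_0 by blast
 next
  case False thus ?thesis using c assms(3) by (metis ex_in_conv)
 qed
qed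

lemma continuous_int_const:
 fixes f :: "'a::topological_space => real"
 assumes "connected S" "continuous_on S f" "!!x. x : S ==> f x : \<int>"
 shows "EX k::int. ALL x:S. f x = of_int k"
proof -
 have "EX c:lat. ALL x:S. complex_of_real (f x) = c"
  by (rule continuous_lat_const[OF assms(1)]) (use assms in "auto intro!: continuous_intros simp: lat_def")
 then obtain c where c: "c : lat" "ALL x:S. complex_of_real (f x) = c" by blast
 then obtain k :: int where "Re c = of_int k" by (auto simp: lat_def elim: Ints_cases)
 thus ?thesis using c by (metis Re_complex_of_real)
qed

context fibred
begin

sublocale c: cov_act_normed H3 G by unfold_locales (rule G_ca)

lemma qrel_const:
 fixes f1 f2 :: "'a::topological_space => point3"
 assumes S: "connected S" and c: "continuous_on S f1" "continuous_on S f2"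
  and q: "!!d. d : S ==> qrel lin (f1 d) (f2 d)"
 shows "EX k v. v : lat & (ALL d:S. f2 d = (lin k (fst (f1 d)) + v, snd (f1 d) - of_int k))"
proof -
 have "EX k::int. ALL d:S. snd (f1 d) - snd (f2 d) = of_int k"
 proof (rule continuous_int_const[OF S])
  show "continuous_on S (%d. snd (f1 d) - snd (f2 d))" using c by (intro continuous_intros)
  fix d assume "d : S"
  then obtain k :: int where "snd (f2 d) = snd (f1 d) - of_int k" using q[of d] unfolding qrel_def by blast
  thus "snd (f1 d) - snd (f2 d) : \<int>" by simp
 qed
 then obtain k :: int where k: "!!d. d : S ==> snd (f1 d) - snd (f2 d) = of_int k" by blast
 have "EX v:lat. ALL d:S. fst (f2 d) - lin k (fst (f1 d)) = v"
 proof (rule continuous_lat_const[OF S])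
  show "continuous_on S (%d. fst (f2 d) - lin k (fst (f1 d)))"
   by (intro continuous_intros c continuous_on_compose2[OF lin_cont]) auto
  fix d assume d: "d : S"
  obtain j v where j: "v : lat" "fst (f2 d) = lin j (fst (f1 d)) + v" "snd (f2 d) = snd (f1 d) - of_int j"
   using q[OF d] by (auto simp: qrel_def)
  hence "j = k" using k[OF d] by simp
  thus "fst (f2 d) - lin k (fst (f1 d)) : lat" using j by simp
 qed
 then obtain v where v: "v : lat" "!!d. d : S ==> fst (f2 d) - lin k (fst (f1 d)) = v" by blast
 have "f2 d = (lin k (fst (f1 d)) + v, snd (f1 d) - of_int k)" if "d : S" for d
  using k[OF that] v(2)[OF that] by (simp add: prod_eq_iff algebra_simps)
 thus ?thesis using v by blast
qed

text \<open>The exponent \<open>k\<close> and the vector \<open>v\<close> range over discrete sets,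
  so they cannot vary over the connected \<open>H3\<close>.\<close>

lemma deck_affine:
 assumes g: "g : G"
 shows "EX k v. v : lat & (ALL p:H3. \<phi> (g p) = (lin k (fst (\<phi> p)) + v, snd (\<phi> p) - of_int k))"
proof (rule qrel_const)
 show "connected H3" using convex_H3 by (rule convex_connected)
 show "continuous_on H3 (%p. \<phi> (g p))"
  by (rule continuous_on_compose2[OF \<phi>_cont c.act_cont[OF g]]) (use c.act_in[OF g] in auto)
 fix p assume "p : H3"
 thus "qrel lin (\<phi> p) (\<phi> (g p))" using \<phi>_rel[of p "g p"] c.act_in[OF g] g by blast
qed (rule \<phi>_cont)

lemma qrel_refl: "qrel lin e e"
 unfolding qrel_def by (intro exI[of _ 0]) (simp add: lin_0)

lemma \<phi>_inj_nbhd: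
 assumes "p : H3" obtains U where "open U" "p : U" "U <= H3" "inj_on \<phi> U"
proof -
 obtain U where U: "open U" "p : U" "U <= H3"
  "!!g u v. g : G ==> u : U ==> g u : U ==> v : H3 ==> g v = v"
  using c.act_nbhd[OF assms] by blast
 have "inj_on \<phi> U"
 proof (rule inj_onI)
  fix x y assume xy: "x : U" "y : U" "\<phi> x = \<phi> y"
  then obtain g where g: "g : G" "y = g x" using \<phi>_rel[of x y] U(3) qrel_refl by auto
  have "g x = x" using U(4)[OF g(1) xy(1) _ subsetD[OF U(3) xy(1)]] g xy by simp
  thus "x = y" using g by simp
 qed
 thus ?thesis using that U by blast
qed

text \<open>A real linear map \<open>p z + q cnj z\<close> of determinant
  \<open>|p|^2 - |q|^2 = 1\<close> has \<open>|q| < |p|\<close>, so \<open>q\<close> can be shrunk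
  to \<open>0\<close> while \<open>p\<close> moves to \<open>1\<close> without a kernel
  appearing.\<close>

lemma sdeg_lin:
 assumes f: "continuous_on S2 f" "!!u. norm u = 1 ==> f u ~= 0"
 shows "sdeg (%u. (lin k (fst (f u)), snd (f u))) = sdeg f"
proof -
 define A B where "A = lin k 1" and "B = lin k \<i>"
 define p q where "p = (A - \<i> * B) / 2" and "q = (A + \<i> * B) / 2"
 have lz: "lin k z = p * z + q * cnj z" for z
 proof -
  have "lin k z = lin k (of_real (Re z) * 1 + of_real (Im z) * \<i>)"
   by (simp add: complex_eq mult.commute flip: complex_eq)
  also have "... = of_real (Re z) * A + of_real (Im z) * B"
   unfolding lin_plus lin_scale A_def B_def ..
  also have "... = p * z + q * cnj z"
   by (simp add: p_def q_def complex_eq_iff field_simps)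
  finally show ?thesis .
 qed
 have "(cmod p)^2 - (cmod q)^2 = Im (cnj A * B)"
  unfolding cmod_power2 p_def q_def by (simp add: power2_eq_square field_simps)
 hence pq: "(cmod p)^2 - (cmod q)^2 = 1" using lin_cross[of k 1 \<i>] by (simp add: A_def B_def)
 have pn: "p ~= 0"
 proof
  assume "p = 0"
  hence "- ((cmod q)^2) = 1" using pq by simp
  thus False by (smt (verit) zero_le_power2)
 qed
 have lt: "cmod (q / p) < 1"
 proof -
  have "(cmod q)^2 < (cmod p)^2" using pq by linarith
  hence "cmod q < cmod p" by (rule power2_less_imp_less) simp
  thus ?thesis using pn by (simp add: norm_divide)
 qed
 define F where "F s = (exp (of_real (fst s) * Ln p) * (fst (f (snd s)) + of_real (fst s) * (q / p) * cnj (fst (f (snd s)))), snd (f (snd s)))"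
  for s :: "real \<times> point3"
 have fc: "continuous_on ({0..1::real} \<times> S2) (%s. f (snd s))"
  by (rule continuous_on_compose2[OF f(1)]) (auto intro!: continuous_intros)
 have "sdeg (%u. F (0, u)) = sdeg (%u. F (1, u))"
 proof (rule sdeg_homotopic)
  show "continuous_on ({0..1} \<times> S2) F" unfolding F_def by (intro continuous_intros fc)
  fix s :: real and u :: "point3" assume s: "0 <= s" "s <= 1" "norm u = 1"
  show "F (s, u) ~= 0"
  proof
   assume 0: "F (s, u) = 0"
   define z where "z = fst (f u)"
   have "z + of_real s * (q / p) * cnj z = 0" using 0 by (simp add: F_def z_def prod_eq_iff)
   hence "z = - (of_real s * (q / p) * cnj z)" by (simp add: eq_neg_iff_add_eq_0)
   hence e: "cmod z = s * cmod (q/p) * cmod z" using s by (metis norm_minus_cancel norm_mult norm_of_real abs_of_nonneg complex_mod_cnj)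
   have "s * cmod (q/p) < 1" using s lt by (metis less_1_mult' mult_left_le_one_le norm_ge_zero order_le_less_trans)
   hence "cmod z = 0" using e by (metis mult_cancel_right1 less_irrefl)
   moreover have "snd (f u) = 0" using 0 by (simp add: F_def prod_eq_iff)
   ultimately have "f u = 0" by (simp add: z_def prod_eq_iff)
   thus False using f(2)[OF s(3)] by simp
  qed
 qed
 moreover have "(%u. F (0, u)) = f" by (simp add: F_def)
 moreover have "(%u. F (1, u)) = (%u. (lin k (fst (f u)), snd (f u)))"
  using pn by (simp add: F_def lz fun_eq_iff algebra_simps)
 ultimately show ?thesis by simp
qed

text \<open>Degrees are compared at a point \<open>j\<close> fixed by \<open>cconj\<close>. If
  \<open>g\<close> is \<open>mob M\<close> after \<open>cconj\<close>, a path from \<open>M\<close>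
  to the identity gives \<open>g\<close> followed by \<open>\<phi>\<close> the negative of the local
  degree of \<open>\<phi>\<close>. But that composite is also \<open>\<phi>\<close> followed by an
  affine map of determinant \<open>1\<close>, which has the same degree, so the degree would be zero
  although \<open>\<phi>\<close> is locally injective.\<close>

lemma deck_orientation:
 assumes g: "g : G"
 shows "EX M. det2 M = 1 & (ALL p:H3. g p = mob M p)"
proof (rule ccontr)
 assume no: "\<not> ?thesis"
 obtain M where M: "det2 M = 1" "!!p. p : H3 ==> g p = mob M (cconj p)" using G_mob[OF g] no by blast
 obtain a b c' d where Me: "M = M2 a b c' d" by (cases M)
 have "(a,b,c',d) : SL" using M(1) by (simp add: Me det2_def)
 then obtain pth where pth: "path pth" "path_image pth <= SL" "pathstart pth = (1,0,0,1)" "pathfinish pth = (a,b,c',d)"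
  using SL_path_component unfolding path_component_def by blast
 define Mt where "Mt t = M2 (fst (pth t)) (fst (snd (pth t))) (fst (snd (snd (pth t)))) (snd (snd (snd (pth t))))" for t
 have Mt: "det2 (Mt t) = 1" if "t : {0..1}" for t
 proof -
  have "pth t : path_image pth" unfolding path_image_def using that by (rule imageI)
  thus ?thesis unfolding Mt_def by (rule SL_det2[OF subsetD[OF pth(2)]])
 qed
 have Mt01: "Mt 0 = mid" "Mt 1 = M" using pth(3,4) by (simp_all add: Mt_def pathstart_def pathfinish_def mid_def Me)
 define J where "J s = mob (Mt (fst s)) (snd s)" for s
 have pc: "continuous_on ({0..1} \<times> H3) (%s. pth (fst s))"
  by (rule continuous_on_compose2[OF pth(1)[unfolded path_def]]) (auto intro!: continuous_intros)
 have Jc: "continuous_on ({0..1} \<times> H3) J"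
 proof -
  have "continuous_on ({0..1} \<times> H3) (%s. hden (Mt (fst s)) (snd s))" "continuous_on ({0..1} \<times> H3) (%s. hnum (Mt (fst s)) (snd s))"
   unfolding hden_def hnum_def Mt_def m2.sel by (intro continuous_intros pc)+
  moreover have "hden (Mt (fst s)) (snd s) ~= 0" if "s : {0..1} \<times> H3" for s
  proof -
   have s: "fst s : {0..1}" "snd s : H3" using that by (simp_all add: mem_Times_iff)
   show ?thesis using hden_pos[OF Mt[OF s(1)] s(2)] by simp
  qed
  ultimately show ?thesis unfolding J_def mob_def by (intro continuous_intros) auto
 qed
 define j where "j = (0::complex, 1::real)"
 have jH: "j : H3" by (simp add: j_def H3_iff)
 have cj: "cconj j = j" by (simp add: j_def cconj_def)
 have cb: "cball j (1/2) <= H3"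
 proof
  fix q assume "q : cball j (1/2)"
  hence "\<bar>1 - snd q\<bar> <= 1/2" using dist_snd_le[of j q] by (simp add: j_def dist_real_def)
  hence "0 < snd q" by linarith
  thus "q : H3" by (simp add: H3_def)
 qed
 define K where "K = (%t. J (t, j)) ` {0..1}"
 have Kc: "compact K" unfolding K_def
  by (intro compact_continuous_image continuous_on_compose2[OF Jc] continuous_intros) (use jH in auto)
 have KH: "K <= H3" using mob_in_H3[OF Mt jH] by (auto simp: K_def J_def)
 have "K <= \<Union>{U. open U & U <= H3 & inj_on \<phi> U}"
 proof
  fix x assume "x : K"
  hence "x : H3" using KH by blast
  then obtain U where "open U" "x : U" "U <= H3" "inj_on \<phi> U" by (rule \<phi>_inj_nbhd)
  thus "x : \<Union>{U. open U & U <= H3 & inj_on \<phi> U}" by (intro UnionI[of U]) simp_all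
 qed
 \<comment> \<open>A Lebesgue number for the injectivity of \<open>\<phi>\<close> along the path of
   \<open>j\<close>, so that one radius \<open>r\<close> keeps the whole homotopy away from
   zero.\<close>
 then obtain \<epsilon> where \<epsilon>: "\<epsilon> > 0" "!!x. x : K ==> EX U : {U. open U & U <= H3 & inj_on \<phi> U}. ball x \<epsilon> <= U"
  by (rule Heine_Borel_lemma[OF Kc]) auto
 have "uniformly_continuous_on ({0..1} \<times> cball j (1/2)) J"
  by (rule compact_uniformly_continuous[OF continuous_on_subset[OF Jc]]) (use cb in "auto intro: compact_Times")
 then obtain r1 where r1: "r1 > 0" "!!x y. x : {0..1} \<times> cball j (1/2) ==> y : {0..1} \<times> cball j (1/2) ==> dist y x < r1 ==> dist (J y) (J x) < \<epsilon>"
  unfolding uniformly_continuous_on_def using \<epsilon>(1) by metis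
 obtain U where U: "open U" "j : U" "U <= H3" "inj_on \<phi> U" using \<phi>_inj_nbhd[OF jH] by blast
 obtain r0 where r0: "r0 > 0" "!!r. 0 < r ==> r <= r0 ==> sdeg (%u. \<phi> (j + r *\<^sub>R u) - \<phi> j) ~= 0"
  using sdeg_injective_nonzero[OF U(1,2) continuous_on_subset[OF \<phi>_cont U(3)] U(4)] by blast
 define r where "r = min (min r0 (r1/2)) (1/2)"
 have r: "0 < r" "r <= r0" "r < r1" "r <= 1/2" using r0(1) r1(1) by (auto simp: r_def)
 have inb: "j + r *\<^sub>R u : cball j (1/2)" if "norm u = 1" for u using that r by (simp add: dist_norm)
 have cr: "cconj (j + r *\<^sub>R u) = j + r *\<^sub>R cconj u" for u by (simp add: cconj_def j_def prod_eq_iff complex_eq_iff)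
 have nc: "norm (cconj u) = 1" if "norm u = 1" for u using that by simp
 have cH: "j + r *\<^sub>R cconj u : H3" if "norm u = 1" for u
  by (rule subsetD[OF cb inb[OF nc[OF that]]])
 define f where "f u = \<phi> (j + r *\<^sub>R u) - \<phi> j" for u
 have fc: "continuous_on S2 f" unfolding f_def
  by (intro continuous_intros continuous_on_compose2[OF \<phi>_cont]) (use inb cb in auto)
 define F where "F s = \<phi> (J (fst s, j + r *\<^sub>R cconj (snd s))) - \<phi> (J (fst s, j))" for s
 have Fc: "continuous_on ({0..1} \<times> S2) F"
 proof -
  have "continuous_on ({0..1} \<times> S2) (%s. (fst s, j + r *\<^sub>R cconj (snd s)))"
   by (intro continuous_intros continuous_on_compose2[OF continuous_on_cconj[of UNIV]]) auto
  hence "continuous_on ({0..1} \<times> S2) (%s. J (fst s, j + r *\<^sub>R cconj (snd s)))"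
   by (rule continuous_on_compose2[OF Jc]) (use cH in "auto simp: image_subset_iff")
  moreover have "continuous_on ({0..1} \<times> S2) (%s. J (fst s, j))"
   by (rule continuous_on_compose2[OF Jc]) (use jH in "auto intro!: continuous_intros")
  moreover have "J (t, j + r *\<^sub>R cconj u) : H3" "J (t, j) : H3" if "t : {0..1}" "norm u = 1" for t u
   using mob_in_H3[OF Mt[OF that(1)]] cH[OF that(2)] jH by (simp_all add: J_def)
  ultimately show ?thesis unfolding F_def
   by (intro continuous_intros continuous_on_compose2[OF \<phi>_cont]) auto
 qed
 have Fnz: "F (t, u) ~= 0" if t: "0 <= t" "t <= 1" "norm u = 1" for t u
 proof
  assume "F (t, u) = 0"
  hence eq: "\<phi> (J (t, j + r *\<^sub>R cconj u)) = \<phi> (J (t, j))" by (simp add: F_def)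
  have tt: "t : {0..1}" using t by simp
  have q: "j + r *\<^sub>R cconj u : cball j (1/2)" using inb nc t by blast
  obtain V where V: "inj_on \<phi> V" "ball (J (t, j)) \<epsilon> <= V" using \<epsilon>(2)[of "J (t,j)"] tt by (auto simp: K_def)
  have "dist (J (t, j + r *\<^sub>R cconj u)) (J (t, j)) < \<epsilon>"
  proof (rule r1(2))
   have "dist (j + r *\<^sub>R cconj u) j = r" using r nc[OF t(3)] by (simp add: dist_norm)
   thus "dist (t, j + r *\<^sub>R cconj u) (t, j) < r1" unfolding dist_Pair_same using r by simp
  qed (use tt q in auto)
  hence "J (t, j + r *\<^sub>R cconj u) : V" "J (t, j) : V" using V(2) \<epsilon>(1) by (auto simp: dist_commute)
  hence "J (t, j + r *\<^sub>R cconj u) = J (t, j)" using V(1) eq by (auto dest: inj_onD)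
  hence "j + r *\<^sub>R cconj u = j" using mob_minv(1)[OF Mt[OF tt]] jH q cb by (metis J_def fst_conv snd_conv subsetD)
  hence "cconj u = 0" using r by simp
  thus False using nc[OF t(3)] by simp
 qed
 have fnz: "f u ~= 0" if "norm u = 1" for u
 proof -
  have "F (0, cconj u) = f u" by (simp add: F_def f_def J_def Mt01 cconj_def)
  thus ?thesis using Fnz[of 0 "cconj u"] that by simp
 qed
 have "sdeg (%u. F (0, u)) = sdeg (%u. F (1, u))" using Fc Fnz by (rule sdeg_homotopic)
 moreover have "sdeg (%u. F (0, u)) = - sdeg f"
  using sdeg_comp_cconj[OF fc fnz] by (simp add: F_def f_def[abs_def] J_def Mt01)
 moreover have "sdeg (%u. F (1, u)) = sdeg f"
 proof -
  obtain k v where kv: "!!p. p : H3 ==> \<phi> (g p) = (lin k (fst (\<phi> p)) + v, snd (\<phi> p) - of_int k)"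
   using deck_affine[OF g] by blast
  have ld: "lin k (x - y) = lin k x - lin k y" for x y using lin_plus[of k "x - y" y] by simp
  have "F (1, u) = (lin k (fst (f u)), snd (f u))" if u: "norm u = 1" for u
  proof -
   have H: "j + r *\<^sub>R u : H3" using inb u cb by blast
   have "F (1, u) = \<phi> (g (j + r *\<^sub>R u)) - \<phi> (g j)"
    using M(2)[OF H] M(2)[OF jH] cr cj by (simp add: F_def J_def Mt01)
   thus ?thesis using kv[OF H] kv[OF jH] by (simp add: f_def ld)
  qed
  hence "sdeg (%u. F (1, u)) = sdeg (%u. (lin k (fst (f u)), snd (f u)))" by (rule sdeg_cong)
  thus ?thesis using sdeg_lin[OF fc fnz] by simp
 qed
 ultimately have "sdeg f = 0" by simp
 thus False using r0(2)[OF r(1,2)] by (simp add: f_def[abs_def])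
qed

end

section \<open>Matrices of deck transformations\<close>

text \<open>Equality in the projective group: the action determines a matrix only up to
  sign.\<close>

definition peq :: "m2 => m2 => bool" (infix "\<simeq>" 50) where
 "M \<simeq> N \<longleftrightarrow> M = N | M = mneg N"

definition shift :: "complex => point3 => point3" where
 "shift b p = (fst p + b, snd p)"

definition trans2 :: "complex => m2" where "trans2 b = M2 1 b 0 1"

lemma mneg_mneg [simp]: "mneg (mneg M) = M" by (cases M) (simp add: mneg_def)

lemma peq_refl [simp]: "M \<simeq> M" by (simp add: peq_def)
lemma peq_sym: "M \<simeq> N ==> N \<simeq> M" by (auto simp: peq_def)
lemma peq_trans: "M \<simeq> N ==> N \<simeq> K ==> M \<simeq> K" by (auto simp: peq_def)

lemma mneg_mmul [simp]: "mneg M *m N = mneg (M *m N)" "M *m mneg N = mneg (M *m N)"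
 by (cases M; cases N; simp add: mneg_def)+

lemma peq_mmul: "M \<simeq> M' ==> N \<simeq> N' ==> M *m N \<simeq> M' *m N'"
 by (auto simp: peq_def)

lemma peq_mob: "M \<simeq> N ==> mob M p = mob N p" by (auto simp: peq_def)

lemma det2_trans2 [simp]: "det2 (trans2 b) = 1" by (simp add: trans2_def det2_def)

lemma mob_trans2 [simp]: "mob (trans2 b) p = shift b p"
 using mob_upper[of "trans2 b" p] by (simp add: shift_def trans2_def det2_def)

lemma shift_H3 [simp]: "shift b p : H3 \<longleftrightarrow> p : H3" by (simp add: H3_def shift_def)
lemma shift_shift [simp]: "shift a (shift b p) = shift (b + a) p" by (simp add: shift_def)
lemma shift_0 [simp]: "shift 0 p = p" by (simp add: shift_def)
lemma shift_Binf: "mob (trans2 b) ` Binf = Binf"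
proof
 show "Binf <= mob (trans2 b) ` Binf"
 proof
  fix p :: "point3" assume "p : Binf"
  thus "p : mob (trans2 b) ` Binf" by (intro image_eqI[of _ _ "shift (- b) p"]) (auto simp: shift_def)
 qed
qed (auto simp: shift_def)

text \<open>If the two products differed by a sign, the first column of \<open>M\<close> would
  vanish. So they agree, which leaves only translations up to sign.\<close>

lemma upper_commute:
 assumes "det2 M = 1" "b ~= 0" "M *m trans2 b \<simeq> trans2 b *m M"
 shows "EX l. M \<simeq> trans2 l"
proof -
 obtain a b' c d where M: "M = M2 a b' c d" by (cases M)
 have "c = 0 & a = d"
  using assms(3,2) unfolding peq_def
 proof (elim disjE)
  assume "M *m trans2 b = trans2 b *m M"
  thus ?thesis using assms(2) by (simp add: M trans2_def)
 next
  assume *: "M *m trans2 b = mneg (trans2 b *m M)"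
  hence "c = - c" by (simp add: M trans2_def mneg_def)
  hence c: "c = 0" by simp
  hence "a = - a" using * by (simp add: M trans2_def mneg_def)
  hence "a = 0" by simp
  thus ?thesis using c assms(1) by (simp add: M det2_def)
 qed
 moreover hence "a * a = 1" using assms(1) by (simp add: M det2_def)
 hence "a = 1 | a = -1" by (metis power2_eq_1_iff power2_eq_square)
 ultimately show ?thesis unfolding peq_def M trans2_def mneg_def
  by (metis m2.sel minus_minus minus_zero)
qed

context fibred
begin

definition inG :: "m2 => bool" where
 "inG M \<longleftrightarrow> det2 M = 1 & (EX g:G. ALL p:H3. g p = mob M p)"

lemma inG_det: "inG M ==> det2 M = 1" by (simp add: inG_def)

lemma inG_mob_H3: "inG M ==> p : H3 ==> mob M p : H3" by (simp add: inG_det mob_in_H3)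

lemma inG_I: assumes "det2 M = 1" "g : G" "!!p. p : H3 ==> g p = mob M p" shows "inG M"
proof -
 have "ALL p:H3. g p = mob M p" using assms(3) by (rule ballI)
 thus ?thesis unfolding inG_def using assms(1,2) by (intro conjI bexI)
qed

lemma inG_E: assumes "inG M" obtains g where "g : G" "ALL p:H3. g p = mob M p"
 using assms unfolding inG_def by (elim conjE bexE) (erule that)

lemma inG_of: assumes "g : G" shows "EX M. inG M & (ALL p:H3. g p = mob M p)"
proof -
 obtain M where M: "det2 M = 1" "ALL p:H3. g p = mob M p" using deck_orientation[OF assms] by (elim exE conjE)
 show ?thesis by (rule exI[of _ M]) (use M(2) inG_I[OF M(1) assms bspec[OF M(2)]] in simp)
qed

lemma inG_mid: "inG mid"
proof -
 obtain e where "e : G" "!!y. y : H3 ==> e y = y" using c.act_id by blast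
 thus ?thesis by (intro inG_I[of mid e]) simp_all
qed

lemma inG_mmul: assumes "inG M" "inG N" shows "inG (M *m N)"
proof -
 obtain g where g: "g : G" "ALL p:H3. g p = mob M p" using assms(1) by (rule inG_E)
 obtain h where h: "h : G" "ALL p:H3. h p = mob N p" using assms(2) by (rule inG_E)
 obtain k where k: "k : G" "ALL p:H3. k p = g (h p)"
  using bspec[OF bspec[OF c.D[THEN conjunct2, THEN conjunct2, THEN conjunct2, THEN conjunct1] g(1)] h(1)] by (rule bexE)
 show ?thesis
 proof (rule inG_I[OF _ k(1)])
  show "det2 (M *m N) = 1" using assms by (simp add: det2_mmul inG_det)
  show "k p = mob (M *m N) p" if "p : H3" for p
   using bspec[OF k(2) that] bspec[OF g(2) inG_mob_H3[OF assms(2) that]] bspec[OF h(2) that] mob_mmul[OF inG_det[OF assms(2)] that]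
   by simp
 qed
qed

lemma inG_mneg: "inG M ==> inG (mneg M)" by (simp add: inG_def)

lemma inG_minv: assumes "inG M" shows "inG (minv M)"
proof -
 obtain g where g: "g : G" "ALL p:H3. g p = mob M p" using assms(1) by (rule inG_E)
 obtain k where k: "k : G" "ALL p:H3. k (g p) = p & g (k p) = p"
  using bspec[OF c.D[THEN conjunct2, THEN conjunct2, THEN conjunct2, THEN conjunct2, THEN conjunct1] g(1)] by (rule bexE)
 have "k p = mob (minv M) p" if "p : H3" for p
 proof -
  have i: "mob (minv M) p : H3" using mob_in_H3[of "minv M"] inG_det[OF assms] that by simp
  thus ?thesis using bspec[OF k(2) i] bspec[OF g(2) i] mob_minv(2)[OF inG_det[OF assms] that] by simp
 qed
 thus ?thesis using k(1) inG_det[OF assms] by (intro inG_I[of _ k]) simp_all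
qed

lemma inG_peq: "M \<simeq> N ==> inG N ==> inG M" by (auto simp: peq_def inG_mneg)

lemma inG_free: assumes "inG M" "p : H3" "mob M p = p" shows "M \<simeq> mid"
proof -
 obtain g where g: "g : G" "ALL p:H3. g p = mob M p" using assms(1) by (rule inG_E)
 have "mob M q = q" if "q : H3" for q using c.act_free[OF g(1) assms(2) _ that] bspec[OF g(2) assms(2)] bspec[OF g(2) that] assms(3) by simp
 thus ?thesis using mob_eq_id_imp[OF inG_det[OF assms(1)]] by (simp add: peq_def)
qed

lemma inG_eq: assumes "inG M" "inG N" "p : H3" "mob M p = mob N p" shows "M \<simeq> N"
proof -
 have "minv N *m M \<simeq> mid"
  by (rule inG_free[OF inG_mmul[OF inG_minv[OF assms(2)] assms(1)] assms(3)])
   (simp add: mob_mmul[OF inG_det[OF assms(1)] assms(3)] assms(4) mob_minv(1)[OF inG_det[OF assms(2)] assms(3)])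
 hence "N *m (minv N *m M) \<simeq> N *m mid" by (intro peq_mmul) auto
 thus ?thesis by (simp add: mmul_assoc[symmetric] mmul_minv(1)[OF inG_det[OF assms(2)]])
qed

lemma inG_rel:
 assumes p: "p : H3" "p' : H3"
 shows "qrel lin (\<phi> p) (\<phi> p') \<longleftrightarrow> (EX M. inG M & p' = mob M p)"
 unfolding \<phi>_rel[OF p, symmetric]
proof
 assume "EX g:G. p' = g p"
 then obtain g where g: "g : G" "p' = g p" by (rule bexE)
 obtain M where "inG M" "ALL p:H3. g p = mob M p" using inG_of[OF g(1)] by (elim exE conjE)
 thus "EX M. inG M & p' = mob M p" using g(2) p(1) by (intro exI[of _ M]) simp
next
 assume "EX M. inG M & p' = mob M p"
 then obtain M where M: "inG M" "p' = mob M p" by (elim exE conjE)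
 obtain g where "g : G" "ALL p:H3. g p = mob M p" using M(1) by (rule inG_E)
 thus "EX g:G. p' = g p" using M(2) p(1) by (intro bexI[of _ g]) simp_all
qed

lemma deck_affine_m:
 assumes "inG M"
 obtains k v where "v : lat" "!!p. p : H3 ==> \<phi> (mob M p) = (lin k (fst (\<phi> p)) + v, snd (\<phi> p) - of_int k)"
proof -
 obtain g where g: "g : G" "ALL p:H3. g p = mob M p" using assms(1) by (rule inG_E)
 obtain k v where kv: "v : lat" "ALL p:H3. \<phi> (g p) = (lin k (fst (\<phi> p)) + v, snd (\<phi> p) - of_int k)"
  using deck_affine[OF g(1)] by (elim exE conjE)
 show ?thesis by (rule that[OF kv(1)]) (use kv(2) g(2) in simp)
qed

text \<open>All group elements with a geometric meaning are produced here; comparing two lifts takes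
  the place of loops in a fundamental group.\<close>

lemma frame_exists:
 fixes f1 f2 :: "'b::topological_space => point3"
 assumes S: "connected S" "continuous_on S f1" "continuous_on S f2" "!!x. x : S ==> f1 x : H3" "!!x. x : S ==> f2 x : H3"
  and q: "!!x. x : S ==> qrel lin (\<phi> (f1 x)) (\<phi> (f2 x))"
 shows "EX M. inG M & (ALL x:S. f2 x = mob M (f1 x))"
proof -
 have "(f1 x, f2 x) : act_rel H3 G" if "x : S" for x
  using \<phi>_rel[OF S(4,5)[OF that]] q[OF that] S(4)[OF that] by (auto simp: act_rel_def)
 then obtain g where g: "g : G" "ALL x:S. f2 x = g (f1 x)" using c.lift_unique[OF S(1-3)] by blast
 obtain M where M: "inG M" "ALL p:H3. g p = mob M p" using inG_of[OF g(1)] by (elim exE conjE)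
 have "ALL x:S. f2 x = mob M (f1 x)" using g(2) M(2) S(4) by simp
 thus ?thesis using M(1) by blast
qed

end

section \<open>Developing map around a puncture\<close>

text \<open>The points visible from the puncture \<open>0\<close>; their logarithms form the region \<open>Dst\<close>, which is contractible by
 moving to the left.\<close>

definition vis :: "complex => bool" where
 "vis x \<longleftrightarrow> (ALL r. 0 < r & r <= 1 --> of_real r * x ~: lat)"

definition Dst :: "(point3) set" where "Dst = {p. vis (exp (fst p))}"

lemma visD: "vis x ==> 0 < r ==> r <= 1 ==> of_real r * x ~: lat" by (simp add: vis_def)

lemma vis_notin: "vis x ==> x ~: lat" using visD[of x 1] by simp

lemma vis_scale: "vis x ==> 0 < r ==> r <= 1 ==> vis (of_real r * x)"
 unfolding vis_def
proof (intro allI impI)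
 fix s :: real assume v: "ALL r. 0 < r & r <= 1 --> of_real r * x ~: lat" and r: "0 < r" "r <= 1" and s: "0 < s & s <= 1"
 hence "0 < s * r" "s * r <= 1" by (auto simp: mult_le_one)
 thus "of_real s * (of_real r * x) ~: lat" using v by (metis mult.assoc of_real_mult)
qed

lemma vis_small: assumes "x ~= 0" "cmod x < 1" shows "vis x"
 unfolding vis_def
proof (intro allI impI notI)
 fix r assume r: "0 < r & r <= 1" and l: "of_real r * x : lat"
 have "1 <= cmod (of_real r * x)" using lat_norm_ge[OF l] assms r by simp
 also have "... = r * cmod x" using r by (simp add: norm_mult)
 also have "... <= 1 * cmod x" using r by (intro mult_right_mono) auto
 finally show False using assms(2) by simp
qed

lemma closed_lat: "closed lat"
proof (rule discrete_imp_closed[of 1])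
 show "ALL x:lat. ALL y:lat. dist y x < 1 --> y = x"
  using lat_norm_ge[OF lat_diff] by (force simp: dist_norm)
qed simp

lemma open_vis: "open {x. vis x}"
 unfolding open_dist
proof (intro ballI)
 fix x0 assume "x0 : {x. vis x}"
 hence v: "vis x0" by simp
 have nz: "x0 ~= 0" using vis_notin[OF v] lat_0 by auto
 \<comment> \<open>Multiples \<open>r x\<close> with \<open>r < rho\<close> have norm below
   \<open>1\<close> for all \<open>x\<close> near \<open>x0\<close>, so only the compact part
   \<open>K\<close> of the segment has to be kept away from \<open>lat\<close>.\<close>
 define rho where "rho = 1 / (cmod x0 + 1)"
 have rho: "0 < rho" "rho <= 1" using add_nonneg_pos[OF norm_ge_zero[of x0] zero_less_one] by (auto simp: rho_def divide_le_eq)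
 define K where "K = (%r. of_real r * x0) ` {rho..1}"
 have "compact K" unfolding K_def by (intro compact_continuous_image continuous_intros) auto
 moreover have "K \<inter> lat = {}" using visD[OF v] rho by (auto simp: K_def)
 ultimately obtain d where d: "d > 0" "!!y z. y : K ==> z : lat ==> d <= dist y z"
  using separate_compact_closed[OF _ closed_lat] by metis
 have "vis x" if x: "dist x x0 < min d (min 1 (cmod x0))" for x
  unfolding vis_def
 proof (intro allI impI notI)
  fix r assume r: "0 < r & r <= 1" and l: "of_real r * x : lat"
  have dx: "cmod (x - x0) < d" "cmod (x - x0) < 1" "cmod (x - x0) < cmod x0" using x by (auto simp: dist_norm)
  hence xn: "x ~= 0" by auto
  show False
  proof (cases "rho <= r")
   case True
   hence "of_real r * x0 : K" using r by (auto simp: K_def)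
   hence "d <= dist (of_real r * x0) (of_real r * x)" using d l by blast
   also have "... = r * cmod (x - x0)" using r by (simp add: dist_norm norm_mult norm_minus_commute flip: right_diff_distrib)
   also have "... <= 1 * cmod (x - x0)" using r by (intro mult_right_mono) auto
   finally show False using dx by simp
  next
   case False
   have "cmod x <= cmod x0 + 1" using dx norm_triangle_sub[of x x0] by linarith
   hence "r * cmod x <= r * (cmod x0 + 1)" using r by simp
   also have "... < rho * (cmod x0 + 1)" using False by (intro mult_strict_right_mono) (auto intro: add_nonneg_pos)
   also have "... = 1" using nz by (simp add: rho_def add_nonneg_eq_0_iff)
   finally have "cmod (of_real r * x) < 1" using r by (simp add: norm_mult)
   thus False using lat_norm_ge[OF l] xn r by auto
  qed
 qed
 thus "EX e>0. ALL y. dist y x0 < e --> y : {x. vis x}"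
  using d(1) nz by (intro exI[of _ "min d (min 1 (cmod x0))"]) auto
qed

lemma open_Dst: "open Dst"
proof -
 have "Dst = (%p. exp (fst p)) -` {x. vis x}" by (auto simp: Dst_def)
 moreover have "isCont (%p. exp (fst p)) x" for x :: "point3" by (intro continuous_intros)
 ultimately show ?thesis using continuous_open_vimage[OF open_vis] by metis
qed

lemma Dst_down: assumes "(z, t) : Dst" "0 <= s" shows "(z - of_real s, t') : Dst"
proof -
 have "exp (z - of_real s) = of_real (exp (- s)) * exp z"
  by (simp add: exp_diff exp_minus exp_of_real field_simps)
 thus ?thesis using vis_scale[of "exp z" "exp (- s)"] assms by (simp add: Dst_def)
qed

lemma Dst_neg: "Re z < 0 ==> (z, t) : Dst"
 unfolding Dst_def by (auto intro!: vis_small)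

text \<open>Where the real part is negative, the exponential has modulus below \<open>1\<close> and
  every point is visible. So \<open>Dst\<close> is pushed left into a half plane and contracted
  there.\<close>

lemma contractible_Dst: "contractible Dst"
proof -
 define r where "r p = (fst p - of_real (max 0 (Re (fst p) + 1)), snd p)" for p :: "point3"
 have rc: "continuous_on Dst r" unfolding r_def by (intro continuous_intros)
 have "homotopic_with_canon (%x. True) Dst Dst id r"
 proof (rule homotopic_with_linear)
  show "continuous_on Dst (id :: point3 => _)" by (intro continuous_intros)
  show "continuous_on Dst r" by (rule rc)
  fix p assume p: "p : Dst"
  show "closed_segment (id p) (r p) <= Dst"
  proof
   fix q assume "q : closed_segment (id p) (r p)"
   then obtain u where u: "0 <= u" "u <= 1" "q = (1 - u) *\<^sub>R p + u *\<^sub>R r p" by (auto simp: in_segment)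
   have "q = (fst p - of_real (u * max 0 (Re (fst p) + 1)), snd p)"
    unfolding u(3) r_def by (simp add: prod_eq_iff scaleR_conv_of_real algebra_simps)
   thus "q : Dst" using Dst_down[of "fst p" "snd p" "u * max 0 (Re (fst p) + 1)"] p u(1) by simp
  qed
 qed
 moreover have "homotopic_with_canon (%x. True) Dst Dst r (%x. (-1, 0))"
 proof (rule homotopic_with_linear[OF rc])
  fix p :: "point3"
  show "closed_segment (r p) (-1, 0) <= Dst"
  proof
   fix q assume "q : closed_segment (r p) (-1, 0)"
   then obtain u where u: "0 <= u" "u <= 1" "q = (1 - u) *\<^sub>R r p + u *\<^sub>R (-1, 0)" by (auto simp: in_segment)
   have "Re (fst (r p)) <= -1" by (simp add: r_def)
   hence "(1 - u) * Re (fst (r p)) <= (1 - u) * (-1)" using u by (intro mult_left_mono) auto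
   hence "Re (fst q) < 0" unfolding u(3) by simp
   thus "q : Dst" using Dst_neg[of "fst q" "snd q"] by simp
  qed
 qed (intro continuous_intros)
 ultimately show ?thesis unfolding contractible_def using homotopic_with_trans by blast
qed

lemma simply_connected_Dst: "simply_connected Dst" "locally path_connected Dst" "connected Dst"
 using contractible_imp_simply_connected[OF contractible_Dst] open_imp_locally_path_connected[OF open_Dst]
  contractible_imp_connected[OF contractible_Dst] by auto

text \<open>\<open>Ps\<close> is a branch of the inverse of \<open>\<phi>\<close> over the points
  visible from the puncture \<open>0\<close>, with the angle unrolled by the exponential; it takes
  the place of a base point.\<close>

locale devel = fibred +
 fixes Ps :: "point3 => point3"
 assumes Ps_cont: "continuous_on Dst Ps" and Ps_H3: "d : Dst ==> Ps d : H3"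
  and Ps_\<phi>: "d : Dst ==> \<phi> (Ps d) = (exp (fst d), snd d)"

lemma (in fibred) devel_exists:
 assumes "p0 : H3" "d0 : Dst" "\<phi> p0 = (exp (fst d0), snd d0)"
 shows "EX Ps. devel G \<phi> lin Ps & Ps d0 = p0"
proof -
 have "(%d. (exp (fst d), snd d)) ` Dst <= Epl" using vis_notin by (auto simp: Dst_def Epl_def)
 moreover have "continuous_on Dst (%d. (exp (fst d), snd d))" by (intro continuous_intros)
 ultimately obtain k where "continuous_on Dst k" "k ` Dst <= H3" "ALL d:Dst. \<phi> (k d) = (exp (fst d), snd d)" "k d0 = p0"
  using \<phi>_lift[where f = "%d. (exp (fst d), snd d)", OF simply_connected_Dst(1,2) _ _ assms(2,1,3)] by blast
 hence "devel G \<phi> lin k" by unfold_locales auto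
 thus ?thesis using \<open>k d0 = p0\<close> by blast
qed

context devel
begin

lemma frame:
 fixes a b :: "'b::topological_space => point3"
 assumes S: "connected S" "continuous_on S a" "continuous_on S b" "!!x. x : S ==> a x : Dst" "!!x. x : S ==> b x : Dst"
  and q: "!!x. x : S ==> qrel lin (exp (fst (a x)), snd (a x)) (exp (fst (b x)), snd (b x))"
 shows "EX M. inG M & (ALL x:S. Ps (b x) = mob M (Ps (a x)))"
proof (rule frame_exists[OF S(1)])
 show "continuous_on S (%x. Ps (a x))" "continuous_on S (%x. Ps (b x))"
  using S by (auto intro: continuous_on_compose2[OF Ps_cont])
qed (use S Ps_H3 Ps_\<phi> q in auto)

lemma qrel_translate: "v : lat ==> y = x + v ==> qrel lin (x, t) (y, t)"
 unfolding qrel_def by (intro exI[of _ 0] exI[of _ v]) (simp add: lin_0)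

lemma Dst_2pi: "(z, t) : Dst ==> (z + tpi * of_int n, t') : Dst"
 by (simp add: Dst_def exp_add exp_integer_2pi mult.commute mult.left_commute)

lemma exp_2pi: "exp (z + tpi * of_int n) = exp z"
 using exp_integer_2pi[of "of_int n"] by (simp add: exp_add mult.commute mult.left_commute)

lemma P_exists: "EX M. inG M & (ALL d:Dst. Ps (fst d + tpi * of_int n, snd d) = mob M (Ps d))"
proof (rule frame)
 show "continuous_on Dst (%d. d)" "continuous_on Dst (%d. (fst d + tpi * of_int n, snd d))"
  by (intro continuous_intros)+
 show "(fst d + tpi * of_int n, snd d) : Dst" if "d : Dst" for d
  using Dst_2pi[of "fst d" "snd d"] that by simp
 show "qrel lin (exp (fst d), snd d) (exp (fst (fst d + tpi * of_int n, snd d)), snd (fst d + tpi * of_int n, snd d))" for d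
  unfolding fst_conv snd_conv exp_2pi by (rule qrel_refl)
qed (use simply_connected_Dst in auto)

text \<open>A loop around the puncture is not contractible: a logarithm of the first component of \<open>\<phi>\<close>
 on \<open>H3\<close> would otherwise take two different values.\<close>

lemma P_nontrivial:
 assumes "d : Dst" "Ps (fst d + tpi * of_int n, snd d) = Ps d" shows "n = 0"
proof -
 have nz: "fst (\<phi> p) ~= 0" if "p : H3" for p using \<phi>_in[OF that] lat_0 by (auto simp: Epl_def mem_Times_iff)
 have cf: "continuous_on H3 (%p. fst (\<phi> p))" by (intro continuous_intros \<phi>_cont)
 obtain l where l: "continuous_on H3 l" "!!p. p : H3 ==> fst (\<phi> p) = exp (l p)"
  using continuous_logarithm_on_contractible[OF cf convex_imp_contractible[OF convex_H3] nz] by metis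
 have "EX c:lat. ALL x:Dst. (l (Ps x) - fst x) / tpi = c"
 proof (rule continuous_lat_const[OF simply_connected_Dst(3)])
  show "continuous_on Dst (%x. (l (Ps x) - fst x) / tpi)"
   by (intro continuous_intros continuous_on_compose2[OF l(1) Ps_cont]) (use Ps_H3 in auto)
  fix x assume x: "x : Dst"
  have "exp (l (Ps x)) = exp (fst x)" using l(2)[OF Ps_H3[OF x]] Ps_\<phi>[OF x] by simp
  then obtain m :: int where "l (Ps x) = fst x + of_int (2 * m) * pi * \<i>" by (auto simp: exp_eq)
  thus "(l (Ps x) - fst x) / tpi : lat" by (simp add: lat_def)
 qed
 then obtain c where c: "!!x. x : Dst ==> (l (Ps x) - fst x) / tpi = c" by blast
 have d': "(fst d + tpi * of_int n, snd d) : Dst" using Dst_2pi[of "fst d" "snd d"] assms by simp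
 have "(l (Ps d) - (fst d + tpi * of_int n)) / tpi = (l (Ps d) - fst d) / tpi"
  using c[OF assms(1)] c[OF d'] assms(2) by simp
 thus ?thesis by (simp add: field_simps)
qed

end

section \<open>The end of the bundle\<close>

lemma countable_lat: "countable lat"
proof -
 have "lat <= (%q. Complex (of_int (fst q)) (of_int (snd q))) ` (UNIV :: (int \<times> int) set)"
 proof
  fix z assume "z : lat"
  then obtain a b :: int where "Re z = of_int a" "Im z = of_int b" by (auto simp: lat_def elim!: Ints_cases)
  thus "z : (%q. Complex (of_int (fst q)) (of_int (snd q))) ` UNIV"
   by (intro image_eqI[of _ _ "(a, b)"]) (auto simp: complex_eq_iff)
 qed
 thus ?thesis using countable_subset countable_image by (metis countableI_type)
qed

lemma open_Epl: "open Epl" and connected_Epl: "connected Epl"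
proof -
 show "open Epl" unfolding Epl_def using closed_lat by (intro open_Times) (auto simp: open_closed)
 have "connected (- lat)"
  by (rule path_connected_imp_connected[OF path_connected_complement_countable]) (use countable_lat in auto)
 thus "connected Epl" unfolding Epl_def by (intro connected_Times) auto
qed

text \<open>Small hyperbolic displacement near \<open>p\<close> is small Euclidean displacement:
  \<open>hD x q - 2\<close> is the squared Euclidean distance divided by both heights,
  \<open>d\<close> bounds the height of \<open>x\<close>, and \<open>\<eta>\<close> then bounds that
  of \<open>q\<close> by a multiple of it.\<close>

lemma hD_near:
 assumes p: "p : H3" and r: "0 < r"
 shows "EX d>0. \<exists>\<eta>>0. ALL x q. x : H3 --> q : H3 --> dist p x < d --> hD x q < 2 + \<eta> --> dist p q < r"
proof -
 define s0 where "s0 = snd p"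
 have s0: "s0 > 0" using p by (simp add: H3_def s0_def)
 define d where "d = min (r / 2) s0"
 define \<eta> where "\<eta> = min 1 ((r / (8 * s0))^2)"
 have dpos: "d > 0" "\<eta> > 0" using r s0 by (auto simp: d_def \<eta>_def)
 have "dist p q < r" if H: "x : H3" "q : H3" and d: "dist p x < d" and h: "hD x q < 2 + \<eta>" for x q
 proof -
  define s t where "s = snd x" and "t = snd q"
  have st: "s > 0" "t > 0" using H by (auto simp: H3_def s_def t_def)
  have "\<bar>s0 - s\<bar> < s0" using dist_snd_le[of p x] d by (simp add: s0_def s_def d_def dist_real_def)
  hence s2: "s < 2 * s0" by linarith
  define D where "D = (cmod (fst x - fst q))^2 + (s - t)^2"
  have "hD x q = 2 + D / (s * t)" unfolding hD_def D_def s_def[symmetric] t_def[symmetric] using st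
   by (simp add: field_simps power2_eq_square)
  hence "D / (s * t) < \<eta>" using h by simp
  hence D: "D < \<eta> * (s * t)" using st by (simp add: divide_less_eq)
  have "t < 4 * s"
  proof (rule ccontr)
   assume "\<not> t < 4 * s"
   hence t4: "4 * s <= t" by simp
   have "s * t <= t / 4 * t" using t4 st by (intro mult_right_mono) auto
   moreover have "(3 / 4 * t)^2 <= (t - s)^2" using t4 st by (intro power_mono) auto
   moreover have "(t - s)^2 <= D" by (simp add: D_def power2_commute)
   moreover have "\<eta> * (s * t) <= 1 * (s * t)" using st by (intro mult_right_mono) (auto simp: \<eta>_def)
   moreover have "0 < t * t" using st by simp
   ultimately show False using D unfolding power2_eq_square by linarith
  qed
  hence "s * t < s * (4 * s)" using st by simp
  also have "... <= (2 * s0) * (4 * (2 * s0))" using s2 st s0 by (intro mult_mono) auto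
  finally have "\<eta> * (s * t) < \<eta> * (16 * s0^2)" using dpos by (simp add: power2_eq_square)
  also have "... <= (r / (8 * s0))^2 * (16 * s0^2)" by (intro mult_right_mono) (auto simp: \<eta>_def)
  also have "... = (r / 2)^2" using s0 by (simp add: power_divide power_mult_distrib)
  finally have "D < (r / 2)^2" using D by linarith
  moreover have "(dist x q)^2 = D"
   unfolding D_def s_def t_def dist_prod_def by (simp add: dist_norm)
  ultimately have "dist x q < r / 2" using r by (intro power2_less_imp_less[of _ "r / 2"]) auto
  moreover have "dist p x < r / 2" using d by (simp add: d_def)
  ultimately show ?thesis using dist_triangle[of p q x] by linarith
 qed
 thus ?thesis using dpos by blast
qed

context fibred
begin

lemma lin_diff: "lin k (x - y) = lin k x - lin k y" using lin_plus[of k "x - y" y] by simp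
lemma lin_zero [simp]: "lin k 0 = 0" using lin_diff[of k 0 0] by simp
lemma lin_inv: "lin (- k) (lin k x) = x" "lin k (lin (- k) x) = x"
 using lin_add[of "- k" k x] lin_add[of k "- k" x] by (simp_all add: lin_0)
lemma lin_eq_0: "lin k x = 0 ==> x = 0" using lin_inv(1)[of k x] by simp
lemma lin_uminus: "lin k (- x) = - lin k x" using lin_diff[of k 0 x] by simp

lemma lin_bound: obtains N where "N >= 1" "!!z. cmod (lin k z) <= N * cmod z"
proof
 let ?N = "cmod (lin k 1) + cmod (lin k \<i>) + 1"
 show "1 <= ?N" by simp
 fix z
 have "lin k z = lin k (of_real (Re z) * 1 + of_real (Im z) * \<i>)"
  by (simp add: complex_eq mult.commute flip: complex_eq)
 also have "... = of_real (Re z) * lin k 1 + of_real (Im z) * lin k \<i>" unfolding lin_plus lin_scale ..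
 finally have "cmod (lin k z) <= \<bar>Re z\<bar> * cmod (lin k 1) + \<bar>Im z\<bar> * cmod (lin k \<i>)"
  by (metis norm_mult norm_of_real norm_triangle_ineq)
 also have "... <= cmod z * cmod (lin k 1) + cmod z * cmod (lin k \<i>)"
  by (intro add_mono mult_right_mono abs_Re_le_cmod abs_Im_le_cmod) auto
 finally have "cmod (lin k z) <= cmod z * cmod (lin k 1) + cmod z * cmod (lin k \<i>)" .
 moreover have "?N * cmod z = cmod z * cmod (lin k 1) + cmod z * cmod (lin k \<i>) + cmod z" by (simp add: algebra_simps)
 ultimately show "cmod (lin k z) <= ?N * cmod z" using norm_ge_zero[of z] by linarith
qed

text \<open>A ball in \<open>Epl\<close> that meets the image lies in it, by lifting the inclusion;
  hence the image and its complement are both open in the connected \<open>Epl\<close>.\<close>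

lemma \<phi>_surj: assumes "e : Epl" shows "e : \<phi> ` H3"
proof -
 have loc: "ball x r <= \<phi> ` H3" if B: "ball x r <= Epl" and p: "p : H3" "\<phi> p : ball x r" for x r p
 proof -
  have "EX k. continuous_on (ball x r) k & k ` ball x r <= H3 & (ALL d:ball x r. \<phi> (k d) = id d) & k (\<phi> p) = p"
   by (rule \<phi>_lift) (use B p convex_imp_simply_connected convex_imp_locally_path_connected in "auto intro: convex_ball")
  then obtain k where k: "k ` ball x r <= H3" "ALL d:ball x r. \<phi> (k d) = id d" by blast
  show ?thesis
  proof
   fix d assume d: "d : ball x r"
   hence "d = \<phi> (k d)" "k d : H3" using k by auto
   thus "d : \<phi> ` H3" by (rule image_eqI)
  qed
 qed
 have nb: "EX r>0. ball x r <= Epl" if "x : Epl" for x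
  using open_Epl that by (auto simp: open_contains_ball)
 have 1: "open (\<phi> ` H3)"
  unfolding open_contains_ball
 proof
  fix x assume "x : \<phi> ` H3"
  then obtain p where p: "p : H3" "x = \<phi> p" by blast
  obtain r where "r > 0" "ball x r <= Epl" using nb \<phi>_in p by blast
  thus "EX r>0. ball x r <= \<phi> ` H3" using loc[of x r p] p by auto
 qed
 have 2: "open (Epl - \<phi> ` H3)"
  unfolding open_contains_ball
 proof
  fix x assume x: "x : Epl - \<phi> ` H3"
  obtain r where r: "r > 0" "ball x r <= Epl" using nb x by blast
  have "ball x r \<inter> \<phi> ` H3 = {}"
  proof (rule ccontr)
   assume "ball x r \<inter> \<phi> ` H3 ~= {}"
   then obtain p where "p : H3" "\<phi> p : ball x r" by blast
   hence "ball x r <= \<phi> ` H3" using loc r by blast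
   thus False using x r(1) by (meson DiffD2 centre_in_ball subsetD)
  qed
  thus "EX r>0. ball x r <= Epl - \<phi> ` H3" using r by blast
 qed
 have "Epl <= \<phi> ` H3 \<union> (Epl - \<phi> ` H3)" by blast
 moreover have "\<phi> (0,1) : \<phi> ` H3 \<inter> Epl" using \<phi>_in[of "(0,1)"] by (simp add: H3_iff)
 ultimately have "Epl - \<phi> ` H3 = {}"
  using connectedD[OF connected_Epl 1 2] by blast
 thus ?thesis using assms by blast
qed

text \<open>A tube around the line over the puncture \<open>v\<close>. At levels near
  \<open>k\<close> it is a round disc only after \<open>lin k\<close>, which is what makes the
  family of tubes compatible with the bundle group.\<close>

definition UV :: "real => complex => (point3) set" where
 "UV \<epsilon> v = {e. EX k::int. \<bar>snd e - of_int k\<bar> < 1 & cmod (lin k (fst e - v)) < \<epsilon>}"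

lemma open_UV: "open (UV \<epsilon> v)"
proof -
 have "UV \<epsilon> v = (\<Union>k::int. {e. \<bar>snd e - of_int k\<bar> < 1} \<inter> {e. cmod (lin k (fst e - v)) < \<epsilon>})"
  by (auto simp: UV_def)
 also have "open ..."
  by (intro open_UN ballI open_Int open_Collect_less continuous_intros continuous_on_compose2[OF lin_cont]) auto
 finally show ?thesis .
qed

lemma UV_shift: "(x, t) : UV \<epsilon> 0 ==> (lin j x + v, t - of_int j) : UV \<epsilon> v"
proof -
 assume "(x, t) : UV \<epsilon> 0"
 then obtain k :: int where k: "\<bar>t - of_int k\<bar> < 1" "cmod (lin k x) < \<epsilon>" by (auto simp: UV_def)
 have "lin (k - j) (lin j x) = lin k x" using lin_add[of "k - j" j x] by simp
 thus ?thesis using k unfolding UV_def by (intro CollectI exI[of _ "k - j"]) simp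
qed

definition eps0 :: real where
 "eps0 = (SOME e. 0 < e & e <= 1/2 & (ALL v v'. v : lat --> v' : lat --> UV e v \<inter> UV e v' ~= {} --> v = v'))"

text \<open>At a common point the integers \<open>k\<close> of two tubes differ by at most one, so a
  bound \<open>N\<close> for the single map \<open>lin 1\<close> suffices, and radius
  \<open>1 / (4 N)\<close> separates the tubes.\<close>

lemma eps0: "0 < eps0" "eps0 <= 1/2" "v : lat ==> v' : lat ==> e : UV eps0 v ==> e : UV eps0 v' ==> v = v'"
proof -
 obtain N where N: "N >= 1" "!!z. cmod (lin 1 z) <= N * cmod z" using lin_bound by blast
 define e0 where "e0 = 1 / (4 * N)"
 have e0: "0 < e0" "e0 <= 1/4" "N * e0 <= 1/4" using N(1) by (auto simp: e0_def field_simps)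
 have z: "x = 0" if "x : lat" "cmod (lin k x) < 1" for k x
 proof (rule lin_eq_0[of k], rule ccontr)
  assume "lin k x ~= 0"
  thus False using lat_norm_ge[OF lin_lat[OF that(1)]] that(2) by fastforce
 qed
 have key: "v = v'" if v: "v : lat" "v' : lat" and "cmod (lin k (x - v)) < e0" "cmod (lin k' (x - v')) < e0" "k' = k | k' = k + 1"
  for v v' x and k k' :: int
 proof -
  have eq: "lin k' (v - v') = lin k' (x - v') - lin (k' - k) (lin k (x - v))"
   using lin_add[of "k' - k" k x] lin_add[of "k' - k" k v] by (simp add: lin_diff)
  moreover have "cmod (lin (k' - k) (lin k (x - v))) <= N * cmod (lin k (x - v))"
   using that(5) N lin_0[of "lin k (x - v)"] mult_right_mono[OF N(1) norm_ge_zero[of "lin k (x - v)"]] by auto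
  moreover have "N * cmod (lin k (x - v)) <= N * e0" using that(3) N(1) by (intro mult_left_mono) auto
  moreover have "cmod (lin k' (v - v')) <= cmod (lin k' (x - v')) + cmod (lin (k' - k) (lin k (x - v)))"
   unfolding eq by (rule norm_triangle_ineq4)
  ultimately have "cmod (lin k' (v - v')) < 1" using that(4) e0 by linarith
  thus ?thesis using z[OF lat_diff[OF v]] by simp
 qed
 have "v = v'" if v: "v : lat" "v' : lat" and ne: "UV e0 v \<inter> UV e0 v' ~= {}" for v v'
 proof -
  obtain e k k' where k: "\<bar>snd e - real_of_int k\<bar> < 1" "cmod (lin k (fst e - v)) < e0" "\<bar>snd e - real_of_int k'\<bar> < 1" "cmod (lin k' (fst e - v')) < e0"
   using ne unfolding UV_def by blast
  have "k' = k | k' = k + 1 | k = k' + 1" using k(1,3) by linarith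
  thus ?thesis using key[OF v k(2,4)] key[OF v(2,1) k(4,2)] by auto
 qed
 hence "0 < e0 & e0 <= 1/2 & (ALL v v'. v : lat --> v' : lat --> UV e0 v \<inter> UV e0 v' ~= {} --> v = v')"
  using e0 by auto
 hence *: "0 < eps0 & eps0 <= 1/2 & (ALL v v'. v : lat --> v' : lat --> UV eps0 v \<inter> UV eps0 v' ~= {} --> v = v')"
  unfolding eps0_def by (rule someI)
 thus "0 < eps0" "eps0 <= 1/2" by auto
 show "v : lat ==> v' : lat ==> e : UV eps0 v ==> e : UV eps0 v' ==> v = v'" using * by blast
qed

text \<open>The complement of the tubes is compact modulo the bundle group, and parabolics have small
 displacement high up in the horoball.\<close>

lemma deep_horoball:
 assumes b: "b ~= 0" "inG (trans2 b)"
 shows "EX h>=1. ALL p. h < snd p --> (EX v:lat. \<phi> p : UV eps0 v)"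
proof (rule ccontr)
 assume neg: "\<not> ?thesis"
 have "EX p. real n + 1 < snd p & (ALL v:lat. \<phi> p ~: UV eps0 v)" for n :: nat
 proof -
  have "\<not> (ALL p. real n + 1 < snd p --> (EX v:lat. \<phi> p : UV eps0 v))" using neg by (metis le_add_same_cancel2 of_nat_0_le_iff)
  thus ?thesis by blast
 qed
 then obtain P where P: "!!n. real n + 1 < snd (P n)" "!!n v. v : lat ==> \<phi> (P n) ~: UV eps0 v" by metis
 have PH: "P n : H3" for n using P(1)[of n] of_nat_0_le_iff[of n, where 'a = real] by (simp add: H3_def)
 define K where "K = (cbox 0 (1 + \<i>) \<inter> (\<Inter>m\<in>lat. {x. eps0 <= cmod (x - m)})) \<times> {0..1::real}"
 have "closed (\<Inter>m\<in>lat. {x. eps0 <= cmod (x - m)})"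
  by (intro closed_INT ballI closed_Collect_le continuous_intros)
 hence Kc: "compact K" unfolding K_def
  by (intro compact_Times compact_Int_closed compact_cbox compact_Icc)
 have "EX e:K. qrel lin (\<phi> (P n)) e" for n
 proof -
  obtain x t where xt: "\<phi> (P n) = (x, t)" by (cases "\<phi> (P n)")
  define k where "k = \<lfloor>t\<rfloor>"
  define y where "y = lin k x"
  define m where "m = Complex (of_int \<lfloor>Re y\<rfloor>) (of_int \<lfloor>Im y\<rfloor>)"
  have m: "m : lat" by (simp add: m_def lat_def)
  have 1: "y - m : cbox 0 (1 + \<i>)"
   unfolding m_def by (simp add: in_cbox_complex_iff) linarith
  have 2: "eps0 <= cmod (y - m - m')" if "m' : lat" for m'
  proof (rule ccontr)
   assume l: "\<not> eps0 <= cmod (y - m - m')"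
   have "lin k (x - lin (- k) (m + m')) = y - m - m'" by (simp add: lin_diff lin_inv y_def)
   moreover have "\<bar>t - of_int k\<bar> < 1" unfolding k_def by linarith
   ultimately have "\<phi> (P n) : UV eps0 (lin (- k) (m + m'))" unfolding xt UV_def using l by auto
   thus False using P(2)[OF lin_lat[OF lat_add[OF m that]]] by blast
  qed
  have 3: "t - of_int k : {0..1}" unfolding k_def by simp linarith
  have "qrel lin (x, t) (y - m, t - of_int k)"
   unfolding qrel_def by (intro exI[of _ k] exI[of _ "- m"]) (simp add: y_def m lat_uminus)
  moreover have "(y - m, t - of_int k) : K" using 1 2 3 by (simp add: K_def)
  ultimately show ?thesis unfolding xt by blast
 qed
 \<comment> \<open>Orbit representatives in the compact set \<open>K\<close>; a limit of them keeps
   distance \<open>eps0\<close> from the lattice, so it has a preimage \<open>p\<close> in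
   \<open>H3\<close>.\<close>
 then obtain E where E: "!!n. E n : K" "!!n. qrel lin (\<phi> (P n)) (E n)" by metis
 then obtain e r where e: "e : K" "strict_mono r" "(E \<circ> r) \<longlonglongrightarrow> e"
  using Kc unfolding compact_def by metis
 have "e : Epl"
 proof -
  have "eps0 <= cmod (fst e - m)" if "m : lat" for m using e(1) that by (auto simp: K_def)
  hence "fst e ~: lat" using eps0(1) by force
  thus ?thesis by (simp add: Epl_def mem_Times_iff)
 qed
 then obtain p where p: "p : H3" "\<phi> p = e" using \<phi>_surj by blast
 obtain U where U: "open U" "p : U" "U <= H3" "!!g u v. g : G ==> u : U ==> g u : U ==> v : H3 ==> g v = v"
  using c.act_nbhd[OF p(1)] by blast
 obtain \<rho> where \<rho>: "\<rho> > 0" "ball p \<rho> <= U" using U(1,2) open_contains_ball by blast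
 obtain d \<eta> where d: "d > 0" "\<eta> > 0" "!!x q. x : H3 ==> q : H3 ==> dist p x < d ==> hD x q < 2 + \<eta> ==> dist p q < \<rho>"
  using hD_near[OF p(1) \<rho>(1)] by metis
 obtain I where I: "open I" "p : I" "I <= H3" "inj_on \<phi> I" using \<phi>_inj_nbhd[OF p(1)] by blast
 let ?W = "I \<inter> ball p (min d \<rho>)"
 have "open (\<phi> ` ?W)"
  by (rule invariance_of_domain) (use I \<phi>_cont in "auto intro: continuous_on_subset inj_on_subset")
 moreover have "e : \<phi> ` ?W" using p I d \<rho> by (intro image_eqI[of _ _ p]) auto
 ultimately have "\<forall>\<^sub>F n in sequentially. (E \<circ> r) n : \<phi> ` ?W" using topological_tendstoD[OF e(3)] by blast
 then obtain n0 where n0: "!!n. n >= n0 ==> E (r n) : \<phi> ` ?W" by (auto simp: eventually_sequentially)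
 obtain n1 :: nat where n1: "(cmod b)^2 / \<eta> < real n1" using reals_Archimedean2 by blast
 define n where "n = r (max n0 n1)"
 obtain x where x: "x : ?W" "\<phi> x = E n" using n0[of "max n0 n1"] by (auto simp: n_def)
 have xH: "x : H3" using x I by blast
 obtain M where M: "inG M" "x = mob M (P n)"
  using inG_rel[OF PH xH] E(2)[of n] x(2) by auto
 \<comment> \<open>The parabolic transported to the representative \<open>x\<close>: it displaces
   \<open>x\<close> as little as \<open>trans2 b\<close> displaces \<open>P n\<close>, against
   discreteness near \<open>p\<close>.\<close>
 define \<gamma> where "\<gamma> = M *m trans2 b *m minv M"
 have \<gamma>: "inG \<gamma>" unfolding \<gamma>_def by (intro inG_mmul M b inG_minv)
 have Mi: "mob (minv M) x = P n" using M mob_minv(1)[OF inG_det[OF M(1)] PH] by simp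
 have gx: "mob \<gamma> x = mob M (shift b (P n))"
  unfolding \<gamma>_def using mob_mmul[of "minv M" x] mob_mmul[of "trans2 b" "P n" M] inG_det[OF M(1)] xH PH Mi by simp
 have "hD x (mob \<gamma> x) = hD (mob M (P n)) (mob M (shift b (P n)))" using gx M(2) by simp
 also have "... = hD (P n) (shift b (P n))"
  by (rule mob_hD[OF inG_det[OF M(1)] PH]) (simp add: PH)
 also have "... = 2 + (cmod b)^2 / (snd (P n))^2"
  using PH[of n] unfolding hD_def H3_def shift_def by (simp add: power2_eq_square add_divide_distrib)
 also have "... < 2 + \<eta>"
 proof -
  have "n >= n1" unfolding n_def using strict_mono_imp_increasing[OF e(2), of "max n0 n1"] by linarith
  hence "(cmod b)^2 / \<eta> < snd (P n)" "1 <= snd (P n)" using n1 P(1)[of n] by linarith+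
  moreover hence "snd (P n) <= (snd (P n))^2" by (simp add: power2_eq_square)
  ultimately have "(cmod b)^2 / \<eta> < (snd (P n))^2" by linarith
  thus ?thesis using d(2) \<open>1 <= snd (P n)\<close> by (simp add: field_simps)
 qed
 finally have "dist p (mob \<gamma> x) < \<rho>"
  using d(3)[OF xH inG_mob_H3[OF \<gamma> xH]] x(1) by simp
 hence gU: "mob \<gamma> x : U" using \<rho>(2) by auto
 have xU: "x : U" using x(1) \<rho>(2) by auto
 obtain g where g: "g : G" "ALL p:H3. g p = mob \<gamma> p" using \<gamma> by (rule inG_E)
 have "mob \<gamma> x = x" using U(4)[OF g(1) xU _ xH] bspec[OF g(2) xH] gU by simp
 hence "mob (minv M) (mob M (shift b (P n))) = P n" using gx Mi by simp
 hence "shift b (P n) = P n" using mob_minv(1)[OF inG_det[OF M(1)]] PH by simp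
 thus False using b(1) by (simp add: shift_def prod_eq_iff)
qed

text \<open>The part of the horoball above \<open>h\<close> is connected, while the tubes are open
  and pairwise disjoint.\<close>

lemma deep_single:
 assumes h: "h >= 1" "!!p. h < snd p ==> EX v:lat. \<phi> p : UV eps0 v"
 shows "EX v:lat. ALL p. h < snd p --> \<phi> p : UV eps0 v"
proof -
 define V where "V = {p :: point3. h < snd p}"
 have "V = UNIV \<times> {h<..}" by (auto simp: V_def)
 hence "convex V" by (simp add: convex_Times)
 hence cV: "connected V" by (rule convex_connected)
 have VH: "V <= H3" using h(1) by (auto simp: V_def H3_def)
 have oV: "open V" unfolding V_def by (intro open_Collect_less continuous_intros)
 have op: "open (V \<inter> \<phi> -` S)" if "open S" for S
  using continuous_open_preimage[OF continuous_on_subset[OF \<phi>_cont VH] oV that] .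
 have "(0, h + 1) : V" by (simp add: V_def)
 then obtain v where v: "v : lat" "\<phi> (0, h + 1) : UV eps0 v" using h(2)[of "(0, h + 1)"] by auto
 let ?A = "V \<inter> \<phi> -` UV eps0 v" and ?B = "V \<inter> \<phi> -` (\<Union>w\<in>lat - {v}. UV eps0 w)"
 have oAB: "open ?A" "open ?B" by (intro op open_UN ballI open_UV)+
 have dis: "?A \<inter> ?B \<inter> V = {}" using eps0(3) v(1) by blast
 have cover: "V <= ?A \<union> ?B"
 proof
  fix p assume p: "p : V"
  hence "h < snd p" by (simp add: V_def)
  then obtain w where w: "w : lat" "\<phi> p : UV eps0 w" using h(2)[of p] by blast
  thus "p : ?A \<union> ?B" using p by (cases "w = v") auto
 qed
 have "?A \<inter> V = {} | ?B \<inter> V = {}" by (rule connectedD[OF cV oAB dis cover])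
 moreover have "(0, h + 1) : ?A \<inter> V" using v \<open>(0, h + 1) : V\<close> by blast
 ultimately have "?B \<inter> V = {}" by (metis empty_iff)
 hence "V <= ?A" using cover by (simp add: Int_absorb2 Int_commute Int_left_commute)
 hence "V <= \<phi> -` UV eps0 v" by (rule order_trans) simp
 hence "ALL p. h < snd p --> \<phi> p : UV eps0 v" unfolding V_def by blast
 thus ?thesis using v(1) by (rule bexI)
qed

lemma qrel_shift: "v0 : lat ==> qrel lin (x - v0, t) (y - v0, u) \<longleftrightarrow> qrel lin (x, t) (y, u)"
proof -
 assume v0: "v0 : lat"
 have "qrel lin (x + w, t) (y + w, u)" if qw: "qrel lin (x, t) (y, u)" "w : lat" for x y w t u
 proof -
  obtain k v where kv: "v : lat" "y = lin k x + v" "u = t - of_int k" using qw(1) unfolding qrel_def fst_conv snd_conv by blast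
  have "v + w - lin k w : lat" using kv qw(2) lin_lat lat_add lat_diff by blast
  thus ?thesis using kv unfolding qrel_def
   by (intro exI[of _ k] exI[of _ "v + w - lin k w"]) (simp add: lin_plus)
 qed
 from this[of x t y u "- v0"] this[of "x - v0" t "y - v0" u v0] show ?thesis using v0 lat_uminus by auto
qed

text \<open>Allows the puncture at which the horoball sits to be placed at \<open>0\<close>.\<close>

lemma fibred_translate:
 assumes v0: "v0 : lat" shows "fibred G (%p. (fst (\<phi> p) - v0, snd (\<phi> p))) lin"
proof
 let ?\<phi> = "%p. (fst (\<phi> p) - v0, snd (\<phi> p))"
 show "continuous_on H3 ?\<phi>" by (intro continuous_intros \<phi>_cont)
 have E: "(x - v0, t) : Epl \<longleftrightarrow> (x, t) : Epl" for x t
  using lat_add[OF _ v0, of "x - v0"] lat_diff[OF _ v0, of x] by (auto simp: Epl_def)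
 show "?\<phi> p : Epl" if "p : H3" for p using \<phi>_in[OF that] E by simp
 show "(EX g:G. p' = g p) \<longleftrightarrow> qrel lin (?\<phi> p) (?\<phi> p')" if "p : H3" "p' : H3" for p p'
  using \<phi>_rel[OF that] qrel_shift[OF v0] by simp
 fix S f and d0 p0 :: "point3"
 assume S: "simply_connected S" "locally path_connected S" "continuous_on S f" "f ` S <= Epl" "d0 : S" "p0 : H3"
  and e: "?\<phi> p0 = f d0"
 let ?f = "%d. (fst (f d) + v0, snd (f d))"
 have "continuous_on S ?f" by (intro continuous_intros S)
 moreover have "?f ` S <= Epl" using S(4) E[of "_ + v0"] by (auto simp: image_subset_iff)
 moreover have "\<phi> p0 = ?f d0" using e[symmetric] by (simp add: prod_eq_iff)
 ultimately obtain k where k: "continuous_on S k" "k ` S <= H3" "ALL d:S. \<phi> (k d) = ?f d" "k d0 = p0"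
  using \<phi>_lift[OF S(1,2) _ _ S(5,6)] by blast
 thus "EX k. continuous_on S k & k ` S <= H3 & (ALL d:S. ?\<phi> (k d) = f d) & k d0 = p0"
  by (intro exI[of _ k]) simp
qed (rule G_ca G_mob lin_0 lin_add lin_plus lin_scale lin_lat lin_cross lin_cont; assumption)+

end

section \<open>The stabiliser of the horoball\<close>

lemma vis_linI: assumes "!!r. (of_real r * y : lat) --> (of_real r * x : lat)" "vis x" shows "vis y"
 using assms unfolding vis_def by blast

locale cusp = devel +
 fixes h :: real and b0 :: complex
 assumes h1: "1 <= h" and high: "h < snd p ==> \<phi> p : UV eps0 0"
  and high_Ps: "h < snd p ==> EX z. (z, snd (\<phi> p)) : Dst & Ps (z, snd (\<phi> p)) = p"
  and b0: "b0 ~= 0" "inG (trans2 b0)"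

context fibred
begin

lemma UV_vis: assumes "e : UV eps0 0" "fst e ~: lat" shows "vis (fst e)"
 unfolding vis_def
proof (intro allI impI notI)
 fix r :: real assume r: "0 < r & r <= 1" and l: "of_real r * fst e : lat"
 obtain k :: int where k: "cmod (lin k (fst e)) < eps0" using assms(1) by (auto simp: UV_def)
 have "cmod (lin k (of_real r * fst e)) = r * cmod (lin k (fst e))" using r by (simp add: lin_scale norm_mult)
 also have "... <= 1 * cmod (lin k (fst e))" using r by (intro mult_right_mono) auto
 also have "... < 1" using k eps0(2) by simp
 finally have "lin k (of_real r * fst e) = 0" using lat_norm_ge[OF lin_lat[OF l]] by fastforce
 hence "fst e = 0" using r lin_eq_0 by fastforce
 thus False using assms(2) by simp
qed

text \<open>High in the horoball the first component of \<open>\<phi>\<close> has a logarithm, and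
  \<open>Ps\<close> composed with it lifts the same map as the identity does; agreement at
  \<open>p0\<close> makes the two equal.\<close>

lemma cusp_exists:
 assumes b: "b ~= 0" "inG (trans2 b)"
 shows "EX v0:lat. EX Ps h. cusp G (%p. (fst (\<phi> p) - v0, snd (\<phi> p))) lin Ps h b"
proof -
 obtain h where h: "h >= 1" "ALL p. h < snd p --> (EX v:lat. \<phi> p : UV eps0 v)" using deep_horoball[OF b] by blast
 obtain v0 where v0: "v0 : lat" "ALL p. h < snd p --> \<phi> p : UV eps0 v0"
  using deep_single[OF h(1)] h(2) by blast
 define \<phi>' where "\<phi>' p = (fst (\<phi> p) - v0, snd (\<phi> p))" for p
 interpret f: fibred G \<phi>' lin unfolding \<phi>'_def using fibred_translate[OF v0(1)] .
 have hi: "\<phi>' p : UV eps0 0" if "h < snd p" for p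
  using v0(2)[rule_format, OF that] by (simp add: \<phi>'_def UV_def)
 define p0 where "p0 = (0 :: complex, h + 1)"
 have p0: "p0 : H3" "h < snd p0" using h(1) by (auto simp: p0_def H3_iff)
 define V where "V = {p :: point3. h < snd p}"
 have "V = UNIV \<times> {h<..}" by (auto simp: V_def)
 hence cV: "convex V" by (simp add: convex_Times)
 have VH: "V <= H3" using h(1) by (auto simp: V_def H3_def)
 have nl: "fst (\<phi>' p) ~: lat" if "p : H3" for p using f.\<phi>_in[OF that] by (simp add: Epl_def mem_Times_iff)
 have nz: "fst (\<phi>' p) ~= 0" if "p : V" for p using nl[of p] VH that lat_0 by (metis subsetD)
 have cf: "continuous_on V (%p. fst (\<phi>' p))"
  by (intro continuous_intros continuous_on_subset[OF f.\<phi>_cont VH])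
 obtain l where l: "continuous_on V l" "!!p. p : V ==> fst (\<phi>' p) = exp (l p)"
  using continuous_logarithm_on_contractible[OF cf convex_imp_contractible[OF cV] nz] by metis
 have d0: "(l p0, snd (\<phi>' p0)) : Dst" and e0: "\<phi>' p0 = (exp (fst (l p0, snd (\<phi>' p0))), snd (l p0, snd (\<phi>' p0)))"
  using f.UV_vis[OF hi[OF p0(2)] nl[OF p0(1)]] l(2)[of p0] p0 by (simp_all add: Dst_def V_def prod_eq_iff)
 obtain Ps where Ps: "devel G \<phi>' lin Ps" "Ps (l p0, snd (\<phi>' p0)) = p0"
  using f.devel_exists[OF p0(1) d0 e0] by blast
 interpret d: devel G \<phi>' lin Ps by (rule Ps(1))
 have inD: "(l p, snd (\<phi>' p)) : Dst" if "p : V" for p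
 proof -
  have "p : H3" "h < snd p" using VH that by (auto simp: V_def)
  hence "vis (fst (\<phi>' p))" using f.UV_vis[OF hi[of p] nl[of p]] by blast
  thus ?thesis using l(2)[OF that] by (simp add: Dst_def)
 qed
 have cP: "continuous_on V (%p. Ps (l p, snd (\<phi>' p)))"
  by (rule continuous_on_compose2[OF d.Ps_cont])
   (use inD in \<open>auto intro!: continuous_intros l(1) continuous_on_subset[OF f.\<phi>_cont VH]\<close>)
 have "(p, Ps (l p, snd (\<phi>' p))) : act_rel H3 G" if p: "p : V" for p
 proof -
  have H: "p : H3" "Ps (l p, snd (\<phi>' p)) : H3" using VH p d.Ps_H3[OF inD[OF p]] by auto
  have "\<phi>' (Ps (l p, snd (\<phi>' p))) = \<phi>' p" using d.Ps_\<phi>[OF inD[OF p]] l(2)[OF p] by (simp add: prod_eq_iff)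
  hence "EX g:G. Ps (l p, snd (\<phi>' p)) = g p" using f.\<phi>_rel[OF H] f.qrel_refl by simp
  thus ?thesis using H by (simp add: act_rel_def)
 qed
 hence "p = Ps (l p, snd (\<phi>' p))" if "p : V" for p
  using c.lift_unique_eq[OF convex_connected[OF cV] continuous_on_id cP _ _ _ that, of p0] Ps(2) p0 by (auto simp: V_def)
 hence "EX z. (z, snd (\<phi>' p)) : Dst & Ps (z, snd (\<phi>' p)) = p" if "h < snd p" for p
  using inD[of p] that by (intro exI[of _ "l p"]) (auto simp: V_def)
 hence "cusp G \<phi>' lin Ps h b"
  using h(1) hi b by unfold_locales auto
 thus ?thesis using v0(1) unfolding \<phi>'_def by blast
qed

section \<open>The monodromy in logarithmic coordinates\<close>

lemma Lam_exists: "EX L. continuous_on UNIV L & (ALL z. exp (L z) = lin k (exp z))"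
proof -
 have "continuous_on UNIV (%z. lin k (exp z))"
  by (rule continuous_on_compose2[OF lin_cont]) (auto intro!: continuous_intros)
 moreover have "lin k (exp z) ~= 0" for z using lin_eq_0[of k "exp z"] by auto
 ultimately obtain L where "continuous_on UNIV L" "!!z. z : UNIV ==> lin k (exp z) = exp (L z)"
  using continuous_logarithm_on_contractible[of UNIV "%z. lin k (exp z)"] by (metis convex_UNIV convex_imp_contractible)
 thus ?thesis by auto
qed

definition Lam :: "int => complex => complex" where
 "Lam k = (SOME L. continuous_on UNIV L & (ALL z. exp (L z) = lin k (exp z)))"

lemma Lam: "continuous_on UNIV (Lam k)" "exp (Lam k z) = lin k (exp z)"
 using someI_ex[OF Lam_exists[of k]] by (auto simp: Lam_def)

lemma exp_eq_lat: assumes "exp z = exp w" shows "(z - w) / tpi : lat"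
proof -
 obtain n :: int where "z = w + (of_int (2 * n) * pi) * \<i>" using assms by (auto simp: exp_eq)
 thus ?thesis by (simp add: lat_def)
qed

text \<open>Scaling commutes with \<open>lin k\<close>, and the discrepancy of the logarithms, in
  units of a full turn, is continuous with values in a discrete set.\<close>

lemma Lam_real: "Lam k (z + of_real r) = Lam k z + of_real r"
proof -
 have "EX c:lat. ALL x:UNIV. (Lam k (z + of_real x) - (Lam k z + of_real x)) / tpi = c"
 proof (rule continuous_lat_const)
  show "continuous_on UNIV (%x. (Lam k (z + of_real x) - (Lam k z + of_real x)) / tpi)"
   by (intro continuous_intros continuous_on_compose2[OF Lam(1)]) auto
  show "(Lam k (z + of_real x) - (Lam k z + of_real x)) / tpi : lat" for x
   using lin_scale[of k "exp x" "exp z"] by (intro exp_eq_lat) (simp add: exp_add Lam(2) exp_of_real mult.commute)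
 qed simp
 then obtain c where c: "!!x. (Lam k (z + of_real x) - (Lam k z + of_real x)) / tpi = c" by blast
 have "c = 0" using c[of 0] by simp
 thus ?thesis using c[of r] by simp
qed

text \<open>\<open>lin k\<close> preserves orientation, so the angle \<open>a x - a 0\<close> stays inside \<open>(0, pi)\<close> for \<open>0 < x < pi\<close>.\<close>

lemma Lam_pi: "Lam k (z + ipi) = Lam k z + ipi"
proof -
 let ?q = "%z. (Lam k (z + ipi) - (Lam k z + ipi)) / tpi"
 have "EX c:lat. ALL x:UNIV. ?q x = c"
 proof (rule continuous_lat_const)
  show "continuous_on UNIV ?q"
   by (intro continuous_intros continuous_on_compose2[OF Lam(1)]) auto
  show "?q x : lat" for x
   by (rule exp_eq_lat) (simp add: exp_add Lam(2) lin_uminus)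
 qed (rule convex_connected[OF convex_UNIV])
 then obtain c where c: "!!x. ?q x = c" by blast
 define a where "a x = Im (Lam k (of_real x * \<i>))" for x
 have ac: "continuous_on {0..pi} a" unfolding a_def
  by (intro continuous_intros continuous_on_compose2[OF Lam(1)]) auto
 have sn: "0 < sin (a x - a 0)" if "0 < x" "x < pi" for x
 proof -
  define u w where "u = Lam k 0" and "w = Lam k (of_real x * \<i>)"
  have "Im (cnj (exp u) * exp w) = sin x"
   using lin_cross[of k "exp 0" "exp (of_real x * \<i>)"] by (simp add: u_def w_def Lam(2) Im_exp)
  moreover have "Im (cnj (exp u) * exp w) = exp (Re u) * exp (Re w) * sin (Im w - Im u)"
   by (simp add: Re_exp Im_exp sin_diff algebra_simps)
  ultimately have "exp (Re u) * exp (Re w) * sin (Im w - Im u) > 0" using sin_gt_zero[OF that] by simp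
  hence "0 < sin (Im w - Im u)"
   using zero_less_mult_pos[OF _ mult_pos_pos[OF exp_gt_zero[of "Re u"] exp_gt_zero[of "Re w"]]] by blast
  thus ?thesis by (simp add: a_def u_def w_def)
 qed
 have "exp (Lam k (ipi)) = exp (Lam k 0 + ipi)"
  using Lam(2)[of k 0] by (simp add: exp_add Lam(2) lin_uminus)
 then obtain n :: int where n: "Lam k (ipi) = Lam k 0 + ipi + (of_int (2 * n) * pi) * \<i>"
  unfolding exp_eq by blast
 hence ap: "a pi - a 0 = pi + 2 * of_int n * pi" by (simp add: a_def)
 have "n = 0"
 proof (rule ccontr)
  assume "n ~= 0"
  then consider "n >= 1" | "n <= -1" by linarith
  thus False
  \<comment> \<open>In either case the angle passes a value where the sine of the difference is not
    positive: \<open>pi\<close> above or \<open>pi / 2\<close> below its start.\<close>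
  proof cases
   case 1
   hence "1 * pi <= of_int n * pi" by (intro mult_right_mono) auto
   hence g: "a pi - a 0 >= 3 * pi" using ap by simp
   then obtain x where x: "0 <= x" "x <= pi" "a x = a 0 + pi"
    using IVT'[of a 0 "a 0 + pi" pi] ac by auto
   have "x ~= 0" "x ~= pi" using x(3) g by auto
   thus False using sn[of x] x by simp
  next
   case 2
   hence "of_int n * pi <= (-1) * pi" by (intro mult_right_mono) auto
   hence g: "a pi - a 0 <= - pi" using ap by simp
   then obtain x where x: "0 <= x" "x <= pi" "a x = a 0 - pi / 2"
    using IVT2'[of a pi "a 0 - pi / 2" 0] ac by auto
   have "x ~= 0" using x(3) pi_gt_zero by auto
   moreover have "x ~= pi"
   proof
    assume "x = pi"
    hence "a pi = a 0 - pi / 2" using x(3) by simp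
    thus False using g pi_gt_zero by linarith
   qed
   ultimately show False using sn[of x] x by simp
  qed
 qed
 hence "c = 0" using c[of 0] n by simp
 thus ?thesis using c[of z] by simp
qed

lemma Lam_2pi: "Lam k (z + tpi * of_int n) = Lam k z + tpi * of_int n"
proof -
 have s: "Lam k (z + tpi) = Lam k z + tpi" for z
  using Lam_pi[of k "z + ipi"] Lam_pi[of k z] by (simp add: algebra_simps)
 show ?thesis
 proof (induction n arbitrary: z rule: int_induct[of _ 0])
  case (step1 i) thus ?case using s[of "z + tpi * of_int i"] by (simp add: algebra_simps)
 next
  case (step2 i) thus ?case using s[of "z + tpi * of_int (i - 1)"] by (simp add: algebra_simps)
 qed simp
qed

lemma Lam_Dst: "(z, t) : Dst ==> (Lam k z, t') : Dst"
proof -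
 assume "(z, t) : Dst"
 hence "vis (exp z)" by (simp add: Dst_def)
 hence "vis (lin k (exp z))"
 proof (rule vis_linI[rotated])
  fix r show "of_real r * lin k (exp z) : lat --> of_real r * exp z : lat"
   using lin_lat[of "lin k (of_real r * exp z)" "- k"] by (simp add: lin_inv flip: lin_scale)
 qed
 thus ?thesis by (simp add: Dst_def Lam(2))
qed

definition aff :: "m2 => int => complex => bool" where
 "aff M k v \<longleftrightarrow> (ALL p:H3. \<phi> (mob M p) = (lin k (fst (\<phi> p)) + v, snd (\<phi> p) - of_int k))"

lemma aff_exists: "inG M ==> EX k v. v : lat & aff M k v"
 using deck_affine_m[of M] unfolding aff_def by (metis (no_types, lifting))

lemma aff_mmul: assumes "aff M k v" "aff N j w" "inG N" shows "aff (M *m N) (k + j) (lin k w + v)"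
 unfolding aff_def
proof
 fix p assume p: "p : H3"
 have "\<phi> (mob (M *m N) p) = (lin k (fst (\<phi> (mob N p))) + v, snd (\<phi> (mob N p)) - of_int k)"
  using assms(1) mob_mmul[OF inG_det[OF assms(3)] p] inG_mob_H3[OF assms(3) p] by (simp add: aff_def)
 thus "\<phi> (mob (M *m N) p) = (lin (k + j) (fst (\<phi> p)) + (lin k w + v), snd (\<phi> p) - of_int (k + j))"
  using assms(2) p by (simp add: aff_def lin_plus lin_add)
qed

lemma aff_unique_k: assumes "aff M k v" "aff M j w" shows "k = j"
proof -
 have "(0,1) : H3" by (simp add: H3_iff)
 thus ?thesis using assms unfolding aff_def by (metis diff_left_imp_eq of_int_eq_iff snd_conv)
qed

lemma aff_peq: "M \<simeq> N ==> aff M k v \<longleftrightarrow> aff N k v"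
 by (simp add: aff_def peq_mob)

lemma inG_trans_int: assumes "inG (trans2 b)" shows "inG (trans2 (of_int n * b))"
proof -
 have tt: "trans2 x *m trans2 y = trans2 (x + y)" for x y by (simp add: trans2_def add.commute)
 have ti: "minv (trans2 x) = trans2 (- x)" for x by (simp add: trans2_def minv_def)
 show ?thesis
 proof (induction n rule: int_induct[of _ 0])
  case base
  have "trans2 0 = mid" by (simp add: trans2_def mid_def)
  thus ?case using inG_mid by simp
 next
  case (step1 i) thus ?case using inG_mmul[OF step1(2) assms] by (simp add: tt algebra_simps)
 next
  case (step2 i) thus ?case using inG_mmul[OF step2(2) inG_minv[OF assms]] by (simp add: tt ti algebra_simps)
 qed
qed

end

lemma trans2_mmul: "trans2 x *m trans2 y = trans2 (x + y)" by (simp add: trans2_def add.commute)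

context cusp
begin

lemma Dst_point: obtains d where "d : Dst" "h < snd (Ps d)"
 using high_Ps[of "(0, h + 1)"] by auto

text \<open>An element preserving \<open>Binf\<close> keeps heights, so the image of a high point is
  again in the tube of \<open>0\<close>; by its affine form it is also in the tube of
  \<open>v\<close>.\<close>

lemma stab_high:
 assumes M: "inG M" "mob M ` Binf = Binf"
 shows "snd (mob M p) = snd p" "aff M k v ==> v : lat ==> v = 0"
proof -
 have "e21 M = 0" "cmod (e11 M) = 1" using mob_Binf_eq[OF inG_det[OF M(1)] M(2)] by auto
 thus s: "snd (mob M p) = snd p" for p using mob_upper[OF inG_det[OF M(1)]] by simp
 assume a: "aff M k v" and v: "v : lat"
 define p where "p = (0::complex, h + 1)"
 have p: "h < snd p" "p : H3" using h1 by (auto simp: p_def H3_iff)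
 have "\<phi> (mob M p) : UV eps0 0" using high[of "mob M p"] s p by simp
 moreover have "\<phi> (mob M p) : UV eps0 v"
  using UV_shift[of "fst (\<phi> p)" "snd (\<phi> p)" eps0 k v] high[OF p(1)] a p(2) by (simp add: aff_def)
 ultimately show "v = 0" using eps0(3) v lat_0 by blast
qed

text \<open>A high point and its image both have logarithms, which correspond under
  \<open>Lam k\<close> up to full turns. The matrix realising this correspondence on all of
  \<open>Dst\<close> agrees with \<open>M\<close> at one point.\<close>

lemma stab_form:
 assumes M: "inG M" "mob M ` Binf = Binf" and a: "aff M k v" "v : lat"
 shows "EX j::int. ALL d:Dst. mob M (Ps d) = Ps (Lam k (fst d) + tpi * of_int j, snd d - of_int k)"
proof -
 obtain d0 where d0: "d0 : Dst" "h < snd (Ps d0)" by (rule Dst_point)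
 have v: "v = 0" using stab_high(2)[OF M a] .
 have "h < snd (mob M (Ps d0))" using stab_high(1)[OF M] d0 by simp
 then obtain z where z: "(z, snd (\<phi> (mob M (Ps d0)))) : Dst" "Ps (z, snd (\<phi> (mob M (Ps d0)))) = mob M (Ps d0)"
  using high_Ps by blast
 have e: "\<phi> (mob M (Ps d0)) = (lin k (exp (fst d0)), snd d0 - of_int k)"
  using a(1) v Ps_H3[OF d0(1)] Ps_\<phi>[OF d0(1)] by (simp add: aff_def)
 have "exp z = exp (Lam k (fst d0))" using Ps_\<phi>[OF z(1)] z(2) e Lam(2) by simp
 then obtain j :: int where j: "z = Lam k (fst d0) + (of_int (2 * j) * pi) * \<i>" unfolding exp_eq by blast
 let ?b = "%d. (Lam k (fst d) + tpi * of_int j, snd d - of_int k)"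
 have bD: "?b d : Dst" if "d : Dst" for d using Dst_2pi[OF Lam_Dst[of "fst d" "snd d"]] that by simp
 have "EX N. inG N & (ALL d:Dst. Ps (?b d) = mob N (Ps d))"
 proof (rule frame[OF simply_connected_Dst(3) continuous_on_id])
  show "continuous_on Dst ?b" by (intro continuous_intros continuous_on_compose2[OF Lam(1)]) auto
  show "?b d : Dst" if "d : Dst" for d using bD[OF that] .
  show "qrel lin (exp (fst d), snd d) (exp (fst (?b d)), snd (?b d))" for d
   unfolding fst_conv snd_conv exp_2pi Lam(2) qrel_def by (intro exI[of _ k] exI[of _ 0]) simp
 qed auto
 then obtain N where N: "inG N" "ALL d:Dst. Ps (?b d) = mob N (Ps d)" by blast
 have "z = fst (?b d0)" using j by (simp add: algebra_simps)
 hence "Ps (?b d0) = mob M (Ps d0)" using z(2) e by simp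
 hence "mob N (Ps d0) = mob M (Ps d0)" using N(2) d0(1) by simp
 hence "N \<simeq> M" using inG_eq[OF N(1) M(1) Ps_H3[OF d0(1)]] by simp
 thus ?thesis using N(2) peq_mob by (intro exI[of _ j]) metis
qed

definition Pm :: m2 where
 "Pm = (SOME M. inG M & (ALL d:Dst. Ps (fst d + tpi, snd d) = mob M (Ps d)))"

lemma Pm: "inG Pm" "d : Dst ==> Ps (fst d + tpi, snd d) = mob Pm (Ps d)"
proof -
 have "EX M. inG M & (ALL d:Dst. Ps (fst d + tpi, snd d) = mob M (Ps d))"
  using P_exists[of 1] by simp
 from someI_ex[OF this] show "inG Pm" "d : Dst ==> Ps (fst d + tpi, snd d) = mob Pm (Ps d)"
  unfolding Pm_def[symmetric] by auto
qed

text \<open>\<open>Lam k\<close> commutes with the full turn \<open>tpi\<close>.\<close>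

lemma commute_Pm:
 assumes M: "inG M" and f: "ALL d:Dst. mob M (Ps d) = Ps (Lam k (fst d) + tpi * of_int j, snd d - of_int k)"
 shows "M *m Pm \<simeq> Pm *m M"
proof -
 obtain d where d: "d : Dst" "h < snd (Ps d)" by (rule Dst_point)
 have d2: "(fst d + tpi, snd d) : Dst" using Dst_2pi[of "fst d" "snd d" 1] d by simp
 have d3: "(Lam k (fst d) + tpi * of_int j, snd d - of_int k) : Dst"
  using Dst_2pi[OF Lam_Dst[of "fst d" "snd d"]] d by simp
 have "mob M (mob Pm (Ps d)) = Ps (Lam k (fst d + tpi) + tpi * of_int j, snd d - of_int k)"
  using f d2 Pm(2)[OF d(1)] by (metis fst_conv snd_conv)
 also have "... = Ps (Lam k (fst d) + tpi * of_int j + tpi, snd d - of_int k)"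
  using Lam_2pi[of k "fst d" 1] by (simp add: algebra_simps)
 also have "... = mob Pm (mob M (Ps d))" using Pm(2)[OF d3] f d(1) by simp
 finally have "mob (M *m Pm) (Ps d) = mob (Pm *m M) (Ps d)"
  using mob_mmul[OF inG_det[OF Pm(1)]] mob_mmul[OF inG_det[OF M]] Ps_H3[OF d(1)] by simp
 thus ?thesis using inG_eq[OF inG_mmul[OF M Pm(1)] inG_mmul[OF Pm(1) M] Ps_H3[OF d(1)]] by simp
qed

definition lam :: complex where "lam = (SOME l. Pm \<simeq> trans2 l)"

text \<open>\<open>Pm\<close> commutes with the given parabolic \<open>trans2 b0\<close>, hence is a
  translation; it is nontrivial because the loop around the puncture is not contractible.\<close>

lemma lam: "Pm \<simeq> trans2 lam" "lam ~= 0" "inG (trans2 lam)"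
proof -
 obtain k v where kv: "v : lat" "aff (trans2 b0) k v" using aff_exists[OF b0(2)] by blast
 obtain j :: int where "ALL d:Dst. mob (trans2 b0) (Ps d) = Ps (Lam k (fst d) + tpi * of_int j, snd d - of_int k)"
  using stab_form[OF b0(2) shift_Binf kv(2,1)] by blast
 hence "Pm *m trans2 b0 \<simeq> trans2 b0 *m Pm" using commute_Pm[OF b0(2)] peq_sym by blast
 hence "EX l. Pm \<simeq> trans2 l" using upper_commute[OF inG_det[OF Pm(1)] b0(1)] by blast
 thus l: "Pm \<simeq> trans2 lam" unfolding lam_def by (rule someI_ex)
 thus "inG (trans2 lam)" using inG_peq[OF peq_sym Pm(1)] by blast
 show "lam ~= 0"
 proof
  assume "lam = 0"
  hence "mob Pm p = p" for p using peq_mob[OF l] by simp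
  moreover obtain d where d: "d : Dst" "h < snd (Ps d)" by (rule Dst_point)
  ultimately show False using P_nontrivial[OF d(1), of 1] Pm(2)[OF d(1)] by simp
 qed
qed

lemma Ps_2pi: "d : Dst ==> Ps (fst d + tpi * of_int n, snd d) = shift (of_int n * lam) (Ps d)"
proof (induction n arbitrary: d rule: int_induct[of _ 0])
 case base thus ?case by simp
next
 case (step1 i)
 let ?d = "(fst d + tpi * of_int i, snd d)"
 have D: "?d : Dst" using Dst_2pi[of "fst d" "snd d"] step1(3) by simp
 have "Ps (fst ?d + tpi, snd ?d) = shift lam (Ps ?d)" using Pm(2)[OF D] peq_mob[OF lam(1)] by simp
 thus ?case using step1 by (simp add: algebra_simps)
next
 case (step2 i)
 let ?d = "(fst d + tpi * of_int (i - 1), snd d)"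
 have D: "?d : Dst" using Dst_2pi[of "fst d" "snd d" "i - 1"] step2(3) by simp
 have "Ps (fst ?d + tpi, snd ?d) = shift lam (Ps ?d)" using Pm(2)[OF D] peq_mob[OF lam(1)] by simp
 moreover have "(fst ?d + tpi, snd ?d) = (fst d + tpi * of_int i, snd d)" by (simp add: algebra_simps)
 ultimately have "shift (of_int i * lam) (Ps d) = shift lam (Ps ?d)" using step2(2)[OF step2(3)] by metis
 hence "shift (- lam) (shift (of_int i * lam) (Ps d)) = shift (- lam) (shift lam (Ps ?d))" by simp
 thus ?case by (simp add: algebra_simps)
qed

lemma nu_exists: "EX n. inG (trans2 n) & (ALL d:Dst. Ps (Lam 1 (fst d), snd d - 1) = shift n (Ps d))"
proof -
 have "EX N. inG N & (ALL d:Dst. Ps (Lam 1 (fst d), snd d - 1) = mob N (Ps d))"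
 proof (rule frame[OF simply_connected_Dst(3) continuous_on_id])
  show "continuous_on Dst (%d. (Lam 1 (fst d), snd d - 1))" by (intro continuous_intros continuous_on_compose2[OF Lam(1)]) auto
  show "(Lam 1 (fst d), snd d - 1) : Dst" if "d : Dst" for d using Lam_Dst[of "fst d" "snd d"] that by simp
  show "qrel lin (exp (fst d), snd d) (exp (fst (Lam 1 (fst d), snd d - 1)), snd (Lam 1 (fst d), snd d - 1))" for d
   unfolding fst_conv snd_conv Lam(2) qrel_def by (intro exI[of _ 1] exI[of _ 0]) simp
 qed auto
 then obtain N where N: "inG N" "ALL d:Dst. Ps (Lam 1 (fst d), snd d - 1) = mob N (Ps d)" by blast
 have "N *m Pm \<simeq> Pm *m N" by (rule commute_Pm[OF N(1), of 1 0]) (use N(2) in simp)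
 hence "N *m trans2 lam \<simeq> trans2 lam *m N"
  using peq_mmul[OF peq_refl[of N] lam(1)] peq_mmul[OF lam(1) peq_refl[of N]] peq_trans peq_sym by meson
 then obtain n where n: "N \<simeq> trans2 n" using upper_commute[OF inG_det[OF N(1)] lam(2)] by blast
 thus ?thesis using N inG_peq[OF peq_sym[OF n] N(1)] peq_mob[OF n] by (intro exI[of _ n]) simp
qed

definition nu :: complex where
 "nu = (SOME n. inG (trans2 n) & (ALL d:Dst. Ps (Lam 1 (fst d), snd d - 1) = shift n (Ps d)))"

lemma nu: "inG (trans2 nu)" "d : Dst ==> Ps (Lam 1 (fst d), snd d - 1) = shift nu (Ps d)"
 using someI_ex[OF nu_exists] by (auto simp: nu_def)

lemma aff_lam: "aff (trans2 (of_int n * lam)) 0 0"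
proof -
 obtain k v where kv: "v : lat" "aff (trans2 (of_int n * lam)) k v" using aff_exists[OF inG_trans_int[OF lam(3)]] by blast
 have v: "v = 0" using stab_high(2)[OF inG_trans_int[OF lam(3)] shift_Binf kv(2,1)] .
 obtain d where d: "d : Dst" "h < snd (Ps d)" by (rule Dst_point)
 have d2: "(fst d + tpi * of_int n, snd d) : Dst" using Dst_2pi[of "fst d" "snd d"] d by simp
 have "\<phi> (shift (of_int n * lam) (Ps d)) = (exp (fst d), snd d)"
  using Ps_2pi[OF d(1), of n] Ps_\<phi>[OF d2] exp_2pi by simp
 moreover have "\<phi> (shift (of_int n * lam) (Ps d)) = (lin k (exp (fst d)) + v, snd d - of_int k)"
  using kv(2) Ps_H3[OF d(1)] Ps_\<phi>[OF d(1)] by (simp add: aff_def)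
 ultimately have "k = 0" by simp
 thus ?thesis using kv(2) v by simp
qed

lemma aff_nu: "aff (trans2 (of_int n * nu)) n 0"
proof -
 have 1: "aff (trans2 nu) 1 0"
 proof -
  obtain k v where kv: "v : lat" "aff (trans2 nu) k v" using aff_exists[OF nu(1)] by blast
  have v: "v = 0" using stab_high(2)[OF nu(1) shift_Binf kv(2,1)] .
  obtain d where d: "d : Dst" "h < snd (Ps d)" by (rule Dst_point)
  have d2: "(Lam 1 (fst d), snd d - 1) : Dst" using Lam_Dst[of "fst d" "snd d"] d by simp
  have "snd (\<phi> (shift nu (Ps d))) = snd d - 1" using nu(2)[OF d(1)] Ps_\<phi>[OF d2] by simp
  moreover have "snd (\<phi> (shift nu (Ps d))) = snd d - of_int k"
   using kv(2) Ps_H3[OF d(1)] Ps_\<phi>[OF d(1)] by (simp add: aff_def)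
  ultimately have "of_int k = (1 :: real)" by simp
  hence "k = 1" by simp
  thus ?thesis using kv(2) v by simp
 qed
 have m1: "aff (trans2 (- nu)) (- 1) 0"
 proof -
  obtain k v where kv: "v : lat" "aff (trans2 (- nu)) k v" using aff_exists[OF inG_trans_int[OF nu(1), of "-1"]] by auto
  have v: "v = 0" using stab_high(2)[OF _ shift_Binf kv(2,1)] inG_trans_int[OF nu(1), of "-1"] by simp
  have "aff (trans2 (nu + - nu)) (1 + k) 0"
   using aff_mmul[OF 1 kv(2)] inG_trans_int[OF nu(1), of "-1"] v by (simp add: trans2_mmul)
  moreover have "aff (trans2 (nu + - nu)) 0 0" using aff_lam[of 0] by simp
  ultimately have "1 + k = 0" using aff_unique_k by blast
  hence "k = - 1" by linarith
  thus ?thesis using kv(2) v by simp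
 qed
 show ?thesis
 proof (induction n rule: int_induct[of _ 0])
  case base thus ?case using aff_lam[of 0] by simp
 next
  case (step1 i) thus ?case using aff_mmul[OF step1(2) 1 nu(1)] by (simp add: trans2_mmul algebra_simps)
 next
  case (step2 i)
  thus ?case using aff_mmul[OF step2(2) m1] inG_trans_int[OF nu(1), of "-1"] by (simp add: trans2_mmul algebra_simps)
 qed
qed

lemma inG_lattice: "inG (trans2 (of_int j * lam + of_int k * nu))"
 using inG_mmul[OF inG_trans_int[OF lam(3), of j] inG_trans_int[OF nu(1), of k]] by (simp add: trans2_mmul)

lemma aff_lattice: "aff (trans2 (of_int j * lam + of_int k * nu)) k 0"
 using aff_mmul[OF aff_lam[of j] aff_nu[of k] inG_trans_int[OF nu(1)]] by (simp add: trans2_mmul)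

text \<open>Once the \<open>k\<close>-th power of the \<open>nu\<close> translation is divided out,
  every level is preserved, and in logarithms only a number of full turns is left.\<close>

theorem stabiliser:
 assumes M: "inG M" "mob M ` Binf = Binf" and a: "aff M k v" "v : lat"
 shows "EX j::int. M \<simeq> trans2 (of_int j * lam + of_int k * nu)"
proof -
 define N where "N = M *m trans2 (of_int (- k) * nu)"
 have N: "inG N" unfolding N_def by (intro inG_mmul M inG_trans_int nu)
 have "mob N p = mob M (mob (trans2 (of_int (- k) * nu)) p)" if "p : H3" for p
  unfolding N_def using mob_mmul[OF det2_trans2 that] .
 hence "mob N ` Binf = mob M ` (mob (trans2 (of_int (- k) * nu)) ` Binf)"
  using Binf_subset by (auto simp: image_image intro!: image_cong)
 hence NB: "mob N ` Binf = Binf" using M(2) shift_Binf by simp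
 have v: "v = 0" using stab_high(2)[OF M a] .
 have "aff N (k + - k) (lin k 0 + v)" unfolding N_def by (rule aff_mmul[OF a(1) aff_nu inG_trans_int[OF nu(1)]])
 hence aN: "aff N 0 0" using v by simp
 obtain j :: int where j: "ALL d:Dst. mob N (Ps d) = Ps (Lam 0 (fst d) + tpi * of_int j, snd d - of_int 0)"
  using stab_form[OF N NB aN lat_0] by blast
 obtain d where d: "d : Dst" "h < snd (Ps d)" by (rule Dst_point)
 have "exp (Lam 0 (fst d)) = exp (fst d)" by (simp add: Lam(2) lin_0)
 then obtain i :: int where i: "Lam 0 (fst d) = fst d + (of_int (2 * i) * pi) * \<i>" unfolding exp_eq by blast
 have "Lam 0 (fst d) + tpi * of_int j = fst d + tpi * of_int (i + j)"
  unfolding i by (simp add: algebra_simps)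
 hence "mob N (Ps d) = shift (of_int (i + j) * lam) (Ps d)" using j d(1) Ps_2pi[OF d(1), of "i + j"] by simp
 hence "N \<simeq> trans2 (of_int (i + j) * lam)"
  using inG_eq[OF N inG_trans_int[OF lam(3), of "i + j"] Ps_H3[OF d(1)]] by simp
 hence "N *m trans2 (of_int k * nu) \<simeq> trans2 (of_int (i + j) * lam) *m trans2 (of_int k * nu)"
  by (rule peq_mmul[OF _ peq_refl])
 moreover have "N *m trans2 (of_int k * nu) = M"
  unfolding N_def by (simp add: mmul_assoc trans2_mmul, simp add: trans2_def flip: mid_def)
 ultimately show ?thesis by (intro exI[of _ "i + j"]) (simp add: trans2_mmul)
qed

text \<open>If \<open>nu\<close> were a real multiple of \<open>lam\<close>, Dirichlet approximation
  would give a very short translation in the group with exponent \<open>k > 0\<close>. Discreteness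
  makes it trivial, and then its exponent is \<open>0\<close>.\<close>

theorem lattice_independent: "Im (cnj lam * nu) ~= 0"
proof
 assume 0: "Im (cnj lam * nu) = 0"
 define r where "r = Re (nu / lam)"
 have "Im (nu / lam) = 0" using 0 by (simp add: Im_complex_div_eq_0 mult.commute)
 hence nr: "nu = of_real r * lam" using lam(2) by (simp add: r_def complex_eq_iff field_simps complex_is_Real_iff[symmetric])
 define p where "p = (0::complex, 1::real)"
 have pH: "p : H3" by (simp add: p_def H3_iff)
 obtain U where U: "open U" "p : U" "U <= H3" "!!g u v. g : G ==> u : U ==> g u : U ==> v : H3 ==> g v = v"
  using c.act_nbhd[OF pH] by blast
 obtain e where e: "e > 0" "ball p e <= U" using U(1,2) open_contains_ball by blast
 obtain N :: nat where N: "cmod lam / e < real N" using reals_Archimedean2 by blast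
 hence N0: "N > 0" using e(1) by (metis divide_nonneg_pos gr0I norm_ge_zero not_less of_nat_0)
 obtain m k where mk: "0 < k" "k <= int N" "\<bar>of_int k * r - of_int m\<bar> < 1 / real N"
  using Dirichlet_approx[OF N0, of r] by blast
 define b where "b = of_int (- m) * lam + of_int k * nu"
 have bb: "b = of_real (of_int k * r - of_int m) * lam" by (simp add: b_def nr algebra_simps)
 have "cmod b = \<bar>of_int k * r - of_int m\<bar> * cmod lam" unfolding bb norm_mult norm_of_real ..
 also have "... <= 1 / real N * cmod lam" using mk(3) by (intro mult_right_mono) auto
 also have "... < e" using N e(1) N0 by (simp add: field_simps)
 finally have be: "cmod b < e" .
 have G: "inG (trans2 b)" unfolding b_def by (rule inG_lattice)
 obtain g where g: "g : G" "ALL p:H3. g p = mob (trans2 b) p" using G by (rule inG_E)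
 have "dist p (shift b p) < e" using be by (simp add: shift_def p_def dist_prod_def dist_norm)
 hence "shift b p : U" using e(2) by auto
 hence "g p = p" using U(4)[OF g(1) U(2) _ pH] g(2) pH by simp
 hence "b = 0" using g(2) pH by (simp add: shift_def p_def)
 hence "aff (trans2 b) 0 0" using aff_lam[of 0] by simp
 hence "k = 0" using aff_unique_k[OF aff_lattice[of "- m" k]] unfolding b_def by blast
 thus False using mk(1) by simp
qed

end

section \<open>Deck transformations along lattice segments\<close>

definition cr :: "complex => complex => real" where "cr v w = Im (cnj v * w)"

lemma cr_eq: "cr v w = Re v * Im w - Im v * Re w" by (simp add: cr_def)

lemma cr_lin: "cr v (of_real a * v + of_real b * w) = b * cr v w" "cr (of_real a * v + of_real b * w) w = a * cr v w"
 by (simp_all add: cr_eq algebra_simps)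

lemma cr_lat: "v : lat ==> w : lat ==> cr v w : \<int>" by (simp add: cr_eq lat_def)

lemma basis_lat:
 assumes "v : lat" "w : lat" "cr v w = 1" "of_real a * v + of_real b * w : lat"
 shows "a : \<int>" "b : \<int>"
 using cr_lat[OF assms(1,4)] cr_lat[OF assms(4,2)] assms(3) by (simp_all add: cr_lin)

lemma Ints_between: "x : \<int> ==> 0 < x ==> x < 1 ==> False" for x :: real
 using Ints_nonzero_abs_less1[of x] by simp

text \<open>A primitive lattice vector given by a logarithm, so that its direction comes with a
  choice of angle and \<open>l\<close> stays distinct from \<open>l + tpi\<close>.\<close>

definition prm :: "complex => bool" where
 "prm l \<longleftrightarrow> exp l : lat & (ALL s. 0 < s & s < 1 --> of_real s * exp l ~: lat)"

lemma prmI: assumes "exp l : lat" "w : lat" "cr (exp l) w = 1 | cr w (exp l) = 1" shows "prm l"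
 unfolding prm_def
proof (intro conjI allI impI notI)
 fix s :: real assume s: "0 < s & s < 1" and l: "of_real s * exp l : lat"
 have "s : \<int>" using assms(3)
 proof
  assume "cr (exp l) w = 1" thus ?thesis using basis_lat(1)[OF assms(1,2), of s 0] l by simp
 next
  assume "cr w (exp l) = 1" thus ?thesis using basis_lat(2)[OF assms(2,1), of 0 s] l by simp
 qed
 thus False using Ints_between s by blast
qed (rule assms(1))

lemma prm_vis: assumes "prm l" "0 < s" "s < 1" shows "vis (of_real s * exp l)"
 unfolding vis_def
proof (intro allI impI)
 fix r :: real assume r: "0 < r & r <= 1"
 have "r * s <= 1 * s" using r assms by (intro mult_right_mono) auto
 hence "0 < r * s & r * s < 1" using r assms by (intro conjI mult_pos_pos) linarith+
 hence "of_real (r * s) * exp l ~: lat" using assms(1) unfolding prm_def by blast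
 thus "of_real r * (of_real s * exp l) ~: lat" by (simp add: mult.assoc)
qed

lemma vis_uminus: "vis (- x) \<longleftrightarrow> vis x"
proof -
 have "- z : lat \<longleftrightarrow> z : lat" for z using lat_uminus[of z] lat_uminus[of "- z"] by auto
 thus ?thesis by (simp add: vis_def)
qed

lemma exp_plus_ln: "0 < s ==> exp (l + of_real (ln s)) = of_real s * exp (l :: complex)"
 by (simp add: exp_add exp_of_real mult.commute)

lemma exp_pi: "exp (l + ipi + z) = - exp (l + z)"
 by (simp add: exp_add)

lemma prm_Dst:
 assumes "prm l" "0 < s" "s < 1"
 shows "(l + of_real (ln s), t) : Dst" "(l + ipi + of_real (ln s), t) : Dst"
 using prm_vis[OF assms] assms(2) unfolding Dst_def by (simp_all add: exp_pi exp_plus_ln vis_uminus)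

lemma prm_pi: "prm l ==> prm (l + ipi)"
 using lat_uminus[of "exp l"] lat_uminus[of "- (_ * exp l)"] unfolding prm_def by (auto simp: exp_add)

context cusp
begin

lemma frame_logs:
 fixes l l' X :: "'b::topological_space => complex"
 assumes S: "connected S" and c: "continuous_on S l" "continuous_on S l'" and pq: "p : lat" "q : lat"
  and e: "!!d. d : S ==> exp (l d) = X d - p" "!!d. d : S ==> exp (l' d) = X d - q"
  and v: "!!d. d : S ==> vis (X d - p)" "!!d. d : S ==> vis (X d - q)"
 shows "EX M. inG M & (ALL d:S. ALL t. Ps (l d, t) = mob M (Ps (l' d, t)))"
proof -
 have D: "(l d, t) : Dst" "(l' d, t) : Dst" if "d : S" for d t
  using e v that by (simp_all add: Dst_def)
 have "EX M. inG M & (ALL x:S \<times> UNIV. Ps (l (fst x), snd x) = mob M (Ps (l' (fst x), snd x)))"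
 proof (rule frame)
  show "connected (S \<times> (UNIV :: real set))" using S by (intro connected_Times) auto
  show "continuous_on (S \<times> UNIV) (%x. (l' (fst x), snd x :: real))" "continuous_on (S \<times> UNIV) (%x. (l (fst x), snd x :: real))"
   by (intro continuous_intros continuous_on_compose2[OF c(1)] continuous_on_compose2[OF c(2)]; auto)+
  show "(l' (fst x), snd x) : Dst" "(l (fst x), snd x) : Dst" if "x : S \<times> UNIV" for x
   using D that by auto
  show "qrel lin (exp (fst (l' (fst x), snd x)), snd (l' (fst x), snd x)) (exp (fst (l (fst x), snd x)), snd (l (fst x), snd x))"
   if "x : S \<times> UNIV" for x
  proof -
   have "fst x : S" using that by auto
   thus ?thesis unfolding fst_conv snd_conv
    by (intro qrel_translate[OF lat_diff[OF pq(2,1)]]) (simp add: e)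
  qed
 qed
 thus ?thesis by force
qed

lemma al_exists:
 assumes "prm l"
 shows "EX M. inG M & (ALL s:{0<..<1}. ALL t. Ps (l + of_real (ln (1 - s)), t) = mob M (Ps (l + ipi + of_real (ln s), t)))"
proof (rule frame_logs)
 show "connected {0<..<1::real}" by (rule convex_connected) simp
 show "continuous_on {0<..<1} (%s. l + of_real (ln (1 - s)))"
  "continuous_on {0<..<1} (%s. l + ipi + of_real (ln s))" by (intro continuous_intros; simp)+
 show "0 : lat" "exp l : lat" using assms by (simp_all add: prm_def)
 fix s :: real assume s: "s : {0<..<1}"
 show "exp (l + of_real (ln (1 - s))) = of_real (1 - s) * exp l - 0" using s exp_plus_ln[of "1 - s" l] by simp
 show "exp (l + ipi + of_real (ln s)) = of_real (1 - s) * exp l - exp l"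
  using s exp_plus_ln[of "s" l] exp_pi[of l "of_real (ln s)"] by (simp add: left_diff_distrib)
 have "of_real (1 - s) * exp l - exp l = - (of_real s * exp l)" by (simp add: algebra_simps)
 thus "vis (of_real (1 - s) * exp l - exp l)" "vis (of_real (1 - s) * exp l - 0)"
  using prm_vis[OF assms, of s] prm_vis[OF assms, of "1 - s"] s vis_uminus by simp_all
qed

text \<open>A point on the segment from the puncture \<open>0\<close> to the lattice point \<open>exp l\<close> is seen from both ends; \<open>al l\<close>
 compares the two.\<close>

definition al :: "complex => m2" where
 "al l = (SOME M. inG M & (ALL s:{0<..<1}. ALL t. Ps (l + of_real (ln (1 - s)), t) = mob M (Ps (l + ipi + of_real (ln s), t))))"

lemma al:
 assumes "prm l"
 shows "inG (al l)" "0 < s ==> s < 1 ==> Ps (l + of_real (ln (1 - s)), t) = mob (al l) (Ps (l + ipi + of_real (ln s), t))"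
 using someI_ex[OF al_exists[OF assms]] unfolding al_def[symmetric] by auto

lemma al_unique:
 assumes "prm l" "inG M" "0 < s" "s < 1" "Ps (l + of_real (ln (1 - s)), t) = mob M (Ps (l + ipi + of_real (ln s), t))"
 shows "M \<simeq> al l"
proof (rule inG_eq[OF assms(2) al(1)[OF assms(1)]])
 show "Ps (l + ipi + of_real (ln s), t) : H3" by (rule Ps_H3[OF prm_Dst(2)[OF assms(1,3,4)]])
 show "mob M (Ps (l + ipi + of_real (ln s), t)) = mob (al l) (Ps (l + ipi + of_real (ln s), t))"
  using assms(5) al(2)[OF assms(1,3,4), of t] by simp
qed

lemma al_aff: assumes "prm l" shows "aff (al l) 0 (exp l)"
proof -
 obtain k v where kv: "v : lat" "aff (al l) k v" using aff_exists[OF al(1)[OF assms]] by blast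
 let ?a = "(l + ipi + of_real (ln (1/2)), 0 :: real)" and ?b = "(l + of_real (ln (1/2)), 0 :: real)"
 have D: "?a : Dst" "?b : Dst" using prm_Dst[OF assms, of "1/2"] by auto
 have "Ps ?b = mob (al l) (Ps ?a)" using al(2)[OF assms, of "1/2" 0] by simp
 hence "\<phi> (Ps ?b) = (lin k (fst (\<phi> (Ps ?a))) + v, snd (\<phi> (Ps ?a)) - of_int k)"
  using kv(2)[unfolded aff_def, rule_format, OF Ps_H3[OF D(1)]] by simp
 hence e: "(exp (fst ?b), snd ?b) = (lin k (exp (fst ?a)) + v, snd ?a - of_int k)"
  unfolding Ps_\<phi>[OF D(1)] Ps_\<phi>[OF D(2)] fst_conv snd_conv .
 hence k: "k = 0" by simp
 have "exp (fst ?b) = of_real (1/2) * exp l" "exp (fst ?a) = - (of_real (1/2) * exp l)"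
  using exp_plus_ln[of "1/2" l] by (simp_all add: exp_pi)
 hence "v = exp l" using e k by (simp add: lin_0)
 thus ?thesis using kv(2) k by simp
qed

text \<open>The edge is run there and back; the two half turns in between add up to one full turn
  around the puncture.\<close>

lemma al_pi: assumes "prm l" shows "al (l + ipi) *m (Pm *m al l) \<simeq> mid"
proof -
 let ?l = "l + ipi" and ?h = "of_real (ln (1/2)) :: complex"
 note p = prm_pi[OF assms]
 have D: "(l + ?h, 0) : Dst" "(?l + ?h, 0) : Dst" using prm_Dst[OF assms, of "1/2"] by auto
 have "Ps (?l + ipi + ?h, 0) = mob Pm (Ps (l + ?h, 0))"
  using Pm(2)[OF D(1)] by (simp add: algebra_simps)
 moreover have "Ps (?l + ?h, 0) = mob (al ?l) (Ps (?l + ipi + ?h, 0))"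
  using al(2)[OF p, of "1/2" 0] by simp
 moreover have "Ps (l + ?h, 0) = mob (al l) (Ps (?l + ?h, 0))" using al(2)[OF assms, of "1/2" 0] by simp
 ultimately have "mob (al ?l *m (Pm *m al l)) (Ps (?l + ?h, 0)) = Ps (?l + ?h, 0)"
  unfolding mob_mmul[OF inG_det[OF inG_mmul[OF Pm(1) al(1)[OF assms]]] Ps_H3[OF D(2)]]
   mob_mmul[OF inG_det[OF al(1)[OF assms]] Ps_H3[OF D(2)]] by simp
 thus ?thesis by (intro inG_free[OF _ Ps_H3[OF D(2)]] inG_mmul al Pm p assms)
qed

lemma prm_Lam: assumes "prm l" shows "prm (Lam k l)"
 unfolding prm_def Lam(2)
proof (intro conjI allI impI notI)
 show "lin k (exp l) : lat" using assms lin_lat by (simp add: prm_def)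
 fix s :: real assume s: "0 < s & s < 1" and l: "of_real s * lin k (exp l) : lat"
 hence "of_real s * exp l : lat" using lin_lat[of "lin k (of_real s * exp l)" "- k"] by (simp add: lin_inv flip: lin_scale)
 thus False using assms s by (simp add: prm_def)
qed

lemma al_nu: assumes "prm l" shows "trans2 nu *m al l *m trans2 (- nu) \<simeq> al (Lam 1 l)"
\<comment> \<open>The \<open>nu\<close> translation lowers the level by \<open>1\<close>, so level
  \<open>0\<close> for \<open>l\<close> corresponds to level \<open>-1\<close> for
  \<open>Lam 1 l\<close>.\<close>
proof (rule al_unique[OF prm_Lam[OF assms], where s = "1/2" and t = "-1"])
 have i: "inG (trans2 (- nu))" using inG_trans_int[OF nu(1), of "-1"] by simp
 show "inG (trans2 nu *m al l *m trans2 (- nu))" by (intro inG_mmul nu al assms i)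
 let ?h = "of_real (ln (1/2)) :: complex"
 have D: "(l + ?h, 0) : Dst" "(l + ipi + ?h, 0) : Dst" using prm_Dst[OF assms, of "1/2"] by auto
 have e1: "Ps (Lam 1 l + ?h, -1) = shift nu (Ps (l + ?h, 0))" using nu(2)[OF D(1)] Lam_real[of 1 l "ln (1/2)"] by simp
 have e2: "Ps (Lam 1 l + ipi + ?h, -1) = shift nu (Ps (l + ipi + ?h, 0))"
  using nu(2)[OF D(2)] Lam_real[of 1 "l + ipi" "ln (1/2)"] Lam_pi[of 1 l] by simp
 have "Ps (l + ?h, 0) = mob (al l) (Ps (l + ipi + ?h, 0))" using al(2)[OF assms, of "1/2" 0] by simp
 thus "Ps (Lam 1 l + of_real (ln (1 - 1/2)), -1) =
  mob (trans2 nu *m al l *m trans2 (- nu)) (Ps (Lam 1 l + ipi + of_real (ln (1/2)), -1))"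
  using e1 e2 Ps_H3[OF D(2)] by (simp add: mob_mmul inG_det[OF al(1)[OF assms]])
qed auto

end

text \<open>In coordinates for a basis \<open>v\<close>, \<open>w\<close> these are the medial
  triangles of the triangles \<open>0, v, v + w\<close> and \<open>0, w, v + w\<close>: convex,
  containing the midpoints of the edges, and visible from all three corners.\<close>

definition med :: "(real \<times> real) set" where "med = {(a, b). 1/2 <= a & b <= 1/2 & a - b <= 1/2}"
definition med' :: "(real \<times> real) set" where "med' = {(a, b). 1/2 <= b & a <= 1/2 & b - a <= 1/2}"

lemma convex_med: "convex med" "convex med'"
proof -
 have "med = {x. (-1, 0) \<bullet> x <= -1/2} \<inter> {x. (0, 1) \<bullet> x <= 1/2} \<inter> {x. (1, -1) \<bullet> x <= 1/2}"
  "med' = {x. (0, -1) \<bullet> x <= -1/2} \<inter> {x. (1, 0) \<bullet> x <= 1/2} \<inter> {x. (-1, 1) \<bullet> x <= 1/2}"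
  by (auto simp: med_def med'_def)
 thus "convex med" "convex med'" using convex_Int convex_halfspace_le by metis+
qed

lemma vis_basis:
 assumes "v : lat" "w : lat" "cr v w = 1" "!!r. 0 < r ==> r <= 1 ==> r * a : \<int> ==> r * b : \<int> ==> False"
 shows "vis (of_real a * v + of_real b * w)"
 unfolding vis_def
proof (intro allI impI notI)
 fix r :: real assume r: "0 < r & r <= 1" and l: "of_real r * (of_real a * v + of_real b * w) : lat"
 hence "of_real (r * a) * v + of_real (r * b) * w : lat" by (simp add: algebra_simps)
 thus False using basis_lat[OF assms(1-3)] assms(4) r by blast
qed

lemma Ints_small: "x : \<int> ==> \<bar>x\<bar> < 1 ==> x = 0" for x :: real
 using Ints_nonzero_abs_less1 by blast

lemma scale_1: fixes r a :: real assumes "0 < r" "r <= 1" "1/2 <= a" "a <= 1" "r * a : \<int>" shows "a = 1"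
proof -
 have le: "r * a <= 1" "r * a <= a" "0 < r * a" using assms by (auto simp: mult_le_one mult_left_le_one_le)
 hence "r * a = 1" using Ints_between[OF assms(5)] by fastforce
 thus ?thesis using le assms by linarith
qed

lemma scale_0: fixes r a :: real assumes "0 < r" "r <= 1" "0 <= a" "a <= 1/2" "r * a : \<int>" shows "a = 0"
proof -
 have le: "r * a <= a" "0 <= r * a" using assms by (auto simp: mult_left_le_one_le)
 hence "r * a = 0" using Ints_small[OF assms(5)] assms by linarith
 thus ?thesis using assms by simp
qed

lemma med_vis:
 assumes B: "v : lat" "w : lat" "cr v w = 1" and d: "(a, b) : med"
 shows "vis (of_real a * v + of_real b * w)" "vis (of_real (a - 1) * v + of_real b * w)"
  "vis (of_real (a - 1) * v + of_real (b - 1) * w)"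
proof -
 have m: "1/2 <= a" "a <= 1" "0 <= b" "b <= 1/2" "a - b <= 1/2" using d by (auto simp: med_def)
 show "vis (of_real a * v + of_real b * w)"
 proof (rule vis_basis[OF B])
  fix r :: real assume r: "0 < r" "r <= 1" "r * a : \<int>" "r * b : \<int>"
  thus False using scale_1[of r a] scale_0[of r b] m by linarith
 qed
 show "vis (of_real (a - 1) * v + of_real b * w)"
 proof (rule vis_basis[OF B])
  fix r :: real assume r: "0 < r" "r <= 1" "r * (a - 1) : \<int>" "r * b : \<int>"
  have "r * (1 - a) : \<int>" using Ints_minus[OF r(3)] by (simp add: algebra_simps)
  thus False using scale_0[of r "1 - a"] scale_0[of r b] m r by linarith
 qed
 show "vis (of_real (a - 1) * v + of_real (b - 1) * w)"
 proof (rule vis_basis[OF B])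
  fix r :: real assume r: "0 < r" "r <= 1" "r * (a - 1) : \<int>" "r * (b - 1) : \<int>"
  have "r * (1 - a) : \<int>" "r * (1 - b) : \<int>" using Ints_minus[OF r(3)] Ints_minus[OF r(4)] by (simp_all add: algebra_simps)
  thus False using scale_0[of r "1 - a"] scale_1[of r "1 - b"] m r by linarith
 qed
qed

lemma med'_vis:
 assumes d: "(a, b) : med'"
 shows "vis (of_real a + of_real b * \<i>)" "vis (of_real a + of_real (b - 1) * \<i>)"
  "vis (of_real (a - 1) + of_real (b - 1) * \<i>)"
proof -
 have B: "1 : lat" "\<i> : lat" "cr 1 \<i> = 1" by (simp_all add: lat_def cr_eq)
 have m: "1/2 <= b" "b <= 1" "0 <= a" "a <= 1/2" "b - a <= 1/2" using d by (auto simp: med'_def)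
 have "vis (of_real a * 1 + of_real b * \<i>)"
 proof (rule vis_basis[OF B])
  fix r :: real assume r: "0 < r" "r <= 1" "r * a : \<int>" "r * b : \<int>"
  thus False using scale_1[of r b] scale_0[of r a] m by linarith
 qed
 thus "vis (of_real a + of_real b * \<i>)" by simp
 have "vis (of_real a * 1 + of_real (b - 1) * \<i>)"
 proof (rule vis_basis[OF B])
  fix r :: real assume r: "0 < r" "r <= 1" "r * a : \<int>" "r * (b - 1) : \<int>"
  have "r * (1 - b) : \<int>" using Ints_minus[OF r(4)] by (simp add: algebra_simps)
  thus False using scale_0[of r "1 - b"] scale_0[of r a] m r by linarith
 qed
 thus "vis (of_real a + of_real (b - 1) * \<i>)" by simp
 have "vis (of_real (a - 1) * 1 + of_real (b - 1) * \<i>)"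
 proof (rule vis_basis[OF B])
  fix r :: real assume r: "0 < r" "r <= 1" "r * (a - 1) : \<int>" "r * (b - 1) : \<int>"
  have "r * (1 - a) : \<int>" "r * (1 - b) : \<int>" using Ints_minus[OF r(3)] Ints_minus[OF r(4)] by (simp_all add: algebra_simps)
  thus False using scale_0[of r "1 - b"] scale_1[of r "1 - a"] m r by linarith
 qed
 thus "vis (of_real (a - 1) + of_real (b - 1) * \<i>)" by simp
qed

lemma half_diff: "1 - 1/2 = (1/2 :: real)" by simp

lemma Ln_scale: "0 < r ==> z ~= 0 ==> Ln (of_real r * z) = Ln z + of_real (ln r)"
 using Ln_times_of_real[of r z] by (simp add: Ln_of_real)

lemma Ln_div_i:
 assumes "z ~= 0" "0 <= Im z" shows "Ln (- \<i> * z) + of_real pi / 2 * \<i> = Ln z"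
proof -
 have "\<i> * (- \<i> * z) = z" by (simp add: complex_eq_iff)
 thus ?thesis using Ln_times_ii[of "- \<i> * z"] assms by (simp add: mult.commute)
qed

lemma Ln_neg_div_i:
 assumes "z ~= 0" "0 <= Re z" shows "Ln (\<i> * z) + of_real pi / 2 * \<i> = Ln z + ipi"
 using Ln_times_ii[of z] assms by (simp add: field_simps)

lemma continuous_on_Ln_ReIm: assumes "continuous_on S f" "!!d. d : S ==> Re (f d) <= 0 ==> Im (f d) ~= 0"
 shows "continuous_on S (%x. Ln (f x))"
proof (rule Complex_Transcendental.continuous_on_Ln'[OF assms(1)])
 show "f z ~: \<real>\<^sub>\<le>\<^sub>0" if "z : S" for z using assms(2)[OF that] by (auto simp: complex_nonpos_Reals_iff)
qed

context cusp
begin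

text \<open>A point of the medial triangle has a logarithm at each corner of
  \<open>0, v, v + w\<close>. One matrix compares two corners over the whole medial triangle, the
  comparisons compose, and each is recognised as an \<open>al\<close> at the midpoint of the
  edge.\<close>

lemma al_add:
 assumes v: "v : lat" "0 <= Re v" "0 <= Im v" and w: "w : lat" "0 <= Re w" "0 <= Im w" and c: "cr v w = 1"
 shows "al (Ln (v + w)) \<simeq> al (Ln v) *m al (Ln w)"
proof -
 have "cr v (v + w) = 1" using c by (simp add: cr_eq algebra_simps)
 hence nz: "v ~= 0" "w ~= 0" "v + w ~= 0" using c by (metis cr_eq diff_zero mult_zero_left mult_zero_right zero_complex.sel zero_neq_one)+
 have p: "prm (Ln v)" "prm (Ln w)" "prm (Ln (v + w))"
  using prmI[of "Ln v" w] prmI[of "Ln w" v] prmI[of "Ln (v + w)" w] v w c nz by (simp_all add: lat_add cr_eq algebra_simps)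
 define X where "X d = of_real (fst d) * v + of_real (snd d) * w" for d :: "real \<times> real"
 \<comment> \<open>At the corner \<open>v\<close> the branch is cut along the negative imaginary
   axis, since the directions from \<open>v\<close> into the triangle run from that of
   \<open>w\<close> to that of \<open>- v\<close>.\<close>
 define l0 l1 l2 where "l0 d = Ln (X d)" and "l1 d = Ln (- \<i> * (X d - v)) + of_real pi / 2 * \<i>"
  and "l2 d = Ln (- (X d - (v + w))) + ipi" for d
 have X1: "X d - v = of_real (fst d - 1) * v + of_real (snd d) * w"
  and X2: "X d - (v + w) = of_real (fst d - 1) * v + of_real (snd d - 1) * w" for d
  by (simp_all add: X_def algebra_simps)
 have V: "vis (X d - 0)" "vis (X d - v)" "vis (X d - (v + w))" if "d : med" for d
  using med_vis[OF v(1) w(1) c, of "fst d" "snd d"] that unfolding X1 X2 by (simp_all add: X_def)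
 have N: "X d ~= 0" "X d - v ~= 0" "X d - (v + w) ~= 0" if "d : med" for d
  using vis_notin[OF V(1)[OF that]] vis_notin[OF V(2)[OF that]] vis_notin[OF V(3)[OF that]] by auto
 have cX: "continuous_on med X" unfolding X_def by (intro continuous_intros)
 have m: "1/2 <= fst d" "fst d <= 1" "0 <= snd d" "snd d <= 1/2" if "d : med" for d
  using that by (auto simp: med_def)
 have Q0: "0 <= Re (X d)" "0 <= Im (X d)" if "d : med" for d using m[OF that] v w by (simp_all add: X_def)
 have Q2: "0 <= Re (- (X d - (v + w)))" "0 <= Im (- (X d - (v + w)))" if "d : med" for d
 proof -
  have "- (X d - (v + w)) = of_real (1 - fst d) * v + of_real (1 - snd d) * w" by (simp add: X_def algebra_simps)
  thus "0 <= Re (- (X d - (v + w)))" "0 <= Im (- (X d - (v + w)))" using m[OF that] v w by simp_all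
 qed
 have c0: "continuous_on med l0" unfolding l0_def
 proof (rule continuous_on_Ln_ReIm[OF cX])
  fix d assume d: "d : med" and R: "Re (X d) <= 0"
  thus "Im (X d) ~= 0" using N(1)[OF d] Q0[OF d] by (metis complex_eq_iff zero_complex.sel order_antisym)
 qed
 have c2: "continuous_on med l2" unfolding l2_def
 proof (rule continuous_on_add[OF continuous_on_Ln_ReIm continuous_on_const], intro continuous_intros cX)
  fix d assume d: "d : med" and R: "Re (- (X d - (v + w))) <= 0"
  have "- (X d - (v + w)) ~= 0" using N(3)[OF d] by (simp only: neg_equal_0_iff_equal not_False_eq_True)
  thus "Im (- (X d - (v + w))) ~= 0" using Q2[OF d] R by (metis complex_eq_iff zero_complex.sel order_antisym)
 qed
 have c1: "continuous_on med l1" unfolding l1_def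
 proof (rule continuous_on_add[OF continuous_on_Ln_ReIm continuous_on_const], intro continuous_intros cX)
  fix d assume d: "d : med" and R: "Re (- \<i> * (X d - v)) <= 0"
  show "Im (- \<i> * (X d - v)) ~= 0"
  proof
   assume "Im (- \<i> * (X d - v)) = 0"
   hence 0: "Re (X d - v) = 0" "Im (X d - v) <= 0" using R by simp_all
   have "cr v (X d - v) = snd d" using cr_lin(1)[of v "fst d - 1" "snd d" w] c unfolding X1 by simp
   hence "Re v * Im (X d - v) = snd d" using 0 by (simp add: cr_eq)
   moreover have "Re v * Im (X d - v) <= 0" using 0 v by (simp add: mult_nonneg_nonpos)
   ultimately have s: "snd d = 0" using m(3)[OF d] by linarith
   have "Re v ~= 0"
   proof
    assume "Re v = 0"
    hence "Im v * Re w = -1" using c by (simp add: cr_eq)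
    thus False using mult_nonneg_nonneg[OF v(3) w(2)] by simp
   qed
   moreover have "X d - v = of_real (fst d - 1) * v" using s unfolding X1 by simp
   ultimately have "fst d = 1" using 0 by simp
   thus False using d s by (auto simp: med_def)
  qed
 qed
 have e: "exp (l0 d) = X d - 0" "exp (l1 d) = X d - v" "exp (l2 d) = X d - (v + w)" if "d : med" for d
 proof -
  have "exp (of_real pi / 2 * \<i>) = \<i>" "exp (ipi) = -1" by (simp_all add: exp_eq_polar cis_conv_exp[symmetric] mult.commute flip: cis_conv_exp)
  moreover have "- (\<i> * (X d - v) * \<i>) = X d - v" by (simp add: complex_eq_iff)
  ultimately show "exp (l0 d) = X d - 0" "exp (l1 d) = X d - v" "exp (l2 d) = X d - (v + w)"
   using N[OF that] by (simp_all add: l0_def l1_def l2_def exp_add)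
 qed
 note cm = convex_connected[OF convex_med(1)]
 have L: "0 : lat" "v + w : lat" using lat_0 lat_add[OF v(1) w(1)] by auto
 obtain A where A: "inG A" "ALL d:med. ALL t. Ps (l0 d, t) = mob A (Ps (l1 d, t))"
  using frame_logs[OF cm c0 c1 L(1) v(1) e(1,2) V(1,2)] by blast
 obtain B where B: "inG B" "ALL d:med. ALL t. Ps (l1 d, t) = mob B (Ps (l2 d, t))"
  using frame_logs[OF cm c1 c2 v(1) L(2) e(2,3) V(2,3)] by blast
 have D: "(l2 d, t) : Dst" if "d : med" for d t using e(3)[OF that] V(3)[OF that] by (simp add: Dst_def)
 have AB: "Ps (l0 d, t) = mob (A *m B) (Ps (l2 d, t))" if "d : med" for d t
  using A(2) B(2) that by (simp add: mob_mmul[OF inG_det[OF B(1)] Ps_H3[OF D[OF that]]])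
 have md: "(1/2, 0) : med" "(1, 1/2) : med" "(1/2, 1/2) : med" by (auto simp: med_def)
 have half: "Ln (of_real (1/2) * z) = Ln z + of_real (ln (1/2))" if "z ~= 0" for z using Ln_scale[OF _ that, of "1/2"] by simp
 have x: "X (1/2, 0) = of_real (1/2) * v" "X (1/2, 0) - v = - (of_real (1/2) * v)"
  "X (1, 1/2) - v = of_real (1/2) * w" "- (X (1, 1/2) - (v + w)) = of_real (1/2) * w"
  "X (1/2, 1/2) = of_real (1/2) * (v + w)" "- (X (1/2, 1/2) - (v + w)) = of_real (1/2) * (v + w)"
  by (simp_all add: X_def complex_eq_iff)
 have "A \<simeq> al (Ln v)"
 proof (rule al_unique[OF p(1) A(1), where s = "1/2" and t = 0])
  have "l1 (1/2, 0) = Ln v + ipi + of_real (ln (1/2))"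
   unfolding l1_def x using Ln_neg_div_i[of "of_real (1/2) * v"] v nz half[OF nz(1)] by simp
  moreover have "l0 (1/2, 0) = Ln v + of_real (ln (1/2))" unfolding l0_def x using half[OF nz(1)] by simp
  ultimately show "Ps (Ln v + of_real (ln (1 - 1/2)), 0) = mob A (Ps (Ln v + ipi + of_real (ln (1/2)), 0))"
   using A(2) md(1) by (metis half_diff)
 qed auto
 moreover have "B \<simeq> al (Ln w)"
 proof (rule al_unique[OF p(2) B(1), where s = "1/2" and t = 0])
  have "l1 (1, 1/2) = Ln w + of_real (ln (1/2))"
   unfolding l1_def x using Ln_div_i[of "of_real (1/2) * w"] w nz half[OF nz(2)] by simp
  moreover have "l2 (1, 1/2) = Ln w + ipi + of_real (ln (1/2))" unfolding l2_def x using half[OF nz(2)] by simp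
  ultimately show "Ps (Ln w + of_real (ln (1 - 1/2)), 0) = mob B (Ps (Ln w + ipi + of_real (ln (1/2)), 0))"
   using B(2) md(2) by (metis half_diff)
 qed auto
 moreover have "A *m B \<simeq> al (Ln (v + w))"
 proof (rule al_unique[OF p(3) inG_mmul[OF A(1) B(1)], where s = "1/2" and t = 0])
  have "l0 (1/2, 1/2) = Ln (v + w) + of_real (ln (1/2))" unfolding l0_def x using half[OF nz(3)] by simp
  moreover have "l2 (1/2, 1/2) = Ln (v + w) + ipi + of_real (ln (1/2))" unfolding l2_def x(6) half[OF nz(3)] by simp
  ultimately show "Ps (Ln (v + w) + of_real (ln (1 - 1/2)), 0) = mob (A *m B) (Ps (Ln (v + w) + ipi + of_real (ln (1/2)), 0))"
   using AB md(3) by (metis half_diff)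
 qed auto
 ultimately show ?thesis using peq_mmul peq_trans peq_sym by meson
qed

text \<open>The triangle on the other side of the diagonal gives the product in the other order. At
  the corner \<open>\<i>\<close> the branch that fits the edge to \<open>0\<close> is a full turn
  off on the edge to \<open>1 + \<i>\<close>, which produces \<open>Pm\<close>; together with
  \<open>al_add\<close> this is the commutator relation.\<close>

lemma al_add': "al (Ln (1 + \<i>)) \<simeq> al (Ln \<i>) *m (Pm *m al (Ln 1))"
proof -
 have L: "0 : lat" "1 : lat" "\<i> : lat" "1 + \<i> : lat" by (simp_all add: lat_def)
 have nz: "1 + \<i> ~= 0" by (simp add: complex_eq_iff)
 have p: "prm (Ln 1)" "prm (Ln \<i>)" "prm (Ln (1 + \<i>))"
  using prmI[of "Ln 1" \<i>, unfolded exp_Ln[OF one_neq_zero]] prmI[of "Ln \<i>" 1, unfolded exp_Ln[OF complex_i_not_zero]]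
   prmI[of "Ln (1 + \<i>)" \<i>, unfolded exp_Ln[OF nz]] L by (simp_all add: cr_eq)
 define X where "X d = of_real (fst d) + of_real (snd d) * \<i>" for d :: "real \<times> real"
 define l0 l1 l2 where "l0 d = Ln (X d)" and "l1 d = Ln (X d - \<i>) + tpi"
  and "l2 d = Ln (- (X d - (1 + \<i>))) + ipi" for d
 have X1: "X d - \<i> = of_real (fst d) + of_real (snd d - 1) * \<i>"
  and X2: "X d - (1 + \<i>) = of_real (fst d - 1) + of_real (snd d - 1) * \<i>" for d
  by (simp_all add: X_def algebra_simps)
 have V: "vis (X d - 0)" "vis (X d - \<i>)" "vis (X d - (1 + \<i>))" if "d : med'" for d
  using med'_vis[of "fst d" "snd d"] that unfolding X1 X2 by (simp_all add: X_def)
 have N: "X d ~= 0" "X d - \<i> ~= 0" "X d - (1 + \<i>) ~= 0" if "d : med'" for d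
  using vis_notin[OF V(1)[OF that]] vis_notin[OF V(2)[OF that]] vis_notin[OF V(3)[OF that]] by auto
 have cX: "continuous_on med' X" unfolding X_def by (intro continuous_intros)
 have m: "1/2 <= snd d" "snd d <= 1" "0 <= fst d" "fst d <= 1/2" if "d : med'" for d
  using that by (auto simp: med'_def)
 have c0: "continuous_on med' l0" unfolding l0_def
 proof (rule continuous_on_Ln_ReIm[OF cX])
  fix d assume d: "d : med'"
  show "Im (X d) ~= 0" using m(1)[OF d] by (simp add: X_def)
 qed
 have c2: "continuous_on med' l2" unfolding l2_def
 proof (rule continuous_on_add[OF continuous_on_Ln_ReIm continuous_on_const], intro continuous_intros cX)
  fix d assume d: "d : med'" and "Re (- (X d - (1 + \<i>))) <= 0"
  thus "Im (- (X d - (1 + \<i>))) ~= 0" using m(4)[OF d] by (simp add: X_def)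
 qed
 have c1: "continuous_on med' l1" unfolding l1_def
 proof (rule continuous_on_add[OF continuous_on_Ln_ReIm continuous_on_const], intro continuous_intros cX)
  fix d assume d: "d : med'" and R: "Re (X d - \<i>) <= 0"
  hence "Re (X d - \<i>) = 0" using m(3)[OF d] by (simp add: X_def)
  thus "Im (X d - \<i>) ~= 0" using N(2)[OF d] by (metis complex_eq_iff zero_complex.sel)
 qed
 have e: "exp (l0 d) = X d - 0" "exp (l1 d) = X d - \<i>" "exp (l2 d) = X d - (1 + \<i>)" if "d : med'" for d
 proof -
  have "exp (ipi) = -1" by simp
  thus "exp (l0 d) = X d - 0" "exp (l1 d) = X d - \<i>" "exp (l2 d) = X d - (1 + \<i>)"
   using N[OF that] by (simp_all add: l0_def l1_def l2_def exp_add)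
 qed
 note cm = convex_connected[OF convex_med(2)]
 obtain A where A: "inG A" "ALL d:med'. ALL t. Ps (l0 d, t) = mob A (Ps (l1 d, t))"
  using frame_logs[OF cm c0 c1 L(1,3) e(1,2) V(1,2)] by blast
 obtain B where B: "inG B" "ALL d:med'. ALL t. Ps (l1 d, t) = mob B (Ps (l2 d, t))"
  using frame_logs[OF cm c1 c2 L(3,4) e(2,3) V(2,3)] by blast
 have D: "(l2 d, t) : Dst" if "d : med'" for d t using e(3)[OF that] V(3)[OF that] by (simp add: Dst_def)
 have AB: "Ps (l0 d, t) = mob (A *m B) (Ps (l2 d, t))" if "d : med'" for d t
  using A(2) B(2) that by (simp add: mob_mmul[OF inG_det[OF B(1)] Ps_H3[OF D[OF that]]])
 have md: "(0, 1/2) : med'" "(1/2, 1) : med'" "(1/2, 1/2) : med'" by (auto simp: med'_def)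
 have half: "Ln (of_real (1/2) * z) = Ln z + of_real (ln (1/2))" if "z ~= 0" for z using Ln_scale[OF _ that, of "1/2"] by simp
 have x: "X (0, 1/2) = of_real (1/2) * \<i>" "X (0, 1/2) - \<i> = of_real (1/2) * - \<i>"
  "X (1/2, 1) - \<i> = of_real (1/2) * 1" "- (X (1/2, 1) - (1 + \<i>)) = of_real (1/2) * 1"
  "X (1/2, 1/2) = of_real (1/2) * (1 + \<i>)" "- (X (1/2, 1/2) - (1 + \<i>)) = of_real (1/2) * (1 + \<i>)"
  by (simp_all add: X_def complex_eq_iff)
 have "A \<simeq> al (Ln \<i>)"
 proof (rule al_unique[OF p(2) A(1), where s = "1/2" and t = 0])
  have "l1 (0, 1/2) = Ln (- \<i>) + of_real (ln (1/2)) + tpi"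
   unfolding l1_def x using half[of "- \<i>"] by simp
  also have "... = Ln \<i> + ipi + of_real (ln (1/2))" by (simp add: complex_eq_iff)
  finally have "l1 (0, 1/2) = Ln \<i> + ipi + of_real (ln (1/2))" .
  moreover have "l0 (0, 1/2) = Ln \<i> + of_real (ln (1/2))" unfolding l0_def x using half[of \<i>] by simp
  ultimately show "Ps (Ln \<i> + of_real (ln (1 - 1/2)), 0) = mob A (Ps (Ln \<i> + ipi + of_real (ln (1/2)), 0))"
   using A(2) md(1) by (metis half_diff)
 qed auto
 moreover have "minv Pm *m B \<simeq> al (Ln 1)"
 proof (rule al_unique[OF p(1) inG_mmul[OF inG_minv[OF Pm(1)] B(1)], where s = "1/2" and t = 0])
  let ?h = "of_real (ln (1/2)) :: complex"
  have l1: "l1 (1/2, 1) = ?h + tpi"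
   unfolding l1_def x using half[of 1] by simp
  have l2: "l2 (1/2, 1) = Ln 1 + ipi + ?h" unfolding l2_def x using half[of 1] by simp
  have h: "(?h, 0 :: real) : Dst" using prm_Dst(1)[OF p(1), of "1/2" 0] by simp
  have "Ps (l1 (1/2, 1), 0) = mob B (Ps (l2 (1/2, 1), 0))" using B(2) md(2) by blast
  hence "mob Pm (Ps (?h, 0)) = mob B (Ps (l2 (1/2, 1), 0))" using Pm(2)[OF h] unfolding l1 by simp
  hence "mob (minv Pm) (mob B (Ps (l2 (1/2, 1), 0))) = Ps (?h, 0)"
   using mob_minv(1)[OF inG_det[OF Pm(1)] Ps_H3[OF h]] by simp
  thus "Ps (Ln 1 + of_real (ln (1 - 1/2)), 0) = mob (minv Pm *m B) (Ps (Ln 1 + ipi + of_real (ln (1/2)), 0))"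
   using mob_mmul[OF inG_det[OF B(1)] Ps_H3[OF D[OF md(2)]], of "minv Pm" 0] l2 by simp
 qed auto
 hence "Pm *m (minv Pm *m B) \<simeq> Pm *m al (Ln 1)" using peq_mmul[OF peq_refl] by blast
 hence "B \<simeq> Pm *m al (Ln 1)" by (simp add: mmul_minv(1)[OF inG_det[OF Pm(1)]] flip: mmul_assoc)
 moreover have "A *m B \<simeq> al (Ln (1 + \<i>))"
 proof (rule al_unique[OF p(3) inG_mmul[OF A(1) B(1)], where s = "1/2" and t = 0])
  have "l0 (1/2, 1/2) = Ln (1 + \<i>) + of_real (ln (1/2))" unfolding l0_def x using half[OF nz] by simp
  moreover have "l2 (1/2, 1/2) = Ln (1 + \<i>) + ipi + of_real (ln (1/2))" unfolding l2_def x(6) half[OF nz] by simp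
  ultimately show "Ps (Ln (1 + \<i>) + of_real (ln (1 - 1/2)), 0) = mob (A *m B) (Ps (Ln (1 + \<i>) + ipi + of_real (ln (1/2)), 0))"
   using AB md(3) by (metis half_diff)
 qed auto
 ultimately show ?thesis using peq_mmul peq_trans peq_sym by meson
qed

end

section \<open>Two parabolics and their short words\<close>

fun crow :: "complex => (int \<times> int) list => complex \<times> complex => complex \<times> complex" where
 "crow \<rho> [] p = p"
| "crow \<rho> ((a, b) # w) p = (let c = fst p - of_int a * \<rho> * snd p in crow \<rho> w (c, snd p + of_int b * c))"

text \<open>\<open>crow \<rho> w\<close> multiplies a row from the right by \<open>Y\<^sup>a X\<^sup>b \<cdots>\<close>, where \<open>X = (1, 1; 0, 1)\<close> and
 \<open>Y = (1, 0; -\<rho>, 1)\<close>. The condition below holds for words in a group whose horoballs at parabolic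
 fixed points are disjoint.\<close>

definition wellsep :: "complex => bool" where
 "wellsep \<rho> \<longleftrightarrow> (ALL w. cmod \<rho> <= (cmod (fst (crow \<rho> w (0, 1))))^2 |
   fst (crow \<rho> w (0, 1)) = 0 & Im (snd (crow \<rho> w (1, 0))) = 0)"

lemma crow_cnj: "crow (cnj \<rho>) w (cnj p, cnj q) = (cnj (fst (crow \<rho> w (p, q))), cnj (snd (crow \<rho> w (p, q))))"
proof (induction w arbitrary: p q)
 case (Cons ab w)
 obtain a b where ab: "ab = (a, b)" by (cases ab)
 show ?case using Cons[of "p - of_int a * \<rho> * q" "q + of_int b * (p - of_int a * \<rho> * q)"] by (simp add: ab Let_def)
qed simp

lemma crow_uminus: "crow (- \<rho>) w p = crow \<rho> (map (%(a, b). (- a, b)) w) p"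
proof (induction w arbitrary: p)
 case (Cons ab w)
 thus ?case by (cases ab) (simp add: Let_def)
qed simp

lemma wellsep_cnj: "wellsep \<rho> ==> wellsep (cnj \<rho>)"
 unfolding wellsep_def using crow_cnj[of \<rho> _ 0 1] crow_cnj[of \<rho> _ 1 0] by simp

lemma wellsep_uminus: "wellsep \<rho> ==> wellsep (- \<rho>)"
 unfolding wellsep_def by (simp add: crow_uminus)

text \<open>Horner's scheme for a polynomial with Gaussian integer coefficients, constant term
  first; \<open>H\<close> will be the offset of \<open>4096 \<rho>\<close> from the centre of a
  square.\<close>

fun hs :: "(int \<times> int) list => complex => complex" where
 "hs [] H = 0" | "hs (z # p) H = Complex (of_int (fst z)) (of_int (snd z)) + H * hs p H"

fun ipadd :: "(int \<times> int) list => (int \<times> int) list => (int \<times> int) list" where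
 "ipadd [] q = q" | "ipadd p [] = p" | "ipadd (a # p) (b # q) = (fst a + fst b, snd a + snd b) # ipadd p q"

definition ipsc :: "int => (int \<times> int) list => (int \<times> int) list" where
 "ipsc a = map (%z. (a * fst z, a * snd z))"

text \<open>Multiplication by \<open>4096 \<rho>\<close>, written as the linear polynomial
  \<open>c + H\<close>.\<close>

definition icm :: "int \<times> int => (int \<times> int) list => (int \<times> int) list" where
 "icm c p = ipadd (map (%z. (fst c * fst z - snd c * snd z, fst c * snd z + snd c * fst z)) p) ((0, 0) # p)"

lemma hs_ipadd: "hs (ipadd p q) H = hs p H + hs q H"
 by (induction p q rule: ipadd.induct) (simp_all add: complex_eq_iff algebra_simps)

lemma hs_ipsc: "hs (ipsc a p) H = of_int a * hs p H"
 by (induction p) (simp_all add: ipsc_def complex_eq_iff algebra_simps)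

lemma hs_icm: "hs (icm c p) H = (Complex (of_int (fst c)) (of_int (snd c)) + H) * hs p H"
proof -
 have "hs (map (%z. (fst c * fst z - snd c * snd z, fst c * snd z + snd c * fst z)) p) H
  = Complex (of_int (fst c)) (of_int (snd c)) * hs p H"
 proof (induction p)
  case (Cons z p)
  have "hs (map (%z. (fst c * fst z - snd c * snd z, fst c * snd z + snd c * fst z)) (z # p)) H =
   Complex (of_int (fst c)) (of_int (snd c)) * Complex (of_int (fst z)) (of_int (snd z)) +
   H * (Complex (of_int (fst c)) (of_int (snd c)) * hs p H)"
   using Cons by (simp add: complex_eq_iff)
  thus ?case by (simp add: ring_distribs mult.left_commute)
 qed simp
 thus ?thesis by (simp add: icm_def hs_ipadd ring_distribs complex_eq_iff)
qed

text \<open>All polynomials are scaled by powers of \<open>4096\<close> to stay integral.\<close>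

definition xstep :: "int => (int \<times> int) list => (int \<times> int) list => (int \<times> int) list \<times> (int \<times> int) list" where
 "xstep b q p = (p, ipadd q (ipsc b p))"

fun irow :: "int \<times> int => (int \<times> int) list => (int \<times> int) list \<times> (int \<times> int) list => (int \<times> int) list \<times> (int \<times> int) list" where
 "irow c [] p = p"
| "irow c ((a, b) # w) p =
  irow c w (xstep b (ipsc 4096 (snd p)) (ipadd (ipsc 4096 (fst p)) (ipsc (- a) (icm c (snd p)))))"

text \<open>Every pair in the word costs one factor \<open>4096\<close>, so the scale after
  \<open>w\<close> can be read off from its length.\<close>

lemma irow_correct:
 assumes "4096 * \<rho> = Complex (of_int (fst c)) (of_int (snd c)) + H"
 shows "crow \<rho> w (hs (fst p) H / 4096 ^ k, hs (snd p) H / 4096 ^ k) =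
  (hs (fst (irow c w p)) H / 4096 ^ (k + length w), hs (snd (irow c w p)) H / 4096 ^ (k + length w))"
proof (induction w arbitrary: p k)
 case (Cons ab w)
 obtain a b where ab: "ab = (a, b)" by (cases ab)
 let ?p = "ipadd (ipsc 4096 (fst p)) (ipsc (- a) (icm c (snd p)))"
 let ?q = "ipadd (ipsc 4096 (snd p)) (ipsc b ?p)"
 have e: "hs (fst p) H / 4096 ^ k - of_int a * \<rho> * (hs (snd p) H / 4096 ^ k) = hs ?p H / 4096 ^ Suc k"
  unfolding hs_ipadd hs_ipsc hs_icm assms[symmetric] by (simp add: field_simps)
 have f: "hs (snd p) H / 4096 ^ k + of_int b * (hs ?p H / 4096 ^ Suc k) = hs ?q H / 4096 ^ Suc k"
  unfolding hs_ipadd hs_ipsc[of _ "snd p"] hs_ipsc[of b] by (simp add: field_simps)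
 have "crow \<rho> (ab # w) (hs (fst p) H / 4096 ^ k, hs (snd p) H / 4096 ^ k) = crow \<rho> w (hs ?p H / 4096 ^ Suc k, hs ?q H / 4096 ^ Suc k)"
  unfolding ab crow.simps Let_def fst_conv snd_conv e f ..
 thus ?case using Cons[of "(?p, ?q)" "Suc k"] by (simp add: ab xstep_def)
qed simp

text \<open>An integer form of the bound \<open>sqrt (M^2 + m^2) <= M + m^2 / (2 M)\<close>.\<close>

definition nb1 :: "int => int => int" where
 "nb1 M m = (if M = 0 then 0 else M + (m * m) div (2 * M) + 1)"

fun nb :: "int \<times> int => int" where
 "nb (x, y) = nb1 (max \<bar>x\<bar> \<bar>y\<bar>) (min \<bar>x\<bar> \<bar>y\<bar>)"

fun hsb :: "int => (int \<times> int) list => int" where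
 "hsb r [] = 0" | "hsb r (z # p) = nb z + r * hsb r p"

lemma nb_bound: "cmod (Complex (of_int x) (of_int y)) <= of_int (nb (x, y))"
proof -
 define M m where "M = max \<bar>x\<bar> \<bar>y\<bar>" and "m = min \<bar>x\<bar> \<bar>y\<bar>"
 have s: "x^2 + y^2 = M^2 + m^2" by (auto simp: M_def m_def max_def min_def)
 show ?thesis
 proof (cases "M = 0")
  case True
  hence "x = 0" "y = 0" by (auto simp: M_def)
  thus ?thesis by (simp add: nb1_def flip: zero_complex.code)
 next
  case False
  hence M: "M > 0" by (auto simp: M_def)
  define d where "d = real_of_int (m * m) / of_int (2 * M)"
  have d0: "d >= 0" using M by (simp add: d_def)
  have "real_of_int ((m * m) div (2 * M)) + 1 > d"
   unfolding d_def floor_divide_of_int_eq[symmetric, where 'a = real] by linarith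
  hence "real_of_int M + d <= of_int (nb (x, y))" using False by (simp add: nb1_def M_def[symmetric] m_def[symmetric])
  moreover have "cmod (Complex (of_int x) (of_int y)) <= real_of_int M + d"
  proof (rule power2_le_imp_le)
   have "(cmod (Complex (of_int x) (of_int y)))^2 = real_of_int (x^2 + y^2)" by (simp add: cmod_power2)
   also have "... = of_int M ^ 2 + of_int m ^ 2" unfolding s by simp
   also have "real_of_int m ^ 2 = 2 * of_int M * d" using M by (simp add: d_def power2_eq_square)
   also have "of_int M ^ 2 + 2 * of_int M * d <= (real_of_int M + d)^2" by (simp add: power2_sum)
   finally show "(cmod (Complex (of_int x) (of_int y)))^2 <= (real_of_int M + d)^2" .
   show "0 <= real_of_int M + d" using M d0 by simp
  qed
  ultimately show ?thesis by linarith
 qed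
qed

lemma hsb_bound: assumes "cmod H <= of_int r" shows "cmod (hs p H) <= of_int (hsb r p)"
proof (induction p)
 case (Cons z p)
 have "cmod (hs (z # p) H) <= cmod (Complex (of_int (fst z)) (of_int (snd z))) + cmod H * cmod (hs p H)"
  by (metis hs.simps(2) norm_mult norm_triangle_ineq)
 also have "... <= of_int (nb z) + of_int r * of_int (hsb r p)"
  using nb_bound[of "fst z" "snd z"] assms Cons order_trans[OF norm_ge_zero assms] by (intro add_mono mult_mono) auto
 finally show ?case by simp
qed simp

datatype qtree = Out | In nat | Ib nat | Iu nat | Qd qtree qtree qtree qtree

text \<open>The words of the certificate, addressed by position. The first two have lower left
  entries \<open>\<rho> (\<rho> - 1)^2\<close> and \<open>2 \<rho> (\<rho> - 1)\<close>, which is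
  what the leaves \<open>Iu\<close> rely on.\<close>

definition wlist :: "(int \<times> int) list list" where
 "wlist = [[(1, 1), (-1, -1), (-1, 0)],
 [(1, 2), (1, 0)],
 [(1, 1), (-1, -1), (1, 0)],
 [(1, 1), (-1, -1), (1, 1), (-1, 0)],
 [(1, 1), (-1, -1), (1, 1), (1, 0)],
 [(1, 1), (-1, -1), (-1, 1), (1, 0)],
 [(1, 1), (-1, -2), (-1, 1), (1, 0)],
 [(1, 1), (-1, -1), (1, 1), (1, -1), (-1, 0)],
 [(1, 1), (-1, -1), (1, -1), (-1, 1), (1, 0)],
 [(1, 1), (-1, -1), (1, 1), (1, -1), (-1, 1), (1, 0)],
 [(1, 1), (-1, -1), (1, 1), (-1, 1), (1, -1), (-1, 1), (1, 0)],
 [(1, 1), (-1, -1), (1, 1), (1, 1), (1, -1), (-1, 1), (1, 0)],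
 [(1, 1), (-1, -1), (1, 1), (1, -1), (-1, 1), (1, -1), (-1, 0)],
 [(1, -1), (-1, -1), (1, 1), (-1, -1), (-1, 1), (1, 0)]]"

text \<open>Two ways to get \<open>|c|^2 < |\<rho>|\<close> when \<open>b\<close> bounds
  \<open>4096^n |c|\<close>: either \<open>|c| < 1\<close>, or \<open>|c|^4 < |\<rho>|^2\<close>
  with \<open>\<rho>\<close> replaced by the corner of the square nearest to the origin.\<close>

definition small1 :: "int => int => int => nat => int => bool" where
 "small1 x y h n b \<longleftrightarrow> b^2 < 4096 ^ (2 * n) |
  h <= x & h <= y & b ^ 4 * 4096^2 < ((x - h)^2 + (y - h)^2) * 4096 ^ (4 * n)"

text \<open>An integer above \<open>sqrt 2 h\<close>, the half diagonal of the square.\<close>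

definition rad :: "int => int" where "rad h = (h * 1415) div 1000 + 1"

definition small :: "int => int => int => (int \<times> int) list => bool" where
 "small x y h w \<longleftrightarrow> small1 x y h (length w) (hsb (rad h) (fst (irow (x, y) w ([], [(1, 0)]))))"

fun leads :: "(int \<times> int => int) => int => (int \<times> int) list => bool" where
 "leads f r [] \<longleftrightarrow> False" | "leads f r (z # p) \<longleftrightarrow> hsb r p * r < f z"

text \<open>A certificate that each square of a subdivision lies outside the annulus (\<open>Out\<close>) or that some word is too
 short there but not parabolic, by a nonzero lower left entry (\<open>In\<close>), a nonreal upper right one (\<open>Ib\<close>), or
 because its lower left entry vanishes at \<open>\<rho> = 1\<close> only (\<open>Iu\<close>).\<close>

fun chk :: "qtree => int => int => int => bool" where
 "chk Out x y h \<longleftrightarrow> 0 <= h & h <= x & h <= y & ((x + h)^2 + (y + h)^2 < 4096^2 | 19203 * 4096^2 <= 10000 * ((x - h)^2 + (y - h)^2))"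
| "chk (In i) x y h \<longleftrightarrow> small x y h (wlist ! i) &
  leads (%z. max \<bar>fst z\<bar> \<bar>snd z\<bar>) (rad h) (fst (irow (x, y) (wlist ! i) ([], [(1, 0)])))"
| "chk (Ib i) x y h \<longleftrightarrow> small x y h (wlist ! i) &
  leads (%z. \<bar>snd z\<bar>) (rad h) (snd (irow (x, y) (wlist ! i) ([(1, 0)], [])))"
| "chk (Iu i) x y h \<longleftrightarrow> small x y h (wlist ! i) & i < 2"
| "chk (Qd a b c d) x y h \<longleftrightarrow> even h &
  chk a (x - h div 2) (y - h div 2) (h div 2) & chk b (x + h div 2) (y - h div 2) (h div 2) &
  chk c (x - h div 2) (y + h div 2) (h div 2) & chk d (x + h div 2) (y + h div 2) (h div 2)"

lemma rad_bound: assumes "\<bar>Re H\<bar> <= of_int h" "\<bar>Im H\<bar> <= of_int h" shows "cmod H <= of_int (rad h)"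
proof (rule power2_le_imp_le)
 have h0: "0 <= h" using assms(1) by linarith
 define d e where "d = (h * 1415) div 1000" and "e = (h * 1415) mod 1000"
 have "1000 * d + e = h * 1415" "e < 1000" unfolding d_def e_def by (rule mult_div_mod_eq) simp
 hence "1000 * rad h >= h * 1415" unfolding rad_def d_def[symmetric] by (simp add: ring_distribs)
 hence r: "real_of_int (rad h) >= 1415 / 1000 * of_int h" by linarith
 have "(cmod H)^2 = \<bar>Re H\<bar>^2 + \<bar>Im H\<bar>^2" by (simp add: cmod_power2)
 also have "... <= (of_int h)^2 + (of_int h)^2" using assms by (intro add_mono power_mono) auto
 also have "... <= (1415 / 1000 * of_int h)^2" by (simp add: power2_eq_square)
 also have "... <= (of_int (rad h))^2" using r h0 by (intro power_mono) auto
 finally show "(cmod H)^2 <= (of_int (rad h))^2" .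
 show "0 <= real_of_int (rad h)" using r h0 by (smt (verit) mult_nonneg_nonneg of_int_0_le_iff divide_nonneg_nonneg)
qed

lemma leads_cmod: assumes "leads f r p" "cmod H <= of_int r"
 shows "EX z e. hs p H = Complex (of_int (fst z)) (of_int (snd z)) + e & cmod e < of_int (f z)"
proof (cases p)
 case (Cons z q)
 have "cmod (H * hs q H) <= of_int r * of_int (hsb r q)"
  unfolding norm_mult using assms(2) hsb_bound[OF assms(2)] order_trans[OF norm_ge_zero assms(2)] by (intro mult_mono) auto
 also have "... < of_int (f z)" using assms(1) unfolding Cons leads.simps
  by (metis mult.commute of_int_less_iff of_int_mult)
 finally show ?thesis unfolding Cons hs.simps by blast
qed (use assms in simp)

context
 fixes \<rho> :: complex and x y h :: int
 assumes sq: "\<bar>4096 * Re \<rho> - of_int x\<bar> <= of_int h" "\<bar>4096 * Im \<rho> - of_int y\<bar> <= of_int h"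
begin

lemma crow_irow:
 obtains H where "cmod H <= of_int (rad h)"
  "fst (crow \<rho> w (0, 1)) = hs (fst (irow (x, y) w ([], [(1, 0)]))) H / 4096 ^ length w"
  "snd (crow \<rho> w (1, 0)) = hs (snd (irow (x, y) w ([(1, 0)], []))) H / 4096 ^ length w"
proof
 define H where "H = 4096 * \<rho> - Complex (of_int x) (of_int y)"
 have e: "4096 * \<rho> = Complex (of_int (fst (x, y))) (of_int (snd (x, y))) + H" by (simp add: H_def)
 have one: "Complex 1 0 = 1" by (simp add: complex_eq_iff)
 show "cmod H <= of_int (rad h)" by (rule rad_bound) (use sq in "simp_all add: H_def")
 show "fst (crow \<rho> w (0, 1)) = hs (fst (irow (x, y) w ([], [(1, 0)]))) H / 4096 ^ length w"
  "snd (crow \<rho> w (1, 0)) = hs (snd (irow (x, y) w ([(1, 0)], []))) H / 4096 ^ length w"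
  using irow_correct[OF e, of w "([], [(1, 0)])" 0] irow_correct[OF e, of w "([(1, 0)], [])" 0] by (simp_all add: one)
qed

lemma small_correct:
 assumes "small x y h w" "1 <= cmod \<rho>" shows "(cmod (fst (crow \<rho> w (0, 1))))^2 < cmod \<rho>"
proof -
 obtain H where H: "cmod H <= of_int (rad h)"
  "fst (crow \<rho> w (0, 1)) = hs (fst (irow (x, y) w ([], [(1, 0)]))) H / 4096 ^ length w"
  using crow_irow[of w] by blast
 define b where "b = hsb (rad h) (fst (irow (x, y) w ([], [(1, 0)])))"
 let ?C = "cmod (fst (crow \<rho> w (0, 1)))" and ?n = "length w"
 have le: "?C * 4096 ^ ?n <= of_int b"
  using hsb_bound[OF H(1), of "fst (irow (x, y) w ([], [(1, 0)]))"] unfolding H(2) b_def by (simp add: norm_divide norm_power)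
 have p2: "(?C^2 * 4096 ^ (2 * ?n)) <= (of_int b)^2"
  using power_mono[OF le, of 2] by (simp add: power_mult_distrib power_mult[symmetric] mult.commute)
 from assms(1) have "b^2 < 4096 ^ (2 * ?n) | h <= x & h <= y & b ^ 4 * 4096^2 < ((x - h)^2 + (y - h)^2) * 4096 ^ (4 * ?n)"
  unfolding small_def small1_def b_def .
 thus ?thesis
 proof (elim disjE conjE)
  assume "b^2 < 4096 ^ (2 * ?n)"
  hence "(real_of_int b)^2 < 4096 ^ (2 * ?n)" by (metis of_int_less_iff of_int_numeral of_int_power)
  with p2 have "?C^2 * 4096 ^ (2 * ?n) < 1 * 4096 ^ (2 * ?n)" by linarith
  hence "?C^2 < 1" by (rule mult_right_less_imp_less) simp
  thus ?thesis using assms(2) by simp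
 next
  assume l: "h <= x" "h <= y" and *: "b ^ 4 * 4096^2 < ((x - h)^2 + (y - h)^2) * 4096 ^ (4 * ?n)"
  have "real_of_int (b ^ 4 * 4096^2) < of_int (((x - h)^2 + (y - h)^2) * 4096 ^ (4 * ?n))" using * by (simp only: of_int_less_iff)
  hence 1: "real_of_int b ^ 4 * 4096^2 < ((of_int (x - h))^2 + (of_int (y - h))^2) * 4096 ^ (4 * ?n)" by simp
  have "(real_of_int (x - h))^2 <= (4096 * Re \<rho>)^2" "(real_of_int (y - h))^2 <= (4096 * Im \<rho>)^2"
   using sq l by (intro power_mono; simp; linarith)+
  hence "(of_int (x - h))^2 + (of_int (y - h))^2 <= 4096^2 * (cmod \<rho>)^2" by (simp add: cmod_power2 power_mult_distrib ring_distribs)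
  hence 2: "((of_int (x - h))^2 + (of_int (y - h))^2) * 4096 ^ (4 * ?n) <= 4096^2 * (cmod \<rho>)^2 * (4096 ^ (4 * ?n) :: real)"
   by (intro mult_right_mono) auto
  have "(?C^2 * 4096 ^ (2 * ?n))^2 <= ((of_int b)^2)^2" using p2 by (intro power_mono) auto
  hence "(?C^2)^2 * 4096 ^ (4 * ?n) <= of_int b ^ 4" by (simp add: power_mult_distrib flip: power_mult)
  hence "(?C^2)^2 * 4096 ^ (4 * ?n) * 4096^2 <= of_int b ^ 4 * 4096^2" by (rule mult_right_mono) simp
  also note 1
  also note 2
  finally have "(?C^2)^2 * (4096 ^ (4 * ?n) * 4096^2) < (cmod \<rho>)^2 * (4096 ^ (4 * ?n) * 4096^2)"
   by (simp only: mult.commute mult.left_commute mult.assoc)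
  hence "(?C^2)^2 < (cmod \<rho>)^2" by (rule mult_right_less_imp_less) simp
  thus ?thesis by (rule power2_less_imp_less) simp
 qed
qed

end

lemma chk_correct:
 assumes "chk t x y h" "\<bar>4096 * Re \<rho> - of_int x\<bar> <= of_int h" "\<bar>4096 * Im \<rho> - of_int y\<bar> <= of_int h"
  and \<rho>: "wellsep \<rho>" "1 <= cmod \<rho>" "(cmod \<rho>)^2 < 19203 / 10000"
 shows "\<rho> = 1"
 using assms(1-3)
proof (induction t arbitrary: x y h)
 case Out
 have l: "0 <= h" "h <= x" "h <= y" using Out(1) by auto
 have r: "0 <= Re \<rho>" "0 <= Im \<rho>" using Out(2,3) l by linarith+
 from Out(1) consider "(x + h)^2 + (y + h)^2 < 4096^2" | "19203 * 4096^2 <= 10000 * ((x - h)^2 + (y - h)^2)" by auto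
 thus ?case
 proof cases
  case 1
  have "real_of_int ((x + h)^2 + (y + h)^2) < of_int (4096^2)" using 1 by (simp only: of_int_less_iff)
  moreover have "(4096 * Re \<rho>)^2 <= (real_of_int (x + h))^2" "(4096 * Im \<rho>)^2 <= (real_of_int (y + h))^2"
   using Out(2,3) l r by (intro power_mono; simp; linarith)+
  ultimately have "4096^2 * (cmod \<rho>)^2 < 4096^2 * 1" by (simp add: cmod_power2 power_mult_distrib)
  hence "(cmod \<rho>)^2 < 1" by simp
  thus ?thesis using \<rho>(2) by (simp add: power_less_one_iff)
 next
  case 2
  have "real_of_int (19203 * 4096^2) <= of_int (10000 * ((x - h)^2 + (y - h)^2))" using 2 by (simp only: of_int_le_iff)
  moreover have "(real_of_int (x - h))^2 <= (4096 * Re \<rho>)^2" "(real_of_int (y - h))^2 <= (4096 * Im \<rho>)^2"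
   using Out(2,3) l by (intro power_mono; simp; linarith)+
  ultimately show ?thesis using \<rho>(3) by (simp add: cmod_power2 power_mult_distrib)
 qed
next
 case (In i)
 let ?w = "wlist ! i"
 have c: "small x y h ?w" "leads (%z. max \<bar>fst z\<bar> \<bar>snd z\<bar>) (rad h) (fst (irow (x, y) ?w ([], [(1, 0)])))" using In(1) by simp_all
 obtain H where H: "cmod H <= of_int (rad h)"
  "fst (crow \<rho> ?w (0, 1)) = hs (fst (irow (x, y) ?w ([], [(1, 0)]))) H / 4096 ^ length ?w"
  using crow_irow[OF In(2,3), of ?w] by blast
 obtain z e where z: "hs (fst (irow (x, y) ?w ([], [(1, 0)]))) H = Complex (of_int (fst z)) (of_int (snd z)) + e"
  "cmod e < of_int (max \<bar>fst z\<bar> \<bar>snd z\<bar>)" using leads_cmod[OF c(2) H(1)] by blast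
 have "hs (fst (irow (x, y) ?w ([], [(1, 0)]))) H ~= 0"
 proof
  assume "hs (fst (irow (x, y) ?w ([], [(1, 0)]))) H = 0"
  hence "e = - Complex (of_int (fst z)) (of_int (snd z))" using z(1) by (metis add_eq_0_iff)
  hence "cmod e = cmod (Complex (of_int (fst z)) (of_int (snd z)))" by simp
  thus False using z(2) abs_Re_le_cmod[of "Complex (of_int (fst z)) (of_int (snd z))"]
   abs_Im_le_cmod[of "Complex (of_int (fst z)) (of_int (snd z))"] by (auto simp: max_def split: if_splits)
 qed
 hence "fst (crow \<rho> ?w (0, 1)) ~= 0" using H(2) by simp
 thus ?case using small_correct[OF In(2,3) c(1) \<rho>(2)] \<rho>(1) unfolding wellsep_def by (meson not_less)
next
 case (Ib i)
 let ?w = "wlist ! i"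
 have c: "small x y h ?w" "leads (%z. \<bar>snd z\<bar>) (rad h) (snd (irow (x, y) ?w ([(1, 0)], [])))" using Ib(1) by simp_all
 obtain H where H: "cmod H <= of_int (rad h)"
  "snd (crow \<rho> ?w (1, 0)) = hs (snd (irow (x, y) ?w ([(1, 0)], []))) H / 4096 ^ length ?w"
  using crow_irow[OF Ib(2,3), of ?w] by blast
 obtain z e where z: "hs (snd (irow (x, y) ?w ([(1, 0)], []))) H = Complex (of_int (fst z)) (of_int (snd z)) + e"
  "cmod e < of_int \<bar>snd z\<bar>" using leads_cmod[OF c(2) H(1)] by blast
 have "Im (hs (snd (irow (x, y) ?w ([(1, 0)], []))) H) ~= 0"
  using z abs_Im_le_cmod[of e] by auto
 moreover have "Im (snd (crow \<rho> ?w (1, 0))) = Im (hs (snd (irow (x, y) ?w ([(1, 0)], []))) H) / 4096 ^ length ?w"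
  unfolding H(2) using Im_divide_of_real[of _ "4096 ^ length ?w"] by simp
 ultimately have "Im (snd (crow \<rho> ?w (1, 0))) ~= 0" by simp
 thus ?case using small_correct[OF Ib(2,3) c(1) \<rho>(2)] \<rho>(1) unfolding wellsep_def by (meson not_less)
next
 case (Iu i)
 have c: "small x y h (wlist ! i)" "i = 0 | i = 1" using Iu(1) by auto
 have "fst (crow \<rho> (wlist ! i) (0, 1)) = 0"
  using small_correct[OF Iu(2,3) c(1) \<rho>(2)] \<rho>(1) unfolding wellsep_def by (meson not_less)
 moreover have "fst (crow \<rho> (wlist ! 0) (0, 1)) = \<rho> * (\<rho> - 1)^2" "fst (crow \<rho> (wlist ! 1) (0, 1)) = 2 * \<rho> * (\<rho> - 1)"
  by (simp_all add: wlist_def Let_def power2_eq_square algebra_simps)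
 moreover have "\<rho> ~= 0" using \<rho>(2) by auto
 ultimately show ?case using c(2) by auto
next
 case (Qd a b c d)
 define k where "k = h div 2"
 have h: "h = 2 * k" using Qd(5) by (auto simp: k_def)
 have q: "chk a (x - k) (y - k) k" "chk b (x + k) (y - k) k" "chk c (x - k) (y + k) k" "chk d (x + k) (y + k) k"
  using Qd(5) by (simp_all add: k_def)
 have X: "\<bar>4096 * Re \<rho> - of_int (x - k)\<bar> <= of_int k | \<bar>4096 * Re \<rho> - of_int (x + k)\<bar> <= of_int k"
  using Qd(6) unfolding h by (simp; linarith)
 have Y: "\<bar>4096 * Im \<rho> - of_int (y - k)\<bar> <= of_int k | \<bar>4096 * Im \<rho> - of_int (y + k)\<bar> <= of_int k"
  using Qd(7) unfolding h by (simp; linarith)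
 from X Y show ?case using Qd(1)[OF q(1)] Qd(2)[OF q(2)] Qd(3)[OF q(3)] Qd(4)[OF q(4)] by blast
qed

text \<open>The quarter annulus \<open>1 <= |\<rho>|\<close>, \<open>|\<rho>|^2 < 1.9203\<close>
  fits into a square of side \<open>5760 / 4096\<close> at the origin, which is checked in four
  subsquares. The first lies inside the unit disc; the second contains
  \<open>\<rho> = 1\<close>.\<close>

lemma chk_1: "chk (Out) 1440 1440 1440"
 by code_simp

lemma chk_2: "chk (Qd (Iu 0) (Iu 0) (Iu 0) (Qd (In 0) (In 0) (In 0) (In 0))) 4320 1440 1440"
 by code_simp

lemma chk_3: "chk (Qd (Ib 2) (Qd (Ib 6) (Qd (In 0) (In 0) (In 6) (In 5)) (Qd (In 4) (Ib 6) (In 4) (Ib 7)) (Qd (Ib 6) (Ib 7) (Qd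
  (In 6) (In 6) (In 7) (In 7)) (Qd (In 7) (In 5) (In 7) (In 7)))) (Qd (Ib 2) (Ib 4) (Qd (In 2) (In 10) (Qd (In
  3) (In 3) (Qd (In 3) (In 3) (In 3) (In 3)) (In 3)) (In 3)) (Qd (Ib 10) (Ib 12) (Qd (Ib 10) (Ib 10) (Ib 12) (Qd
  (In 10) (In 10) Out Out)) (Qd (Ib 12) (In 12) Out Out))) (Qd (Ib 7) (Qd (In 7) (In 7) (In 7) (In 7)) (Qd (In
  9) (Ib 9) (Qd (In 9) (In 9) Out Out) Out) (Qd (Qd (In 9) (In 9) (In 9) Out) (Qd (Qd (In 7) (In 7) Out Out) Out
  Out Out) Out Out))) 1440 4320 1440"
 by code_simp

lemma chk_4: "chk (Qd (Qd (In 5) (In 5) (Ib 7) (Ib 5)) (Qd (Qd (In 0) (In 0) (In 5) Out) Out (Qd (In 5) Out Out Out) Out) (Qd (Qd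
  (In 7) (In 5) (Qd (In 7) (In 13) (Qd (In 7) Out Out Out) Out) Out) (Qd (In 5) Out Out Out) Out Out) Out) 4320 4320 1440"
 by code_simp

text \<open>Conjugation and change of sign move \<open>\<rho>\<close> into the first quadrant, where
  the certificate leaves only \<open>\<rho> = 1\<close>. The word \<open>Y\<close> alone already
  gives \<open>|\<rho>| >= 1\<close>.\<close>

theorem wellsep_bound:
 assumes "wellsep \<rho>" "\<rho> ~= 0" "\<rho> ~= 1" "\<rho> ~= - 1"
 shows "19203 / 10000 <= (cmod \<rho>)^2"
proof (rule ccontr)
 assume n: "\<not> ?thesis"
 have one: "1 <= cmod \<rho>" if "wellsep \<rho>" "\<rho> ~= 0" for \<rho>
  using that(1)[unfolded wellsep_def, rule_format, of "[(1, 0)]"] that(2) by (simp add: power2_eq_square)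
 obtain a b c d where "chk a 1440 1440 1440" "chk b 4320 1440 1440" "chk c 1440 4320 1440" "chk d 4320 4320 1440"
  using chk_1 chk_2 chk_3 chk_4 by blast
 hence ex: "chk (Qd a b c d) 2880 2880 2880" by simp
 have q: "\<rho> = 1" if r: "wellsep \<rho>" "\<rho> ~= 0" "(cmod \<rho>)^2 < 19203 / 10000" "0 <= Re \<rho>" "0 <= Im \<rho>" for \<rho>
 proof (rule chk_correct[OF ex _ _ r(1) one[OF r(1,2)] r(3)])
  have "cmod \<rho> <= 5760 / 4096"
  proof (rule power2_le_imp_le)
   show "(cmod \<rho>)^2 <= (5760 / 4096)^2" using r(3) by (simp add: power_divide)
  qed simp
  hence "4096 * Re \<rho> <= 5760" "4096 * Im \<rho> <= 5760"
   using complex_Re_le_cmod[of \<rho>] abs_Im_le_cmod[of \<rho>] by linarith+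
  thus "\<bar>4096 * Re \<rho> - of_int 2880\<bar> <= of_int 2880" "\<bar>4096 * Im \<rho> - of_int 2880\<bar> <= of_int 2880"
   using r(4,5) by simp_all
 qed
 have h: "\<rho> = 1 | \<rho> = -1" if r: "wellsep \<rho>" "\<rho> ~= 0" "(cmod \<rho>)^2 < 19203 / 10000" "0 <= Re \<rho>" for \<rho>
 proof (cases "0 <= Im \<rho>")
  case False
  hence "cnj \<rho> = 1" using q[OF wellsep_cnj[OF r(1)]] r by simp
  thus ?thesis by (metis complex_cnj_cnj complex_cnj_one)
 qed (use q r in blast)
 have "\<rho> = 1 | \<rho> = -1"
 proof (cases "0 <= Re \<rho>")
  case False
  hence "- \<rho> = 1 | - \<rho> = -1" using h[OF wellsep_uminus[OF assms(1)]] assms(2) n by simp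
  thus ?thesis by (metis minus_minus)
 qed (use h[OF assms(1,2)] n in simp)
 thus False using assms by blast
qed

section \<open>Traces and centres\<close>

lemma tr2_mneg [simp]: "tr2 (mneg M) = - tr2 M" by (simp add: tr2_def mneg_def)
lemma tr2_minv [simp]: "tr2 (minv M) = tr2 M" by (simp add: tr2_def minv_def)

lemma fricke:
 "tr2 (minv W *m V *m W *m minv V) + 2 * det2 V * det2 W =
 (tr2 V)^2 * det2 W + (tr2 W)^2 * det2 V + (tr2 (V *m W))^2 - tr2 V * tr2 W * tr2 (V *m W)"
 by (cases V; cases W) (simp add: tr2_def det2_def minv_def power2_eq_square algebra_simps)

lemma tr_minv_mmul: "tr2 (V *m minv W) = tr2 V * tr2 W - tr2 (V *m W)"
 by (cases V; cases W) (simp add: tr2_def minv_def algebra_simps)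

lemma minv_mmul: "minv (A *m B) = minv B *m minv A"
 by (cases A; cases B) (simp add: minv_def algebra_simps)

lemma minv_minv [simp]: "minv (minv A) = A" by (cases A) (simp add: minv_def)
lemma minv_mneg [simp]: "minv (mneg A) = mneg (minv A)" by (cases A) (simp add: minv_def mneg_def)

text \<open>The image of infinity, at which the image of \<open>Binf\<close> is based.\<close>

definition ctr :: "m2 => complex" where "ctr M = e11 M / e21 M"

lemma ctr_peq: "M \<simeq> N ==> ctr M = ctr N" by (auto simp: peq_def ctr_def mneg_def)

lemma ctr_diff:
 assumes "det2 M = 1" "e21 M ~= 0" "e21 (M *m N) ~= 0"
 shows "ctr (M *m N) - ctr M = - e21 N / (e21 M * e21 (M *m N))"
proof -
 obtain a b c d where M: "M = M2 a b c d" by (cases M)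
 obtain a' b' c' d' where N: "N = M2 a' b' c' d'" by (cases N)
 have d: "a * d = 1 + b * c" using assms(1) by (simp add: M det2_def algebra_simps)
 have "(a * a' + b * c') * c - a * (c * a' + d * c') = - c' * (a * d - b * c)" by (simp add: algebra_simps)
 also have "... = - c'" using d by simp
 finally have "(a * a' + b * c') * c - a * (c * a' + d * c') = - c'" .
 moreover have "c * a' + d * c' ~= 0" "c ~= 0" using assms(2,3) by (simp_all add: M N)
 ultimately show ?thesis by (simp add: M N ctr_def diff_frac_eq mult.commute[of c])
qed

lemma ctr_minv_mmul:
 assumes "e21 M ~= 0" "e21 N ~= 0"
 shows "e21 (minv M *m N) = e21 M * e21 N * (ctr M - ctr N)"
 using assms by (cases M; cases N) (simp add: minv_def ctr_def field_simps)

lemma half_neg: "- t - 2 * k = t ==> k = - t" for t k :: complex by (auto simp: complex_eq_iff)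

text \<open>\<open>V\<close> and \<open>W\<close> generate a punctured torus group whose boundary element is translation by \<open>2 m\<close>.\<close>

locale ptorus =
 fixes V W :: m2 and m :: complex
 assumes dV: "det2 V = 1" and dW: "det2 W = 1" and m0: "m ~= 0"
  and P: "minv W *m V *m W *m minv V = mneg (trans2 (2 * m))"
begin

lemma PV: "W *m (mneg (trans2 (2 * m)) *m V) = V *m W"
 unfolding P[symmetric] mmul_assoc mmul_minv(2)[OF dV] by (simp add: mmul_minv(1)[OF dW] flip: mmul_assoc)

text \<open>By the boundary relation each of the three matrices is conjugate to its product with
  \<open>mneg (trans2 (2 * m))\<close>; equality of the traces is a linear equation for the lower
  left entry.\<close>

lemma tr_c: "m * e21 V = - tr2 V" "m * e21 W = - tr2 W" "m * e21 (V *m W) = - tr2 (V *m W)"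
proof -
 have t: "tr2 (mneg (trans2 (2 * m)) *m M) = - tr2 M - 2 * (m * e21 M)" for M
  by (cases M) (simp add: trans2_def tr2_def mneg_def)
 have "tr2 (mneg (trans2 (2 * m)) *m V) = tr2 (minv W *m (V *m W))"
  using PV by (metis mmul_assoc mmul_minv(2)[OF dW] mmul_mid(2))
 also have "... = tr2 V" using tr2_mmul_commute[of "minv W" "V *m W"] by (simp add: mmul_assoc mmul_minv(1)[OF dW])
 finally show "m * e21 V = - tr2 V" unfolding t by (rule half_neg)
 have "tr2 (W *m mneg (trans2 (2 * m))) = tr2 (V *m (W *m minv V))"
  using PV by (metis mmul_assoc mmul_minv(1)[OF dV] mmul_mid(1))
 also have "... = tr2 W" using tr2_mmul_commute[of V "W *m minv V"] by (simp add: mmul_assoc mmul_minv(2)[OF dV])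
 finally show "m * e21 W = - tr2 W" unfolding tr2_mmul_commute[of W] t by (rule half_neg)
 have "V *m W *m mneg (trans2 (2 * m)) = V *m (V *m W *m minv V)"
  unfolding P[symmetric] by (metis mmul_assoc mmul_minv(1)[OF dW] mmul_mid(1))
 hence "tr2 (V *m W *m mneg (trans2 (2 * m))) = tr2 (V *m W)"
  using tr2_mmul_commute[of V "V *m W *m minv V"] by (simp add: mmul_assoc mmul_minv(2)[OF dV])
 thus "m * e21 (V *m W) = - tr2 (V *m W)" unfolding tr2_mmul_commute[of "V *m W"] t by (rule half_neg)
qed

lemma markov: "(tr2 V)^2 + (tr2 W)^2 + (tr2 (V *m W))^2 = tr2 V * tr2 W * tr2 (V *m W)"
proof -
 have "tr2 (mneg (trans2 (2 * m))) = -2" by (simp add: trans2_def tr2_def mneg_def)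
 thus ?thesis using fricke[of W V] dV dW unfolding P by (simp add: algebra_simps)
qed

lemma e21_eq: "e21 V = - tr2 V / m" "e21 W = - tr2 W / m" "e21 (V *m W) = - tr2 (V *m W) / m"
 using tr_c m0 by (simp_all add: field_simps)

text \<open>\<open>PV\<close> exhibits both \<open>V\<close> and \<open>W\<close> as left factors of
  \<open>V *m W\<close>, so both centres can be compared with the centre of the product.\<close>

lemma ctr_VW:
 assumes "tr2 V ~= 0" "tr2 W ~= 0" "tr2 (V *m W) ~= 0"
 shows "ctr W - ctr V = m * ((tr2 V)^2 + (tr2 W)^2) / (tr2 V * tr2 W * tr2 (V *m W))"
proof -
 have "ctr (V *m W) - ctr V = m * tr2 W / (tr2 V * tr2 (V *m W))"
  using ctr_diff[OF dV, of W] assms m0 by (simp add: e21_eq field_simps)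
 moreover have "e21 (mneg (trans2 (2 * m)) *m V) = - e21 V" by (cases V) (simp add: trans2_def mneg_def)
 hence "ctr (V *m W) - ctr W = - m * tr2 V / (tr2 W * tr2 (V *m W))"
  using ctr_diff[OF dW, of "mneg (trans2 (2 * m)) *m V"] assms m0 unfolding PV by (simp add: e21_eq field_simps)
 ultimately have "ctr W - ctr V = m * tr2 W / (tr2 V * tr2 (V *m W)) + m * tr2 V / (tr2 W * tr2 (V *m W))"
  by (simp add: algebra_simps)
 thus ?thesis using assms by (simp add: field_simps power2_eq_square)
qed

lemma Im_ctr:
 assumes l: "cmod m <= cmod (tr2 V)" "cmod m <= cmod (tr2 W)" "cmod m <= cmod (tr2 (V *m W))"
 shows "\<bar>Im ((ctr W - ctr V) / m)\<bar> <= 2 / (cmod m)^2"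
proof -
 define x y z where "x = tr2 V" and "y = tr2 W" and "z = tr2 (V *m W)"
 have mp: "cmod m > 0" using m0 by simp
 have nz: "x ~= 0" "y ~= 0" "z ~= 0" using l mp by (auto simp: x_def y_def z_def)
 have mk: "x^2 + y^2 + z^2 = x * y * z" using markov by (simp add: x_def y_def z_def)
 define q u where "q = (x^2 + y^2) / (x * y * z)" and "u = 1 / x^2 + 1 / y^2"
 have q: "(ctr W - ctr V) / m = q" using ctr_VW nz m0 by (simp add: q_def x_def y_def z_def)
 have "x^2 + y^2 = x * y * z - z^2" using mk by (simp add: algebra_simps)
 hence q1: "q = 1 - z / (x * y)" using nz by (simp add: q_def diff_divide_distrib power2_eq_square)
 have "q = x * y * u / z" using nz by (simp add: q_def u_def field_simps power2_eq_square)
 moreover have "1 - q = z / (x * y)" using q1 by simp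
 ultimately have "q * (1 - q) = (x * y * u / z) * (z / (x * y))" by simp
 hence "q * (1 - q) = u" using nz by simp
 hence qu: "u = 1/4 - (q - 1/2)^2" by (simp add: power2_eq_square algebra_simps)
 have ub: "cmod u <= 2 / (cmod m)^2"
 proof -
  have "1 / (cmod x)^2 <= 1 / (cmod m)^2" "1 / (cmod y)^2 <= 1 / (cmod m)^2"
   using l mp by (auto simp: x_def y_def intro!: divide_left_mono power_mono mult_pos_pos)
  moreover have "cmod u <= 1 / (cmod x)^2 + 1 / (cmod y)^2"
   unfolding u_def using norm_triangle_ineq[of "1 / x^2" "1 / y^2"] by (simp add: norm_divide norm_power)
  ultimately show ?thesis by simp
 qed
 \<comment> \<open>For \<open>q - 1/2 = a + \<i> b\<close> and
   \<open>u = 1/4 - (a + \<i> b)^2\<close> the difference \<open>|u|^2 - b^2\<close> is the square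
   of \<open>1/4 - a^2 - b^2\<close>; hence \<open>|Im q| <= |u|\<close>.\<close>
 define a b where "a = Re q - 1/2" and "b = Im q"
 have u2: "u = Complex (1/4 - a^2 + b^2) (- 2 * a * b)"
  unfolding qu a_def b_def by (simp add: complex_eq_iff power2_eq_square algebra_simps)
 have "(cmod u)^2 - b^2 = (1/4 - a^2 - b^2)^2" unfolding u2 cmod_power2
  by (simp add: power2_eq_square algebra_simps)
 hence "b^2 <= (cmod u)^2" by (metis diff_ge_0_iff_ge zero_le_power2)
 hence "\<bar>b\<bar> <= cmod u" by (metis abs_le_square_iff abs_norm_cancel)
 thus ?thesis using q ub by (simp add: b_def)
qed

end

text \<open>The pair stands for the columns of a matrix multiplied from the right by
  \<open>R_mat\<close> (\<open>True\<close>) or \<open>L_mat\<close> (\<open>False\<close>): a step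
  from one Farey edge to the next.\<close>

fun stp :: "bool list => complex \<times> complex => complex \<times> complex" where
 "stp [] p = p"
| "stp (b # ls) p = stp ls (if b then (fst p, fst p + snd p) else (fst p + snd p, snd p))"

definition letters :: "(nat \<times> nat) list => bool list" where
 "letters w = concat (map (%(p, q). replicate p True @ replicate q False) w)"

lemma stp_append: "stp (xs @ ys) p = stp ys (stp xs p)"
 by (induction xs arbitrary: p) simp_all

lemma stp_True: "stp (replicate p True) (v, w) = (v, of_nat p * v + w)"
 by (induction p arbitrary: w) (simp_all add: algebra_simps)

lemma stp_False: "stp (replicate q False) (v, w) = (v + of_nat q * w, w)"
 by (induction q arbitrary: v) (simp_all add: algebra_simps)

lemma letters_Cons: "letters (pq # w) = replicate (fst pq) True @ replicate (snd pq) False @ letters w"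
 by (simp add: letters_def split_beta)

definition tc :: "complex => m2 => bool" where
 "tc m M \<longleftrightarrow> m * e21 M = - tr2 M & e21 M ~= 0"

lemma tc_peq: "M \<simeq> N ==> tc m M \<longleftrightarrow> tc m N"
proof -
 have "- (m * e21 N) = tr2 N \<longleftrightarrow> m * e21 N = - tr2 N" by (metis minus_minus)
 hence "tc m (mneg N) \<longleftrightarrow> tc m N" by (simp add: tc_def) (simp add: mneg_def)
 thus "M \<simeq> N ==> ?thesis" by (auto simp: peq_def)
qed

declare peq_trans [trans]

lemma tr_peq: "M \<simeq> N ==> cmod (tr2 M) = cmod (tr2 N)" by (auto simp: peq_def)

text \<open>The inverse is based at \<open>- d / c - 0\<close>, that is at \<open>- d / c\<close>,
  and the trace relation \<open>a + d = - m c\<close> turns this into \<open>a / c + m\<close>. Thus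
  a half turn of a slope moves its centre by half the meridian.\<close>

lemma tc_up: assumes "tc m M"
 shows "tc m (minv (trans2 (2 * m) *m M))" "ctr (minv (trans2 (2 * m) *m M)) = ctr M + m"
  "cmod (tr2 (minv (trans2 (2 * m) *m M))) = cmod (tr2 M)"
proof -
 obtain a b c d where M: "M = M2 a b c d" by (cases M)
 have c: "c ~= 0" "m * c = - a - d" using assms by (simp_all add: tc_def M tr2_def)
 hence d: "d = - a - m * c" by simp
 have t: "tr2 (minv (trans2 (2 * m) *m M)) = - tr2 M" by (simp add: tr2_def minv_def trans2_def M d)
 show "tc m (minv (trans2 (2 * m) *m M))" unfolding tc_def t using c by (simp add: M trans2_def minv_def tr2_def)
 show "ctr (minv (trans2 (2 * m) *m M)) = ctr M + m" using c(1) by (simp add: M trans2_def minv_def ctr_def d field_simps)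
 show "cmod (tr2 (minv (trans2 (2 * m) *m M))) = cmod (tr2 M)" unfolding t by simp
qed

lemma tc_down: assumes "tc m M"
 shows "tc m (trans2 (- (2 * m)) *m minv M)" "ctr (trans2 (- (2 * m)) *m minv M) = ctr M - m"
  "cmod (tr2 (trans2 (- (2 * m)) *m minv M)) = cmod (tr2 M)"
proof -
 obtain a b c d where M: "M = M2 a b c d" by (cases M)
 have c: "c ~= 0" "m * c = - a - d" using assms by (simp_all add: tc_def M tr2_def)
 hence d: "d = - a - m * c" by simp
 have t: "tr2 (trans2 (- (2 * m)) *m minv M) = - tr2 M" by (simp add: tr2_def minv_def trans2_def M d)
 show "tc m (trans2 (- (2 * m)) *m minv M)" unfolding tc_def t using c by (simp add: M trans2_def minv_def tr2_def)
 show "ctr (trans2 (- (2 * m)) *m minv M) = ctr M - m" using c(1) by (simp add: M trans2_def minv_def ctr_def d field_simps)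
 show "cmod (tr2 (trans2 (- (2 * m)) *m minv M)) = cmod (tr2 M)" unfolding t by simp
qed

lemma trans_conj:
 "tr2 (trans2 n *m M *m trans2 (- n)) = tr2 M" "e21 (trans2 n *m M *m trans2 (- n)) = e21 M"
 "e21 M ~= 0 ==> ctr (trans2 n *m M *m trans2 (- n)) = ctr M + n"
 by (cases M; simp add: trans2_def tr2_def ctr_def field_simps)+

section \<open>Matrices of slopes for an embedded horoball\<close>

locale mcusp = cusp +
 assumes emb: "inG M ==> mob M ` Binf = Binf | mob M ` Binf \<inter> Binf = {}"
begin

lemma c_ge: "inG M ==> e21 M ~= 0 ==> 1 <= cmod (e21 M)"
 using emb mob_Binf_eq(1) mob_Binf_disjoint inG_det by blast

lemma c_zero: assumes "inG M" "e21 M = 0" shows "mob M ` Binf = Binf"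
 using emb[OF assms(1)] mob_Binf_disjoint[OF inG_det[OF assms(1)]] assms(2) by auto

text \<open>Otherwise \<open>al l\<close> would preserve the horoball at infinity, while it moves
  the tube of \<open>0\<close> to that of \<open>exp l\<close>.\<close>

lemma al_c: assumes "prm l" shows "e21 (al l) ~= 0"
proof
 assume "e21 (al l) = 0"
 hence "exp l = 0"
  using stab_high(2)[OF al(1)[OF assms] c_zero[OF al(1)[OF assms]] al_aff[OF assms]] assms by (simp add: prm_def)
 thus False by simp
qed

definition mu :: complex where "mu = lam / 2"

lemma mu: "lam = 2 * mu" "mu ~= 0" using lam(2) by (simp_all add: mu_def)

lemma al_step: assumes "prm l" shows "al (l + ipi) \<simeq> minv (trans2 (2 * mu) *m al l)"
proof -
 let ?M = "trans2 (2 * mu) *m al l"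
 have d: "det2 ?M = 1" by (simp add: det2_mmul inG_det[OF al(1)[OF assms]])
 have "al (l + ipi) *m ?M \<simeq> mid"
  using al_pi[OF assms] peq_mmul[OF peq_refl peq_mmul[OF lam(1) peq_refl]] peq_sym peq_trans unfolding mu(1) by meson
 hence "al (l + ipi) *m ?M *m minv ?M \<simeq> mid *m minv ?M" by (rule peq_mmul) simp
 thus ?thesis by (simp add: mmul_assoc[of "al _" ?M] mmul_minv(1)[OF d])
qed

lemma al_pi_int:
 assumes "prm l" "tc mu (al l)"
 shows "prm (l + ipi * of_int n) & tc mu (al (l + ipi * of_int n)) &
  ctr (al (l + ipi * of_int n)) = ctr (al l) + of_int n * mu &
  cmod (tr2 (al (l + ipi * of_int n))) = cmod (tr2 (al l))"
proof (induction n rule: int_induct[of _ 0])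
 case (step1 i)
 let ?l = "l + ipi * of_int i"
 have e: "l + ipi * of_int (i + 1) = ?l + ipi" by (simp add: algebra_simps)
 note s = al_step[OF step1(2)[THEN conjunct1]] and p = prm_pi[OF step1(2)[THEN conjunct1]]
 show ?case unfolding e using p step1(2) tc_up[of mu "al ?l"] tc_peq[OF s] ctr_peq[OF s] tr_peq[OF s]
  by (simp add: algebra_simps)
next
 case (step2 i)
 let ?l = "l + ipi * of_int (i - 1)"
 have e: "l + ipi * of_int i = ?l + ipi" by (simp add: algebra_simps)
 have p: "prm (?l + ipi)" using step2(2) unfolding e by blast
 have "prm (?l + ipi + ipi)" by (rule prm_pi[OF p])
 hence pl: "prm ?l" using exp_pi[of "?l + ipi" 0] exp_pi[of ?l 0] by (simp add: prm_def)
 note s = al_step[OF pl]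
 have d: "det2 (al ?l) = 1" using inG_det[OF al(1)[OF pl]] .
 have "trans2 (- (2 * mu)) *m minv (al (?l + ipi)) \<simeq> trans2 (- (2 * mu)) *m minv (minv (trans2 (2 * mu) *m al ?l))"
  using s unfolding peq_def by (elim disjE) simp_all
 also have "trans2 (- (2 * mu)) *m minv (minv (trans2 (2 * mu) *m al ?l)) = al ?l"
  by (simp add: trans2_mmul flip: mmul_assoc) (simp add: trans2_def flip: mid_def)
 finally have s': "trans2 (- (2 * mu)) *m minv (al (?l + ipi)) \<simeq> al ?l" .
 show ?case using pl step2(2) tc_down[of mu "al (?l + ipi)"] tc_peq[OF s'] ctr_peq[OF s'] tr_peq[OF s']
  unfolding e by (simp add: algebra_simps)
qed (use assms in simp)

definition A :: "complex => m2" where "A v = al (Ln v)"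

text \<open>The commutator relation is carried along with the basis: it starts from the two
  triangles at \<open>1\<close> and \<open>\<i>\<close> and survives every Farey step.\<close>

definition gp :: "complex => complex => bool" where
 "gp v w \<longleftrightarrow> (v : lat & 0 <= Re v & 0 <= Im v) & (w : lat & 0 <= Re w & 0 <= Im w) & cr v w = 1 &
  minv (A w) *m A v *m A w *m minv (A v) \<simeq> Pm"

lemma gp_prm: assumes "gp v w" shows "prm (Ln v)" "prm (Ln w)" "v ~= 0" "w ~= 0"
proof -
 show nz: "v ~= 0" "w ~= 0" using assms by (auto simp: gp_def cr_eq)
 show "prm (Ln v)" "prm (Ln w)" using assms prmI[of "Ln v" w] prmI[of "Ln w" v] nz by (simp_all add: gp_def)
qed

lemma gp_det: assumes "gp v w" shows "det2 (A v) = 1" "det2 (A w) = 1" "inG (A v)" "inG (A w)"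
 using al(1) inG_det gp_prm[OF assms] by (simp_all add: A_def)

lemma gp_sum: "gp v w ==> A (v + w) \<simeq> A v *m A w"
 unfolding A_def gp_def by (intro al_add) auto

lemma gp_R: assumes g: "gp v w" shows "gp v (v + w)"
proof -
 let ?VW = "A v *m A w"
 have "minv (A (v + w)) *m A v *m A (v + w) *m minv (A v) \<simeq> minv ?VW *m A v *m ?VW *m minv (A v)"
  using gp_sum[OF g] unfolding peq_def by (elim disjE) simp_all
 also have "minv ?VW *m A v *m ?VW *m minv (A v) = minv (A w) *m (minv (A v) *m A v) *m A v *m A w *m minv (A v)"
  by (simp add: minv_mmul mmul_assoc)
 also have "... \<simeq> Pm" using g mmul_minv(2)[OF gp_det(1)[OF g]] by (simp add: gp_def)
 finally show ?thesis using g by (simp add: gp_def lat_add cr_eq algebra_simps)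
qed

lemma gp_L: assumes g: "gp v w" shows "gp (v + w) w"
proof -
 let ?VW = "A v *m A w"
 have "minv (A w) *m A (v + w) *m A w *m minv (A (v + w)) \<simeq> minv (A w) *m ?VW *m A w *m minv ?VW"
  using gp_sum[OF g] unfolding peq_def by (elim disjE) simp_all
 also have "minv (A w) *m ?VW *m A w *m minv ?VW = minv (A w) *m A v *m A w *m (A w *m minv (A w)) *m minv (A v)"
  by (simp add: minv_mmul mmul_assoc)
 also have "... \<simeq> Pm" using g mmul_minv(1)[OF gp_det(2)[OF g]] by (simp add: gp_def)
 finally show ?thesis using g by (simp add: gp_def lat_add cr_eq algebra_simps)
qed

lemma gp_init: "gp 1 \<i>"
proof -
 have L: "1 : lat" "\<i> : lat" and c: "cr 1 \<i> = 1" by (simp_all add: lat_def cr_eq)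
 have p: "prm (Ln 1)" "prm (Ln \<i>)"
  using prmI[of "Ln 1" \<i>, unfolded exp_Ln[OF one_neq_zero]] prmI[of "Ln \<i>" 1, unfolded exp_Ln[OF complex_i_not_zero]] L c by simp_all
 have d: "det2 (A 1) = 1" "det2 (A \<i>) = 1" using inG_det al(1) p by (simp_all add: A_def)
 have h: "A 1 *m A \<i> \<simeq> A \<i> *m (Pm *m A 1)"
  using peq_trans[OF peq_sym[OF al_add[OF L(1) _ _ L(2) _ _ c]] al_add'] unfolding A_def by simp
 have "minv (A \<i>) *m (A 1 *m A \<i>) *m minv (A 1) \<simeq> minv (A \<i>) *m (A \<i> *m (Pm *m A 1)) *m minv (A 1)"
  by (rule peq_mmul[OF peq_mmul[OF peq_refl h] peq_refl])
 also have "minv (A \<i>) *m (A \<i> *m (Pm *m A 1)) *m minv (A 1) = minv (A \<i>) *m A \<i> *m Pm *m (A 1 *m minv (A 1))"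
  by (simp add: mmul_assoc)
 also have "... = Pm" using mmul_minv(1)[OF d(1)] mmul_minv(2)[OF d(2)] by simp
 finally show ?thesis using L c by (simp add: gp_def mmul_assoc)
qed

text \<open>Only the sign is in question: with the plus sign, equality of the traces of
  \<open>A v\<close> and its conjugate would make the lower left entry of \<open>A v\<close>
  vanish.\<close>

lemma gp_ptorus: assumes g: "gp v w" shows "ptorus (A v) (A w) mu"
proof
 show "det2 (A v) = 1" "det2 (A w) = 1" "mu ~= 0" using gp_det[OF g] mu by auto
 let ?P = "minv (A w) *m A v *m A w *m minv (A v)"
 have "?P \<simeq> trans2 (2 * mu)" using g lam(1) peq_trans unfolding gp_def mu(1) by blast
 moreover have "?P ~= trans2 (2 * mu)"
 proof
  assume e: "?P = trans2 (2 * mu)"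
  have "tr2 (?P *m A v) = tr2 (minv (A w) *m (A v *m A w))"
   by (simp add: mmul_assoc mmul_minv(2)[OF gp_det(1)[OF g]])
  also have "... = tr2 (A v)"
   unfolding tr2_mmul_commute[of "minv (A w)"] by (simp add: mmul_assoc mmul_minv(1)[OF gp_det(2)[OF g]])
  finally have "2 * mu * e21 (A v) = 0" unfolding e by (cases "A v") (simp add: trans2_def tr2_def)
  thus False using mu(2) al_c[OF gp_prm(1)[OF g]] by (simp add: A_def)
 qed
 ultimately show "?P = mneg (trans2 (2 * mu))" by (auto simp: peq_def)
qed

lemma gp_tc: assumes g: "gp v w" shows "tc mu (A v)" "tc mu (A w)"
 using ptorus.tr_c[OF gp_ptorus[OF g]] al_c gp_prm[OF g] unfolding tc_def A_def by blast+

lemma tc_ge: assumes "tc mu M" "inG M" shows "cmod mu <= cmod (tr2 M)"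
proof -
 have "cmod mu * 1 <= cmod mu * cmod (e21 M)" using c_ge[OF assms(2)] assms(1) by (intro mult_left_mono) (auto simp: tc_def)
 also have "... = cmod (tr2 M)" using assms(1) unfolding tc_def by (metis norm_minus_cancel norm_mult)
 finally show ?thesis by simp
qed

lemma gp_ge: assumes g: "gp v w"
 shows "cmod mu <= cmod (tr2 (A v))" "cmod mu <= cmod (tr2 (A w))" "cmod mu <= cmod (tr2 (A v *m A w))"
proof -
 show "cmod mu <= cmod (tr2 (A v))" "cmod mu <= cmod (tr2 (A w))" using tc_ge gp_tc[OF g] gp_det[OF g] by auto
 show "cmod mu <= cmod (tr2 (A v *m A w))"
  using tc_ge[OF gp_tc(2)[OF gp_R[OF g]] gp_det(4)[OF gp_R[OF g]]] tr_peq[OF gp_sum[OF g]] by simp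
qed

lemma gp_stp: "gp v w ==> gp (fst (stp ls (v, w))) (snd (stp ls (v, w)))"
 by (induction ls arbitrary: v w) (use gp_R gp_L in auto)

text \<open>\<open>v\<close> is constant along the letters R of a block and \<open>w'\<close> along
  its letters L, so a block changes the centre only across the edges \<open>(v, w')\<close> and
  \<open>(v', w')\<close>, each costing at most \<open>2 / |mu|^2\<close>.\<close>

lemma stp_ctr:
 assumes "gp v w"
 shows "\<bar>Im ((ctr (A (fst (stp (letters ws) (v, w)))) - ctr (A v)) / mu)\<bar> <= 4 * real (length ws) / (cmod mu)^2"
 using assms
proof (induction ws arbitrary: v w)
 case (Cons pq ws)
 obtain p q where pq: "pq = (p, q)" by (cases pq)
 define w' v' where "w' = of_nat p * v + w" and "v' = v + of_nat q * w'"
 have g1: "gp v w'" using gp_stp[OF Cons(2), of "replicate p True"] by (simp add: stp_True w'_def)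
 have g2: "gp v' w'" using gp_stp[OF g1, of "replicate q False"] by (simp add: stp_False v'_def)
 let ?v = "fst (stp (letters ws) (v', w'))"
 have e: "stp (letters (pq # ws)) (v, w) = stp (letters ws) (v', w')"
  by (simp add: letters_Cons stp_append stp_True stp_False pq v'_def w'_def)
 have "(ctr (A ?v) - ctr (A v)) / mu =
  (ctr (A ?v) - ctr (A v')) / mu + (ctr (A w') - ctr (A v)) / mu - (ctr (A w') - ctr (A v')) / mu"
  by (simp add: diff_divide_distrib)
 hence "\<bar>Im ((ctr (A ?v) - ctr (A v)) / mu)\<bar> <= 4 * real (length ws) / (cmod mu)^2 + 2 / (cmod mu)^2 + 2 / (cmod mu)^2"
  using Cons.IH[OF g2] ptorus.Im_ctr[OF gp_ptorus[OF g1] gp_ge[OF g1]] ptorus.Im_ctr[OF gp_ptorus[OF g2] gp_ge[OF g2]]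
  by (simp only: plus_complex.sel minus_complex.sel)
 thus ?case unfolding e by (simp add: add_divide_distrib ring_distribs)
qed (simp add: letters_def)

end

locale rlcusp = mcusp +
 fixes sg :: real and w :: "(nat \<times> nat) list"
 assumes sg: "sg = 1 | sg = -1" and w: "1 <= length w" "ALL (p, q):set w. 0 < p & 0 < q"
  and lin_1: "lin 1 1 = of_real sg * fst (stp (letters w) (1, \<i>))" "lin 1 \<i> = of_real sg * snd (stp (letters w) (1, \<i>))"
begin

definition Fl :: "complex => complex" where "Fl z = of_real sg * lin 1 z"

lemma sg2: "sg * sg = 1" using sg by auto

lemma Fl_1: "(Fl 1, Fl \<i>) = stp (letters w) (1, \<i>)"
 using sg by (auto simp: Fl_def lin_1 prod_eq_iff)

lemma Fl_lin: "lin 1 z = of_real sg * Fl z"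
 using sg by (auto simp: Fl_def)

text \<open>Conjugation by the \<open>nu\<close> translation moves the centre by \<open>nu\<close>.
  The logarithm of the image slope may be off by half turns, among them the one from the sign of the
  monodromy, and each half turn shifts the centre by \<open>mu\<close>.\<close>

lemma Fl_ctr:
 assumes g: "gp v u | gp u v" "gp (Fl v) u' | gp u' (Fl v)"
 shows "EX m::int. ctr (A (Fl v)) = ctr (A v) + nu - of_int m * mu" "cmod (tr2 (A (Fl v))) = cmod (tr2 (A v))"
proof -
 have p: "prm (Ln v)" "v ~= 0" and p': "prm (Ln (Fl v))" "Fl v ~= 0" "tc mu (A (Fl v))"
  using g gp_prm gp_tc by blast+
 have "exp (Lam 1 (Ln v)) = of_real sg * Fl v" using Lam(2)[of 1 "Ln v"] p(2) by (simp add: Fl_lin)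
 also have "of_real sg * Fl v = exp (Ln (Fl v) + (if sg = 1 then 0 else ipi))"
  using sg p'(2) by (auto simp: exp_add)
 finally obtain n :: int where "Lam 1 (Ln v) = Ln (Fl v) + (if sg = 1 then 0 else ipi) + (of_int (2 * n) * pi) * \<i>"
  unfolding exp_eq by blast
 hence m: "Lam 1 (Ln v) = Ln (Fl v) + ipi * of_int (2 * n + (if sg = 1 then 0 else 1))"
  by (simp add: algebra_simps)
 note s = al_nu[OF p(1)]
 have "ctr (al (Lam 1 (Ln v))) = ctr (A v) + nu" "cmod (tr2 (al (Lam 1 (Ln v)))) = cmod (tr2 (A v))"
  using ctr_peq[OF s] tr_peq[OF s] trans_conj[where n = nu and M = "al (Ln v)"] al_c[OF p(1)] by (simp_all add: A_def)
 thus "EX m::int. ctr (A (Fl v)) = ctr (A v) + nu - of_int m * mu" "cmod (tr2 (A (Fl v))) = cmod (tr2 (A v))"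
  using al_pi_int[OF p'(1), of "2 * n + (if sg = 1 then 0 else 1)"] p'(3) unfolding m A_def
  by (auto simp: algebra_simps intro!: exI[of _ "2 * n + (if sg = 1 then 0 else 1)"])
qed

theorem area_upper: "\<bar>Im (cnj lam * nu)\<bar> <= 8 * real (length w)"
proof -
 let ?s = "stp (letters w) (1, \<i>)"
 have g: "gp (fst ?s) (snd ?s)" by (rule gp_stp[OF gp_init])
 have F: "fst ?s = Fl 1" using Fl_1 by (metis fst_conv)
 obtain m :: int where m: "ctr (A (Fl 1)) = ctr (A 1) + nu - of_int m * mu" using Fl_ctr(1)[of 1 \<i> "snd ?s"] gp_init g F by metis
 have "(ctr (A (Fl 1)) - ctr (A 1)) / mu = nu / mu - of_int m" using mu(2) unfolding m by (simp add: field_simps)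
 hence "\<bar>Im (nu / mu)\<bar> <= 4 * real (length w) / (cmod mu)^2" using stp_ctr[OF gp_init, of w] F by simp
 moreover have "Im (cnj lam * nu) = 2 * (cmod mu)^2 * Im (nu / mu)"
 proof -
  have "cnj lam * nu = 2 * (mu * cnj mu) * (nu / mu)" using mu by simp
  also have "mu * cnj mu = of_real ((cmod mu)^2)" by (rule complex_norm_square[symmetric])
  finally have "cnj lam * nu = of_real (2 * (cmod mu)^2) * (nu / mu)" by simp
  thus ?thesis by (simp only: times_complex.sel Re_complex_of_real Im_complex_of_real)
 qed
 moreover have "0 < (cmod mu)^2" using mu(2) by simp
 ultimately show ?thesis by (simp add: abs_mult field_simps)
qed

end

section \<open>The half translation normalises the group\<close>

text \<open>The open star of \<open>0\<close> in the triangulation with edges \<open>1\<close>,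
  \<open>\<i>\<close> and \<open>1 + \<i>\<close>. Its lattice translates cover the plane, and
  distinct ones that meet have centres joined by an edge.\<close>

definition hex :: "complex => bool" where
 "hex x \<longleftrightarrow> \<bar>Re x\<bar> < 1 & \<bar>Im x\<bar> < 1 & \<bar>Re x - Im x\<bar> < 1"

lemma hex_scale: assumes "hex x" "0 <= r" "r <= 1" shows "hex (of_real r * x)"
proof -
 have "\<bar>r * a\<bar> < 1" if "\<bar>a\<bar> < 1" for a :: real
  using mult_mono[of r 1 "\<bar>a\<bar>" "\<bar>a\<bar>"] assms(2,3) that by (simp add: abs_mult)
 thus ?thesis using assms(1) by (simp add: hex_def flip: right_diff_distrib)
qed

lemma hex_vis: assumes "hex x" "x ~= 0" shows "vis x"
 unfolding vis_def
proof (intro allI impI notI)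
 fix r :: real assume r: "0 < r & r <= 1" and l: "of_real r * x : lat"
 have "hex (of_real r * x)" using hex_scale assms(1) r by simp
 hence "Re (of_real r * x) = 0" "Im (of_real r * x) = 0"
  using l Ints_small unfolding lat_def hex_def by blast+
 hence "of_real r * x = 0" by (simp only: complex_eq_iff zero_complex.sel)
 thus False using r assms(2) by simp
qed

lemma convex_hex: "convex {x. hex x & hex (x - e)}"
proof -
 have c: "convex {x. hex x}"
 proof -
  have l: "\<bar>u * a + v * b\<bar> < 1" if "\<bar>a\<bar> < 1" "\<bar>b\<bar> < 1" "0 <= u" "0 <= v" "u + v = 1" for a b u v :: real
   using convexD[OF convex_real_interval(8)[of "-1" 1], of a b u v] that by (auto simp: abs_less_iff)
  show ?thesis
  proof (rule convexI)
   fix x y :: complex and u v :: real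
   assume *: "x : {x. hex x}" "y : {x. hex x}" "0 <= u" "0 <= v" "u + v = 1"
   have "\<bar>u * (Re x - Im x) + v * (Re y - Im y)\<bar> < 1" by (rule l) (use * in "simp_all add: hex_def")
   thus "u *\<^sub>R x + v *\<^sub>R y : {x. hex x}"
    using * l[of "Re x" "Re y" u v] l[of "Im x" "Im y" u v]
    by (simp add: hex_def algebra_simps)
  qed
 qed
 have "{x. hex x & hex (x - e)} = {x. hex x} \<inter> (+) e ` {x. hex x}"
  by (auto simp: image_iff) (metis add_diff_cancel_left' diff_add_cancel add.commute)
 thus ?thesis using c by (simp add: convex_Int convex_translation)
qed

context cusp
begin

text \<open>\<open>Ps\<close> is locally injective because two logarithms of one point at distance
  below \<open>2\<close> coincide; invariance of domain does the rest.\<close>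

lemma Ps_open: assumes "open U" "U <= Dst" shows "open (Ps ` U)"
proof -
 have "open (Ps ` (U \<inter> ball d 1))" for d
 proof (rule invariance_of_domain)
  show "continuous_on (U \<inter> ball d 1) Ps" by (rule continuous_on_subset[OF Ps_cont]) (use assms in auto)
  show "open (U \<inter> ball d 1)" using assms by blast
  show "inj_on Ps (U \<inter> ball d 1)"
  proof (rule inj_onI)
   fix x y assume xy: "x : U \<inter> ball d 1" "y : U \<inter> ball d 1" "Ps x = Ps y"
   have D: "x : Dst" "y : Dst" using xy assms(2) by auto
   have e: "exp (fst x) = exp (fst y)" "snd x = snd y" using Ps_\<phi>[OF D(1)] Ps_\<phi>[OF D(2)] xy(3) by simp_all
   obtain n :: int where n: "fst x = fst y + (of_int (2 * n) * pi) * \<i>" using e(1) unfolding exp_eq by blast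
   have "dist x y < 2" using xy(1,2) dist_triangle_less_add[of x d 1 y 1] by (auto simp: dist_commute)
   hence d: "cmod (fst x - fst y) < 2" using dist_fst_le[of x y] by (simp add: dist_norm)
   have "n = 0"
   proof (rule ccontr)
    assume "n ~= 0"
    hence "1 <= \<bar>real_of_int n\<bar>" by linarith
    hence "1 * 2 <= \<bar>real_of_int n\<bar> * (2 * pi)" using pi_gt3 by (intro mult_mono) auto
    moreover have "cmod (fst x - fst y) = \<bar>real_of_int n\<bar> * (2 * pi)" unfolding n by (simp add: norm_mult)
    ultimately show False using d by simp
   qed
   thus "x = y" using n e(2) by (simp add: prod_eq_iff)
  qed
 qed
 moreover have "Ps ` U = (\<Union>d\<in>U. Ps ` (U \<inter> ball d 1))" by force
 ultimately show ?thesis by (metis open_UN)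
qed

text \<open>The overlap of the hexagons around \<open>0\<close> and \<open>exp l\<close> is convex
  and visible from both centres, so one matrix compares them there; at the midpoint of the edge it
  is \<open>al l\<close>. Other choices of logarithm add powers of the \<open>lam\<close>
  translation.\<close>

lemma edge_unique:
 assumes l: "prm l" and R: "!!x. hex x ==> hex (x - exp l) ==> 0 < Re (x / exp l) & 0 < Re ((exp l - x) / exp l)"
  and h: "hex (exp l / 2)" "hex (exp l / 2 - exp l)"
  and K: "inG K" and d: "hex (exp z')" "hex (exp z)" "exp z' = exp z + exp l" "mob K (Ps (z, t)) = Ps (z', t)"
 shows "EX i j :: int. K \<simeq> trans2 (of_int i * lam) *m al l *m trans2 (of_int j * lam)"
proof -
 let ?e = "exp l"
 define S where "S = {x. hex x & hex (x - ?e)}"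
 define l1 l2 where "l1 x = Ln (x / ?e) + l" and "l2 x = Ln ((?e - x) / ?e) + (l + ipi)" for x
 have pos: "0 < Re (x / ?e)" "0 < Re ((?e - x) / ?e)" if "x : S" for x using R that by (auto simp: S_def)
 have nz: "x / ?e ~= 0" "(?e - x) / ?e ~= 0" if "x : S" for x using pos[OF that] by (metis less_irrefl zero_complex.sel(1))+
 have c1: "continuous_on S l1" unfolding l1_def
  by (rule continuous_on_add[OF continuous_on_Ln_ReIm continuous_on_const], intro continuous_intros)
   (use pos in "auto simp: not_le dest: less_le_trans")
 have c2: "continuous_on S l2" unfolding l2_def
  by (rule continuous_on_add[OF continuous_on_Ln_ReIm continuous_on_const], intro continuous_intros)
   (use pos in "auto simp: not_le dest: less_le_trans")
 have e: "exp (l1 x) = x - 0" "exp (l2 x) = x - ?e" if "x : S" for x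
  unfolding l1_def l2_def exp_add using nz[OF that] by (simp_all add: field_simps)
 have v: "vis (x - 0)" "vis (x - ?e)" if "x : S" for x
 proof -
  have "x ~= 0" "x - ?e ~= 0" using nz[OF that] by auto
  thus "vis (x - 0)" "vis (x - ?e)" using hex_vis that by (auto simp: S_def)
 qed
 have L: "0 : lat" "?e : lat" using l by (auto simp: prm_def)
 obtain M where M: "inG M" "ALL x:S. ALL t. Ps (l1 x, t) = mob M (Ps (l2 x, t))"
  using frame_logs[OF convex_connected[OF convex_hex[of ?e, folded S_def]] c1 c2 L e v] by blast
 have "M \<simeq> al l"
 proof (rule al_unique[OF l M(1), where s = "1/2" and t = 0])
  have "?e / 2 / ?e = of_real (1/2)" "(?e - ?e / 2) / ?e = of_real (1/2)" by (simp_all add: field_simps)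
  hence "l1 (?e / 2) = l + of_real (ln (1/2))" "l2 (?e / 2) = l + ipi + of_real (ln (1/2))"
   unfolding l1_def l2_def using Ln_of_real[of "1/2"] by (simp_all add: algebra_simps)
  moreover have "?e / 2 : S" using h by (simp add: S_def)
  ultimately show "Ps (l + of_real (ln (1 - 1/2)), 0) = mob M (Ps (l + ipi + of_real (ln (1/2)), 0))"
   using M(2) half_diff by metis
 qed auto
 define x where "x = exp z'"
 have x: "x : S" "exp z' = exp (l1 x)" "exp z = exp (l2 x)" using d e by (simp_all add: S_def x_def)
 obtain i :: int where i: "z' = l1 x + (of_int (2 * i) * pi) * \<i>" using x(2) unfolding exp_eq by blast
 obtain j :: int where j: "z = l2 x + (of_int (2 * j) * pi) * \<i>" using x(3) unfolding exp_eq by blast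
 have D: "(l1 x, t) : Dst" "(l2 x, t) : Dst" "(z, t) : Dst" using v[OF x(1)] e[OF x(1)] x(3) by (simp_all add: Dst_def)
 have iz: "Ps (z', t) = shift (of_int i * lam) (Ps (l1 x, t))" using Ps_2pi[OF D(1), of i] unfolding i by (simp add: algebra_simps)
 have jz: "Ps (z, t) = shift (of_int j * lam) (Ps (l2 x, t))" using Ps_2pi[OF D(2), of j] unfolding j by (simp add: algebra_simps)
 let ?N = "trans2 (of_int i * lam) *m M *m trans2 (of_int (- j) * lam)"
 have G: "inG ?N" by (intro inG_mmul M inG_trans_int lam)
 have "mob K (Ps (z, t)) = mob ?N (Ps (z, t))"
  unfolding d(4) mmul_assoc using Ps_H3[OF D(2)] Ps_H3[OF D(3)] M iz jz x(1)
  by (simp add: mob_mmul inG_det[OF M(1)] det2_mmul)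
 hence "K \<simeq> ?N" by (rule inG_eq[OF K G Ps_H3[OF D(3)]])
 also have "?N \<simeq> trans2 (of_int i * lam) *m al l *m trans2 (of_int (- j) * lam)"
  by (intro peq_mmul peq_refl \<open>M \<simeq> al l\<close>)
 finally show ?thesis by blast
qed

definition nk :: "m2 => int => bool" where "nk M k \<longleftrightarrow> inG M & (EX v. aff M k v)"

lemma nk_mmul: "nk M k ==> nk N j ==> nk (M *m N) (k + j)"
 unfolding nk_def using inG_mmul aff_mmul by blast

lemma nk_peq: "M \<simeq> N ==> nk N k ==> nk M k"
 unfolding nk_def using inG_peq aff_peq by blast

lemma nk_exists: "inG M ==> EX k. nk M k" unfolding nk_def using aff_exists by blast

lemma nk_unique: "nk M k ==> nk M j ==> k = j" unfolding nk_def using aff_unique_k by blast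

lemma nk_lattice: "nk (trans2 (of_int j * lam + of_int k * nu)) k"
 unfolding nk_def using inG_lattice aff_lattice by blast

lemma trans2_0: "trans2 0 = mid" by (simp add: trans2_def mid_def)

lemma nk_minv: assumes "nk M k" shows "nk (minv M) (- k)"
proof -
 obtain j where j: "nk (minv M) j" using nk_exists[OF inG_minv, of M] assms unfolding nk_def[of M] by blast
 have "nk mid (k + j)" using nk_mmul[OF assms j] assms by (simp add: nk_def mmul_minv(1)[OF inG_det])
 moreover have "nk mid 0" using nk_lattice[of 0 0] by (simp add: trans2_0)
 ultimately have "j = - k" using nk_unique by fastforce
 thus ?thesis using j by simp
qed

end

context mcusp
begin

definition tn :: "int => m2 => m2" where "tn n M = trans2 (of_int n * mu) *m M *m trans2 (- (of_int n * mu))"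

lemma tn_mmul: "tn n (M *m N) = tn n M *m tn n N"
proof -
 have "trans2 (- x) *m (trans2 x *m N) = N" for x N by (simp add: trans2_mmul trans2_0 flip: mmul_assoc)
 thus ?thesis by (simp add: tn_def mmul_assoc)
qed

lemma tn_trans2 [simp]: "tn n (trans2 b) = trans2 b" by (simp add: tn_def trans2_mmul)

lemma tn_tn: "tn i (tn j M) = tn (i + j) M"
proof -
 have "tn i (tn j M) = (trans2 (of_int i * mu) *m trans2 (of_int j * mu)) *m M *m (trans2 (- (of_int j * mu)) *m trans2 (- (of_int i * mu)))"
  unfolding tn_def mmul_assoc ..
 thus ?thesis by (simp add: tn_def trans2_mmul ring_distribs add.commute)
qed

lemma tn_0 [simp]: "tn 0 M = M" by (simp add: tn_def trans2_0)

lemma tn_minv: "tn n (minv M) = minv (tn n M)"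
 by (cases M) (simp add: tn_def trans2_def minv_def algebra_simps)

lemma tn_peq: "M \<simeq> N ==> tn n M \<simeq> tn n N" unfolding tn_def by (intro peq_mmul peq_refl)

definition tH :: "m2 => bool" where "tH M \<longleftrightarrow> (EX k. nk M k & nk (tn 1 M) k)"

lemma tH_mmul: "tH M ==> tH N ==> tH (M *m N)"
 unfolding tH_def tn_mmul using nk_mmul by blast

lemma tH_minv: "tH M ==> tH (minv M)"
 unfolding tH_def tn_minv using nk_minv by blast

lemma tH_peq: "M \<simeq> N ==> tH N ==> tH M"
 unfolding tH_def using nk_peq tn_peq by blast

lemma tH_lattice: "tH (trans2 (of_int j * lam + of_int k * nu))"
 unfolding tH_def tn_trans2 using nk_lattice by blast

lemma tH_lam: "tH (trans2 (of_int j * lam))" using tH_lattice[of j 0] by simp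

text \<open>The half translation induces the hyperelliptic involution of the fibre, a half turn
  around the puncture: it takes \<open>al l\<close> to \<open>al (l + ipi)\<close>, which is again
  in the group.\<close>

lemma tH_al: assumes "prm l" "tc mu (al l)" shows "tH (al l)"
proof -
 have nk0: "nk (al l) 0" if "prm l" for l using al(1)[OF that] al_aff[OF that] by (auto simp: nk_def)
 obtain a b c d where M: "al l = M2 a b c d" by (cases "al l")
 have d: "d = - a - mu * c" using assms(2) by (simp add: tc_def M tr2_def)
 have "tn 1 (al l) = mneg (minv (trans2 (2 * mu) *m al l))"
  by (simp add: tn_def M trans2_def minv_def mneg_def d algebra_simps)
 hence "tn 1 (al l) \<simeq> al (l + ipi)"
  using al_step[OF assms(1)] peq_sym by (auto simp: peq_def)
 hence "nk (tn 1 (al l)) 0" using nk_peq nk0[OF prm_pi[OF assms(1)]] by blast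
 thus ?thesis using nk0[OF assms(1)] unfolding tH_def by blast
qed

text \<open>Hexagon charts that overlap are based at equal or adjacent lattice points, so the
  transition is a power of the \<open>lam\<close> translation or comes from \<open>al\<close> on one
  of the three edges.\<close>

lemma overlap_tH:
 assumes K: "nk K 0" and d: "d : Dst" "d' : Dst" "hex (exp (fst d))" "hex (exp (fst d'))" "mob K (Ps d) = Ps d'"
 shows "tH K"
proof -
 obtain v where v: "v : lat" "aff K 0 v"
  using K aff_exists[of K] aff_unique_k unfolding nk_def by metis
 have iK: "inG K" using K by (simp add: nk_def)
 have "(exp (fst d'), snd d') = (lin 0 (exp (fst d)) + v, snd d - of_int 0)"
  using v(2) Ps_H3[OF d(1)] Ps_\<phi>[OF d(1)] Ps_\<phi>[OF d(2)] d(5) unfolding aff_def by (metis fst_conv snd_conv)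
 hence e: "exp (fst d') = exp (fst d) + v" "snd d' = snd d" by (simp_all add: lin_0)
 have E: "tH K" if a: "A u = al (Ln u)" "prm (Ln u)" "tc mu (al (Ln u))" "u ~= 0" "v = u | v = - u" "hex (u / 2)"
  "!!x. hex x ==> hex (x - u) ==> 0 < Re (x / u) & 0 < Re ((u - x) / u)" for u
 proof -
  have "u / 2 - u = - (u / 2)" by simp
  hence h2: "hex (u / 2 - u)" using a(6) by (simp only: hex_def uminus_complex.sel abs_minus_cancel minus_diff_minus)
  have X: "tH L" if L: "inG L" "hex (exp z')" "hex (exp z)" "exp z' = exp z + u" "mob L (Ps (z, t)) = Ps (z', t)" for L z z' t
  proof -
   have "EX i j :: int. L \<simeq> trans2 (of_int i * lam) *m al (Ln u) *m trans2 (of_int j * lam)"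
    by (rule edge_unique[OF a(2) _ _ _ L(1-3) _ L(5)]) (use a L h2 in simp_all)
   thus ?thesis using tH_peq tH_mmul tH_lam tH_al[OF a(2,3)] by blast
  qed
  show ?thesis using a(5)
  proof
   assume "v = u"
   thus ?thesis using X[OF iK d(4,3), of "snd d"] e d(5) by (metis prod.collapse)
  next
   assume "v = - u"
   hence "exp (fst d) = exp (fst d') + u" using e(1) by simp
   moreover have "mob (minv K) (Ps d') = Ps d"
    using mob_minv(1)[OF inG_det[OF iK] Ps_H3[OF d(1)]] unfolding d(5) .
   ultimately have "tH (minv K)" using X[OF inG_minv[OF iK] d(3,4), of "snd d"] e(2) by (metis prod.collapse)
   thus ?thesis using tH_minv by fastforce
  qed
 qed
 have "\<bar>Re v\<bar> < 2" "\<bar>Im v\<bar> < 2" "\<bar>Re v - Im v\<bar> < 2" using d(3,4) e(1) by (auto simp: hex_def)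
 moreover obtain a b :: int where ab: "Re v = of_int a" "Im v = of_int b" using v(1) by (auto simp: lat_def elim!: Ints_cases)
 ultimately have "\<bar>a\<bar> < 2" "\<bar>b\<bar> < 2" "\<bar>a - b\<bar> < 2" by linarith+
 hence "(a = 0 & b = 0) | (a = 1 & b = 0 | a = -1 & b = 0) | (a = 0 & b = 1 | a = 0 & b = -1) | (a = 1 & b = 1 | a = -1 & b = -1)"
  by presburger
 hence "v = 0 | (v = 1 | v = - 1) | (v = \<i> | v = - \<i>) | (v = 1 + \<i> | v = - (1 + \<i>))"
  using ab by (auto simp: complex_eq_iff)
 thus ?thesis
 proof (elim disjE[of "v = 0"] disjE[of "v = 1 | v = - 1"] disjE[of "v = \<i> | v = - \<i>"])
  assume "v = 0"
  hence "exp (fst d') = exp (fst d)" using e(1) by simp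
  then obtain n :: int where n: "fst d' = fst d + (of_int (2 * n) * pi) * \<i>" unfolding exp_eq by blast
  have "d' = (fst d + tpi * of_int n, snd d)" using n e(2) by (simp add: prod_eq_iff algebra_simps)
  hence "mob K (Ps d) = mob (trans2 (of_int n * lam)) (Ps d)" using Ps_2pi[OF d(1), of n] d(5) by simp
  hence "K \<simeq> trans2 (of_int n * lam)" by (rule inG_eq[OF iK inG_trans_int[OF lam(3)] Ps_H3[OF d(1)]])
  thus ?thesis using tH_peq tH_lam by blast
 next
  assume "v = 1 | v = - 1"
  thus ?thesis using gp_prm(1)[OF gp_init] gp_tc(1)[OF gp_init]
   by (intro E[of 1]) (auto simp: A_def hex_def)
 next
  assume "v = \<i> | v = - \<i>"
  thus ?thesis using gp_prm(2)[OF gp_init] gp_tc(2)[OF gp_init]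
   by (intro E[of \<i>]) (auto simp: A_def hex_def)
 next
  assume vv: "v = 1 + \<i> | v = - (1 + \<i>)"
  have dv: "x / (1 + \<i>) = x * (1 - \<i>) / 2" for x by (simp add: complex_eq_iff Re_divide Im_divide)
  show ?thesis
  proof (rule E[of "1 + \<i>", OF A_def _ _ _ vv])
   show "prm (Ln (1 + \<i>))" "tc mu (al (Ln (1 + \<i>)))" "1 + \<i> ~= 0"
    using gp_prm(2)[OF gp_R[OF gp_init]] gp_tc(2)[OF gp_R[OF gp_init]] gp_prm(4)[OF gp_R[OF gp_init]] by (auto simp: A_def)
   show "hex ((1 + \<i>) / 2)" by (simp add: hex_def)
   show "0 < Re (x / (1 + \<i>)) & 0 < Re ((1 + \<i> - x) / (1 + \<i>))" if "hex x" "hex (x - (1 + \<i>))" for x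
    using that unfolding dv by (auto simp: hex_def)
  qed
 qed
qed

lemma hex_cover:
 assumes p: "p : H3" shows "EX M d. nk M 0 & d : Dst & hex (exp (fst d)) & p = mob M (Ps d)"
proof -
 define x where "x = fst (\<phi> p)"
 have xl: "x ~: lat" using \<phi>_in[OF p] by (simp add: Epl_def mem_Times_iff x_def)
 define v where "v = Complex (of_int \<lfloor>Re x\<rfloor>) (of_int \<lfloor>Im x\<rfloor>)"
 have v: "v : lat" by (simp add: v_def lat_def)
 have nz: "x - v ~= 0" using xl v by auto
 have "\<bar>(a - of_int \<lfloor>a\<rfloor>) - (b - of_int \<lfloor>b\<rfloor>)\<bar> < 1" "\<bar>a - of_int \<lfloor>a\<rfloor>\<bar> < 1" for a b :: real by linarith+
 hence hx: "hex (x - v)" by (simp add: hex_def v_def)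
 define d where "d = (Ln (x - v), snd (\<phi> p))"
 have d: "d : Dst" "exp (fst d) = x - v" using hex_vis[OF hx nz] nz by (simp_all add: d_def Dst_def)
 have "qrel lin (\<phi> (Ps d)) (\<phi> p)"
  unfolding Ps_\<phi>[OF d(1)] d(2) using qrel_translate[OF v, of x "x - v" "snd d"] by (simp add: x_def d_def)
 then obtain M where M: "inG M" "p = mob M (Ps d)" using inG_rel[OF Ps_H3[OF d(1)] p] by blast
 obtain k u where k: "aff M k u" using aff_exists[OF M(1)] by blast
 hence "snd (\<phi> p) = snd d - of_int k" using M(2) Ps_H3[OF d(1)] Ps_\<phi>[OF d(1)] by (simp add: aff_def)
 hence "k = 0" by (simp add: d_def)
 hence "nk M 0" using M(1) k by (auto simp: nk_def)
 thus ?thesis using M(2) d hx by metis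
qed

lemma overlap_tH2:
 assumes M: "nk M 0" "nk N 0" and d: "d : Dst" "d' : Dst" "hex (exp (fst d))" "hex (exp (fst d'))" "mob M (Ps d) = mob N (Ps d')" and N: "tH N"
 shows "tH M"
proof -
 have iM: "inG M" "inG N" using M by (auto simp: nk_def)
 have "nk (minv N *m M) 0" using nk_mmul[OF nk_minv[OF M(2)] M(1)] by simp
 moreover have "mob (minv N *m M) (Ps d) = Ps d'"
  using mob_mmul[OF inG_det[OF iM(1)] Ps_H3[OF d(1)]] d(5) mob_minv(1)[OF inG_det[OF iM(2)] Ps_H3[OF d(2)]] by simp
 ultimately have "tH (minv N *m M)" using overlap_tH d by blast
 hence "tH (N *m (minv N *m M))" using tH_mmul N by blast
 thus ?thesis by (simp add: mmul_minv(1)[OF inG_det[OF iM(2)]] flip: mmul_assoc)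
qed

text \<open>Generation by transitions, put as a connectedness argument: the translates of the
  hexagon chart by elements with and without \<open>tH\<close> form two open sets that cover
  \<open>H3\<close> and cannot overlap.\<close>

lemma nk0_tH: assumes M: "nk M 0" shows "tH M"
proof -
 define Q where "Q = {d : Dst. hex (exp (fst d))}"
 have oQ: "open Q"
 proof -
  have "open {x. hex x}" unfolding hex_def by (intro open_Collect_conj open_Collect_less continuous_intros)
  moreover have "continuous_on UNIV (%d :: point3. exp (fst d))" by (intro continuous_intros)
  ultimately have "open ((%d :: point3. exp (fst d)) -` {x. hex x})" using open_vimage by blast
  moreover have "Q = Dst \<inter> (%d. exp (fst d)) -` {x. hex x}" by (auto simp: Q_def)
  ultimately show ?thesis using open_Dst by (simp add: open_Int)
 qed
 define U where "U b = (\<Union>N\<in>{N. nk N 0 & tH N = b}. mob N ` Ps ` Q)" for b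
 have oU: "open (U b)" for b
 proof -
  have "open (mob N ` Ps ` Q)" if "nk N 0" for N
  proof -
   have i: "inG N" using that by (simp add: nk_def)
   obtain g where g: "g : G" "ALL p:H3. g p = mob N p" using i by (rule inG_E)
   have s: "Ps ` Q <= H3" using Ps_H3 by (auto simp: Q_def)
   have "open (g ` Ps ` Q)" by (rule c.act_open_image[OF g(1) Ps_open[OF oQ] s]) (auto simp: Q_def)
   moreover have "g ` Ps ` Q = mob N ` Ps ` Q" using g(2) s by (intro image_cong) auto
   ultimately show ?thesis by simp
  qed
  thus ?thesis unfolding U_def by blast
 qed
 have cov: "H3 <= U True \<union> U False"
 proof
  fix p assume "p : H3"
  then obtain M d where "nk M 0" "d : Dst" "hex (exp (fst d))" "p = mob M (Ps d)" using hex_cover by metis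
  thus "p : U True \<union> U False" by (cases "tH M") (auto simp: U_def Q_def)
 qed
 have dis: "U True \<inter> U False \<inter> H3 = {}"
 proof (rule ccontr)
  assume "U True \<inter> U False \<inter> H3 ~= {}"
  then obtain p where p: "p : U True" "p : U False" by blast
  obtain N d where N: "nk N 0 & tH N = True" "d : Q" "p = mob N (Ps d)"
   using p(1) unfolding U_def by (elim UN_E imageE) (rule that, simp_all)
  obtain N' d' where N': "nk N' 0 & tH N' = False" "d' : Q" "p = mob N' (Ps d')"
   using p(2) unfolding U_def by (elim UN_E imageE) (rule that, simp_all)
  show False using overlap_tH2[of N' N d' d] N N' by (simp add: Q_def)
 qed
 obtain d where d: "d : Q"
 proof -
  have "(0 :: complex, 1) : H3" by (simp add: H3_iff)
  from hex_cover[OF this] show ?thesis by (elim exE conjE) (rule that, simp add: Q_def)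
 qed
 have mid: "nk mid 0" "tH mid" using nk_lattice[of 0 0] tH_lattice[of 0 0] by (simp_all add: trans2_0)
 have "Ps d : U True" unfolding U_def using d mid by (auto intro!: bexI[of _ mid] simp: image_image)
 moreover have "Ps d : H3" using d Ps_H3 by (simp add: Q_def)
 ultimately have "U True \<inter> H3 ~= {}" by blast
 hence F: "U False \<inter> H3 = {}"
  using connectedD[OF convex_connected[OF convex_H3] oU[of True] oU[of False] dis cov] by blast
 show ?thesis
 proof (rule ccontr)
  assume "\<not> tH M"
  hence "mob M (Ps d) : U False" using M d by (auto simp: U_def)
  moreover have "mob M (Ps d) : H3" using M d inG_mob_H3 Ps_H3 by (simp add: Q_def nk_def)
  ultimately show False using F by blast
 qed
qed

lemma nk_tn: "nk M 0 ==> nk (tn n M) 0"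
proof (induction n rule: int_induct[of _ 0])
 case (step1 i)
 hence "tH (tn i M)" using nk0_tH by blast
 hence "nk (tn 1 (tn i M)) 0" unfolding tH_def using nk_unique step1 by blast
 thus ?case by (simp add: tn_tn add.commute)
next
 case (step2 i)
 hence "tH (tn i M)" using nk0_tH by blast
 hence "nk (tn 1 (tn i M)) 0" unfolding tH_def using nk_unique step2 by blast
 hence n: "nk (tn (i + 1) M) 0" by (simp add: tn_tn add.commute)
 \<comment> \<open>Two half translations make up an element of the group, so a step down is a step
   up followed by an inner conjugation.\<close>
 have t: "tn (-2) N = trans2 (of_int (-1) * lam) *m N *m trans2 (of_int 1 * lam)" for N by (simp add: tn_def mu(1))
 have "nk (tn (-2) (tn (i + 1) M)) (0 + 0 + 0)"
  unfolding t using nk_lattice[of "-1" 0] nk_lattice[of 1 0] by (intro nk_mmul n) simp_all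
 thus ?case by (simp add: tn_tn)
qed simp

end

locale maxcusp = mcusp +
 assumes tangent: "EX f. inG f & cmod (e21 f) = 1"
begin

text \<open>The group of fibre elements (exponent \<open>0\<close>) extended by the half
  translation; \<open>M\<close> lies in the coset of its \<open>- n\<close>-th power.\<close>

definition tG :: "m2 => int => bool" where "tG M n \<longleftrightarrow> nk (trans2 (of_int n * mu) *m M) 0"

lemma tG_mmul: assumes "tG M n" "tG N k" shows "tG (M *m N) (n + k)"
proof -
 let ?t = "%n. trans2 (of_int n * mu)"
 have "nk (tn k (?t n *m M)) 0" using nk_tn assms(1) by (simp add: tG_def)
 hence "nk (tn k (?t n *m M) *m (?t k *m N)) (0 + 0)" using nk_mmul assms(2) unfolding tG_def by blast
 also have "tn k (?t n *m M) *m (?t k *m N) = ?t k *m ?t n *m M *m (trans2 (- (of_int k * mu)) *m ?t k) *m N"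
  unfolding tn_def mmul_assoc ..
 also have "... = ?t (n + k) *m (M *m N)" by (simp add: trans2_mmul trans2_0 mmul_assoc ring_distribs add.commute)
 finally show ?thesis by (simp add: tG_def)
qed

lemma tG_minv: assumes "tG M n" shows "tG (minv M) (- n)"
proof -
 let ?t = "trans2 (of_int n * mu)"
 have "nk (minv (?t *m M)) 0" using nk_minv[of "?t *m M" 0] assms by (simp add: tG_def)
 hence "nk (tn (- n) (minv (?t *m M))) 0" by (rule nk_tn)
 also have "tn (- n) (minv (?t *m M)) = trans2 (of_int (- n) * mu) *m minv M *m (minv ?t *m ?t)"
  by (simp add: tn_def minv_mmul mmul_assoc)
 also have "minv ?t *m ?t = mid" by (simp add: mmul_minv)
 finally show ?thesis by (simp add: tG_def)
qed

lemma tG_pow: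
 assumes M: "tG (f 1) n" and f: "!!i j :: int. f i *m f j = f (i + j)" "minv (f 1) = f (-1)" "f 0 = mid"
 shows "tG (f k) (k * n)"
proof (induction k rule: int_induct[of _ 0])
 case base thus ?case using nk_lattice[of 0 0] by (simp add: f tG_def trans2_0)
next
 case (step1 i) thus ?case using tG_mmul[OF step1(2) M] by (simp add: f algebra_simps)
next
 case (step2 i) thus ?case using tG_mmul[OF step2(2) tG_minv[OF M]] by (simp add: f algebra_simps)
qed

text \<open>Multiplying by a translation from the left keeps the lower left entry, so the
  disjointness bound passes to the extended group.\<close>

lemma tG_c: assumes "tG M n"
 shows "e21 M ~= 0 ==> 1 <= cmod (e21 M)" "e21 M = 0 ==> EX k::int. M \<simeq> trans2 (of_int k * mu)"
proof -
 let ?M = "trans2 (of_int n * mu) *m M"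
 have e: "e21 ?M = e21 M" by (cases M) (simp add: trans2_def)
 have i: "inG ?M" using assms by (simp add: tG_def nk_def)
 show "e21 M ~= 0 ==> 1 <= cmod (e21 M)" using c_ge[OF i] e by simp
 assume "e21 M = 0"
 hence B: "mob ?M ` Binf = Binf" using c_zero[OF i] e by simp
 obtain k v where kv: "v : lat" "aff ?M k v" using aff_exists[OF i] by blast
 have "k = 0" using kv(2) assms aff_unique_k unfolding tG_def nk_def by blast
 then obtain j :: int where "?M \<simeq> trans2 (of_int j * lam)" using stabiliser[OF i B kv(2,1)] by auto
 hence "trans2 (of_int (- n) * mu) *m ?M \<simeq> trans2 (of_int (- n) * mu) *m trans2 (of_int j * lam)" by (rule peq_mmul[OF peq_refl])
 moreover have "trans2 (of_int (- n) * mu) *m ?M = M" by (simp add: trans2_mmul trans2_0 flip: mmul_assoc)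
 ultimately have "M \<simeq> trans2 (of_int (2 * j - n) * mu)" by (simp add: trans2_mmul mu(1) algebra_simps)
 thus "EX k::int. M \<simeq> trans2 (of_int k * mu)" by blast
qed

text \<open>An element of order three is elliptic; it fixes the top of its axis.\<close>

lemma no_order_3: assumes "inG M" "tr2 M = 1" "e21 M ~= 0" shows False
proof -
 obtain a b c d where M: "M = M2 a b c d" by (cases M)
 have c: "c ~= 0" and d: "d = 1 - a" and det: "a * d - b * c = 1"
  using assms inG_det[OF assms(1)] by (simp_all add: M tr2_def det2_def algebra_simps)
 define t where "t = sqrt 3 / (2 * cmod c)"
 define z where "z = (a - d) / (2 * c)"
 have cz: "c * z + d = 1/2" using c by (simp add: z_def d field_simps)
 have t2: "t^2 * (cmod c)^2 = 3/4" using c by (simp add: t_def power_divide power_mult_distrib field_simps)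
 have h: "hden M (z, t) = 1"
 proof -
  have "hden M (z, t) = (cmod (1/2))^2 + t^2 * (cmod c)^2" by (simp add: hden_def M cz mult.commute)
  thus ?thesis unfolding t2 by (simp add: norm_divide power_divide)
 qed
 have "hnum M (z, t) = (a * z + b) / 2 + a * cnj c * (of_real t)^2" by (simp add: hnum_def M cz)
 also have "cnj c * (of_real t)^2 = 3 / (4 * c)"
 proof -
  have "c * (cnj c * (of_real t)^2) = (c * cnj c) * of_real (t^2)" by simp
  also have "... = of_real ((cmod c)^2) * of_real (t^2)" unfolding complex_norm_square ..
  also have "... = of_real (t^2 * (cmod c)^2)" by (simp add: mult.commute)
  also have "... = 3 / 4" unfolding t2 by simp
  finally show ?thesis using c by (simp add: field_simps)
 qed
 hence "a * cnj c * (of_real t)^2 = a * (3 / (4 * c))" by (simp add: mult.assoc)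
 also have "a * z + b = (a - 2) / (2 * c)"
 proof -
  have bc: "b * c = a * d - 1" using det by (simp add: algebra_simps)
  have "(a * z + b) * (2 * c) = a * (a - d) + 2 * (b * c)" using c by (simp add: z_def field_simps)
  also have "... = a - 2" unfolding bc d by (simp add: algebra_simps)
  finally have "(a * z + b) * (2 * c) = a - 2" .
  thus ?thesis using c by (simp add: field_simps)
 qed
 finally have "hnum M (z, t) = (a - 2) / (2 * c) / 2 + a * (3 / (4 * c))" .
 also have "... = z" using c by (simp add: z_def d field_simps)
 finally have "mob M (z, t) = (z, t)" by (simp add: mob_def h)
 moreover have "(z, t) : H3" using c by (simp add: H3_iff t_def)
 ultimately have "M \<simeq> mid" using inG_free[OF assms(1)] by blast
 thus False using c by (auto simp: peq_def M mid_def mneg_def)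
qed

theorem mu_bound: "19203 / 10000 <= cmod mu ^ 4"
proof -
 obtain f0 where f0: "inG f0" "cmod (e21 f0) = 1" using tangent by blast
 obtain k0 where k0: "nk f0 k0" using nk_exists[OF f0(1)] by blast
 \<comment> \<open>A power of the \<open>nu\<close> translation makes the tangency element a fibre
   element without changing its lower left entry.\<close>
 define f where "f = f0 *m trans2 (of_int (- k0) * nu)"
 have f: "nk f 0" using nk_mmul[OF k0 nk_lattice[of 0 "- k0"]] by (simp add: f_def)
 have df: "det2 f = 1" using f inG_det by (simp add: nk_def)
 define a b c d where "a = e11 f" and "b = e12 f" and "c = e21 f" and "d = e22 f"
 have F: "f = M2 a b c d" by (simp add: a_def b_def c_def d_def)
 have c1: "cmod c = 1" using f0(2) by (cases f0) (simp add: c_def f_def trans2_def)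
 hence c0: "c ~= 0" by auto
 have ad: "a * d = 1 + b * c" using df by (simp add: F det2_def algebra_simps)
 define \<kappa> \<rho> where "\<kappa> = a / c" and "\<rho> = c^2 * mu^2"
 have \<rho>: "cmod \<rho> = (cmod mu)^2" "\<rho> ~= 0" using c1 c0 mu(2) by (simp_all add: \<rho>_def norm_mult norm_power)
 \<comment> \<open>Conjugation by \<open>z -> mu z + \<kappa>\<close>. It turns \<open>X 1\<close>
   into the half translation and \<open>Y 1\<close> into the conjugate of the half translation by
   \<open>f\<close>.\<close>
 define cj where "cj N = M2 (e11 N + \<kappa> * e21 N / mu) (mu * e12 N + \<kappa> * e22 N - \<kappa> * e11 N - \<kappa>^2 * e21 N / mu)
  (e21 N / mu) (e22 N - \<kappa> * e21 N / mu)" for N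
 have cjm: "cj M *m cj N = cj (M *m N)" for M N
  using mu(2) by (cases M; cases N) (simp add: cj_def field_simps power2_eq_square)
 have cji: "minv (cj N) = cj (minv N)" for N
  by (cases N) (simp add: cj_def minv_def algebra_simps)
 have cj1: "cj mid = mid" by (simp add: cj_def mid_def)
 define X Y where "X i = M2 1 (of_int i) 0 1" and "Y i = M2 1 0 (- of_int i * \<rho>) 1" for i :: int
 have XY: "X i *m X j = X (i + j)" "Y i *m Y j = Y (i + j)" "minv (X i) = X (- i)" "minv (Y i) = Y (- i)" "X 0 = mid" "Y 0 = mid" for i j
  by (simp_all add: X_def Y_def minv_def mid_def algebra_simps)
 have tX: "tG (cj (X 1)) (-1)"
 proof -
  have "trans2 (of_int (-1) * mu) *m cj (X 1) = trans2 0" by (simp add: cj_def X_def trans2_def)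
  thus ?thesis using nk_lattice[of 0 0] by (simp add: tG_def)
 qed
 have tY: "tG (cj (Y 1)) (-1)"
 proof -
  have tf: "tG f 0" using f by (simp add: tG_def trans2_0)
  have X1: "cj (X 1) = M2 1 mu 0 1" by (simp add: cj_def X_def)
  have 1: "1 + \<kappa> * (- \<rho>) / mu = 1 - a * c * mu" "- \<rho> / mu = - c * c * mu" "1 - \<kappa> * (- \<rho>) / mu = 1 + a * c * mu"
   "- (\<kappa>^2 * (- \<rho>) / mu) = a * a * mu"
   using c0 mu(2) by (simp_all add: \<kappa>_def \<rho>_def field_simps power2_eq_square)
  have "cj (Y 1) = M2 (1 - a * c * mu) (a * a * mu) (- c * c * mu) (1 + a * c * mu)"
   unfolding cj_def Y_def using 1 by (simp add: algebra_simps)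
  also have "... = f *m cj (X 1) *m minv f" unfolding X1 F minv_def using ad by (simp add: algebra_simps)
  finally show ?thesis using tG_mmul[OF tG_mmul[OF tf tX] tG_minv[OF tf]] by simp
 qed
 have tXn: "tG (cj (X i)) (i * -1)" and tYn: "tG (cj (Y i)) (i * -1)" for i
  by (rule tG_pow[where f = "%i. cj (X i)", OF tX] tG_pow[where f = "%i. cj (Y i)", OF tY]; simp add: cjm XY cji cj1)+
 have word: "EX N n. det2 N = 1 & tG (cj N) n & crow \<rho> w (e11 M, e12 M) = (e11 N, e12 N) & crow \<rho> w (e21 M, e22 M) = (e21 N, e22 N)"
  if "det2 M = 1" "tG (cj M) k" for w M k
  using that
 proof (induction w arbitrary: M k)
  case (Cons ab w)
  obtain i j where ab: "ab = (i, j)" by (cases ab)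
  let ?M = "M *m Y i *m X j"
  have d: "det2 ?M = 1" using Cons(2) by (simp add: det2_mmul) (simp add: det2_def X_def Y_def)
  have g: "tG (cj ?M) (k + i * -1 + j * -1)" using tG_mmul[OF tG_mmul[OF Cons(3) tYn] tXn] by (simp add: cjm)
  have r: "crow \<rho> (ab # w) (e11 M, e12 M) = crow \<rho> w (e11 ?M, e12 ?M)" "crow \<rho> (ab # w) (e21 M, e22 M) = crow \<rho> w (e21 ?M, e22 ?M)"
   by (cases M; simp add: ab Let_def X_def Y_def algebra_simps)+
  show ?case unfolding r using Cons.IH[OF d g] .
 next
  case Nil
  thus ?case by (intro exI[of _ M] exI[of _ k]) simp
 qed
 have "wellsep \<rho>"
  unfolding wellsep_def
 proof
  fix w
  have "tG (cj mid) 0" using nk_lattice[of 0 0] by (simp add: cj1 tG_def trans2_0)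
  then obtain N n where N: "det2 N = 1" "tG (cj N) n" "crow \<rho> w (1, 0) = (e11 N, e12 N)" "crow \<rho> w (0, 1) = (e21 N, e22 N)"
   using word[of mid 0 w] by (auto simp: mid_def det2_def)
  show "cmod \<rho> <= (cmod (fst (crow \<rho> w (0, 1))))^2 | fst (crow \<rho> w (0, 1)) = 0 & Im (snd (crow \<rho> w (1, 0))) = 0"
  proof (cases "e21 N = 0")
   case True
   then obtain k :: int where "cj N \<simeq> trans2 (of_int k * mu)" using tG_c(2)[OF N(2)] by (auto simp: cj_def)
   hence "mu * e12 N = of_int k * mu | mu * e12 N = - (of_int k * mu)"
    using True by (auto simp: peq_def cj_def trans2_def mneg_def)
   hence "e12 N = of_int k | e12 N = - of_int k" using mu(2) by (metis mult.commute mult_cancel_left mult_minus_right)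
   thus ?thesis using N(3,4) True by auto
  next
   case False
   hence "1 <= cmod (e21 N / mu)" using tG_c(1)[OF N(2)] mu(2) by (simp add: cj_def)
   hence "cmod mu <= cmod (e21 N)" using mu(2) by (simp add: norm_divide field_simps)
   hence "(cmod mu)^2 <= (cmod (e21 N))^2" by (intro power_mono) auto
   thus ?thesis using N(4) \<rho>(1) by simp
  qed
 qed
 \<comment> \<open>For \<open>\<rho> = s\<close> the product \<open>Y 1 *m X s\<close> has trace
   \<open>2 - s^2 = 1\<close>, and its half translations add up to an even number, so it is an
   element of order three in the group itself.\<close>
 moreover have "\<rho> ~= of_int s" if s: "s = 1 | s = -1" for s :: int
 proof
  assume r: "\<rho> = of_int s"
  have ss: "s * s = 1" using s by auto
  let ?N = "Y 1 *m X s"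
  let ?T = "trans2 (of_int (1 + s) * mu)"
  have "tG (cj ?N) (1 * -1 + s * -1)" using tG_mmul[OF tYn[of 1] tXn[of s]] by (simp add: cjm)
  hence "nk (trans2 (of_int (- 1 - s) * mu) *m cj ?N) 0" by (simp add: tG_def)
  moreover have "nk ?T 0" using s nk_lattice[of 1 0] nk_lattice[of 0 0] mu(1) by auto
  ultimately have "nk (?T *m (trans2 (of_int (- 1 - s) * mu) *m cj ?N)) (0 + 0)" using nk_mmul by blast
  moreover have "?T *m (trans2 (of_int (- 1 - s) * mu) *m cj ?N) = cj ?N"
   by (simp add: trans2_mmul flip: mmul_assoc) (simp add: trans2_0 flip: ring_distribs)
  ultimately have "inG (cj ?N)" by (simp add: nk_def)
  moreover have "tr2 (cj ?N) = 1" using s by (auto simp: cj_def tr2_def X_def Y_def r)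
  moreover have "e21 (cj ?N) ~= 0" using \<rho>(2) mu(2) by (simp add: cj_def X_def Y_def)
  ultimately show False by (rule no_order_3)
 qed
 from this[of 1] this[of "-1"] have "\<rho> ~= 1" "\<rho> ~= -1" by auto
 ultimately have "19203 / 10000 <= (cmod \<rho>)^2" using wellsep_bound \<rho>(2) by blast
 thus ?thesis unfolding \<rho>(1) by (simp flip: power_mult)
qed

end

section \<open>Short slopes\<close>

text \<open>Here \<open>a\<close> and \<open>b\<close> are the traces on an edge, \<open>f\<close>
  and \<open>g\<close> those at the far corners of its two triangles. The larger far corner
  dominates the edge, and the situation reproduces itself on that side.\<close>

lemma growth_half:
 fixes a b f g :: real
 assumes "2 < a" "2 < b" "g <= f" "a * b <= f + g" shows "a < f" "b < f" "f < a * f - b" "f < b * f - a"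
proof -
 have "2 * b < a * b" "a * 2 < a * b" using assms(1,2) by (auto intro: mult_strict_right_mono mult_strict_left_mono)
 thus 1: "a < f" "b < f" using assms(3,4) by linarith+
 have "2 * f < a * f" "2 * f < b * f" using assms(1,2) 1 by (auto intro!: mult_strict_right_mono)
 thus "f < a * f - b" "f < b * f - a" using 1 by linarith+
qed

text \<open>Away from the edges with an end of trace at most \<open>2\<close> the traces grow, forwards or backwards, which a periodic
 sequence of edges does not allow.\<close>

lemma growth:
 fixes X Y f g :: "nat => real"
 assumes R: "!!n. b n ==> X (Suc n) = X n & Y (Suc n) = f n & g (Suc n) = Y n"
  and L: "!!n. \<not> b n ==> X (Suc n) = f n & Y (Suc n) = Y n & g (Suc n) = X n"
  and fg: "!!n. X n * Y n <= f n + g n" and per: "!!n. X (n + N) = X n & Y (n + N) = Y n" and N: "0 < N"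
 shows "X n <= 2 | Y n <= 2"
proof (rule ccontr)
 define F where "F n \<longleftrightarrow> 2 < X n & 2 < Y n & g n <= f n" for n
 define B where "B n \<longleftrightarrow> 2 < X n & 2 < Y n & f n <= g n" for n
 have Fs: "F (Suc n) & X n + Y n < X (Suc n) + Y (Suc n)" if "F n" for n
  using that growth_half[of "X n" "Y n" "g n" "f n"] fg[of n] R[of n] L[of n] fg[of "Suc n"]
  by (cases "b n") (auto simp: F_def mult.commute)
 have Bs: "B n & X (Suc n) + Y (Suc n) < X n + Y n" if "B (Suc n)" for n
  using that growth_half[of "X (Suc n)" "Y (Suc n)" "f (Suc n)" "g (Suc n)"] fg[of "Suc n"] R[of n] L[of n] fg[of n]
  by (cases "b n") (auto simp: B_def mult.commute add.commute)
 assume "\<not> ?thesis"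
 hence nn: "2 < X (n + N)" "2 < Y (n + N)" using per[of n] by simp_all
 show False
 proof (cases "g (n + N) <= f (n + N)")
  case True
  hence F0: "F (n + N)" using nn by (simp add: F_def)
  have "F (n + N + k) & (0 < k --> X (n + N) + Y (n + N) < X (n + N + k) + Y (n + N + k))" for k
  proof (induction k)
   case (Suc k) thus ?case using Fs[of "n + N + k"] by (cases "k = 0") auto
  qed (use F0 in simp)
  from this[of N] show False using N per[of "n + N"] by simp
 next
  case False
  hence B0: "B (n + N)" using nn by (simp add: B_def)
  have "k <= N --> B (n + N - k) & (0 < k --> X (n + N) + Y (n + N) < X (n + N - k) + Y (n + N - k))" for k
  proof (induction k)
   case (Suc k)
   show ?case
   proof
    assume k: "Suc k <= N"
    hence e: "n + N - k = Suc (n + N - Suc k)" by simp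
    show "B (n + N - Suc k) & (0 < Suc k --> X (n + N) + Y (n + N) < X (n + N - Suc k) + Y (n + N - Suc k))"
     using Suc k Bs[of "n + N - Suc k"] unfolding e by (cases "k = 0") auto
   qed
  qed (use B0 in simp)
  from this[of N] show False using N per[of n] by simp
 qed
qed

text \<open>The last R of a block is followed by an L of the same block, so every block yields a
  turn inside the word, without reading it cyclically.\<close>

lemma turns:
 assumes "ALL (p, q):set w. 0 < p & 0 < q"
 shows "length w <= card {n. Suc n < length (letters w) & letters w ! n & \<not> letters w ! Suc n}"
 using assms
proof (induction w)
 case (Cons pq w)
 obtain p q where pq: "pq = (p, q)" "0 < p" "0 < q" using Cons(2) by (cases pq) auto
 define T where "T ls = {n. Suc n < length ls & ls ! n & \<not> ls ! Suc n}" for ls :: "bool list"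
 let ?ls = "letters (pq # w)" and ?f = "%n. p + q + n"
 have fin: "finite (T ls)" for ls by (rule finite_subset[of _ "{..<length ls}"]) (auto simp: T_def)
 have e: "?ls = (replicate p True @ replicate q False) @ letters w" by (simp add: letters_Cons pq)
 have "?f ` T (letters w) <= T ?ls"
  unfolding e T_def by (auto simp: nth_append simp flip: add_Suc_right)
 moreover have "p - 1 : T ?ls" using pq unfolding e T_def by (auto simp: nth_append)
 ultimately have "insert (p - 1) (?f ` T (letters w)) <= T ?ls" by blast
 hence "card (insert (p - 1) (?f ` T (letters w))) <= card (T ?ls)" by (rule card_mono[OF fin])
 moreover have "p - 1 ~: ?f ` T (letters w)" using pq by auto
 hence "card (insert (p - 1) (?f ` T (letters w))) = Suc (card (T (letters w)))"
  using fin by (simp add: card_image inj_on_def)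
 moreover have "length w <= card (T (letters w))" using Cons by (simp add: T_def)
 ultimately show ?case by (simp add: T_def)
qed simp

context rlcusp
begin

definition NN :: nat where "NN = length (letters w)"
definition bt :: "nat => bool" where "bt n = letters w ! (n mod NN)"

lemma NN: "0 < NN"
proof -
 obtain p q l where "w = (p, q) # l" using w(1) by (cases w) auto
 thus ?thesis using w(2) unfolding NN_def by (simp add: letters_Cons)
qed

fun ev :: "nat => complex \<times> complex" where
 "ev 0 = (1, \<i>)" | "ev (Suc n) = stp [bt n] (ev n)"

lemma ev_stp: "n <= NN ==> ev n = stp (take n (letters w)) (1, \<i>)"
 by (induction n) (simp_all add: bt_def NN_def take_Suc_conv_app_nth stp_append)

lemma ev_NN: "ev (n + NN) = (Fl (fst (ev n)), Fl (snd (ev n)))"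
proof (induction n)
 case 0 thus ?case using ev_stp[of NN] Fl_1 by (simp add: NN_def)
next
 case (Suc n)
 have "Fl (x + y) = Fl x + Fl y" for x y by (simp add: Fl_def lin_plus ring_distribs)
 thus ?case using Suc by (simp add: bt_def)
qed

lemma ev_gp: "gp (fst (ev n)) (snd (ev n))"
proof (induction n)
 case 0 thus ?case by (simp add: gp_init)
next
 case (Suc n) thus ?case using gp_stp[OF Suc, of "[bt n]"] by simp
qed

abbreviation "Xn n \<equiv> cmod (tr2 (A (fst (ev n))))"
abbreviation "Yn n \<equiv> cmod (tr2 (A (snd (ev n))))"

lemma short_edge: "Xn n <= 2 | Yn n <= 2"
proof -
 define V W where "V n = A (fst (ev n))" and "W n = A (snd (ev n))" for n
 \<comment> \<open>The far corners of the two Farey triangles on the edge; the product of the traces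
   of \<open>V n\<close> and \<open>W n\<close> is the sum of the traces there.\<close>
 define f g where "f n = cmod (tr2 (V n *m W n))" and "g n = cmod (tr2 (V n *m minv (W n)))" for n
 have d: "det2 (V n) = 1" "det2 (W n) = 1" for n using gp_det[OF ev_gp] by (simp_all add: V_def W_def)
 have s: "A (fst (ev n) + snd (ev n)) \<simeq> V n *m W n" for n using gp_sum[OF ev_gp] by (simp add: V_def W_def)
 have s': "minv (A (fst (ev n) + snd (ev n))) \<simeq> minv (W n) *m minv (V n)" for n
  using s[of n] unfolding peq_def by (auto simp: minv_mmul)
 show ?thesis
 proof (rule growth[where b = bt and f = f and g = g and N = NN])
  fix n
  have "cmod (tr2 (V n) * tr2 (W n)) <= g n + f n"
   unfolding f_def g_def using norm_triangle_ineq[of "tr2 (V n *m minv (W n))" "tr2 (V n *m W n)"] by (simp add: tr_minv_mmul)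
  thus "Xn n * Yn n <= f n + g n" by (simp add: V_def W_def norm_mult)
  show "Xn (n + NN) = Xn n & Yn (n + NN) = Yn n"
   using Fl_ctr(2)[of "fst (ev n)" "snd (ev n)" "Fl (snd (ev n))"] Fl_ctr(2)[of "snd (ev n)" "fst (ev n)" "Fl (fst (ev n))"]
    ev_gp[of n] ev_gp[of "n + NN"] by (simp add: ev_NN)
 next
  fix n assume b: "bt n"
  have "V (Suc n) = V n" "W (Suc n) = A (fst (ev n) + snd (ev n))" using b by (simp_all add: V_def W_def)
  moreover have "V n *m minv (A (fst (ev n) + snd (ev n))) \<simeq> V n *m (minv (W n) *m minv (V n))" by (rule peq_mmul[OF peq_refl s'])
  moreover have "tr2 (V n *m (minv (W n) *m minv (V n))) = tr2 (W n)"
   unfolding tr2_mmul_commute[of "V n"] by (simp add: mmul_assoc mmul_minv(2)[OF d(1)])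
  ultimately show "Xn (Suc n) = Xn n & Yn (Suc n) = f n & g (Suc n) = Yn n"
   using tr_peq[OF s[of n]] tr_peq by (fastforce simp: f_def g_def V_def W_def)
 next
  fix n assume b: "\<not> bt n"
  have "W (Suc n) = W n" "V (Suc n) = A (fst (ev n) + snd (ev n))" using b by (simp_all add: V_def W_def)
  moreover have "A (fst (ev n) + snd (ev n)) *m minv (W n) \<simeq> V n *m W n *m minv (W n)" by (rule peq_mmul[OF s peq_refl])
  moreover have "V n *m W n *m minv (W n) = V n" by (simp add: mmul_assoc mmul_minv(1)[OF d(2)])
  ultimately show "Xn (Suc n) = f n & Yn (Suc n) = Yn n & g (Suc n) = Xn n"
   using tr_peq[OF s[of n]] tr_peq by (fastforce simp: f_def g_def V_def W_def)
 qed (rule NN)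
qed

text \<open>The index is \<open>Suc n\<close> because a turn at \<open>n\<close> concerns the edge
  reached after letter \<open>n\<close>, where R changes to L.\<close>

definition sh :: "nat => complex" where
 "sh n = (if Xn (Suc n) <= 2 then fst (ev (Suc n)) else snd (ev (Suc n)))"

definition turn :: "nat => bool" where "turn n \<longleftrightarrow> bt n & \<not> bt (Suc n)"

lemma sh_slope: "(EX u. gp (sh n) u | gp u (sh n))" "cmod (tr2 (A (sh n))) <= 2"
 using ev_gp[of "Suc n"] short_edge[of "Suc n"] by (auto simp: sh_def simp del: ev.simps)

lemma sh_NN: "sh (n + NN) = Fl (sh n)"
proof -
 have "Xn (Suc (n + NN)) = Xn (Suc n)"
  using Fl_ctr(2)[of "fst (ev (Suc n))" "snd (ev (Suc n))" "Fl (snd (ev (Suc n)))"] ev_gp[of "Suc n"] ev_gp[of "Suc n + NN"] ev_NN[of "Suc n"]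
  by (simp del: ev.simps)
 thus ?thesis using ev_NN[of "Suc n"] by (simp add: sh_def del: ev.simps)
qed

lemma turn_NN: "turn n ==> turn (n + NN)" by (simp add: turn_def bt_def flip: add_Suc)

definition ht :: "complex => real" where "ht z = Re z + Im z"

lemma ht_pos: "gp v u | gp u v ==> 0 < ht v"
 using gp_prm(3,4)[of v u] gp_prm(3,4)[of u v] unfolding gp_def ht_def by (auto simp: complex_eq_iff add_nonneg_eq_0_iff less_le)

lemma ht_add [simp]: "ht (x + y) = ht x + ht y" by (simp add: ht_def)

lemma ht_mono: "n <= m ==> ht (fst (ev n)) <= ht (fst (ev m))"
proof (induction m)
 case (Suc m)
 have "ht (fst (ev m)) <= ht (fst (ev (Suc m)))" using ht_pos[of "snd (ev m)" "fst (ev m)"] ev_gp[of m] by simp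
 thus ?case using Suc by (cases "n = Suc m") auto
qed simp

text \<open>The L after the turn makes the first end higher than both ends of the turning edge, and
  first ends never get lower.\<close>

lemma sh_strict: assumes t: "turn n" "turn m" and nm: "n < m" shows "ht (sh n) < ht (sh m)"
proof -
 have e: "ev (Suc k) = (fst (ev k), fst (ev k) + snd (ev k))" if "turn k" for k using that by (simp add: turn_def)
 have p: "0 < ht (snd (ev k))" "0 < ht (fst (ev k))" for k
  using ht_pos[of "snd (ev k)" "fst (ev k)"] ht_pos[of "fst (ev k)" "snd (ev k)"] ev_gp[of k] by auto
 have "ht (sh n) <= ht (snd (ev (Suc n)))" using e[OF t(1)] p[of n] by (simp add: sh_def)
 also have "... < ht (fst (ev (Suc (Suc n))))" using t(1) p[of "Suc n"] by (simp add: turn_def ht_def)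
 also have "... <= ht (fst (ev (Suc m)))" using nm by (intro ht_mono) simp
 also have "... <= ht (sh m)" using e[OF t(2)] p[of m] by (simp add: sh_def)
 finally show ?thesis .
qed

lemma sh_inj: assumes "turn n" "turn m" "s * s = 1" "sh n = of_real s * sh m" shows "n = m"
proof -
 have "s = 1 | s = -1" using assms(3) by (metis power2_eq_1_iff power2_eq_square)
 moreover have "ht (sh n) = s * ht (sh m)" using assms(4) by (simp add: ht_def ring_distribs)
 moreover have "0 < ht (sh n)" "0 < ht (sh m)" using ht_pos sh_slope(1) by blast+
 ultimately have "ht (sh n) = ht (sh m)" by auto
 thus ?thesis using sh_strict[OF assms(1,2)] sh_strict[OF assms(2,1)] by (metis less_irrefl nat_neq_iff)
qed

lemma lin_sh: "EX s. s * s = 1 & lin (int k) (sh n) = of_real s * sh (n + k * NN)"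
proof (induction k)
 case 0 show ?case by (intro exI[of _ 1]) (simp add: lin_0)
next
 case (Suc k)
 then obtain s where s: "s * s = 1" "lin (int k) (sh n) = of_real s * sh (n + k * NN)" by blast
 have "lin (int (Suc k)) (sh n) = lin 1 (of_real s * sh (n + k * NN))" using lin_add[of 1 "int k" "sh n"] s(2) by (simp add: add.commute)
 also have "... = of_real (s * sg) * sh (n + Suc k * NN)"
  using sh_NN[of "n + k * NN"] by (simp add: lin_scale Fl_lin algebra_simps)
 finally show ?case using s(1) sg2 by (intro exI[of _ "s * sg"]) (simp add: mult.commute mult.left_commute)
qed

lemma turn_mult: "turn n ==> turn (n + k * NN)"
proof (induction k)
 case (Suc k) thus ?case using turn_NN[of "n + k * NN"] by (simp add: add_ac)
qed simp

text \<open>Up to sign the monodromy shifts the number of a turn by the period, so two turns within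
  one period never give equivalent slopes.\<close>

lemma sh_orbit:
 assumes t: "turn n" "turn m" "n < NN" "m < NN" and e: "lin k (sh n) = of_real s * sh m" "s * s = 1"
 shows "n = m & k = 0"
proof -
 have X: "n = m & j = 0" if t: "turn n" "turn m" "n < NN" "m < NN" and e: "lin (int j) (sh n) = of_real s * sh m" "s * s = 1" for n m j s
 proof -
  obtain s' where s': "s' * s' = 1" "lin (int j) (sh n) = of_real s' * sh (n + j * NN)" using lin_sh by blast
  have "of_real s' * (of_real s' * sh (n + j * NN)) = of_real s' * (of_real s * sh m)" using s'(2) e(1) by simp
  hence "sh (n + j * NN) = of_real (s' * s) * sh m" using s'(1) by (simp flip: of_real_mult mult.assoc)
  moreover have "(s' * s) * (s' * s) = 1" using s'(1) e(2) by (simp add: mult.commute mult.left_commute)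
  ultimately have "n + j * NN = m" using sh_inj[OF turn_mult[OF t(1)] t(2)] by blast
  thus ?thesis using t(4) by (cases j) auto
 qed
 show ?thesis
 proof (cases "0 <= k")
  case True
  thus ?thesis using X[OF t, of "nat k" s] e by simp
 next
  case False
  have "of_real s * lin (- k) (lin k (sh n)) = of_real s * lin (- k) (of_real s * sh m)" using e(1) by simp
  hence "lin (- k) (sh m) = of_real s * sh n" using e(2) by (simp add: lin_inv lin_scale flip: mult.assoc of_real_mult)
  hence "m = n & nat (- k) = 0" using X[OF t(2,1,4,3), of "nat (- k)" s] e(2) False by simp
  thus ?thesis using False by simp
 qed
qed

lemma aff_unique_v: assumes "aff M k v" "aff M k u" shows "v = u"
proof -
 have "(0,1) : H3" by (simp add: H3_iff)
 thus ?thesis using assms unfolding aff_def by (metis add_left_cancel fst_conv)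
qed

lemma mu_le: "cmod mu <= 2"
proof -
 have "tc mu (A (sh 0))" "inG (A (sh 0))" using sh_slope(1)[of 0] gp_tc gp_det by blast+
 thus ?thesis using tc_ge sh_slope(2)[of 0] by fastforce
qed

text \<open>For matrices \<open>M\<close> and \<open>N\<close> with these centres, the lower left
  entry of \<open>minv M *m N\<close> has modulus \<open>|c_M c_N|\<close> times the distance of the
  centres. It is at least \<open>1\<close> unless it vanishes, which \<open>sh_orbit\<close>
  excludes, and \<open>|mu c| = |tr| <= 2\<close> for both. Translates of one centre by multiples of
  \<open>mu\<close> alone are covered by \<open>|mu| <= 2\<close>.\<close>

lemma separated:
 assumes t: "turn n" "turn m" "n < NN" "m < NN" and ne: "(n, k, l) ~= (m, k', l')"
 shows "(cmod mu)^2 / 4 <= cmod ((ctr (A (sh n)) + of_int k * mu + of_int l * nu) - (ctr (A (sh m)) + of_int k' * mu + of_int l' * nu))"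
proof (cases "n = m & l = l'")
 case True
 hence "k ~= k'" using ne by auto
 hence "1 <= \<bar>real_of_int (k - k')\<bar>" by linarith
 hence "1 * cmod mu <= \<bar>real_of_int (k - k')\<bar> * cmod mu" by (rule mult_right_mono) simp
 also have "... = cmod (of_int (k - k') * mu)" by (simp only: norm_mult norm_of_int)
 also have "of_int (k - k') * mu = (ctr (A (sh n)) + of_int k * mu + of_int l * nu) - (ctr (A (sh m)) + of_int k' * mu + of_int l' * nu)"
  using True by (simp add: algebra_simps)
 finally have "cmod mu <= cmod ((ctr (A (sh n)) + of_int k * mu + of_int l * nu) - (ctr (A (sh m)) + of_int k' * mu + of_int l' * nu))"
  by simp
 moreover have "(cmod mu)^2 <= 2 * cmod mu" using mult_mono[OF mu_le order_refl[of "cmod mu"]] by (simp add: power2_eq_square)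
 ultimately show ?thesis using norm_ge_zero[of mu] by linarith
next
 case False
 define M where "M n k l = trans2 (of_int l * nu) *m al (Ln (sh n) + ipi * of_int k)" for n k l
 have M: "inG (M n k l) & ctr (M n k l) = ctr (A (sh n)) + of_int k * mu + of_int l * nu & e21 (M n k l) ~= 0 &
  cmod mu * cmod (e21 (M n k l)) <= 2 & (EX s. s * s = 1 & aff (M n k l) l (lin l (of_real s * sh n)))" for n k l
 proof -
  let ?l = "Ln (sh n) + ipi * of_int k"
  have g: "prm (Ln (sh n))" "tc mu (al (Ln (sh n)))" "sh n ~= 0" using sh_slope(1)[of n] gp_prm gp_tc by (auto simp: A_def)
  note a = al_pi_int[OF g(1,2), of k]
  have e: "e21 (M n k l) = e21 (al ?l)" unfolding M_def by (cases "al ?l") (simp add: trans2_def)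
  have "ctr (M n k l) = ctr (al ?l) + of_int l * nu"
   using a unfolding M_def by (cases "al ?l") (simp add: trans2_def ctr_def tc_def add_divide_distrib)
  moreover have "cmod mu * cmod (e21 (al ?l)) = cmod (tr2 (al ?l))" using a unfolding tc_def by (metis norm_minus_cancel norm_mult)
  moreover have "EX s. s * s = 1 & aff (M n k l) l (lin l (of_real s * sh n))"
  proof -
   have "exp (ipi * of_int k) = of_real (cos (pi * of_int k))"
   proof -
    have "exp (ipi * of_int k) = cis (pi * of_int k)" by (simp add: cis_conv_exp mult.commute mult.left_commute)
    also have "... = of_real (cos (pi * of_int k))" unfolding complex_eq_iff by (simp only: cis.sel sin_npi_int Re_complex_of_real Im_complex_of_real)
    finally show ?thesis .
   qed
   hence "exp ?l = of_real (cos (pi * of_int k)) * sh n" using g(3) by (simp add: exp_add mult.commute)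
   moreover have "aff (M n k l) (l + 0) (lin l (exp ?l) + 0)"
    unfolding M_def using a al(1) by (intro aff_mmul aff_nu al_aff) auto
   moreover have "cos (pi * of_int k) * cos (pi * of_int k) = 1" using sin_cos_squared_add3[of "pi * of_int k"] sin_npi_int by simp
   ultimately show ?thesis by (metis add.right_neutral)
  qed
  ultimately show ?thesis using a sh_slope(2)[of n] al(1) inG_mmul[OF inG_trans_int[OF nu(1)]] unfolding e by (auto simp: tc_def M_def A_def add_ac)
 qed
 let ?M = "M n k l" and ?N = "M m k' l'"
 have iM: "inG (minv ?M *m ?N)" using M inG_minv inG_mmul by blast
 have "e21 (minv ?M *m ?N) ~= 0"
 proof
  assume 0: "e21 (minv ?M *m ?N) = 0"
  obtain p v where p: "v : lat" "aff (minv ?M *m ?N) p v" using aff_exists[OF iM] by blast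
  obtain j :: int where j: "minv ?M *m ?N \<simeq> trans2 (of_int j * lam + of_int p * nu)"
   using stabiliser[OF iM c_zero[OF iM 0] p(2,1)] by blast
  obtain s s' where s: "s * s = 1" "aff ?M l (lin l (of_real s * sh n))" and s': "s' * s' = 1" "aff ?N l' (lin l' (of_real s' * sh m))"
   using M by meson
  have "?M *m (minv ?M *m ?N) \<simeq> ?M *m trans2 (of_int j * lam + of_int p * nu)" by (rule peq_mmul[OF peq_refl j])
  hence "?N \<simeq> ?M *m trans2 (of_int j * lam + of_int p * nu)"
   using M by (simp add: mmul_minv(1)[OF inG_det] flip: mmul_assoc)
  hence a: "aff ?N (l + p) (lin l 0 + lin l (of_real s * sh n))"
   using aff_mmul[OF s(2) aff_lattice inG_lattice] aff_peq by blast
  hence "l' = l + p" using s'(2) aff_unique_k by blast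
  hence "lin l (of_real s * sh n) = lin l' (of_real s' * sh m)" using a s'(2) aff_unique_v by fastforce
  hence "lin (- l') (lin l (of_real s * sh n)) = of_real s' * sh m" by (simp add: lin_inv)
  hence "lin (l - l') (of_real s * sh n) = of_real s' * sh m" using lin_add[of "- l'" l] by simp
  hence "of_real s * (of_real s * lin (l - l') (sh n)) = of_real s * (of_real s' * sh m)" by (simp add: lin_scale)
  hence "lin (l - l') (sh n) = of_real (s * s') * sh m" using s(1) by (simp flip: of_real_mult mult.assoc)
  moreover have "(s * s') * (s * s') = 1" using s(1) s'(1) by (simp add: mult.commute mult.left_commute)
  ultimately have "n = m & l - l' = 0" by (rule sh_orbit[OF t])
  thus False using False by simp
 qed
 hence "1 <= cmod (e21 (minv ?M *m ?N))" using c_ge[OF iM] by blast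
 also have "... = cmod (e21 ?M) * cmod (e21 ?N) * cmod (ctr ?M - ctr ?N)"
  using M[of n k l] M[of m k' l'] by (simp add: ctr_minv_mmul norm_mult)
 finally have 1: "1 <= cmod (e21 ?M) * cmod (e21 ?N) * cmod (ctr ?M - ctr ?N)" .
 have "(cmod mu)^2 * 1 <= (cmod mu)^2 * (cmod (e21 ?M) * cmod (e21 ?N) * cmod (ctr ?M - ctr ?N))"
  by (rule mult_left_mono[OF 1]) simp
 also have "... = (cmod mu * cmod (e21 ?M)) * (cmod mu * cmod (e21 ?N)) * cmod (ctr ?M - ctr ?N)"
  by (simp add: power2_eq_square)
 also have "... <= 2 * 2 * cmod (ctr ?M - ctr ?N)" using M[of n k l] M[of m k' l'] by (intro mult_right_mono mult_mono) auto
 finally show ?thesis using M[of n k l] M[of m k' l'] by simp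
qed

lemma card_turns: "length w <= card {n. n < NN & turn n}"
proof -
 have "{n. Suc n < length (letters w) & letters w ! n & \<not> letters w ! Suc n} <= {n. n < NN & turn n}"
  by (auto simp: turn_def bt_def NN_def)
 hence "card {n. Suc n < length (letters w) & letters w ! n & \<not> letters w ! Suc n} <= card {n. n < NN & turn n}"
  by (rule card_mono[rotated]) simp
 thus ?thesis using turns[OF w(2)] by simp
qed

end

section \<open>Covolume of a lattice\<close>

lemma lborel_cpx: "distr lborel borel cpx = (lborel :: complex measure)"
proof (rule lborel_eqI[symmetric])
 have m[measurable]: "cpx : borel_measurable borel" by (rule borel_measurable_continuous_onI) (intro continuous_intros)
 fix l u :: complex assume le: "!!b. b : Basis ==> l \<bullet> b <= u \<bullet> b"
 have lu: "Re l <= Re u" "Im l <= Im u" using le[of 1] le[of \<i>] by (simp_all add: Basis_complex_def)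
 have B: "(Basis :: (real^2) set) = (%i. axis i 1) ` UNIV" by (auto simp: Basis_vec_def)
 have "cpx -` box l u = box (vec2 l) (vec2 u)"
  by (auto simp: box_def Basis_complex_def B inner_axis forall_2 cpx_def vec2_def)
 moreover have "(\<Prod>b\<in>Basis. (vec2 u - vec2 l) \<bullet> b) = (Re u - Re l) * (Im u - Im l)"
  unfolding B by (subst prod.reindex) (auto simp: inj_on_def axis_eq_axis inner_axis prod_2 vec2_def UNIV_2)
 moreover have "vec2 l $ i <= vec2 u $ i" for i using lu exhaust_2[of i] by (auto simp: vec2_def)
 hence "!!b. b : Basis ==> vec2 l \<bullet> b <= vec2 u \<bullet> b" by (auto simp: B inner_axis)
 ultimately have "emeasure lborel (cpx -` box l u) = ennreal ((Re u - Re l) * (Im u - Im l))"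
  by (simp add: emeasure_lborel_box)
 moreover have "(\<Prod>b\<in>Basis. (u - l) \<bullet> b) = (Re u - Re l) * (Im u - Im l)" by (simp add: Basis_complex_def)
 ultimately show "emeasure (distr lborel borel cpx) (box l u) = ennreal (\<Prod>b\<in>Basis. (u - l) \<bullet> b)"
  by (simp add: emeasure_distr)
qed simp

lemma emeasure_cpx: "S : sets borel ==> emeasure lborel S = emeasure lborel (cpx -` S)"
 using arg_cong[OF lborel_cpx, of "%M. emeasure M S"]
 by (simp add: emeasure_distr borel_measurable_continuous_onI continuous_intros)

locale plattice =
 fixes a b :: complex
 assumes ind: "Im (cnj a * b) ~= 0"
begin

definition trn :: "int \<times> int => complex" where "trn k = of_int (fst k) * a + of_int (snd k) * b"

definition coA :: "complex => real" where "coA z = Im (cnj z * b) / Im (cnj a * b)"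
definition coB :: "complex => real" where "coB z = Im (cnj a * z) / Im (cnj a * b)"

lemma co: "of_real (coA z) * a + of_real (coB z) * b = z"
proof -
 let ?D = "Im (cnj a * b)"
 have e: "of_real ?D * (of_real (x / ?D) * u) = of_real x * u" for x and u :: complex
  using ind by (simp flip: mult.assoc of_real_mult)
 have "of_real ?D * (of_real (coA z) * a + of_real (coB z) * b) = of_real (Im (cnj z * b)) * a + of_real (Im (cnj a * z)) * b"
  unfolding coA_def coB_def ring_distribs(1) e ..
 also have "... = of_real ?D * z" by (simp add: complex_eq_iff algebra_simps)
 finally show ?thesis using ind by (metis mult_cancel_left of_real_eq_0_iff)
qed

lemma co_trn: "coA (z + trn k) = coA z + of_int (fst k)" "coB (z + trn k) = coB z + of_int (snd k)"
 using ind by (simp_all add: coA_def coB_def trn_def field_simps)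

lemma trn_inj: "trn k = trn j ==> k = j"
 using co_trn[of 0 k] co_trn[of 0 j] by (simp add: prod_eq_iff)

definition fund :: "complex set => bool" where "fund D \<longleftrightarrow> D : sets borel & (ALL z. EX! k. z + trn k : D)"

lemma emeasure_translate: "S : sets borel ==> emeasure lborel ((+) c -` S) = emeasure lborel (S :: complex set)"
 using arg_cong[OF lborel_distr_plus, of "%M. emeasure M S" c] by (simp add: emeasure_distr)

text \<open>Each point of \<open>S\<close> is carried into \<open>D\<close> by exactly one lattice
  vector; the pieces land disjointly because \<open>S\<close> contains no two equivalent
  points.\<close>

lemma fund_le:
 assumes D: "fund D" and S: "S : sets borel" "!!z k. z : S ==> z + trn k : S ==> trn k = 0"
 shows "emeasure lborel S <= emeasure lborel D"
proof -
 have [measurable]: "D : sets borel" "S : sets borel" using D S by (auto simp: fund_def)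
 have m: "(+) c -` X : sets borel" if "X : sets borel" for c :: complex and X
  using measurable_sets_borel[OF _ that, of "(+) c"] by simp
 define P Q where "P k = S \<inter> (+) (trn k) -` D" and "Q k = (+) (- trn k) -` S \<inter> D" for k
 have sP: "P k : sets lborel" "Q k : sets lborel" for k using m by (auto simp: P_def Q_def)
 have PQ: "emeasure lborel (P k) = emeasure lborel (Q k)" for k
 proof -
  have "P k = (+) (trn k) -` Q k" by (auto simp: P_def Q_def)
  thus ?thesis using emeasure_translate sP by simp
 qed
 have dP: "disjoint_family P"
  unfolding disjoint_family_on_def
 proof (intro ballI impI, rule ccontr)
  fix k j :: "int \<times> int" assume "k ~= j" and "P k \<inter> P j ~= {}"
  then obtain z where "z + trn k : D" "z + trn j : D" by (auto simp: P_def add.commute)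
  thus False using D \<open>k ~= j\<close> unfolding fund_def by metis
 qed
 have dQ: "disjoint_family Q"
  unfolding disjoint_family_on_def
 proof (intro ballI impI, rule ccontr)
  fix k j :: "int \<times> int" assume ne: "k ~= j" and "Q k \<inter> Q j ~= {}"
  then obtain z where z: "z - trn k : S" "z - trn j : S" by (auto simp: Q_def)
  let ?k = "(fst k - fst j, snd k - snd j)"
  have t: "trn ?k = trn k - trn j" by (simp add: trn_def algebra_simps)
  hence "trn ?k = 0" using S(2)[OF z(1), of ?k] z(2) by simp
  thus False using trn_inj[of k j] ne t by simp
 qed
 have "S <= (\<Union>k. P k)"
 proof
  fix z assume "z : S"
  moreover obtain k where "z + trn k : D" using D unfolding fund_def by metis
  ultimately have "z : P k" by (simp add: P_def add.commute)
  thus "z : (\<Union>k. P k)" by blast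
 qed
 hence "S = (\<Union>k. P k)" by (auto simp: P_def)
 hence "emeasure lborel S = (\<integral>\<^sup>+k. emeasure lborel (P k) \<partial>count_space UNIV)"
  using emeasure_UN_countable[of UNIV P lborel] sP(1) dP by simp
 also have "... = (\<integral>\<^sup>+k. emeasure lborel (Q k) \<partial>count_space UNIV)" using PQ by simp
 also have "... = emeasure lborel (\<Union>k. Q k)"
  using emeasure_UN_countable[of UNIV Q lborel] sP(2) dQ by simp
 also have "... <= emeasure lborel D" by (rule emeasure_mono) (auto simp: Q_def)
 finally show ?thesis .
qed

definition par :: "complex set" where "par = {z. 0 <= coA z & coA z < 1 & 0 <= coB z & coB z < 1}"

lemma fund_par: "fund par"
 unfolding fund_def
proof (intro conjI allI)
 have [measurable]: "coA : borel_measurable borel" "coB : borel_measurable borel" unfolding coA_def coB_def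
  by (intro borel_measurable_divide borel_measurable_const borel_measurable_continuous_onI continuous_intros)+
 show "par : sets borel" unfolding par_def by measurable
 fix z
 have u: "0 <= x + of_int k & x + of_int k < 1 \<longleftrightarrow> k = - \<lfloor>x\<rfloor>" for x :: real and k by linarith
 have "z + trn k : par \<longleftrightarrow> k = (- \<lfloor>coA z\<rfloor>, - \<lfloor>coB z\<rfloor>)" for k
  using u[of "coA z" "fst k"] u[of "coB z" "snd k"] unfolding par_def mem_Collect_eq co_trn prod_eq_iff fst_conv snd_conv by blast
 thus "EX! k. z + trn k : par" by simp
qed

lemma emeasure_par: "emeasure lborel par = ennreal \<bar>Im (cnj a * b)\<bar>"
proof -
 define f :: "real^2 => real^2" where "f x = vec2 (of_real (x$1) * a + of_real (x$2) * b)" for x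
 define U :: "(real^2) set" where "U = {x. 0 <= x$1 & x$1 < 1 & 0 <= x$2 & x$2 < 1}"
 have lf: "linear f" by (rule linearI) (simp_all add: f_def vec2_def vec_eq_iff forall_2 algebra_simps)
 have det: "det (matrix f) = Im (cnj a * b)"
  by (simp add: det_2 matrix_def f_def vec2_def axis_def algebra_simps)
 have im: "cpx -` par = f ` U"
 proof (intro equalityI subsetI)
  fix x assume "x : cpx -` par"
  hence "vector [coA (cpx x), coB (cpx x)] : U" by (simp add: U_def par_def)
  moreover have "f (vector [coA (cpx x), coB (cpx x)]) = x" by (simp add: f_def co)
  ultimately show "x : f ` U" by (metis image_eqI)
 next
  fix x assume "x : f ` U"
  then obtain y where y: "y : U" "x = f y" by blast
  have "coA (cpx x) = y$1" "coB (cpx x) = y$2" using ind by (simp_all add: y(2) f_def coA_def coB_def field_simps)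
  thus "x : cpx -` par" using y(1) by (simp add: par_def U_def)
 qed
 have U: "measure lebesgue U = 1" "U : lmeasurable"
 proof -
  have B: "(Basis :: (real^2) set) = (%i. axis i 1) ` UNIV" by (auto simp: Basis_vec_def)
  have [measurable]: "U : sets borel" unfolding U_def by measurable
  have s: "box 0 1 <= U" "U <= cbox 0 1"
   by (auto simp: U_def box_def cbox_def B inner_axis forall_2)
  have "(\<Prod>b\<in>(Basis :: (real^2) set). (1 - 0) \<bullet> b) = 1"
   unfolding B by (subst prod.reindex) (auto simp: inj_on_def axis_eq_axis inner_axis)
  moreover have "(!!b :: real^2. b : Basis ==> 0 \<bullet> b <= 1 \<bullet> b)" by (auto simp: B inner_axis)
  ultimately have "emeasure lborel (box 0 1 :: (real^2) set) = 1" "emeasure lborel (cbox 0 1 :: (real^2) set) = 1"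
   by (simp_all add: emeasure_lborel_box emeasure_lborel_cbox)
  hence "emeasure lborel U = 1"
   using emeasure_mono[OF s(1), of lborel] emeasure_mono[OF s(2), of lborel] by (simp add: order_antisym)
  hence "emeasure lebesgue U = 1" by simp
  thus "U : lmeasurable" "measure lebesgue U = 1" by (auto simp: fmeasurable_def measure_def)
 qed
 have fi: "f ` U : lmeasurable" "measure lebesgue (f ` U) = \<bar>Im (cnj a * b)\<bar>"
  using measurable_linear_image[OF lf U(2)] measure_linear_image[OF lf U(2)] U(1) det by simp_all
 have p: "par : sets borel" using fund_par by (simp add: fund_def)
 have "cpx -` par : sets borel" using measurable_sets_borel[OF _ p, of cpx] by (simp add: borel_measurable_continuous_onI continuous_intros)
 hence "emeasure lborel (cpx -` par) = emeasure lebesgue (cpx -` par)" by simp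
 also have "... = ennreal \<bar>Im (cnj a * b)\<bar>" unfolding im using fi by (simp add: emeasure_eq_measure2)
 finally show ?thesis using emeasure_cpx[OF p] by simp
qed

lemma measure_fund: assumes "fund D" shows "measure lborel D = \<bar>Im (cnj a * b)\<bar>"
proof -
 have d: "trn k = 0" if "fund E" "z : E" "z + trn k : E" for E z k
 proof -
  have "z + trn (0, 0) : E" using that(2) by (simp add: trn_def)
  hence "k = (0, 0)" using that(1,3) unfolding fund_def by metis
  thus ?thesis by (simp add: trn_def)
 qed
 have "emeasure lborel D = emeasure lborel par"
  using fund_le[OF assms] fund_le[OF fund_par] d assms fund_par
  by (intro order_antisym) (auto simp: fund_def)
 thus ?thesis using emeasure_par by (simp add: measure_def)
qed

lemma packing:
 fixes c :: "nat => complex"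
 assumes J: "finite J" and r: "0 <= r"
  and sep: "!!n m k j. n : J ==> m : J ==> (n, k) ~= (m, j) ==> 2 * r <= cmod ((c n + trn k) - (c m + trn j))"
 shows "real (card J) * (pi * r^2) <= \<bar>Im (cnj a * b)\<bar>"
proof -
 let ?S = "\<Union>n\<in>J. ball (c n) r"
 have z: "trn (0, 0) = 0" by (simp add: trn_def)
 have far: "\<not> (cmod (x - y) < 2 * r)" if "n : J" "m : J" "(n, k) ~= (m, j)" "x = c n + trn k" "y = c m + trn j" for n m k j x y
  using sep[OF that(1-3)] that(4,5) by simp
 have dis: "disjoint_family_on (%n. ball (c n) r) J"
  unfolding disjoint_family_on_def
 proof (intro ballI impI, rule ccontr)
  fix n m assume nm: "n : J" "m : J" "n ~= m" and "ball (c n) r \<inter> ball (c m) r ~= {}"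
  then obtain x where "dist (c n) x < r" "dist (c m) x < r" by auto
  hence "cmod (c n - c m) < 2 * r" using dist_triangle_less_add[of "c n" x r "c m" r] by (simp add: dist_norm norm_minus_commute)
  thus False using far[of n m "(0,0)" "(0,0)"] nm z by auto
 qed
 have "emeasure lborel ?S = (\<Sum>n\<in>J. emeasure lborel (ball (c n) r))"
  by (rule sum_emeasure[symmetric]) (use J dis in auto)
 also have "... = (\<Sum>n\<in>J. ennreal (pi * r^2))"
 proof (rule sum.cong)
  fix n
  have "emeasure lborel (ball (c n) r) = ennreal (unit_ball_vol (real DIM(complex)) * r ^ DIM(complex))" using r by (rule emeasure_ball)
  thus "emeasure lborel (ball (c n) r) = ennreal (pi * r^2)" by (simp add: unit_ball_vol_2)
 qed simp
 also have "... = ennreal (real (card J) * (pi * r^2))" using r by (simp add: ennreal_of_nat_eq_real_of_nat flip: ennreal_mult)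
 finally have S: "emeasure lborel ?S = ennreal (real (card J) * (pi * r^2))" .
 have "emeasure lborel ?S <= emeasure lborel par"
 proof (rule fund_le[OF fund_par])
  fix x k assume "x : ?S" "x + trn k : ?S"
  then obtain n m where nm: "n : J" "m : J" "dist (c n) x < r" "dist (c m) (x + trn k) < r" by auto
  have "dist (c n + trn k) (x + trn k) < r" using nm(3) by simp
  hence "cmod ((c n + trn k) - c m) < 2 * r"
   using dist_triangle_less_add[of "c n + trn k" "x + trn k" r "c m" r] nm(4) by (simp add: dist_commute dist_norm norm_minus_commute[of "c m"])
  hence "(n, k) = (m, (0, 0))" using far[OF nm(1,2), of k "(0,0)"] z by force
  thus "trn k = 0" by (simp add: z)
 qed auto
 thus ?thesis unfolding S emeasure_par by simp
qed

end

locale final = rlcusp + maxcusp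
begin

sublocale half: plattice mu nu
proof
 have "Im (cnj lam * nu) = 2 * Im (cnj mu * nu)" by (simp add: mu(1))
 thus "Im (cnj mu * nu) ~= 0" using lattice_independent by auto
qed

theorem area_lower_mu: "real (length w) * (pi * ((cmod mu)^2 / 8)^2) <= \<bar>Im (cnj mu * nu)\<bar>"
proof -
 let ?J = "{n. n < NN & turn n}"
 have "real (length w) * (pi * ((cmod mu)^2 / 8)^2) <= real (card ?J) * (pi * ((cmod mu)^2 / 8)^2)"
  using card_turns by (intro mult_right_mono) auto
 also have "... <= \<bar>Im (cnj mu * nu)\<bar>"
 proof (rule half.packing[where c = "%n. ctr (A (sh n))"])
  fix n m and k j :: "int \<times> int" assume "n : ?J" "m : ?J" "(n, k) ~= (m, j)"
  thus "2 * ((cmod mu)^2 / 8) <= cmod (ctr (A (sh n)) + half.trn k - (ctr (A (sh m)) + half.trn j))"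
   using separated[of n m "fst k" "snd k" "fst j" "snd j"] unfolding half.trn_def by (auto simp: prod_eq_iff add_ac)
 qed auto
 finally show ?thesis .
qed

theorem area_lower: "16 * sqrt 3 / 147 * real (length w) <= \<bar>Im (cnj lam * nu)\<bar>"
proof -
 have "16 * sqrt 3 / 147 <= 314159 / 100000 * (19203 / 10000) / (32 :: real)"
 proof -
  have "sqrt 3 <= 173206 / (100000 :: real)" by (rule real_le_lsqrt) (simp_all add: power_divide)
  thus ?thesis by simp
 qed
 also have "... <= pi * cmod mu ^ 4 / 32"
  using mu_bound pi_approx(1) by (intro divide_right_mono mult_mono) auto
 finally have "16 * sqrt 3 / 147 * real (length w) <= pi * cmod mu ^ 4 / 32 * real (length w)" by (rule mult_right_mono) simp
 also have "... = 2 * (real (length w) * (pi * ((cmod mu)^2 / 8)^2))" by (simp add: power_divide flip: power_mult)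
 also have "... <= 2 * \<bar>Im (cnj mu * nu)\<bar>" using area_lower_mu by simp
 also have "... = \<bar>Im (cnj lam * nu)\<bar>"
 proof -
  have "Im (cnj lam * nu) = 2 * Im (cnj mu * nu)" by (simp add: mu(1))
  thus ?thesis by (simp only: abs_mult)
 qed
 finally show ?thesis .
qed

text \<open>The imaginary part of \<open>cnj mu * z\<close> sees only the \<open>nu\<close>
  component of \<open>z\<close>, so the length is at least the covolume of \<open>mu\<close> and
  \<open>nu\<close> divided by \<open>|mu|\<close>, which is at least \<open>pi |mu|^3 / 64\<close>
  per block.\<close>

theorem length_lower: assumes "k ~= 0" shows "4 * sqrt 6 / 147 * real (length w) <= cmod (of_int j * lam + of_int k * nu)"
proof -
 let ?z = "of_int j * lam + of_int k * nu"
 have m: "1 <= cmod mu" using mu_bound power_le_one[of "cmod mu" 4] by (cases "1 <= cmod mu") auto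
 have "1 * 1 <= \<bar>real_of_int k\<bar>" using assms by linarith
 hence "1 * \<bar>Im (cnj mu * nu)\<bar> <= \<bar>real_of_int k\<bar> * \<bar>Im (cnj mu * nu)\<bar>" by (intro mult_right_mono) auto
 also have "... = \<bar>Im (cnj mu * ?z)\<bar>" by (simp add: mu(1) algebra_simps flip: abs_mult)
 also have "... <= cmod (cnj mu * ?z)" by (rule abs_Im_le_cmod)
 finally have 1: "\<bar>Im (cnj mu * nu)\<bar> <= cmod mu * cmod ?z" by (simp add: norm_mult)
 have "4 * sqrt 6 / 147 <= 314 / 100 * (15 / 10) / (64 :: real)"
 proof -
  have "sqrt 6 <= 25 / (10 :: real)" by (rule real_le_lsqrt) (simp_all add: power_divide)
  thus ?thesis by simp
 qed
 also have "... <= pi * cmod mu ^ 3 / 64"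
 proof -
  \<comment> \<open>Compared as twelfth powers: \<open>1.9203^3 > 1.5^4\<close>.\<close>
  have "15 / 10 <= cmod mu ^ 3"
  proof (rule ccontr)
   assume n: "\<not> ?thesis"
   have "(cmod mu ^ 3) ^ 4 < (15 / 10) ^ 4" using n by (intro power_strict_mono) auto
   moreover have "(19203 / 10000) ^ 3 <= (cmod mu ^ 4) ^ 3" using mu_bound by (intro power_mono) auto
   ultimately show False by (simp add: power_divide flip: power_mult)
  qed
  thus ?thesis using pi_approx(1) by (intro divide_right_mono mult_mono) auto
 qed
 finally have "4 * sqrt 6 / 147 * real (length w) <= pi * cmod mu ^ 3 / 64 * real (length w)" by (rule mult_right_mono) simp
 also have "... <= cmod ?z"
 proof -
  have "cmod mu * (pi * cmod mu ^ 3 / 64 * real (length w)) = real (length w) * (pi * ((cmod mu)^2 / 8)^2)"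
   by (simp add: power_divide power2_eq_square power3_eq_cube)
  also have "... <= cmod mu * cmod ?z" using area_lower_mu 1 by linarith
  finally show ?thesis using mu(2) by simp
 qed
 finally show ?thesis .
qed

end

section \<open>Volumes of regular ideal polyhedra\<close>

lemma lin_inverse:
 fixes B :: "real^3 => real^3"
 assumes B: "linear B" and d: "det (matrix B) ~= 0"
 shows "EX g. linear g & g \<circ> B = id & B \<circ> g = id"
proof -
 have inj: "inj B" using d B by (metis det_nz_iff_inj)
 obtain g where g: "linear g" "g \<circ> B = id" using linear_injective_left_inverse[OF B inj] by blast
 have "B (g y) = y" for y
  using linear_injective_imp_surjective[OF B inj] g(2) by (metis comp_apply id_apply surjD)
 thus ?thesis using g by (auto simp: fun_eq_iff)
qed

lemma lin_nn:
 fixes B :: "real^3 => real^3"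
 assumes B: "linear B" and d: "det (matrix B) ~= 0" and F[measurable]: "F : borel_measurable borel"
 shows "(\<integral>\<^sup>+x. F x \<partial>lborel) = ennreal \<bar>det (matrix B)\<bar> * (\<integral>\<^sup>+x. F (B x) \<partial>lborel)"
proof -
 have mB[measurable]: "B : borel_measurable borel" using B by (intro borel_measurable_continuous_onI linear_continuous_on linear_linear[THEN iffD2])
 obtain g where g: "linear g" "g \<circ> B = id" "B \<circ> g = id" using lin_inverse[OF B d] by blast
 have "lborel = density (distr lborel borel B) (%_. ennreal \<bar>det (matrix B)\<bar>)"
 proof (rule lborel_eqI)
  fix l u :: "real^3" assume le: "!!b. b : Basis ==> l \<bullet> b <= u \<bullet> b"
  have im: "B -` box l u = g ` box l u" "B ` (B -` box l u) = box l u"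
   using g(2,3) by (auto simp: image_iff fun_eq_iff) metis+
  have lm: "B -` box l u : lmeasurable" unfolding im(1) by (intro measurable_linear_image g) simp
  have sb: "B -` box l u : sets borel" using measurable_sets_borel[OF mB, of "box l u"] by simp
  have "emeasure (density (distr lborel borel B) (%_. ennreal \<bar>det (matrix B)\<bar>)) (box l u) =
   ennreal \<bar>det (matrix B)\<bar> * emeasure lborel (B -` box l u)"
   by (simp add: emeasure_density emeasure_distr nn_integral_cmult)
  also have "emeasure lborel (B -` box l u) = emeasure lebesgue (B -` box l u)" using sb by simp
  also have "... = ennreal (measure lebesgue (B -` box l u))" using lm by (rule emeasure_eq_measure2)
  also have "ennreal \<bar>det (matrix B)\<bar> * ... = ennreal (measure lebesgue (box l u))"
   using measure_linear_image[OF B lm] unfolding im(2) by (simp add: ennreal_mult)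
  also have "measure lebesgue (box l u) = (\<Prod>b\<in>Basis. (u - l) \<bullet> b)" using le by (simp add: measure_lborel_box)
  finally show "emeasure (density (distr lborel borel B) (%_. ennreal \<bar>det (matrix B)\<bar>)) (box l u) = ennreal (\<Prod>b\<in>Basis. (u - l) \<bullet> b)" .
 qed simp
 hence "(\<integral>\<^sup>+x. F x \<partial>lborel) = (\<integral>\<^sup>+x. F x \<partial>(density (distr lborel borel B) (%_. ennreal \<bar>det (matrix B)\<bar>)))" by metis
 also have "... = ennreal \<bar>det (matrix B)\<bar> * (\<integral>\<^sup>+x. F (B x) \<partial>lborel)"
  by (simp add: nn_integral_density nn_integral_distr nn_integral_cmult)
 finally show ?thesis .
qed

definition kd :: "real^3 => real" where "kd x = 1 / (1 - (norm x)^2)^2"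

lemma kd_measurable [measurable]: "kd : borel_measurable borel" unfolding kd_def by measurable

text \<open>Extended values allow pieces to be compared before finiteness is known; the Bochner
  integral of a non-integrable function would be \<open>0\<close>.\<close>

definition NI :: "(real^3) set => ennreal" where "NI S = (\<integral>\<^sup>+x. ennreal (kd x) * indicator S x \<partial>lborel)"

lemma klein_volume_NI: "S : sets borel ==> klein_volume S = enn2real (NI S)"
proof -
 assume [measurable]: "S : sets borel"
 have "klein_volume S = (\<integral>x. indicator S x * kd x \<partial>lborel)" by (simp add: klein_volume_def set_lebesgue_integral_def kd_def)
 also have "... = enn2real (\<integral>\<^sup>+x. ennreal (indicator S x * kd x) \<partial>lborel)"
  by (rule integral_eq_nn_integral) (auto simp: kd_def)
 also have "(\<integral>\<^sup>+x. ennreal (indicator S x * kd x) \<partial>lborel) = NI S"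
  unfolding NI_def by (intro nn_integral_cong) (simp add: indicator_def)
 finally show "klein_volume S = enn2real (NI S)" .
qed

definition simp3 :: "(real^3) set" where "simp3 = {x. 0 < x$1 & 0 < x$2 & 0 < x$3 & x$1 + x$2 + x$3 <= 1}"

lemma simp3I: "0 < p ==> 0 < q ==> 0 < r ==> p + q + r <= 1 ==> vector [p, q, r] : simp3"
 by (simp add: simp3_def)

lemma simp3_measurable [measurable]: "simp3 : sets borel" unfolding simp3_def by measurable

lemma norm3: "(norm (x :: real^3))^2 = (x$1)^2 + (x$2)^2 + (x$3)^2"
 unfolding power2_norm_eq_inner by (simp add: inner_vec_def sum_3 power2_eq_square)

definition refl3 :: "3 => real^3 => real^3" where "refl3 i x = (\<chi> j. if j = i then - x$j else x$j)"

lemma AE_coord: "AE x in lborel. (x :: real^3) $ i ~= 0"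
proof -
 have "negligible {x :: real^3. x $ i = 0}"
  using negligible_standard_hyperplane[of "axis i 1 :: real^3" 0] by (auto simp: inner_axis Basis_vec_def)
 hence "{x :: real^3. x $ i = 0} : null_sets lebesgue" by (simp add: negligible_iff_null_sets)
 hence "{x :: real^3. x $ i = 0} : null_sets lborel"
  by (simp add: null_sets_completion_iff)
 thus ?thesis by (rule AE_I'[of _]) auto
qed

lemma reflect_half:
 assumes [measurable]: "F : borel_measurable borel" and s: "!!x. F (refl3 i x) = F x"
 shows "(\<integral>\<^sup>+x. F x \<partial>lborel) = 2 * (\<integral>\<^sup>+x. F x * indicator {x. 0 < x$i} x \<partial>lborel)"
proof -
 have l: "linear (refl3 i)" by (rule linearI) (simp_all add: refl3_def vec_eq_iff)
 have d: "\<bar>det (matrix (refl3 i))\<bar> = 1"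
  using exhaust_3[of i] by (auto simp: det_3 matrix_def refl3_def axis_def)
 have e: "(\<integral>\<^sup>+x. F x * indicator {x. x$i < 0} x \<partial>lborel) = (\<integral>\<^sup>+x. F x * indicator {x. 0 < x$i} x \<partial>lborel)"
 proof -
  have "(\<integral>\<^sup>+x. F x * indicator {x. x$i < 0} x \<partial>lborel) = (\<integral>\<^sup>+x. F (refl3 i x) * indicator {x. x$i < 0} (refl3 i x) \<partial>lborel)"
   using lin_nn[OF l, of "%x. F x * indicator {x. x$i < 0} x"] d by fastforce
  also have "... = (\<integral>\<^sup>+x. F x * indicator {x. 0 < x$i} x \<partial>lborel)"
   unfolding s by (intro nn_integral_cong) (simp add: refl3_def indicator_def)
  finally show ?thesis .
 qed
 have "(\<integral>\<^sup>+x. F x \<partial>lborel) = (\<integral>\<^sup>+x. F x * indicator {x. 0 < x$i} x + F x * indicator {x. x$i < 0} x \<partial>lborel)"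
  by (rule nn_integral_cong_AE) (use AE_coord[of i] in "auto simp: indicator_def")
 also have "... = (\<integral>\<^sup>+x. F x * indicator {x. 0 < x$i} x \<partial>lborel) + (\<integral>\<^sup>+x. F x * indicator {x. x$i < 0} x \<partial>lborel)"
  by (rule nn_integral_add) measurable
 finally show ?thesis unfolding e by (simp add: mult_2)
qed

lemma convex_comb3:
 assumes "convex H" "0 : H" "p : H" "q : H" "r : H" "0 <= a" "0 <= b" "0 <= c" "a + b + c <= 1"
 shows "a *\<^sub>R p + b *\<^sub>R q + c *\<^sub>R r : H"
proof (cases "a + b + c = 0")
 case True
 hence "a = 0" "b = 0" "c = 0" using assms by linarith+
 thus ?thesis using assms by simp
next
 case False
 let ?s = "a + b + c"
 let ?y = "(a / ?s) *\<^sub>R p + (b / ?s) *\<^sub>R q + (c / ?s) *\<^sub>R r"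
 have "a / ?s + b / ?s + c / ?s = 1" using False by (simp flip: add_divide_distrib)
 hence "?y : convex hull {p, q, r}" using assms False unfolding convex_hull_3 by (intro CollectI exI conjI) auto
 moreover have "convex hull {p, q, r} <= H" using assms by (intro hull_minimal) auto
 ultimately have "?s *\<^sub>R ?y + (1 - ?s) *\<^sub>R 0 : H" using assms by (intro convexD) auto
 thus ?thesis using False by (simp add: scaleR_add_right)
qed

definition octa :: "(real^3) set" where
 "octa = convex hull {vector [1, 0, 0], vector [-1, 0, 0], vector [0, 1, 0], vector [0, -1, 0], vector [0, 0, 1], vector [0, 0, -1]}"

lemma octa: "octa = {x. \<bar>x$1\<bar> + \<bar>x$2\<bar> + \<bar>x$3\<bar> <= 1}"
proof
 have c: "convex {x :: real^3. \<bar>x$1\<bar> + \<bar>x$2\<bar> + \<bar>x$3\<bar> <= 1}"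
 proof (rule convexI)
  fix x y :: "real^3" and u v :: real
  assume *: "x : {x. \<bar>x$1\<bar> + \<bar>x$2\<bar> + \<bar>x$3\<bar> <= 1}" "y : {x. \<bar>x$1\<bar> + \<bar>x$2\<bar> + \<bar>x$3\<bar> <= 1}" "0 <= u" "0 <= v" "u + v = 1"
  have t: "\<bar>u * a + v * b\<bar> <= u * \<bar>a\<bar> + v * \<bar>b\<bar>" for a b using abs_triangle_ineq[of "u * a" "v * b"]
   unfolding abs_mult abs_of_nonneg[OF *(3)] abs_of_nonneg[OF *(4)] .
  let ?x = "%i. x $ i" and ?y = "%i. y $ i"
  have "\<bar>u * ?x 1 + v * ?y 1\<bar> + \<bar>u * ?x 2 + v * ?y 2\<bar> + \<bar>u * ?x 3 + v * ?y 3\<bar> <=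
   (u * \<bar>?x 1\<bar> + v * \<bar>?y 1\<bar>) + (u * \<bar>?x 2\<bar> + v * \<bar>?y 2\<bar>) + (u * \<bar>?x 3\<bar> + v * \<bar>?y 3\<bar>)"
   by (intro add_mono t)
  also have "... = u * (\<bar>?x 1\<bar> + \<bar>?x 2\<bar> + \<bar>?x 3\<bar>) + v * (\<bar>?y 1\<bar> + \<bar>?y 2\<bar> + \<bar>?y 3\<bar>)"
   by (simp only: ring_distribs add_ac)
  also have "... <= u * 1 + v * 1" using * by (intro add_mono mult_left_mono) auto
  finally show "u *\<^sub>R x + v *\<^sub>R y : {x. \<bar>x$1\<bar> + \<bar>x$2\<bar> + \<bar>x$3\<bar> <= 1}" using *(5) by simp
 qed
 show "octa <= {x. \<bar>x$1\<bar> + \<bar>x$2\<bar> + \<bar>x$3\<bar> <= 1}" unfolding octa_def by (rule hull_minimal) (use c in auto)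
 show "{x. \<bar>x$1\<bar> + \<bar>x$2\<bar> + \<bar>x$3\<bar> <= 1} <= octa"
 proof
  fix x :: "real^3" assume x: "x : {x. \<bar>x$1\<bar> + \<bar>x$2\<bar> + \<bar>x$3\<bar> <= 1}"
  define s where "s t = (if t < 0 then -1 else 1 :: real)" for t :: real
  have m: "vector [s t, 0, 0] : octa" "vector [0, s t, 0] : octa" "vector [0, 0, s t] : octa" for t
   unfolding octa_def s_def by (auto intro!: hull_inc)
  have co: "convex octa" unfolding octa_def by simp
  have "(1/2) *\<^sub>R vector [s 1, 0, 0] + (1/2) *\<^sub>R vector [s (-1), 0, 0] : octa"
   using m(1)[of 1] m(1)[of "-1"] co by (intro convexD) auto
  moreover have "(1/2) *\<^sub>R vector [s 1, 0, 0] + (1/2) *\<^sub>R vector [s (-1), 0, 0] = (0 :: real^3)"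
   by (simp add: s_def vec_eq_iff forall_3)
  ultimately have "(0 :: real^3) : octa" by simp
  hence "\<bar>x$1\<bar> *\<^sub>R vector [s (x$1), 0, 0] + \<bar>x$2\<bar> *\<^sub>R vector [0, s (x$2), 0] + \<bar>x$3\<bar> *\<^sub>R vector [0, 0, s (x$3)] : octa"
   using m co x by (intro convex_comb3) auto
  moreover have "\<bar>x$1\<bar> *\<^sub>R vector [s (x$1), 0, 0] + \<bar>x$2\<bar> *\<^sub>R vector [0, s (x$2), 0] + \<bar>x$3\<bar> *\<^sub>R vector [0, 0, s (x$3)] = x"
   by (simp add: vec_eq_iff forall_3 s_def)
  ultimately show "x : octa" by simp
 qed
qed

lemma octa_measurable [measurable]: "octa : sets borel" unfolding octa by measurable

lemma NI_octa: "NI octa = 8 * NI simp3"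
proof -
 have r: "norm (refl3 i x) = norm x" "refl3 i x : octa \<longleftrightarrow> x : octa" for i x
 proof -
  have "(norm (refl3 i x))^2 = (norm x)^2" unfolding norm3 by (simp add: refl3_def)
  thus "norm (refl3 i x) = norm x" by simp
  show "refl3 i x : octa \<longleftrightarrow> x : octa" by (simp add: octa refl3_def)
 qed
 have n: "refl3 i x $ j = x $ j" if "i ~= j" for i j x using that by (auto simp: refl3_def)
 let ?f = "%x. ennreal (kd x) * indicator octa x"
 have ij: "(1::3) ~= 2" "(1::3) ~= 3" "(2::3) ~= 3" by simp_all
 have "NI octa = 2 * (\<integral>\<^sup>+x. ?f x * indicator {x. 0 < x$1} x \<partial>lborel)"
  unfolding NI_def by (rule reflect_half) (simp_all add: kd_def r indicator_def)
 also have "(\<integral>\<^sup>+x. ?f x * indicator {x. 0 < x$1} x \<partial>lborel) = 2 * (\<integral>\<^sup>+x. ?f x * indicator {x. 0 < x$1} x * indicator {x. 0 < x$2} x \<partial>lborel)"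
  by (rule reflect_half) (use ij in "simp_all add: kd_def r n indicator_def")
 also have "(\<integral>\<^sup>+x. ?f x * indicator {x. 0 < x$1} x * indicator {x. 0 < x$2} x \<partial>lborel) =
  2 * (\<integral>\<^sup>+x. ?f x * indicator {x. 0 < x$1} x * indicator {x. 0 < x$2} x * indicator {x. 0 < x$3} x \<partial>lborel)"
  by (rule reflect_half) (use ij in "simp_all add: kd_def r n indicator_def")
 also have "(\<integral>\<^sup>+x. ?f x * indicator {x. 0 < x$1} x * indicator {x. 0 < x$2} x * indicator {x. 0 < x$3} x \<partial>lborel) = NI simp3"
  unfolding NI_def by (intro nn_integral_cong) (auto simp: indicator_def simp3_def octa)
 finally show ?thesis by (simp flip: mult.assoc)
qed

section \<open>Finiteness of the volume at the ideal vertices\<close>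

definition bx :: "nat => 3 => (real^3) set" where
 "bx k i = cbox (\<chi> j. if j = i then 1 - (1/2)^k else 0) (\<chi> j. if j = i then 1 else (1/2)^k)"

lemma emeasure_bx: "emeasure lborel (bx k i) = ennreal ((1/8) ^ k)"
proof -
 have B: "(Basis :: (real^3) set) = (%i. axis i 1) ` UNIV" by (auto simp: Basis_vec_def)
 have "emeasure lborel (bx k i) = ennreal (\<Prod>b\<in>Basis. ((\<chi> j. if j = i then 1 else (1/2)^k) - (\<chi> j. if j = i then 1 - (1/2)^k else 0) :: real^3) \<bullet> b)"
  unfolding bx_def by (rule emeasure_lborel_cbox) (auto simp: B inner_axis power_le_one)
 also have "(\<Prod>b\<in>Basis. ((\<chi> j. if j = i then 1 else (1/2)^k) - (\<chi> j. if j = i then 1 - (1/2)^k else 0) :: real^3) \<bullet> b) =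
   (\<Prod>j\<in>(UNIV :: 3 set). (if j = i then 1 else (1/2)^k) - (if j = i then 1 - (1/2)^k else 0))"
  unfolding B by (subst prod.reindex) (auto simp: inj_on_def axis_eq_axis inner_axis)
 also have "... = (\<Prod>j\<in>(UNIV :: 3 set). (1/2)^k)" by (rule prod.cong) auto
 also have "... = (1/8 :: real) ^ k" by (simp flip: power_mult power_mult_distrib) (simp add: mult.commute[of k] power_mult power3_eq_cube)
 finally show ?thesis .
qed

text \<open>On the simplex \<open>\<bar>x\<bar>\<^sup>2\<close> is at most the largest coordinate \<open>m\<close>, and \<open>1 - m\<close> is comparable to a power of \<open>1/2\<close>.\<close>

lemma kd_shell:
 assumes x: "x : simp3" "kd x ~= 0"
 shows "EX k i. x : bx k i & kd x <= 4 * 4 ^ k"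
proof -
 have p: "0 < x$1" "0 < x$2" "0 < x$3" "x$1 + x$2 + x$3 <= 1" using x by (auto simp: simp3_def)
 obtain i where i: "!!j. x$j <= x$i"
  using Max_in[of "range (($) x)"] Max_ge[of "range (($) x)"] by (metis (no_types) UNIV_I empty_iff finite_class.finite_UNIV finite_imageI imageE image_eqI)
 define u where "u = 1 - x$i"
 have u: "0 < u" "u <= 1" using p exhaust_3[of i] by (auto simp: u_def)
 have oth: "0 < x$j" "j ~= i ==> x$j <= u" for j using p exhaust_3[of i] exhaust_3[of j] by (auto simp: u_def)
 have "(norm x)^2 <= x$i * x$1 + x$i * x$2 + x$i * x$3"
  unfolding norm3 unfolding power2_eq_square using i p by (intro add_mono mult_right_mono) auto
 also have "... = x$i * (x$1 + x$2 + x$3)" by (simp add: algebra_simps)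
 also have "... <= x$i * 1" using p(4) oth(1)[of i] by (intro mult_left_mono) auto
 finally have n: "u <= 1 - (norm x)^2" by (simp add: u_def)
 obtain N where N: "(1/2::real) ^ N < u" using real_arch_pow_inv[OF u(1), of "1/2"] by auto
 define k where "k = (LEAST k. (1/2::real) ^ Suc k < u)"
 have ex: "(1/2::real) ^ Suc N < u" using N u by simp
 have k: "(1/2::real) ^ Suc k < u" unfolding k_def by (rule LeastI[of "%k. (1/2::real) ^ Suc k < u", OF ex])
 have k2: "u <= (1/2) ^ k"
 proof (cases k)
  case (Suc l)
  hence "\<not> (1/2::real) ^ Suc l < u" using not_less_Least[of l "%k. (1/2::real) ^ Suc k < u"] by (simp add: k_def)
  thus ?thesis using Suc by simp
 qed (use u in simp)
 have "x : bx k i" using oth i k2 p u(1) by (auto simp: bx_def mem_box_cart u_def less_imp_le intro: order_trans[OF oth(2)])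
 moreover have "kd x <= 4 * 4 ^ k"
 proof -
  have "((1/2) ^ Suc k)^2 <= (1 - (norm x)^2)^2" using k n by (intro power_mono) auto
  hence "kd x <= 1 / ((1/2) ^ Suc k)^2" unfolding kd_def by (intro divide_left_mono) (use u n in auto)
  also have "... = 4 * 4 ^ k" by (simp add: power_one_over power_mult_distrib flip: power_mult) (simp add: power_mult mult.commute[of k])
  finally show ?thesis .
 qed
 ultimately show ?thesis by blast
qed

text \<open>A box of volume \<open>8^(-k)\<close> carries density at most \<open>4 * 4^k\<close>, so
  the three vertices contribute a geometric series.\<close>

lemma NI_simp3_finite: "NI simp3 < \<infinity>"
proof -
 let ?g = "%k x. \<Sum>i\<in>UNIV. ennreal (4 * 4 ^ k) * indicator (bx k i) (x :: real^3)"
 have [measurable]: "bx k i : sets borel" for k i by (simp add: bx_def)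
 have le: "ennreal (kd x) * indicator simp3 x <= suminf (%k. ?g k x)" for x
 proof (cases "x : simp3 & kd x ~= 0")
  case True
  then obtain k i where k: "x : bx k i" "kd x <= 4 * 4 ^ k" using kd_shell by blast
  have "ennreal (kd x) * indicator simp3 x <= ennreal (4 * 4 ^ k) * indicator (bx k i) x" using True k by (simp add: ennreal_leI)
  also have "... <= ?g k x" by (rule member_le_sum) auto
  also have "... <= suminf (%k. ?g k x)" using sum_le_suminf[of "%k. ?g k x" "{k}"] by simp
  finally show ?thesis .
 qed (auto simp: indicator_def)
 have "NI simp3 <= (\<integral>\<^sup>+x. suminf (%k. ?g k x) \<partial>lborel)" unfolding NI_def by (rule nn_integral_mono) (rule le)
 also have "... = suminf (%k. \<integral>\<^sup>+x. ?g k x \<partial>lborel)" by (rule nn_integral_suminf) measurable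
 also have "... = suminf (%k. ennreal (12 * (1/2) ^ k))"
 proof (rule suminf_cong)
  fix k
  have "(\<integral>\<^sup>+x. ?g k x \<partial>lborel) = (\<Sum>i\<in>(UNIV::3 set). ennreal (4 * 4 ^ k) * ennreal ((1/8) ^ k))"
   by (subst nn_integral_sum) (auto simp: nn_integral_cmult_indicator emeasure_bx)
  also have "ennreal (4 * 4 ^ k) * ennreal ((1/8) ^ k) = ennreal (4 * (1/2) ^ k)"
   by (simp add: mult.assoc flip: ennreal_mult power_mult_distrib)
  also have "(\<Sum>i\<in>(UNIV::3 set). ennreal (4 * (1/2) ^ k)) = ennreal (12 * (1/2) ^ k)"
   by (simp flip: ennreal_numeral ennreal_mult')
  finally show "(\<integral>\<^sup>+x. ?g k x \<partial>lborel) = ennreal (12 * (1/2) ^ k)" .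
 qed
 also have "... = ennreal (suminf (%k. 12 * (1/2) ^ k))"
  by (intro suminf_ennreal2 summable_mult summable_geometric) auto
 finally show ?thesis using ennreal_less_top by (metis infinity_ennreal_def le_less_trans)
qed

text \<open>The cones of the octahedron over its faces are mapped linearly to those of the tetrahedron, whose vertices have
 pairwise inner product \<open>- 1/3\<close>; this decreases norms and hence the volume density.\<close>

definition B3 :: "real^3 => real^3 => real^3 => real^3 => real^3" where
 "B3 p q r x = (x$1) *\<^sub>R p + (x$2) *\<^sub>R q + (x$3) *\<^sub>R r"

lemma NI_cone:
 assumes ip: "p \<bullet> p = 1" "q \<bullet> q = 1" "r \<bullet> r = 1" "p \<bullet> q <= 0" "p \<bullet> r <= 0" "q \<bullet> r <= 0"
  and d: "det (matrix (B3 p q r)) ~= 0"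
 shows "NI (B3 p q r ` simp3) <= ennreal \<bar>det (matrix (B3 p q r))\<bar> * NI simp3"
  "ennreal \<bar>det (matrix (B3 p q r))\<bar> * emeasure lborel simp3 <= NI (B3 p q r ` simp3)"
  "B3 p q r ` simp3 : sets borel"
proof -
 let ?B = "B3 p q r"
 have l: "linear ?B" by (rule linearI) (simp_all add: B3_def algebra_simps)
 obtain g where g: "linear g" "g \<circ> ?B = id" "?B \<circ> g = id" using lin_inverse[OF l d] by blast
 have inj: "inj ?B" using g(2) by (metis inj_on_id inj_on_imageI2)
 have sur: "surj ?B" using g(3) by (metis comp_apply id_apply surjI)
 have im: "?B ` simp3 = g -` simp3"
 proof (intro equalityI subsetI)
  fix y assume "y : g -` simp3"
  moreover obtain x where "y = ?B x" using sur by blast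
  ultimately show "y : ?B ` simp3" using g(2) by (auto simp: fun_eq_iff)
 qed (use g(2) in "auto simp: fun_eq_iff")
 have "g : borel_measurable borel" using g(1) by (intro borel_measurable_continuous_onI linear_continuous_on linear_linear[THEN iffD2])
 thus m[measurable]: "?B ` simp3 : sets borel" unfolding im using measurable_sets_borel[OF _ simp3_measurable, of g] by simp
 have e: "NI (?B ` simp3) = ennreal \<bar>det (matrix ?B)\<bar> * (\<integral>\<^sup>+x. ennreal (kd (?B x)) * indicator simp3 x \<partial>lborel)"
 proof -
  have "indicator (?B ` simp3) (?B x) = (indicator simp3 x :: ennreal)" for x using inj by (auto simp: indicator_def inj_image_mem_iff)
  thus ?thesis unfolding NI_def by (subst lin_nn[OF l d]) simp_all
 qed
 have n: "(norm (?B x))^2 <= (norm x)^2 & (norm x)^2 <= 1" if "x : simp3" for x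
 proof -
  have p: "0 < x$1" "0 < x$2" "0 < x$3" "x$1 + x$2 + x$3 <= 1" using that by (auto simp: simp3_def)
  have "(norm (?B x))^2 = (norm x)^2 + 2 * (x$1 * x$2 * (p \<bullet> q) + x$1 * x$3 * (p \<bullet> r) + x$2 * x$3 * (q \<bullet> r))"
  proof -
   have "(norm (?B x))^2 = ?B x \<bullet> ?B x" by (rule power2_norm_eq_inner)
   also have "... = x$1 * x$1 * (p \<bullet> p) + x$2 * x$2 * (q \<bullet> q) + x$3 * x$3 * (r \<bullet> r) +
    2 * (x$1 * x$2 * (p \<bullet> q) + x$1 * x$3 * (p \<bullet> r) + x$2 * x$3 * (q \<bullet> r))"
    unfolding B3_def inner_add_left inner_add_right inner_scaleR_left inner_scaleR_right inner_commute[of q p]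
     inner_commute[of r p] inner_commute[of r q] by (simp add: algebra_simps)
   finally show ?thesis
    by (simp only: ip(1-3) norm3[of x] power2_eq_square[of "x $ 1"] power2_eq_square[of "x $ 2"] power2_eq_square[of "x $ 3"] mult_1_right)
  qed
  moreover have "x$1 * x$2 * (p \<bullet> q) <= 0" "x$1 * x$3 * (p \<bullet> r) <= 0" "x$2 * x$3 * (q \<bullet> r) <= 0"
   using p ip by (auto intro!: mult_nonneg_nonpos)
  moreover have "(norm x)^2 <= x$1 * 1 + x$2 * 1 + x$3 * 1"
   unfolding norm3 unfolding power2_eq_square using p by (intro add_mono mult_left_mono) auto
  ultimately show ?thesis using p by simp
 qed
 have lt: "(norm x)^2 < 1" if "x : simp3" for x
 proof -
  have p: "0 < x$1" "0 < x$2" "0 < x$3" "x$1 + x$2 + x$3 <= 1" using that by (auto simp: simp3_def)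
  have "(norm x)^2 < x$1 * 1 + x$2 * 1 + x$3 * 1"
   unfolding norm3 unfolding power2_eq_square using p by (intro add_strict_mono mult_strict_left_mono) auto
  thus ?thesis using p by simp
 qed
 have k: "1 <= kd (?B x) & kd (?B x) <= kd x" if "x : simp3" for x
 proof -
  have a: "0 < 1 - (norm x)^2" "1 - (norm x)^2 <= 1 - (norm (?B x))^2" "1 - (norm (?B x))^2 <= 1" using n[OF that] lt[OF that] by auto
  have "(1 - (norm x)^2)^2 <= (1 - (norm (?B x))^2)^2" using a by (intro power_mono) linarith+
  moreover have "(1 - (norm (?B x))^2)^2 <= 1" using a by (intro power_le_one) linarith+
  moreover have "0 < (1 - (norm x)^2)^2" "0 < (1 - (norm (?B x))^2)^2"
   by (rule zero_less_power, use a in linarith)+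
  ultimately show ?thesis unfolding kd_def
   by (intro conjI divide_left_mono mult_pos_pos) (simp_all only: le_divide_eq_1_pos zero_le_one)
 qed
 show "NI (?B ` simp3) <= ennreal \<bar>det (matrix ?B)\<bar> * NI simp3"
  unfolding e unfolding NI_def using k by (intro mult_left_mono nn_integral_mono) (auto simp: indicator_def intro!: ennreal_leI)
 have "emeasure lborel simp3 = (\<integral>\<^sup>+x. indicator simp3 x \<partial>lborel)" by simp
 also have "... <= (\<integral>\<^sup>+x. ennreal (kd (?B x)) * indicator simp3 x \<partial>lborel)"
 proof (rule nn_integral_mono)
  fix x
  show "indicator simp3 x <= ennreal (kd (?B x)) * indicator simp3 x"
   using ennreal_leI[of 1 "kd (?B x)"] k[of x] by (simp add: indicator_def)
 qed
 finally show "ennreal \<bar>det (matrix ?B)\<bar> * emeasure lborel simp3 <= NI (?B ` simp3)" unfolding e by (intro mult_left_mono) auto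
qed

definition tetra :: "(real^3) set" where
 "tetra = convex hull ((%x. (1 / sqrt 3) *\<^sub>R x) ` {vector [1, 1, 1], vector [1, -1, -1], vector [-1, 1, -1], vector [-1, -1, 1]})"

text \<open>The octahedron consists of eight copies of the simplex, the tetrahedron of four images
  under maps of determinant \<open>4 / (3 sqrt 3)\<close> up to sign, on which the density is no
  larger. What remains is the ratio of the Euclidean volumes.\<close>

theorem v8_v3: "3 * sqrt 3 / 2 <= v8 / v3"
proof -
 define s where "s = 1 / sqrt 3"
 have s: "s * s = 1/3" "s * (s * x) = x/3" "0 < s" for x
  unfolding s_def by (simp_all add: field_simps)
 have s3: "s ^ 3 * 4 = 4 / (3 * sqrt 3)" by (simp add: s_def power3_eq_cube field_simps)
 define a b c d :: "real^3" where "a = s *\<^sub>R vector [1, 1, 1]" and "b = s *\<^sub>R vector [1, -1, -1]"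
  and "c = s *\<^sub>R vector [-1, 1, -1]" and "d = s *\<^sub>R vector [-1, -1, 1]"
 note abcd = a_def b_def c_def d_def
 have tet: "tetra = convex hull {a, b, c, d}" by (simp add: tetra_def abcd s_def)
 have ip: "a \<bullet> a = 1" "b \<bullet> b = 1" "c \<bullet> c = 1" "d \<bullet> d = 1" "a \<bullet> b <= 0" "a \<bullet> c <= 0" "a \<bullet> d <= 0" "b \<bullet> c <= 0" "b \<bullet> d <= 0" "c \<bullet> d <= 0"
  unfolding abcd by (simp_all add: inner_vec_def sum_3 s)
 have dt: "\<bar>det (matrix (B3 b c d))\<bar> = 4 / (3 * sqrt 3)" "\<bar>det (matrix (B3 a c d))\<bar> = 4 / (3 * sqrt 3)"
  "\<bar>det (matrix (B3 a b d))\<bar> = 4 / (3 * sqrt 3)" "\<bar>det (matrix (B3 a b c))\<bar> = 4 / (3 * sqrt 3)"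
  unfolding s3[symmetric] using s(3)
  by (simp_all add: det_3 matrix_def B3_def abcd axis_def power3_eq_cube)
 let ?k = "4 / (3 * sqrt 3)"
 have nz: "det (matrix (B3 b c d)) ~= 0" "det (matrix (B3 a c d)) ~= 0" "det (matrix (B3 a b d)) ~= 0" "det (matrix (B3 a b c)) ~= 0"
  using dt by (auto simp del: abs_eq_0)
 note C1 = NI_cone[OF ip(2,3,4,8,9,10) nz(1), unfolded dt(1)] and C2 = NI_cone[OF ip(1,3,4,6,7,10) nz(2), unfolded dt(2)]
  and C3 = NI_cone[OF ip(1,2,4,5,7,9) nz(3), unfolded dt(3)] and C4 = NI_cone[OF ip(1,2,3,5,6,8) nz(4), unfolded dt(4)]
 have tT[measurable]: "tetra : sets borel" unfolding tet by (intro borel_closed compact_imp_closed finite_imp_compact_convex_hull) simp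
 have hT: "tetra <= {x. -1/3 <= a \<bullet> x & -1/3 <= b \<bullet> x & -1/3 <= c \<bullet> x & -1/3 <= d \<bullet> x}"
  unfolding tet
 proof (rule hull_minimal)
  show "convex {x. -1/3 <= a \<bullet> x & -1/3 <= b \<bullet> x & -1/3 <= c \<bullet> x & -1/3 <= d \<bullet> x}"
   by (simp only: Collect_conj_eq) (intro convex_Int, (rule convex_halfspace_ge)+)
  show "{a, b, c, d} <= {x. -1/3 <= a \<bullet> x & -1/3 <= b \<bullet> x & -1/3 <= c \<bullet> x & -1/3 <= d \<bullet> x}"
   unfolding abcd by (auto simp: inner_vec_def sum_3 s)
 qed
 \<comment> \<open>For a regular tetrahedron \<open>x\<close> is \<open>3/4\<close> times the sum of
   \<open>(a \<bullet> x) a\<close> over its vertices, and the vertices add up to \<open>0\<close>;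
   so any one coefficient can be subtracted from all four.\<close>
 have rep: "x = B3 b c d (vector [3/4 * (b \<bullet> x) - 3/4 * (a \<bullet> x), 3/4 * (c \<bullet> x) - 3/4 * (a \<bullet> x), 3/4 * (d \<bullet> x) - 3/4 * (a \<bullet> x)])"
  "x = B3 a c d (vector [3/4 * (a \<bullet> x) - 3/4 * (b \<bullet> x), 3/4 * (c \<bullet> x) - 3/4 * (b \<bullet> x), 3/4 * (d \<bullet> x) - 3/4 * (b \<bullet> x)])"
  "x = B3 a b d (vector [3/4 * (a \<bullet> x) - 3/4 * (c \<bullet> x), 3/4 * (b \<bullet> x) - 3/4 * (c \<bullet> x), 3/4 * (d \<bullet> x) - 3/4 * (c \<bullet> x)])"
  "x = B3 a b c (vector [3/4 * (a \<bullet> x) - 3/4 * (d \<bullet> x), 3/4 * (b \<bullet> x) - 3/4 * (d \<bullet> x), 3/4 * (c \<bullet> x) - 3/4 * (d \<bullet> x)])"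
  "a \<bullet> x + b \<bullet> x + c \<bullet> x + d \<bullet> x = 0" for x
  unfolding abcd B3_def vec_eq_iff forall_3 by (simp_all add: inner_vec_def sum_3 algebra_simps s)
 define E where "E = {x. a \<bullet> x = b \<bullet> x | a \<bullet> x = c \<bullet> x | a \<bullet> x = d \<bullet> x | b \<bullet> x = c \<bullet> x | b \<bullet> x = d \<bullet> x | c \<bullet> x = d \<bullet> x}"
 have E0: "E : null_sets lborel"
 proof -
  have z: "{x. u \<bullet> x = v \<bullet> x} : null_sets lborel" if "u ~= v" for u v :: "real^3"
  proof -
   have "negligible {x. (u - v) \<bullet> x = 0}" using that by (intro negligible_hyperplane) simp
   hence "{x. u \<bullet> x = v \<bullet> x} : null_sets lebesgue" by (simp add: negligible_iff_null_sets inner_diff_left)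
   thus ?thesis by (simp add: null_sets_completion_iff)
  qed
  have "a ~= b" "a ~= c" "a ~= d" "b ~= c" "b ~= d" "c ~= d" using ip by force+
  thus ?thesis unfolding E_def Collect_disj_eq by (intro null_sets.Un z)
 qed
 \<comment> \<open>A point lies in the cone that omits the vertex with the smallest inner product;
   ties form the null set \<open>E\<close>.\<close>
 have cov: "tetra - E <= B3 b c d ` simp3 \<union> B3 a c d ` simp3 \<union> B3 a b d ` simp3 \<union> B3 a b c ` simp3"
 proof
  fix x assume "x : tetra - E"
  hence h: "-1/3 <= a \<bullet> x" "-1/3 <= b \<bullet> x" "-1/3 <= c \<bullet> x" "-1/3 <= d \<bullet> x"
   and ne: "a \<bullet> x ~= b \<bullet> x" "a \<bullet> x ~= c \<bullet> x" "a \<bullet> x ~= d \<bullet> x" "b \<bullet> x ~= c \<bullet> x" "b \<bullet> x ~= d \<bullet> x" "c \<bullet> x ~= d \<bullet> x"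
   using hT by (auto simp: E_def)
  consider "a \<bullet> x < b \<bullet> x" "a \<bullet> x < c \<bullet> x" "a \<bullet> x < d \<bullet> x" | "b \<bullet> x < a \<bullet> x" "b \<bullet> x < c \<bullet> x" "b \<bullet> x < d \<bullet> x" |
   "c \<bullet> x < a \<bullet> x" "c \<bullet> x < b \<bullet> x" "c \<bullet> x < d \<bullet> x" | "d \<bullet> x < a \<bullet> x" "d \<bullet> x < b \<bullet> x" "d \<bullet> x < c \<bullet> x"
   using ne by linarith
  thus "x : B3 b c d ` simp3 \<union> B3 a c d ` simp3 \<union> B3 a b d ` simp3 \<union> B3 a b c ` simp3"
  proof cases
   case 1
   hence "x : B3 b c d ` simp3" using h rep(5)[of x] by (intro simp3I image_eqI[where f = "B3 b c d", OF rep(1)[of x]]) linarith+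
   thus ?thesis by blast
  next
   case 2
   hence "x : B3 a c d ` simp3" using h rep(5)[of x] by (intro simp3I image_eqI[where f = "B3 a c d", OF rep(2)[of x]]) linarith+
   thus ?thesis by blast
  next
   case 3
   hence "x : B3 a b d ` simp3" using h rep(5)[of x] by (intro simp3I image_eqI[where f = "B3 a b d", OF rep(3)[of x]]) linarith+
   thus ?thesis by blast
  next
   case 4
   hence "x : B3 a b c ` simp3" using h rep(5)[of x] by (intro simp3I image_eqI[where f = "B3 a b c", OF rep(4)[of x]]) linarith+
   thus ?thesis by blast
  qed
 qed
 have up: "NI tetra <= 4 * (ennreal ?k * NI simp3)"
 proof -
  note [measurable] = C1(3) C2(3) C3(3) C4(3)
  have "NI tetra <= (\<integral>\<^sup>+x. ennreal (kd x) * indicator (B3 b c d ` simp3) x + ennreal (kd x) * indicator (B3 a c d ` simp3) x +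
   ennreal (kd x) * indicator (B3 a b d ` simp3) x + ennreal (kd x) * indicator (B3 a b c ` simp3) x \<partial>lborel)"
   unfolding NI_def
  proof (rule nn_integral_mono_AE)
   have "AE x in lborel. x ~: E" by (rule AE_not_in[OF E0])
   thus "AE x in lborel. ennreal (kd x) * indicator tetra x <= ennreal (kd x) * indicator (B3 b c d ` simp3) x + ennreal (kd x) * indicator (B3 a c d ` simp3) x +
    ennreal (kd x) * indicator (B3 a b d ` simp3) x + ennreal (kd x) * indicator (B3 a b c ` simp3) x"
   proof eventually_elim
    case (elim x)
    thus ?case using cov by (cases "x : tetra") (auto simp: indicator_def add_increasing add_increasing2)
   qed
  qed
  also have "... = NI (B3 b c d ` simp3) + NI (B3 a c d ` simp3) + NI (B3 a b d ` simp3) + NI (B3 a b c ` simp3)"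
   unfolding NI_def by (simp add: nn_integral_add)
  also have "... <= ennreal ?k * NI simp3 + ennreal ?k * NI simp3 + ennreal ?k * NI simp3 + ennreal ?k * NI simp3"
   by (intro add_mono C1(1) C2(1) C3(1) C4(1))
  also have "... = (1 + 1 + 1 + 1) * (ennreal ?k * NI simp3)" by (simp only: distrib_right mult_1_left)
  also have "1 + 1 + 1 + 1 = (4 :: ennreal)" by simp
  finally show ?thesis .
 qed
 have lo: "0 < NI tetra"
 proof -
  have H: "convex tetra" "a : tetra" "b : tetra" "c : tetra" "d : tetra" unfolding tet by (auto intro: hull_inc)
  have "(1/3) *\<^sub>R b + (1/3) *\<^sub>R c + (1/3) *\<^sub>R d : convex hull {b, c, d}" unfolding convex_hull_3 by (intro CollectI exI conjI) auto
  moreover have "convex hull {b, c, d} <= tetra" using H by (intro hull_minimal) auto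
  ultimately have "(1/4) *\<^sub>R a + (3/4) *\<^sub>R ((1/3) *\<^sub>R b + (1/3) *\<^sub>R c + (1/3) *\<^sub>R d) : tetra" using H by (intro convexD) auto
  moreover have "(1/4) *\<^sub>R a + (3/4) *\<^sub>R ((1/3) *\<^sub>R b + (1/3) *\<^sub>R c + (1/3) *\<^sub>R d) = 0"
   unfolding abcd by (simp add: vec_eq_iff forall_3)
  ultimately have z: "0 : tetra" by simp
  have "B3 b c d ` simp3 <= tetra"
   unfolding B3_def simp3_def using H z by (auto intro!: convex_comb3)
  hence "NI (B3 b c d ` simp3) <= NI tetra" unfolding NI_def by (intro nn_integral_mono) (auto simp: indicator_def)
  moreover have "0 < emeasure lborel simp3"
  proof -
   have "box 0 (vector [1/3, 1/3, 1/3]) <= simp3" by (auto simp: simp3_def mem_box_cart forall_3)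
   moreover have "box 0 (vector [1/3, 1/3, 1/3]) ~= ({} :: (real^3) set)" by (simp add: interval_ne_empty_cart forall_3)
   ultimately have "interior simp3 ~= {}" by (metis interior_maximal open_box subset_empty)
   hence "\<not> negligible simp3" using open_not_negligible negligible_subset interior_subset open_interior by metis
   hence "emeasure lborel simp3 ~= 0" by (auto simp: negligible_iff_null_sets null_sets_def)
   thus ?thesis by (simp add: zero_less_iff_neq_zero)
  qed
  hence "0 < ennreal ?k * emeasure lborel simp3" by (simp add: ennreal_zero_less_mult_iff)
  ultimately show ?thesis using C1(2) by (metis less_le_trans)
 qed
 define i where "i = enn2real (NI simp3)"
 have i: "NI simp3 = ennreal i" "0 <= i" using NI_simp3_finite by (simp_all add: i_def)
 have 8: "v8 = 8 * i"
 proof -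
  have "v8 = enn2real (8 * ennreal i)" unfolding v8_def octa_def[symmetric] by (simp add: klein_volume_NI NI_octa i(1))
  also have "8 * ennreal i = ennreal (8 * i)" using i(2) by (simp add: ennreal_mult)
  finally show ?thesis using i(2) by simp
 qed
 have e: "ennreal (4 * (K * i)) = ennreal 4 * (ennreal K * ennreal i)" if "0 <= K" for K
  using that by (simp only: ennreal_mult' zero_le_numeral)
 have up': "NI tetra <= ennreal (4 * (?k * i))" using up unfolding i(1) by (subst e) (simp_all only: ennreal_numeral, simp)
 have 3: "v3 = enn2real (NI tetra)" unfolding v3_def tetra_def[symmetric] by (simp add: klein_volume_NI)
 have "v3 <= 4 * (?k * i)" unfolding 3 using up' i(2) by (intro enn2real_leI) auto
 moreover have "0 < v3" unfolding 3 using lo up' by (auto simp: enn2real_positive_iff intro: le_less_trans)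
 ultimately show ?thesis unfolding 8 by (simp add: field_simps)
qed

corollary v8_bound: "8 < 2 * sqrt 3 * (v8 / v3)"
proof -
 have "8 < 2 * sqrt 3 * (3 * sqrt 3 / 2)" by simp
 also have "... <= 2 * sqrt 3 * (v8 / v3)" using v8_v3 by (intro mult_left_mono) auto
 finally show ?thesis .
qed

section \<open>The theorem\<close>

lemma RL_stp:
 "stp (letters w) (v, u) = (of_real (RL_word w $1$1) * v + of_real (RL_word w $2$1) * u,
  of_real (RL_word w $1$2) * v + of_real (RL_word w $2$2) * u)"
proof (induction w arbitrary: v u)
 case (Cons pq w)
 obtain p q where pq: "pq = (p, q)" by (cases pq)
 have R: "mat_power R_mat p = vector [vector [1, of_nat p], vector [0, 1]]"
  by (induction p) (simp_all add: mat_power_Suc R_mat_def matrix_matrix_mult_def sum_2 vec_eq_iff forall_2 mat_def)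
 have L: "mat_power L_mat q = vector [vector [1, 0], vector [of_nat q, 1]]"
  by (induction q) (simp_all add: mat_power_Suc L_mat_def matrix_matrix_mult_def sum_2 vec_eq_iff forall_2 mat_def)
 show ?case
  by (simp add: pq letters_Cons stp_append stp_True stp_False Cons R L matrix_matrix_mult_def sum_2 algebra_simps)
qed (simp add: letters_def mat_def)

lemma closure_image_H3:
 fixes f :: "point3 => point3"
 assumes f: "continuous_on H3 f" and S: "S <= H3" and q: "q : H3" "q : closure S"
 shows "f q : closure (f ` S)"
proof -
 obtain X where X: "!!n. X n : S" "X \<longlonglongrightarrow> q" using q(2) unfolding closure_sequential by blast
 have "\<forall>\<^sub>F n in sequentially. X n : H3" using S X(1) by (intro always_eventually) blast
 hence "(%n. f (X n)) \<longlonglongrightarrow> f q" by (rule continuous_on_tendsto_compose[OF f X(2) q(1)])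
 moreover have "ALL n. f (X n) : f ` S" using X(1) by blast
 ultimately show ?thesis unfolding closure_sequential by (intro exI[of _ "%n. f (X n)"] conjI)
qed

text \<open>Two charts of one horoball differ by such a map, hence by a Euclidean isometry of the
  horosphere; this makes the area independent of the chart.\<close>

lemma Binf_isometry:
 assumes e: "H3_isometry e" "e ` Binf = Binf"
 shows "EX u b. cmod u = 1 & ((ALL z. e (z, 1) = (u * z + b, 1)) | (ALL z. e (z, 1) = (u * cnj z + b, 1)))"
proof -
 obtain M where M: "det2 M = 1" "(ALL p:H3. e p = mob M p) | (ALL p:H3. e p = mob M (cconj p))" using H3_isometry_cases[OF e(1)] by blast
 have c: "cconj ` Binf = Binf"
 proof
  show "Binf <= cconj ` Binf"
  proof
   fix p :: "point3" assume "p : Binf"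
   thus "p : cconj ` Binf" by (intro image_eqI[of _ _ "cconj p"]) (auto simp: cconj_def)
  qed
 qed (auto simp: cconj_def)
 have "mob M ` Binf = Binf"
 proof (cases "ALL p:H3. e p = mob M p")
  case True
  hence "e ` Binf = mob M ` Binf" using Binf_subset by (intro image_cong) auto
  thus ?thesis using e(2) by simp
 next
  case False
  hence "e ` Binf = mob M ` (cconj ` Binf)" using M(2) Binf_subset unfolding image_image by (intro image_cong) auto
  thus ?thesis using e(2) c by simp
 qed
 hence m: "e21 M = 0" "cmod (e11 M) = 1" using mob_Binf_eq[OF M(1)] by auto
 have "mob M (z, 1) = ((e11 M)^2 * z + e11 M * e12 M, 1)" for z using mob_upper[OF M(1) m(1)] m(2) by simp
 moreover have "(z, 1) : H3" for z by (simp add: H3_iff)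
 moreover have "cmod ((e11 M)^2) = 1" using m(2) by (simp add: norm_power)
 ultimately show ?thesis using M(2) unfolding cconj_def by (intro exI[of _ "(e11 M)^2"] exI[of _ "e11 M * e12 M"]) auto
qed

section \<open>Passage from the given manifold and horoball to matrices\<close>

locale ptbundle =
 fixes w :: "(nat \<times> nat) list" and \<Omega> :: "real^2^2" and \<Gamma> :: "(point3 => point3) set"
  and h :: "(point3) set => ((real^2) \<times> real) set" and B :: "(point3) set"
 assumes w: "1 <= length w" "ALL (p, q) : set w. 0 < p & 0 < q" and \<Omega>: "\<Omega> = RL_word w | \<Omega> = - RL_word w"
  and deck: "hyperbolic_deck_group \<Gamma>" and homeo: "homeomorphic_map (hyperbolic_manifold \<Gamma>) (punctured_torus_bundle \<Omega>) h"
  and maxi: "maximal_cusp_horoball \<Gamma> B"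
begin

lemma \<Omega>_det: "det \<Omega> = 1" "int_mat \<Omega>"
 using \<Omega> RL_word_det RL_word_int det_uminus2 int_mat_uminus by auto

context
 fixes \<psi> assumes chart: "horoball_chart B \<psi>"
begin

lemma \<psi>: "H3_isometry \<psi>" "\<psi> ` Binf = B" "p : H3 ==> \<psi> p : H3" "continuous_on H3 \<psi>"
 "p : H3 ==> inv_into H3 \<psi> (\<psi> p) = p" "p : H3 ==> \<psi> (inv_into H3 \<psi> p) = p" "p : H3 ==> inv_into H3 \<psi> p : H3"
 using chart H3_isometry_in H3_isometry_continuous inv_into_H3_isometry by (auto simp: horoball_chart_def)

lemma B_H3: "B <= H3" using \<psi>(2,3) Binf_subset by blast

abbreviation "GG \<equiv> conj_group \<Gamma> \<psi>"

lemma GG: "\<gamma> : \<Gamma> ==> (%p. inv_into H3 \<psi> (\<gamma> (\<psi> p))) : GG" by (auto simp: conj_group_def)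

lemma GG_image: assumes g: "\<gamma> : \<Gamma>" "ALL p:H3. inv_into H3 \<psi> (\<gamma> (\<psi> p)) = mob M p"
 shows "\<gamma> ` B = \<psi> ` mob M ` Binf" "inv_into H3 \<psi> ` \<gamma> ` B = mob M ` Binf"
proof -
 have \<gamma>: "\<gamma> p : H3" if "p : H3" for p using H3_isometry_in[OF deck_group_ops(4)[OF deck g(1)] that] .
 have "\<gamma> (\<psi> p) = \<psi> (mob M p)" if "p : H3" for p using g(2) that \<psi>(6)[OF \<gamma>[OF \<psi>(3)[OF that]]] by simp
 thus "\<gamma> ` B = \<psi> ` mob M ` Binf" unfolding \<psi>(2)[symmetric] image_image using Binf_subset by (intro image_cong) auto
 show "inv_into H3 \<psi> ` \<gamma> ` B = mob M ` Binf" unfolding \<psi>(2)[symmetric] image_image using Binf_subset g(2) by (intro image_cong) auto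
qed

lemma final_exists:
 "\<exists>\<phi> Ps hh b sg. final GG \<phi> (linc \<Omega>) Ps hh b sg w &
  (ALL p:H3. EX x. (x, snd (\<phi> p)) : h (orbit_rel \<Gamma> `` {\<psi> p}))"
proof -
 obtain \<phi>0 where \<phi>0: "fibred GG \<phi>0 (linc \<Omega>)" "ALL p:H3. (vec2 (fst (\<phi>0 p)), snd (\<phi>0 p)) : h (orbit_rel \<Gamma> `` {\<psi> p})"
  using fibred_exists[OF deck \<Omega>_det homeo \<psi>(1)] by blast
 interpret f: fibred GG \<phi>0 "linc \<Omega>" by (rule \<phi>0(1))
 have emc: "embedded_cusp_horoball \<Gamma> B" using maxi by (simp add: maximal_cusp_horoball_def)
 have emb: "mob M ` Binf = Binf | mob M ` Binf \<inter> Binf = {}" if M: "f.inG M" for M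
 proof -
  obtain g where g: "g : GG" "ALL p:H3. g p = mob M p" using M by (rule f.inG_E)
  obtain \<gamma> where \<gamma>: "\<gamma> : \<Gamma>" "g = (%p. inv_into H3 \<psi> (\<gamma> (\<psi> p)))" using g(1) by (auto simp: conj_group_def)
  have gi: "ALL p:H3. inv_into H3 \<psi> (\<gamma> (\<psi> p)) = mob M p" using g(2) unfolding \<gamma>(2) .
  note im = GG_image[OF \<gamma>(1) gi]
  have inv: "inv_into H3 \<psi> ` B = Binf"
  proof -
   have "inv_into H3 \<psi> ` B = (%p. p) ` Binf" unfolding \<psi>(2)[symmetric] image_image using Binf_subset \<psi>(5) by (intro image_cong) auto
   thus ?thesis by simp
  qed
  have "\<gamma> ` B = B | \<gamma> ` B \<inter> B = {}" using emc \<gamma>(1) by (simp add: embedded_cusp_horoball_def)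
  thus ?thesis
  proof
   assume "\<gamma> ` B = B"
   thus ?thesis using im(2) inv by simp
  next
   assume d: "\<gamma> ` B \<inter> B = {}"
   have "p ~: Binf" if "p : mob M ` Binf" for p
    using that d im(1) \<psi>(2) by blast
   thus ?thesis by blast
  qed
 qed
 obtain \<gamma> p0 where \<gamma>: "\<gamma> : \<Gamma>" "\<gamma> ` B = B" "p0 : H3" "\<gamma> p0 ~= p0" using emc by (auto simp: embedded_cusp_horoball_def)
 obtain M where M: "f.inG M" "ALL p:H3. inv_into H3 \<psi> (\<gamma> (\<psi> p)) = mob M p" using f.inG_of[OF GG[OF \<gamma>(1)]] by blast
 have d: "det2 M = 1" by (rule f.inG_det[OF M(1)])
 have "mob M ` Binf = Binf"
 proof -
  have "mob M ` Binf = inv_into H3 \<psi> ` B" using GG_image(2)[OF \<gamma>(1) M(2)] \<gamma>(2) by simp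
  also have "... = (%p. p) ` Binf" unfolding \<psi>(2)[symmetric] image_image using Binf_subset \<psi>(5) by (intro image_cong) auto
  finally show ?thesis by simp
 qed
 hence e: "e21 M = 0" "cmod (e11 M) = 1" using mob_Binf_eq[OF d] by auto
 let ?a = "e11 M" and ?b = "e12 M"
 have up: "mob M p = (?a^2 * fst p + ?a * ?b, snd p)" for p using mob_upper[OF d e(1)] e(2) by simp
 have nofix: "mob M p ~= p" if "p : H3" for p
 proof
  assume "mob M p = p"
  hence "M \<simeq> mid" using f.inG_free[OF M(1) that] by blast
  hence "mob M (inv_into H3 \<psi> p0) = inv_into H3 \<psi> p0" using peq_mob[of M mid] by simp
  hence "inv_into H3 \<psi> (\<gamma> p0) = inv_into H3 \<psi> p0" using M(2) \<psi>(6,7)[OF \<gamma>(3)] by metis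
  thus False using \<gamma>(3,4) \<psi>(6) H3_isometry_in[OF deck_group_ops(4)[OF deck \<gamma>(1)] \<gamma>(3)] by metis
 qed
 \<comment> \<open>Otherwise \<open>z -> a^2 z + a b\<close> has a fixed point, and the element
   fixes the vertical line over it. So a nontrivial stabiliser element is a translation.\<close>
 have a1: "?a^2 = 1"
 proof (rule ccontr)
  assume "?a^2 ~= 1"
  hence "?a^2 * (?a * ?b / (1 - ?a^2)) + ?a * ?b = ?a * ?b / (1 - ?a^2)" by (simp add: field_simps)
  thus False using nofix[of "(?a * ?b / (1 - ?a^2), 1)"] up by (simp add: H3_iff)
 qed
 define b where "b = ?a * ?b"
 have b: "b ~= 0" using nofix[of "(0, 1)"] up a1 by (auto simp: H3_iff b_def)
 have "f.inG (trans2 b)"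
 proof -
  obtain g where "g : GG" "ALL p:H3. g p = mob M p" using M(1) by (rule f.inG_E)
  thus ?thesis using up a1 by (intro f.inG_I[of _ g]) (auto simp: shift_def b_def)
 qed
 then obtain v0 Ps hh where c: "v0 : lat" "cusp GG (%p. (fst (\<phi>0 p) - v0, snd (\<phi>0 p))) (linc \<Omega>) Ps hh b"
  using f.cusp_exists[OF b] by blast
 let ?\<phi> = "%p. (fst (\<phi>0 p) - v0, snd (\<phi>0 p))"
 interpret c: cusp GG ?\<phi> "linc \<Omega>" Ps hh b by (rule c(2))
 have same: "c.inG = f.inG" by (simp add: fun_eq_iff c.inG_def f.inG_def)
 interpret m: mcusp GG ?\<phi> "linc \<Omega>" Ps hh b by unfold_locales (use emb same in simp)
 \<comment> \<open>The point of tangency has height at least \<open>1\<close> in the chart but lies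
   in the closure of a horoball of height \<open>1 / |c|^2\<close>, while disjointness gives
   \<open>|c| >= 1\<close>.\<close>
 have tang: "EX f. c.inG f & cmod (e21 f) = 1"
 proof -
  obtain \<gamma> where g: "\<gamma> : \<Gamma>" "\<gamma> ` B ~= B" "H3 \<inter> closure (\<gamma> ` B) \<inter> closure B ~= {}"
   using maxi unfolding maximal_cusp_horoball_def by blast
  then obtain q where \<gamma>: "\<gamma> : \<Gamma>" "\<gamma> ` B ~= B" "q : H3" "q : closure (\<gamma> ` B)" "q : closure B" by blast
  obtain M where M: "f.inG M" "ALL p:H3. inv_into H3 \<psi> (\<gamma> (\<psi> p)) = mob M p" using f.inG_of[OF GG[OF \<gamma>(1)]] by blast
  let ?i = "inv_into H3 \<psi>"
  have ci: "continuous_on H3 ?i"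
   using H3_isometry_continuous[OF H3_isometry_inv[OF \<psi>(1)]] by (simp cong: continuous_on_cong)
  have gB: "\<gamma> ` B <= H3" using B_H3 H3_isometry_in[OF deck_group_ops(4)[OF deck \<gamma>(1)]] by blast
  have "?i q : closure (mob M ` Binf)"
   using closure_image_H3[OF ci gB \<gamma>(3,4)] unfolding GG_image(2)[OF \<gamma>(1) M(2)] .
  moreover have "e21 M ~= 0"
  proof
   assume "e21 M = 0"
   hence "mob M ` Binf = Binf" using m.c_zero[of M] M(1) same by simp
   thus False using GG_image(1)[OF \<gamma>(1) M(2)] \<psi>(2) \<gamma>(2) by simp
  qed
  moreover have "?i q : closure Binf"
  proof -
   have "?i ` B = (%p. p) ` Binf" unfolding \<psi>(2)[symmetric] image_image using Binf_subset \<psi>(5) by (intro image_cong) auto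
   thus ?thesis using closure_image_H3[OF ci B_H3 \<gamma>(3,5)] by simp
  qed
  moreover have "closure Binf <= {p. 1 <= snd p}"
   by (rule closure_minimal) (auto intro!: closed_Collect_le continuous_intros)
  ultimately have "1 <= snd (?i q)" "snd (?i q) <= 1 / (cmod (e21 M))^2" "1 <= cmod (e21 M)"
   using mob_Binf_closure_height[OF f.inG_det[OF M(1)] _ _ \<psi>(7)[OF \<gamma>(3)]] m.c_ge[of M] M(1) same by auto
  hence "1 <= 1 / (cmod (e21 M))^2" "1 <= cmod (e21 M)" by linarith+
  hence "(cmod (e21 M))^2 <= 1^2" by (auto simp: le_divide_eq split: if_splits)
  hence "cmod (e21 M) <= 1" by (rule power2_le_imp_le) simp
  thus ?thesis using \<open>1 <= cmod (e21 M)\<close> M(1) same by (intro exI[of _ M]) simp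
 qed
 define sg :: real where "sg = (if \<Omega> = RL_word w then 1 else -1)"
 have "\<Omega> $ i $ j = sg * RL_word w $ i $ j" for i j using \<Omega> by (auto simp: sg_def)
 moreover have "mpw \<Omega> 1 = \<Omega>" using mpw_nat[of \<Omega> 1] by (simp add: mat_power_Suc)
 ultimately have l: "linc \<Omega> 1 1 = of_real sg * fst (stp (letters w) (1, \<i>))" "linc \<Omega> 1 \<i> = of_real sg * snd (stp (letters w) (1, \<i>))"
  by (simp_all add: linc_eq RL_stp complex_eq_iff)
 have "final GG ?\<phi> (linc \<Omega>) Ps hh b sg w"
  by unfold_locales (use tang l w in "auto simp: sg_def")
 moreover have "ALL p:H3. EX x. (x, snd (?\<phi> p)) : h (orbit_rel \<Gamma> `` {\<psi> p})" using \<phi>0(2) by auto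
 ultimately show ?thesis by blast
qed

end

end

locale charted = ptbundle w \<Omega> \<Gamma> h B + final "conj_group \<Gamma> \<psi>" \<phi> "linc \<Omega>" Ps hh b sg w
 for w \<Omega> \<Gamma> h B \<psi> \<phi> Ps hh b sg +
 assumes chart: "horoball_chart B \<psi>" and \<phi>_class: "p : H3 ==> EX x. (x, snd (\<phi> p)) : h (orbit_rel \<Gamma> `` {\<psi> p})"
begin

lemma torus_rel: "(z, z') : cusp_torus_rel \<Gamma> B \<psi> \<longleftrightarrow> (EX j k :: int. z' = z + (of_int j * lam + of_int k * nu))"
proof
 have H: "(z, 1) : H3" "(z', 1) : H3" by (simp_all add: H3_iff)
 have inv: "inv_into H3 \<psi> ` B = Binf"
 proof -
  have "inv_into H3 \<psi> ` B = (%p. p) ` Binf" unfolding \<psi>(2)[OF chart, symmetric] image_image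
   using Binf_subset \<psi>(5)[OF chart] by (intro image_cong) auto
  thus ?thesis by simp
 qed
 {
  assume "(z, z') : cusp_torus_rel \<Gamma> B \<psi>"
  then obtain \<gamma> where \<gamma>: "\<gamma> : \<Gamma>" "\<gamma> ` B = B" "\<gamma> (\<psi> (z, 1)) = \<psi> (z', 1)" by (auto simp: cusp_torus_rel_def)
  obtain M where M: "inG M" "ALL p:H3. inv_into H3 \<psi> (\<gamma> (\<psi> p)) = mob M p" using inG_of[OF GG[OF chart \<gamma>(1)]] by blast
  have "mob M ` Binf = Binf" using GG_image(2)[OF chart \<gamma>(1) M(2)] \<gamma>(2) inv by simp
  moreover obtain k v where "v : lat" "aff M k v" using aff_exists[OF M(1)] by blast
  ultimately obtain j :: int where "M \<simeq> trans2 (of_int j * lam + of_int k * nu)" using stabiliser[OF M(1)] by blast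
  hence "mob M (z, 1) = (z + (of_int j * lam + of_int k * nu), 1)" using peq_mob by (simp add: shift_def)
  moreover have "mob M (z, 1) = (z', 1)" using bspec[OF M(2) H(1)] \<gamma>(3) \<psi>(5)[OF chart H(2)] by simp
  ultimately show "EX j k :: int. z' = z + (of_int j * lam + of_int k * nu)" by auto
 next
  assume "EX j k :: int. z' = z + (of_int j * lam + of_int k * nu)"
  then obtain j k :: int where jk: "z' = z + (of_int j * lam + of_int k * nu)" by blast
  let ?t = "of_int j * lam + of_int k * nu"
  obtain g where g: "g : conj_group \<Gamma> \<psi>" "ALL p:H3. g p = mob (trans2 ?t) p" using inG_lattice[of j k] by (rule inG_E)
  obtain \<gamma> where \<gamma>: "\<gamma> : \<Gamma>" "g = (%p. inv_into H3 \<psi> (\<gamma> (\<psi> p)))" using g(1) by (auto simp: conj_group_def)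
  have gi: "ALL p:H3. inv_into H3 \<psi> (\<gamma> (\<psi> p)) = mob (trans2 ?t) p" using g(2) unfolding \<gamma>(2) .
  have "\<gamma> ` B = B" using GG_image(1)[OF chart \<gamma>(1) gi] shift_Binf \<psi>(2)[OF chart] by simp
  moreover have "\<gamma> (\<psi> (z, 1)) = \<psi> (z', 1)"
   using gi H \<psi>(6)[OF chart H3_isometry_in[OF deck_group_ops(4)[OF deck \<gamma>(1)] \<psi>(3)[OF chart H(1)]]] jk by (simp add: shift_def)
  ultimately show "(z, z') : cusp_torus_rel \<Gamma> B \<psi>" using \<gamma>(1) by (auto simp: cusp_torus_rel_def)
 }
qed

text \<open>In another chart the lattice is rotated or reflected, which keeps its covolume, so the
  description in the definition of the area has only one value.\<close>

lemma fund_area: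
 assumes c: "horoball_chart B \<psi>'" and D: "D : sets borel" "ALL z. EX! v. v : D & (z, v) : cusp_torus_rel \<Gamma> B \<psi>'"
 shows "measure lborel D = \<bar>Im (cnj lam * nu)\<bar>"
proof -
 define e where "e = restrict (%p. inv_into H3 \<psi> (\<psi>' p)) H3"
 have pe: "\<psi> (e p) = \<psi>' p" if "p : H3" for p using that \<psi>(6)[OF chart \<psi>(3)[OF c that]] by (simp add: e_def)
 have ie: "H3_isometry e"
 proof -
  have "bij_betw (inv_into H3 \<psi> \<circ> \<psi>') H3 H3"
   by (rule bij_betw_trans[OF inv_into_H3_isometry(1)[OF \<psi>(1)[OF c]] bij_betw_inv_into[OF inv_into_H3_isometry(1)[OF \<psi>(1)[OF chart]]]])
  hence "bij_betw e H3 H3" unfolding e_def by (simp add: comp_def cong: bij_betw_cong)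
  moreover have "hdist (e p) (e q) = hdist p q" if "p : H3" "q : H3" for p q
  proof -
   have "e p : H3" "e q : H3" using that \<psi>(7)[OF chart \<psi>(3)[OF c]] by (simp_all add: e_def)
   hence "hdist (e p) (e q) = hdist (\<psi> (e p)) (\<psi> (e q))" using \<psi>(1)[OF chart] by (simp add: H3_isometry_def)
   thus ?thesis using \<psi>(1)[OF c] that pe by (simp add: H3_isometry_def)
  qed
  ultimately show ?thesis by (simp add: H3_isometry_def Bij_def e_def)
 qed
 have "e ` Binf = Binf"
 proof -
  have "e ` Binf = inv_into H3 \<psi> ` (\<psi>' ` Binf)" unfolding image_image e_def using Binf_subset by (intro image_cong) auto
  also have "... = inv_into H3 \<psi> ` (\<psi> ` Binf)" using \<psi>(2)[OF c] \<psi>(2)[OF chart] by simp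
  also have "... = (%p. p) ` Binf" unfolding image_image using Binf_subset \<psi>(5)[OF chart] by (intro image_cong) auto
  finally show ?thesis by simp
 qed
 then obtain u b where ub: "cmod u = 1" "(ALL z. e (z, 1) = (u * z + b, 1)) | (ALL z. e (z, 1) = (u * cnj z + b, 1))"
  using Binf_isometry[OF ie] by blast
 have uu: "u * cnj u = 1" "cnj u * u = 1" using ub(1) complex_norm_square[of u] by (simp_all add: mult.commute)
 define l n where "l = (if ALL z. e (z, 1) = (u * z + b, 1) then cnj u * lam else u * cnj lam)"
  and "n = (if ALL z. e (z, 1) = (u * z + b, 1) then cnj u * nu else u * cnj nu)"
 have In: "\<bar>Im (cnj l * n)\<bar> = \<bar>Im (cnj lam * nu)\<bar>"
 proof (cases "ALL z. e (z, 1) = (u * z + b, 1)")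
  case True
  have "cnj l * n = (u * cnj u) * (cnj lam * nu)" unfolding l_def n_def if_P[OF True] by (simp add: mult_ac)
  thus ?thesis unfolding uu by simp
 next
  case False
  have "cnj l * n = (cnj u * u) * (lam * cnj nu)" unfolding l_def n_def if_not_P[OF False] by (simp add: mult_ac)
  thus ?thesis unfolding uu by (simp add: algebra_simps abs_minus_commute)
 qed
 interpret p: plattice l n by unfold_locales (use In lattice_independent in auto)
 have r: "(z, v) : cusp_torus_rel \<Gamma> B \<psi>' \<longleftrightarrow> (EX k. v = z + p.trn k)" for z v
 proof -
  have H: "(z, 1) : H3" "(v, 1) : H3" by (simp_all add: H3_iff)
  have "(z, v) : cusp_torus_rel \<Gamma> B \<psi>' \<longleftrightarrow> (fst (e (z, 1)), fst (e (v, 1))) : cusp_torus_rel \<Gamma> B \<psi>"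
  proof -
   have "e (z, 1) = (fst (e (z, 1)), 1)" "e (v, 1) = (fst (e (v, 1)), 1)" using ub(2) by auto
   hence "\<psi>' (z, 1) = \<psi> (fst (e (z, 1)), 1)" "\<psi>' (v, 1) = \<psi> (fst (e (v, 1)), 1)"
    using pe[OF H(1)] pe[OF H(2)] by simp_all
   thus ?thesis by (simp add: cusp_torus_rel_def)
  qed
  also have "... \<longleftrightarrow> (EX j k :: int. fst (e (v, 1)) = fst (e (z, 1)) + (of_int j * lam + of_int k * nu))" by (rule torus_rel)
  finally have t: "(z, v) : cusp_torus_rel \<Gamma> B \<psi>' \<longleftrightarrow> (EX j k :: int. fst (e (v, 1)) = fst (e (z, 1)) + (of_int j * lam + of_int k * nu))" .
  have "fst (e (v, 1)) = fst (e (z, 1)) + (of_int j * lam + of_int k * nu) \<longleftrightarrow> v = z + p.trn (j, k)" for j k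
  proof (cases "ALL z. e (z, 1) = (u * z + b, 1)")
   case True
   have "u * v = u * (z + cnj u * t) \<longleftrightarrow> v = z + cnj u * t" for t using ub(1) by auto
   moreover have "u * (z + cnj u * t) = u * z + t" for t using uu(1) by (simp add: ring_distribs flip: mult.assoc)
   ultimately have "u * v = u * z + t \<longleftrightarrow> v = z + cnj u * t" for t by metis
   from this[of "of_int j * lam + of_int k * nu"] show ?thesis
    unfolding p.trn_def unfolding l_def n_def if_P[OF True] using True by (simp add: algebra_simps)
  next
   case False
   hence e: "e (z, 1) = (u * cnj z + b, 1)" "e (v, 1) = (u * cnj v + b, 1)" using ub(2) by auto
   have "u * cnj v = u * cnj (z + u * cnj t) \<longleftrightarrow> v = z + u * cnj t" for t
    using ub(1) by (metis complex_cnj_cancel_iff mult_cancel_left norm_zero zero_neq_one)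
   moreover have "u * cnj (z + u * cnj t) = u * cnj z + t" for t using uu(1) by (simp add: ring_distribs flip: mult.assoc)
   ultimately have "u * cnj v = u * cnj z + t \<longleftrightarrow> v = z + u * cnj t" for t by metis
   from this[of "of_int j * lam + of_int k * nu"] show ?thesis
    unfolding p.trn_def e fst_conv unfolding l_def n_def if_not_P[OF False] by (simp add: algebra_simps)
  qed
  thus ?thesis unfolding t by (simp add: split_paired_Ex)
 qed
 have "p.fund D" unfolding p.fund_def
 proof (intro conjI allI)
  fix z
  obtain v where v: "v : D" "(z, v) : cusp_torus_rel \<Gamma> B \<psi>'" "!!v'. v' : D ==> (z, v') : cusp_torus_rel \<Gamma> B \<psi>' ==> v' = v"
   using D(2) by metis
  obtain k where k: "v = z + p.trn k" using v(2) r by blast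
  show "EX! k. z + p.trn k : D"
  proof (rule ex1I)
   show "z + p.trn k : D" using v(1) k by simp
   fix j assume "z + p.trn j : D"
   hence "z + p.trn j = z + p.trn k" using v(3) r k by blast
   thus "j = k" using p.trn_inj by simp
  qed
 qed (rule D(1))
 thus ?thesis using p.measure_fund In by simp
qed

lemma area_eq: "cusp_area \<Gamma> B = \<bar>Im (cnj lam * nu)\<bar>"
 unfolding cusp_area_def
proof (rule the_equality)
 interpret p: plattice lam nu by unfold_locales (rule lattice_independent)
 have t: "(z, v) : cusp_torus_rel \<Gamma> B \<psi> \<longleftrightarrow> (EX k. v = z + p.trn k)" for z v
  unfolding torus_rel p.trn_def by (auto simp: split_paired_Ex)
 have "EX! v. v : p.par & (z, v) : cusp_torus_rel \<Gamma> B \<psi>" for z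
  using p.fund_par unfolding t p.fund_def by metis
 moreover have "p.par : sets borel" using p.fund_par by (simp add: p.fund_def)
 ultimately show "\<exists>\<psi> D. horoball_chart B \<psi> & D : sets borel & (ALL z. EX! w. w : D & (z, w) : cusp_torus_rel \<Gamma> B \<psi>) &
  \<bar>Im (cnj lam * nu)\<bar> = measure lborel D"
  using chart p.measure_fund[OF p.fund_par] by (intro exI[of _ \<psi>] exI[of _ p.par]) simp
next
 fix a assume "\<exists>\<psi> D. horoball_chart B \<psi> & D : sets borel & (ALL z. EX! w. w : D & (z, w) : cusp_torus_rel \<Gamma> B \<psi>) & a = measure lborel D"
 thus "a = \<bar>Im (cnj lam * nu)\<bar>" using fund_area by blast
qed

text \<open>If the curve closed up with \<open>k = 0\<close>, \<open>F\<close> would take the same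
  value at both ends, and Rolle would give a point where the curve is tangent to the fibration. So
  \<open>k\<close> is nonzero, and the length is at least the distance of the end points.\<close>

lemma curve_bound:
 assumes F: "boundary_fibration \<Gamma> h B \<psi> F grad" and c: "simple_closed_cusp_curve \<Gamma> B \<psi> c c'" and t: "transverse_to_fibers grad c c'"
 shows "4 * sqrt 6 / 147 * real (length w) <= curve_length c'"
proof -
 have d: "(c has_vector_derivative c' t) (at t within {0..1})" if "t : {0..1}" for t using c that by (simp add: simple_closed_cusp_curve_def)
 have cc: "continuous_on {0..1} c'" and c01: "(c 0, c 1) : cusp_torus_rel \<Gamma> B \<psi>" using c by (auto simp: simple_closed_cusp_curve_def)
 obtain j k :: int where jk: "c 1 = c 0 + (of_int j * lam + of_int k * nu)" using c01 torus_rel by blast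
 obtain \<tau> where \<tau>: "lifted_projection \<Gamma> h \<tau>"
  "ALL (z, v) : cusp_torus_rel \<Gamma> B \<psi>. F v - \<tau> (\<psi> (v, 1)) = F z - \<tau> (\<psi> (z, 1))" using F by (auto simp: boundary_fibration_def)
 \<comment> \<open>Two lifts of the projection to the circle differ by a constant integer, so
   increments of \<open>\<tau>\<close> can be read off from the second component of
   \<open>\<phi>\<close>.\<close>
 have "EX m::int. ALL p:H3. \<tau> (\<psi> p) - snd (\<phi> p) = of_int m"
 proof (rule continuous_int_const)
  show "connected H3" by (rule convex_connected[OF convex_H3])
  show "continuous_on H3 (%p. \<tau> (\<psi> p) - snd (\<phi> p))"
   by (intro continuous_intros \<phi>_cont continuous_on_compose2[OF _ \<psi>(4)[OF chart]])
    (use \<tau>(1) \<psi>(3)[OF chart] in "auto simp: lifted_projection_def")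
  fix p assume p: "p : H3"
  let ?C = "h (orbit_rel \<Gamma> `` {\<psi> p})"
  obtain x y where xy: "(x, \<tau> (\<psi> p)) : ?C" "(y, snd (\<phi> p)) : ?C"
   using \<tau>(1) \<psi>(3)[OF chart p] \<phi>_class[OF p] unfolding lifted_projection_def by meson
  have "orbit_rel \<Gamma> `` {\<psi> p} : topspace (hyperbolic_manifold \<Gamma>)"
   using \<psi>(3)[OF chart p] by (simp add: hyperbolic_manifold_def topspace_quotient_topology quotientI)
  hence "?C : topspace (punctured_torus_bundle \<Omega>)"
   using homeomorphic_imp_surjective_map[OF homeo] by blast
  hence C: "?C : punctured_plane_line // bundle_rel \<Omega>" by (simp add: punctured_torus_bundle_def topspace_quotient_topology)
  interpret b: cov_act punctured_plane_line "bundle_group \<Omega>" by unfold_locales (rule covering_action_bundle[OF \<Omega>_det])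
  have eq: "equiv punctured_plane_line (bundle_rel \<Omega>)" unfolding bundle_rel_eq[OF \<Omega>_det] by (rule b.act_equiv)
  have "((x, \<tau> (\<psi> p)), (y, snd (\<phi> p))) : bundle_rel \<Omega>"
   using quotient_eq_class[OF eq C xy(1)] xy(2) by blast
  then obtain n :: nat where "\<tau> (\<psi> p) = snd (\<phi> p) + real n | snd (\<phi> p) = \<tau> (\<psi> p) + real n" unfolding bundle_rel_def by blast
  hence "\<tau> (\<psi> p) - snd (\<phi> p) = of_int (int n) | \<tau> (\<psi> p) - snd (\<phi> p) = of_int (- int n)" by auto
  thus "\<tau> (\<psi> p) - snd (\<phi> p) : \<int>" by (metis Ints_of_int)
 qed
 then obtain m :: int where m: "ALL p:H3. \<tau> (\<psi> p) - snd (\<phi> p) = of_int m" by blast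
 have H: "(c 0, 1) : H3" "(c 1, 1) : H3" by (simp_all add: H3_iff)
 have "mob (trans2 (of_int j * lam + of_int k * nu)) (c 0, 1) = (c 1, 1)" using jk by (simp add: shift_def)
 hence s: "snd (\<phi> (c 1, 1)) = snd (\<phi> (c 0, 1)) - of_int k"
  using aff_lattice[of j k, unfolded aff_def, rule_format, OF H(1)] by simp
 have "F (c 1) - \<tau> (\<psi> (c 1, 1)) = F (c 0) - \<tau> (\<psi> (c 0, 1))" using \<tau>(2) c01 by blast
 moreover have "\<tau> (\<psi> (c 1, 1)) - snd (\<phi> (c 1, 1)) = of_int m" "\<tau> (\<psi> (c 0, 1)) - snd (\<phi> (c 0, 1)) = of_int m" using m H by auto
 ultimately have Fk: "F (c 1) = F (c 0) - of_int k" using s by linarith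
 have "k ~= 0"
 proof
  assume "k = 0"
  hence "F (c 0) = F (c 1)" using Fk by simp
  moreover have D: "((%t. F (c t)) has_real_derivative (grad (c t) \<bullet> c' t)) (at t within {0..1})" if "t : {0..1}" for t
  proof -
   have "(F has_derivative (%v. v \<bullet> grad (c t))) (at (c t))"
    using F by (simp add: boundary_fibration_def gderiv_def)
   hence "((F \<circ> c) has_derivative (%v. v \<bullet> grad (c t)) \<circ> (%s. s *\<^sub>R c' t)) (at t within {0..1})"
    using d[OF that] unfolding has_vector_derivative_def by (intro diff_chain_within) (auto intro: has_derivative_at_withinI)
   thus ?thesis unfolding has_field_derivative_def o_def
    by (rule has_derivative_eq_rhs) (simp add: fun_eq_iff inner_commute)
  qed
  moreover have "continuous_on {0..1} (%t. F (c t))"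
   using D DERIV_continuous continuous_on_eq_continuous_within by blast
  moreover have "((%t. F (c t)) has_derivative (%s. s * (grad (c t) \<bullet> c' t))) (at t)" if "0 < t" "t < 1" for t
  proof -
   have "((%t. F (c t)) has_real_derivative (grad (c t) \<bullet> c' t)) (at t)"
    using D[of t] at_within_interior[of t "{0..1}"] that by simp
   thus ?thesis unfolding has_field_derivative_def by (rule has_derivative_eq_rhs) (simp add: fun_eq_iff)
  qed
  ultimately obtain t0 where t0: "0 < t0" "t0 < 1" "(%s. s * (grad (c t0) \<bullet> c' t0)) = (%v. 0)"
   using Rolle_deriv[of 0 1 "%t. F (c t)" "%t s. s * (grad (c t) \<bullet> c' t)"] by auto
  hence "grad (c t0) \<bullet> c' t0 = 0" by (metis mult_1)
  thus False using t t0(1,2) by (simp add: transverse_to_fibers_def)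
 qed
 hence "4 * sqrt 6 / 147 * real (length w) <= cmod (c 1 - c 0)" using length_lower[of k j] jk by simp
 also have "(c' has_integral (c 1 - c 0)) {0..1}" by (rule fundamental_theorem_of_calculus) (use d in auto)
 hence "c 1 - c 0 = integral {0..1} c'" by (simp add: integral_unique)
 also have "cmod (integral {0..1} c') <= integral {0..1} (%t. norm (c' t))"
  by (rule integral_norm_bound_integral) (auto intro!: integrable_continuous_real cc continuous_intros)
 finally show ?thesis by (simp add: curve_length_def)
qed

end

lemma (in ptbundle) charted_exists:
 assumes "horoball_chart B \<psi>" shows "\<exists>\<phi> Ps hh b sg. charted w \<Omega> \<Gamma> h B \<psi> \<phi> Ps hh b sg"
proof -
 obtain \<phi> Ps hh b sg where f: "final (conj_group \<Gamma> \<psi>) \<phi> (linc \<Omega>) Ps hh b sg w"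
  "ALL p:H3. EX x. (x, snd (\<phi> p)) : h (orbit_rel \<Gamma> `` {\<psi> p})" using final_exists[OF assms] by blast
 have "charted w \<Omega> \<Gamma> h B \<psi> \<phi> Ps hh b sg"
  unfolding charted_def charted_axioms_def using f assms ptbundle_axioms by blast
 thus ?thesis by blast
qed

theorem theorem4p1:
  fixes w :: "(nat \<times> nat) list" and \<Omega> :: "real^2^2"
    and \<Gamma> :: "(complex \<times> real \<Rightarrow> complex \<times> real) set"
    and h :: "(complex \<times> real) set \<Rightarrow> ((real^2) \<times> real) set"
    and B :: "(complex \<times> real) set"
  assumes "1 \<le> length w"
    and "\<forall>(p, q) \<in> set w. 0 < p \<and> 0 < q"
    and "\<Omega> = RL_word w \<or> \<Omega> = - RL_word w"
    and "hyperbolic_deck_group \<Gamma>"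
    and "homeomorphic_map (hyperbolic_manifold \<Gamma>) (punctured_torus_bundle \<Omega>) h"
    and "maximal_cusp_horoball \<Gamma> B"
  shows "16 * sqrt 3 / 147 * real (length w) \<le> cusp_area \<Gamma> B \<and>
         cusp_area \<Gamma> B < 2 * sqrt 3 * (v8 / v3) * real (length w) \<and>
         (\<forall>\<psi> F grad c c'.
            horoball_chart B \<psi> \<longrightarrow>
            boundary_fibration \<Gamma> h B \<psi> F grad \<longrightarrow>
            simple_closed_cusp_curve \<Gamma> B \<psi> c c' \<longrightarrow>
            transverse_to_fibers grad c c' \<longrightarrow>
            curve_length c' \<ge> 4 * sqrt 6 / 147 * real (length w))"
proof -
 interpret ptbundle w \<Omega> \<Gamma> h B by unfold_locales (rule assms)+
 obtain \<psi> where "horoball_chart B \<psi>"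
  using assms(6) by (auto simp: maximal_cusp_horoball_def embedded_cusp_horoball_def horoball_def)
 then obtain \<phi> Ps hh b sg where "charted w \<Omega> \<Gamma> h B \<psi> \<phi> Ps hh b sg" using charted_exists by blast
 then interpret charted w \<Omega> \<Gamma> h B \<psi> \<phi> Ps hh b sg .
 have "cusp_area \<Gamma> B <= 8 * real (length w)" using area_upper by (simp add: area_eq)
 also have "... < 2 * sqrt 3 * (v8 / v3) * real (length w)"
  by (rule mult_strict_right_mono[OF v8_bound]) (use assms(1) in linarith)
 finally have "cusp_area \<Gamma> B < 2 * sqrt 3 * (v8 / v3) * real (length w)" .
 moreover have "16 * sqrt 3 / 147 * real (length w) <= cusp_area \<Gamma> B" using area_lower by (simp add: area_eq)
 moreover have "4 * sqrt 6 / 147 * real (length w) <= curve_length c'"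
  if *: "horoball_chart B \<psi>" "boundary_fibration \<Gamma> h B \<psi> F grad" "simple_closed_cusp_curve \<Gamma> B \<psi> c c'" "transverse_to_fibers grad c c'"
  for \<psi> F grad c c'
 proof -
  \<comment> \<open>The matrices depend on the chart, so they are built anew for the chart in which
    the curve is given.\<close>
  obtain \<phi> Ps hh b sg where "charted w \<Omega> \<Gamma> h B \<psi> \<phi> Ps hh b sg" using charted_exists[OF *(1)] by blast
  then interpret c: charted w \<Omega> \<Gamma> h B \<psi> \<phi> Ps hh b sg .
  show ?thesis by (rule c.curve_bound[OF *(2-4)])
 qed
 ultimately show ?thesis by blast
qed

end
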